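(* The Cubic Symmetric Comajor Lamination $C_sCL$, i.e. the set of all chords of the unit circle that are comajors of some symmetric cubic lamination, is a q-lamination.
   Context: Laminations. Identify the unit circle $\mathbb S$ with $\mathbb R/\mathbb Z$, let $\mathbb D$ be the open unit disk and $\sigma_3(t)=3t \bmod 1$. A chord $\overline{ab}$ is the segment joining $a,b\in\mathbb S$ (degenerate, i.e. a point of $\mathbb S$, if $a=b$). Distinct chords cross if they meet inside $\mathbb D$. Put $\sigma_3(\overline{ab})=\overline{\sigma_3(a)\sigma_3(b)}$, and let $-\ell$ be the image of $\ell$ under rotation by $180^\circ$ ($t\mapsto t+\frac12$). A lamination is a set of chords (leaves), pairwise non-crossing, whose union is closed; all points of $\mathbb S$ are regarded as degenerate leaves. It is cubic ($\sigma_3$-invariant) if: (D1) for each leaf $\ell$, $\sigma_3(\ell)$ is a leaf or a point of $\mathbb S$; (D2) for each leaf $\ell$ there is a leaf $\ell'$ with $\sigma_3(\ell')=\ell$, and for each leaf $\ell$ with $\sigma_3(\ell)$ non-degenerate there are three pairwise disjoint leaves $\ell_1=\ell,\ell_2,\ell_3$ with $\sigma_3(\ell_i)=\sigma_3(\ell)$. It is symmetric if moreover $-\ell$ is a leaf whenever $\ell$ is. Majors and comajors. The length $\|\overline{ab}\|\in[0,\frac12]$ is the length of the shorter arc of $\mathbb S=\mathbb R/\mathbb Z$ between $a$ and $b$. For a symmetric lamination $\mathcal L$ having a non-degenerate leaf, a major is a non-degenerate leaf $M$ of $\mathcal L$ for which $\bigl|\|M\|-\frac13\bigr|$ is minimal.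 If a major $M$ is not critical ($\|M\|\ne\frac13$), then $M$ lies in a unique triple of pairwise disjoint leaves of $\mathcal L$ with the same $\sigma_3$-image, and a leaf of this triple other than $M$ which has length $<\frac16$ (or length $\frac16$, if such a sibling exists) is a comajor of $\mathcal L$. If the majors are critical, the comajors are the points of $\mathbb S$ that have the same $\sigma_3$-image as a major $M$ but are not endpoints of $M$ (degenerate comajors). Comajors come in pairs $\{c,-c\}$. q-laminations. For a lamination $\mathcal L$, let $x\sim_{\mathcal L}y$ ($x,y\in\mathbb S$) iff there is a finite concatenation of leaves of $\mathcal L$ joining $x$ to $y$. An equivalence relation on $\mathbb S$ is laminational if its graph is closed in $\mathbb S\times\mathbb S$, convex hulls of distinct classes are disjoint, and every class is finite. $\mathcal L$ is a q-lamination if $\sim_{\mathcal L}$ is laminational and $\mathcal L$ consists of the edges (boundary chords) of the convex hulls of the $\sim_{\mathcal L}$-classes.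
   Formalization: A symmetric cubic lamination is assigned comajors only if each non-critical major lies in just one sibling triple; this excludes those containing an invariant diameter and all six sides of its preimage hexagon, where uniqueness fails and some sides would be comajors crossing others. *)

theory Defs
  imports "HOL-Analysis.Analysis"
begin

text \<open>
  The circle \<open>\<real>/\<int>\<close> is realised as the unit circle of the complex plane via
  \<open>t \<mapsto> cis (2 * pi * t)\<close>. Under this identification \<open>t \<mapsto> 3 * t mod 1\<close> is cubing and
  \<open>t \<mapsto> t + 1/2\<close> is negation.
\<close>

abbreviation circle :: "complex set" where
  "circle \<equiv> sphere 0 1"

definition sigma3 :: "complex \<Rightarrow> complex" where
  "sigma3 z = z ^ 3"

text \<open>The length of the shorter arc between two points of the circle, in units of a full turn.\<close>

definition arc_dist :: "complex \<Rightarrow> complex \<Rightarrow> real" where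
  "arc_dist a b = \<bar>Arg (b / a)\<bar> / (2 * pi)"

section \<open>Chords\<close>

definition chords :: "complex set set" where
  "chords = {closed_segment a b | a b. a \<in> circle \<and> b \<in> circle}"

definition degenerate :: "complex set \<Rightarrow> bool" where
  "degenerate l \<longleftrightarrow> (\<exists>x\<in>circle. l = {x})"

definition crossing :: "complex set \<Rightarrow> complex set \<Rightarrow> bool" where
  "crossing l m \<longleftrightarrow> l \<noteq> m \<and> l \<inter> m \<inter> ball 0 1 \<noteq> {}"

definition endpoints :: "complex set \<Rightarrow> complex set" where
  "endpoints l = l \<inter> circle"

text \<open>
  A chord is mapped to the chord spanned by the images of its endpoints, not to its pointwise
  image under cubing; see \<open>chord_image_closed_segment\<close> below.
\<close>

definition chord_image :: "complex set \<Rightarrow> complex set" where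
  "chord_image l = convex hull (sigma3 ` endpoints l)"

definition chord_length :: "complex set \<Rightarrow> real" where
  "chord_length l = (THE r. \<exists>a b. endpoints l = {a, b} \<and> r = arc_dist a b)"

lemma endpoints_closed_segment:
  assumes "a \<in> circle" "b \<in> circle"
  shows "endpoints (closed_segment a b) = {a, b}"
proof -
  have "x \<in> {a, b}" if x: "x \<in> closed_segment a b" "x \<in> circle" for x
  proof (rule ccontr)
    assume "x \<notin> {a, b}"
    then have "x \<in> open_segment a b"
      using x by (simp add: open_segment_def)
    then have "dist x 0 < dist a 0 \<or> dist x 0 < dist b 0"
      using dist_decreases_open_segment[of x a b 0] by (simp add: dist_commute)
    then show False
      using assms x by (simp add: dist_commute)
  qed
  then have "closed_segment a b \<inter> circle \<subseteq> {a, b}"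
    by blast
  moreover have "{a, b} \<subseteq> closed_segment a b \<inter> circle"
    using assms by simp
  ultimately show ?thesis
    unfolding endpoints_def by (rule subset_antisym)
qed

lemma chord_image_closed_segment:
  assumes "a \<in> circle" "b \<in> circle"
  shows "chord_image (closed_segment a b) = closed_segment (sigma3 a) (sigma3 b)"
  unfolding chord_image_def endpoints_closed_segment[OF assms]
  by (simp add: segment_convex_hull)

lemma arc_dist_commute:
  assumes "a \<in> circle" "b \<in> circle"
  shows "arc_dist a b = arc_dist b a"
proof -
  have "b / a \<noteq> 0" using assms by auto
  moreover have "a / b = inverse (b / a)" by simp
  ultimately have "\<bar>Arg (a / b)\<bar> = \<bar>Arg (b / a)\<bar>"
    using Arg_inverse[of "b / a"] by (auto simp: Arg_eq_pi elim!: Reals_cases)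
  then show ?thesis
    by (simp add: arc_dist_def)
qed

lemma chord_length_closed_segment:
  assumes "a \<in> circle" "b \<in> circle"
  shows "chord_length (closed_segment a b) = arc_dist a b"
  unfolding chord_length_def endpoints_closed_segment[OF assms]
  by (rule the_equality) (auto simp: doubleton_eq_iff arc_dist_commute[OF assms])

section \<open>Laminations\<close>

definition lamination :: "complex set set \<Rightarrow> bool" where
  "lamination L \<longleftrightarrow>
     L \<subseteq> chords \<and>
     (\<forall>x\<in>circle. {x} \<in> L) \<and>
     (\<forall>l\<in>L. \<forall>m\<in>L. \<not> crossing l m) \<and>
     closed (\<Union>L)"

text \<open>\<open>T\<close> consists of \<open>l\<close> and two further leaves of \<open>L\<close>, pairwise disjoint and with the same image.\<close>

definition sibling_triple :: "complex set set \<Rightarrow> complex set \<Rightarrow> complex set set \<Rightarrow> bool" where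
  "sibling_triple L l T \<longleftrightarrow>
     T \<subseteq> L \<and> l \<in> T \<and> card T = 3 \<and> pairwise disjnt T \<and>
     (\<forall>m\<in>T. chord_image m = chord_image l)"

definition cubic_lamination :: "complex set set \<Rightarrow> bool" where
  "cubic_lamination L \<longleftrightarrow>
     lamination L \<and>
     (\<forall>l\<in>L. chord_image l \<in> L \<or> degenerate (chord_image l)) \<and>
     (\<forall>l\<in>L. \<exists>l'\<in>L. chord_image l' = l) \<and>
     (\<forall>l\<in>L. \<not> degenerate (chord_image l) \<longrightarrow> (\<exists>T. sibling_triple L l T))"

definition symmetric_cubic_lamination :: "complex set set \<Rightarrow> bool" where
  "symmetric_cubic_lamination L \<longleftrightarrow> cubic_lamination L \<and> (\<forall>l\<in>L. uminus ` l \<in> L)"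

section \<open>Majors and comajors\<close>

definition major :: "complex set set \<Rightarrow> complex set \<Rightarrow> bool" where
  "major L M \<longleftrightarrow>
     is_arg_min (\<lambda>l. \<bar>chord_length l - 1/3\<bar>) (\<lambda>l. l \<in> L \<and> \<not> degenerate l) M"

definition critical :: "complex set \<Rightarrow> bool" where
  "critical l \<longleftrightarrow> chord_length l = 1/3"

text \<open>
  Comajors are read off from \<^emph>\<open>the\<close> sibling triple of a non-critical major, so they are defined
  when every non-critical major lies in exactly one such triple. The only symmetric cubic
  laminations for which this fails are those that contain a diameter \<open>D\<close> with
  \<open>chord_image D = D\<close> together with all six sides of the regular hexagon spanned by the
  \<open>sigma3\<close>-preimages of the endpoints of \<open>D\<close>. There all sides and \<open>D\<close> are majors, two of the
  sides lie in two triples each, and no comajors are assigned. (Without this proviso the side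
  from \<open>t = 1/3\<close> to \<open>t = 1/2\<close>, obtained for \<open>D\<close> from \<open>0\<close> to \<open>1/2\<close>, would count as a comajor;
  it crosses the comajor from \<open>5/12\<close> to \<open>7/12\<close> obtained for \<open>D\<close> from \<open>1/4\<close> to \<open>3/4\<close>.)
\<close>

definition unique_major_triples :: "complex set set \<Rightarrow> bool" where
  "unique_major_triples L \<longleftrightarrow>
     (\<forall>M. major L M \<and> \<not> critical M \<longrightarrow> (\<exists>!T. sibling_triple L M T))"

text \<open>
  In a triple whose image has length \<open>d\<close>, all lengths are among \<open>d/3\<close>, \<open>(1 - d)/3\<close> and
  \<open>(1 + d)/3\<close>. A sibling of length \<open>1/6\<close> thus forces \<open>d = 1/2\<close> and excludes shorter siblings, so
  that the bound \<open>\<le> 1/6\<close> selects the siblings shorter than \<open>1/6\<close>, or those of length exactly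
  \<open>1/6\<close> if there are any.
\<close>

definition comajor :: "complex set set \<Rightarrow> complex set \<Rightarrow> bool" where
  "comajor L c \<longleftrightarrow>
     unique_major_triples L \<and>
     (\<exists>M. major L M \<and>
       (if critical M
        then \<exists>x\<in>circle. c = {x} \<and> x \<notin> endpoints M \<and> chord_image {x} = chord_image M
        else \<exists>T. sibling_triple L M T \<and> c \<in> T \<and> c \<noteq> M \<and> chord_length c \<le> 1/6))"

definition CsCL :: "complex set set" where
  "CsCL = {c. \<exists>L. symmetric_cubic_lamination L \<and> comajor L c}"

section \<open>q-laminations\<close>

definition lam_rel :: "complex set set \<Rightarrow> complex rel" where
  "lam_rel L =
     {(x, y). x \<in> circle \<and> y \<in> circle \<and>
              (x, y) \<in> {(a, b). a \<in> circle \<and> b \<in> circle \<and> closed_segment a b \<in> L}\<^sup>*}"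

definition laminational :: "complex rel \<Rightarrow> bool" where
  "laminational R \<longleftrightarrow>
     equiv circle R \<and>
     closedin (top_of_set (circle \<times> circle)) R \<and>
     (\<forall>A\<in>circle // R. \<forall>B\<in>circle // R. A \<noteq> B \<longrightarrow> convex hull A \<inter> convex hull B = {}) \<and>
     (\<forall>A\<in>circle // R. finite A)"

text \<open>
  The convex hull of a two-point class is a chord, which is its own single edge in the sense of
  \<open>edge_of\<close>. Edges are non-degenerate; the points of the circle, which are leaves by
  convention, are listed separately.
\<close>

definition q_lamination :: "complex set set \<Rightarrow> bool" where
  "q_lamination L \<longleftrightarrow>
     lamination L \<and>
     laminational (lam_rel L) \<and>
     L = {{x} | x. x \<in> circle} \<union> {e. \<exists>A\<in>circle // lam_rel L. e edge_of (convex hull A)}"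

end

theory Submission
  imports Defs
begin

text \<open>
  Points of the circle are real numbers modulo one, and tripling is \<open>t \<mapsto> 3 * t\<close>. A comajor
  \<open>c = pq\<close> of length \<open>e < 1/6\<close> has majors \<open>M\<close>, \<open>M'\<close> of lengths \<open>1/3 + e\<close> and \<open>1/3 - e\<close>; since no
  iterate of \<open>c\<close> crosses \<open>c\<close>, \<open>M\<close>, \<open>M'\<close> or their negatives, and no leaf is closer to length \<open>1/3\<close> than
  \<open>M\<close>, the endpoints \<open>p\<close> and \<open>q\<close> have the same itinerary with respect to the three sectors left by the
  strips \<open>c + k/6\<close> (predicate \<open>Q\<close>). Chords with property \<open>Q\<close> generate an equivalence relation with
  finite, mutually unlinked classes. On a periodic class the return maps act transitively (an argument
  of Milnor), so a diagonal of a class crosses one of its own iterates. Hence comajors are edges of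
  classes. Conversely an edge \<open>pq\<close> of a class is the comajor of the lamination formed by all chords
  that stay in the closed pieces cut out by the strips and cross no chord of that kind.

  The remaining comajors are the points of the circle, realised by the closure of the iterated
  preimages of a pair of critical chords, and four chords of length \<open>1/6\<close>, realised by the iterated
  preimages of an invariant diameter; the latter are classes of their own.
\<close>

section \<open>Arcs and crossing chords\<close>

text \<open>The obstacle is transitivity. Two chords with a common endpoint \<open>z\<close> have
  different strips, and their itineraries can be compared only through the strips of width zero at
  \<open>z\<close>: two critical chords, whose sectors share boundary points and on which tripling
  is not injective. If the orbit of \<open>z\<close> returns to such a boundary point
  (\<open>hyp\<close>), two partners of \<open>z\<close> are impossible, because the return
  contradicts transitivity of the return maps or the cyclic order. Otherwise the width-zero
  itinerary of \<open>z\<close> is unambiguous and, by expansion, not periodic (\<open>per\<close>);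
  then later iterates of chords of the class do not cross images of such chords, and every pair in
  the class has property \<open>Q\<close>.

  Positive width makes tripling injective and expanding on a sector, hence classes finite. The image
  of a chord of length \<open>e\<close> has length \<open>3 * e\<close> and lies in one sector, so
  \<open>3 * e \<le> 1/3 - e\<close> and \<open>e \<le> 1/12\<close>. Iterates are taken up to the
  half turn, the only nontrivial rotation commuting with tripling.\<close>

definition pos :: "real \<Rightarrow> real \<Rightarrow> real" where "pos a b = frac (b - a)"

lemma pos_ge0: "0 \<le> pos a b" and pos_lt1: "pos a b < 1"
  by (simp_all add: pos_def frac_lt_1)

lemma pos_unique: "0 \<le> r \<Longrightarrow> r < 1 \<Longrightarrow> b - a - r \<in> \<int> \<Longrightarrow> pos a b = r"
  unfolding pos_def by (metis frac_unique_iff)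

lemma pos_Ints: "b - a - pos a b \<in> \<int>"
  unfolding pos_def frac_def by simp

text \<open>\<open>pos\<close> is the counterclockwise distance from its first to its second
  argument, computed on real lifts. Moving the base point costs at most one full turn, so after
  choosing a common base point all questions of order on the circle become linear arithmetic with
  case distinctions.\<close>

lemma pos_base: "pos b c = (if pos o' b \<le> pos o' c then pos o' c - pos o' b else pos o' c - pos o' b + 1)"
proof -
  have 1: "c - b - (pos o' c - pos o' b) \<in> \<int>"
    using Ints_diff[OF pos_Ints[of c o'] pos_Ints[of b o']] by (simp add: algebra_simps)
  then have 2: "c - b - (pos o' c - pos o' b + 1) \<in> \<int>"
    using Ints_diff[OF 1 Ints_1] by (simp add: algebra_simps)
  note pos_lt1[of o' c] pos_lt1[of o' b] pos_ge0[of o' c] pos_ge0[of o' b]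
  with 1 2 show ?thesis by (auto intro!: pos_unique)
qed

lemma pos_triple:
  "pos (3*a) (3*b) = (if pos a b < 1/3 then 3 * pos a b else if pos a b < 2/3 then 3 * pos a b - 1 else 3 * pos a b - 2)"
proof -
  have "3 * (b - a - pos a b) \<in> \<int>" by (intro Ints_mult pos_Ints) simp
  then have 1: "3*b - 3*a - 3 * pos a b \<in> \<int>" by (simp add: algebra_simps)
  have 2: "3*b - 3*a - (3 * pos a b - 1) \<in> \<int>" using Ints_add[OF 1 Ints_1] by (simp add: algebra_simps)
  have 3: "3*b - 3*a - (3 * pos a b - 2) \<in> \<int>" using Ints_add[OF 2 Ints_1] by (simp add: algebra_simps)
  note pos_lt1[of a b] pos_ge0[of a b]
  with 1 2 3 show ?thesis by (auto intro!: pos_unique)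
qed

lemma pos_self [simp]: "pos a a = 0"
  by (simp add: pos_def)

lemma pos_shift [simp]: "pos (a + s) (b + s) = pos a b"
  by (simp add: pos_def)

lemma pos_add_right:
  assumes "0 \<le> s" "s < 1"
  shows "pos a (b + s) = (if pos a b + s < 1 then pos a b + s else pos a b + s - 1)"
proof -
  have 1: "b + s - a - (pos a b + s) \<in> \<int>" using pos_Ints[of b a] by (simp add: algebra_simps)
  have 2: "b + s - a - (pos a b + s - 1) \<in> \<int>" using Ints_add[OF 1 Ints_1] by (simp add: algebra_simps)
  note pos_lt1[of a b] pos_ge0[of a b]
  with 1 2 assms show ?thesis by (auto intro!: pos_unique)
qed

lemma pos_self_add: "0 \<le> s \<Longrightarrow> s < 1 \<Longrightarrow> pos a (a + s) = s"
  by (simp add: pos_add_right)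

lemma pos_swap: "pos b a = (if pos a b = 0 then 0 else 1 - pos a b)"
  using pos_base[of b a a] pos_ge0[of a b] by auto

lemma pos_eq0: "pos a b = 0 \<longleftrightarrow> b - a \<in> \<int>"
  by (simp add: pos_def frac_eq_0_iff)

lemma pos_cong: "pos a a' = 0 \<Longrightarrow> pos b b' = 0 \<Longrightarrow> pos a b = pos a' b'"
  using pos_base[of a b a] pos_base[of a' b a] pos_base[of a' b' b] pos_base[of a' b a']
    pos_swap[of b a'] pos_ge0[of a b] pos_lt1[of a b] pos_ge0[of b a'] pos_lt1[of a' b]
  by argo

section \<open>Cyclic order and crossing in coordinates\<close>

definition cyc :: "real \<Rightarrow> real \<Rightarrow> real \<Rightarrow> bool" where
  "cyc a b c \<longleftrightarrow> 0 < pos a b \<and> pos a b < pos a c"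

text \<open>All inequalities are strict, so chords that share an endpoint or are degenerate are not
  linked. \<open>crossing_seg\<close> identifies the relation with crossing inside the disk.\<close>

definition linked :: "real \<Rightarrow> real \<Rightarrow> real \<Rightarrow> real \<Rightarrow> bool" where
  "linked a b c d \<longleftrightarrow> cyc a c b \<and> cyc b d a \<or> cyc a d b \<and> cyc b c a"

lemma cyc_rot: "cyc a b c \<Longrightarrow> cyc b c a"
  unfolding cyc_def using pos_base[of b c a] pos_base[of b a a] pos_lt1[of a c]
  by (auto split: if_splits)

lemma linked_base:
  "linked a b c d \<longleftrightarrow>
    (0 < pos a c \<and> pos a c < pos a b \<and> pos a b < pos a d) \<or>
    (0 < pos a d \<and> pos a d < pos a b \<and> pos a b < pos a c)"
  unfolding linked_def cyc_def
  using pos_base[of b d a] pos_base[of b c a] pos_swap[of b a] pos_lt1[of a c] pos_lt1[of a d]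
  by (smt (verit) pos_ge0)

lemma linked_sym: "linked a b c d \<Longrightarrow> linked c d a b"
  unfolding linked_base
  using pos_base[of c a a] pos_base[of c b a] pos_base[of c d a] pos_self[of a]
  by (smt (verit) pos_ge0 pos_lt1)

lemma linked_swap1: "linked a b c d \<Longrightarrow> linked b a c d"
  unfolding linked_def by blast

lemma linked_swap2: "linked a b c d \<Longrightarrow> linked a b d c"
  unfolding linked_def by blast

lemma cyc_base:
  "cyc a b c \<longleftrightarrow> (pos u a < pos u b \<and> pos u b < pos u c) \<or> (pos u b < pos u c \<and> pos u c < pos u a)
    \<or> (pos u c < pos u a \<and> pos u a < pos u b)"
  unfolding cyc_def pos_base[of a b u] pos_base[of a c u]
  using pos_lt1[of u a] pos_lt1[of u b] pos_lt1[of u c] pos_ge0[of u a] pos_ge0[of u b] pos_ge0[of u c]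
  by auto

text \<open>The base point \<open>u\<close> is arbitrary, so that the four endpoints can be compared
  in the coordinate in which the sectors are described.\<close>

lemma linked_coord:
  "linked a b c d \<longleftrightarrow>
    (pos u a < pos u c \<and> pos u c < pos u b \<and> (pos u d < pos u a \<or> pos u b < pos u d)) \<or>
    (pos u b < pos u c \<and> pos u c < pos u a \<and> (pos u d < pos u b \<or> pos u a < pos u d)) \<or>
    (pos u a < pos u d \<and> pos u d < pos u b \<and> (pos u c < pos u a \<or> pos u b < pos u c)) \<or>
    (pos u b < pos u d \<and> pos u d < pos u a \<and> (pos u c < pos u b \<or> pos u a < pos u c))"
  unfolding linked_def cyc_base[of _ _ _ u] by linarith

section \<open>The three sectors between the strips\<close>

datatype sector = Near | Far | Mid

text \<open>Coordinates are measured from the endpoint \<open>p\<close> of the comajor. The band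
  between the chords from 1/6 to \<open>5/6 + e\<close> and from \<open>1/6 + e\<close> to 5/6, and
  the band between those from 1/3 to \<open>2/3 + e\<close> and from \<open>1/3 + e\<close> to 2/3,
  cut the disk into three closed pieces: \<open>Near\<close> contains the comajor,
  \<open>Far\<close> its negative, and \<open>Mid\<close> lies between the bands. At
  \<open>e = 0\<close> the bands shrink to two critical chords.\<close>

fun sec :: "real \<Rightarrow> sector \<Rightarrow> real \<Rightarrow> bool" where
  "sec e Near u \<longleftrightarrow> u \<le> 1/6 \<or> e + 5/6 \<le> u"
| "sec e Far u \<longleftrightarrow> e + 1/3 \<le> u \<and> u \<le> 2/3"
| "sec e Mid u \<longleftrightarrow> e + 1/6 \<le> u \<and> u \<le> 1/3 \<or> e + 2/3 \<le> u \<and> u \<le> 5/6"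

definition K :: "real \<Rightarrow> real \<Rightarrow> sector \<Rightarrow> real \<Rightarrow> bool" where
  "K p e j t \<longleftrightarrow> sec e j (pos p t)"

definition same :: "real \<Rightarrow> real \<Rightarrow> real \<Rightarrow> real \<Rightarrow> bool" where
  "same p e a b \<longleftrightarrow> (\<exists>j. K p e j a \<and> K p e j b)"

lemma same_sym: "same p e a b \<Longrightarrow> same p e b a"
  unfolding same_def by blast

text \<open>After the arcs missing from a sector are collapsed, a circle of length at most 1/3 is
  left, which tripling wraps at most once around the target; so the cyclic order survives. At
  \<open>e = 0\<close> the two ends of a missing arc have the same image, hence the assumption that
  the images are distinct.\<close>

lemma K_order:
  assumes "0 \<le> e" "K p e j a" "K p e j b" "K p e j c" "cyc a b c"
    and "pos (3*a) (3*b) \<noteq> 0" "pos (3*b) (3*c) \<noteq> 0" "pos (3*a) (3*c) \<noteq> 0"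
  shows "cyc (3*a) (3*b) (3*c)"
proof -
  define x y z where d: "x = pos p a" "y = pos p b" "z = pos p c"
  have r: "0 \<le> x" "x < 1" "0 \<le> y" "y < 1" "0 \<le> z" "z < 1" using d pos_ge0 pos_lt1 by auto
  define x' y' z' where d': "x' = pos (3*p) (3*a)" "y' = pos (3*p) (3*b)" "z' = pos (3*p) (3*c)"
  have n: "x' \<noteq> y'" "y' \<noteq> z'" "x' \<noteq> z'"
    using assms(6-) pos_base[of "3*a" "3*b" "3*p"] pos_base[of "3*b" "3*c" "3*p"] pos_base[of "3*a" "3*c" "3*p"]
    unfolding d' by auto
  have f: "x' = (if x < 1/3 then 3 * x else if x < 2/3 then 3 * x - 1 else 3 * x - 2)"
    "y' = (if y < 1/3 then 3 * y else if y < 2/3 then 3 * y - 1 else 3 * y - 2)"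
    "z' = (if z < 1/3 then 3 * z else if z < 2/3 then 3 * z - 1 else 3 * z - 2)" unfolding d d' by (rule pos_triple)+
  have s: "sec e j x" "sec e j y" "sec e j z" using assms d by (auto simp: K_def)
  have c: "(x < y \<and> y < z) \<or> (y < z \<and> z < x) \<or> (z < x \<and> x < y)"
    using assms(5) unfolding d cyc_base[of _ _ _ p] .
  have "(x' < y' \<and> y' < z') \<or> (y' < z' \<and> z' < x') \<or> (z' < x' \<and> x' < y')"
  proof (cases j)
    case Near
    show ?thesis using assms(1) n f r c s unfolding Near sec.simps
      by argo
  next
    case Far
    show ?thesis using assms(1) n f r c s unfolding Far sec.simps
      by argo
  next
    case Mid
    show ?thesis using assms(1) n f r c s unfolding Mid sec.simps
      by argo
  qed
  then show ?thesis unfolding d' cyc_base[of _ _ _ "3*p"] .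
qed

text \<open>Chords in different pieces of the disk cannot cross. A common border, possible at
  \<open>e = 0\<close>, does no harm because linking is strict.\<close>

lemma K_linked:
  assumes "0 \<le> e" "K p e i a" "K p e i b" "K p e j c" "K p e j d" "linked a b c d"
  shows "i = j"
  using assms unfolding K_def linked_coord[of _ _ _ _ p]
  by (cases i; cases j) auto

text \<open>For \<open>e > 0\<close> no two points of a sector are at a distance within less than
  \<open>e\<close> of 1/3; this is what makes tripling injective and expanding there.\<close>

lemma K_gap:
  assumes "0 \<le> e" "e \<le> 1/6" "K p e j a" "K p e j b"
  shows "pos a b \<le> 1/3 - e \<or> (1/3 + e \<le> pos a b \<and> pos a b \<le> 2/3 - e) \<or> 2/3 + e \<le> pos a b"
proof -
  define x y where d: "x = pos p a" "y = pos p b"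
  have r: "0 \<le> x" "x < 1" "0 \<le> y" "y < 1" using d pos_ge0 pos_lt1 by auto
  have f: "pos a b = (if x \<le> y then y - x else y - x + 1)" unfolding d by (rule pos_base)
  have s: "sec e j x" "sec e j y" using assms d by (auto simp: K_def)
  show ?thesis
    using assms(1,2) r s unfolding f
    by (cases j) (auto split: if_splits)
qed

definition apart :: "real \<Rightarrow> real \<Rightarrow> real \<Rightarrow> bool" where
  "apart r a b \<longleftrightarrow> r \<le> pos a b \<and> pos a b \<le> 1 - r"

text \<open>The images of two points are close only if the distance of the points is near 0, 1/3 or
  2/3. \<open>K_gap\<close> keeps the last two at least \<open>e\<close> away, so a bound
  \<open>s\<close> below \<open>e\<close> and below the original distance is tripled.\<close>

lemma same_apart:
  assumes "0 < e" "e \<le> 1/6" "same p e a b" "apart r a b" "r \<le> 3 * s" "0 < r" "s \<le> e" "s \<le> r"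
  shows "apart (3 * s) (3*a) (3*b)"
proof -
  obtain j where "K p e j a" "K p e j b" using assms unfolding same_def by blast
  from K_gap[OF _ _ this] assms show ?thesis
    unfolding apart_def pos_triple by (auto split: if_splits)
qed

section \<open>Itineraries with respect to a strip\<close>

lemma pos_frac_left [simp]: "pos (frac a) b = pos a b"
  using pos_base[of "frac a" b a] pos_eq0[of a "frac a"] pos_ge0[of a b] by (simp add: frac_def)

lemma pos_frac_right [simp]: "pos a (frac b) = pos a b"
  using pos_base[of a "frac b" b] pos_base[of a b b] pos_eq0[of b "frac b"] by (simp add: frac_def)

lemma pos_0: "pos 0 t = frac t"
  by (simp add: pos_def)

lemma pos0_sym: "pos a b = 0 \<Longrightarrow> pos b a = 0"
  using pos_swap[of b a] by simp

lemma pos0_trans: "pos a b = 0 \<Longrightarrow> pos b c = 0 \<Longrightarrow> pos a c = 0"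
  using pos_base[of a c b] by (simp add: pos0_sym)

lemma pos0_mult: "pos a b = 0 \<Longrightarrow> pos (3 ^ n * a) (3 ^ n * b) = 0"
  unfolding pos_eq0 by (metis Ints_mult Ints_numeral Ints_power right_diff_distrib)

lemma pos0_frac: "0 \<le> a \<Longrightarrow> a < 1 \<Longrightarrow> 0 \<le> b \<Longrightarrow> b < 1 \<Longrightarrow> pos a b = 0 \<Longrightarrow> a = b"
  by (metis pos_0 pos_cong pos_self frac_eq)

lemma pos_frac_mult_left [simp]: "pos (3 ^ n * frac a) b = pos (3 ^ n * a) b"
  and pos_frac_mult_right [simp]: "pos b (3 ^ n * frac a) = pos b (3 ^ n * a)"
proof -
  have "pos (3 ^ n * frac a) (3 ^ n * a) = 0"
    by (rule pos0_mult) simp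
  then show "pos (3 ^ n * frac a) b = pos (3 ^ n * a) b" "pos b (3 ^ n * frac a) = pos b (3 ^ n * a)"
    by (auto intro: pos_cong)
qed

text \<open>The two rotations that commute with tripling. Since the laminations are symmetric,
  iterates are always considered up to one of them.\<close>

definition turns :: "real set" where "turns = {0, 1/2}"

lemma pos_half: "h \<in> turns \<Longrightarrow> pos (3 ^ n * h) h = 0"
proof -
  have "even (3 ^ n - 1 :: int)" by simp
  then obtain k where "3 ^ n - 1 = 2 * (k::int)" by (elim evenE)
  then have "real_of_int (3 ^ n - 1) = real_of_int (2 * k)" by presburger
  then have "1/2 - 3 ^ n * (1/2) = - real_of_int k" by simp
  then have "1/2 - 3 ^ n * (1/2) \<in> (\<int>::real set)" by (metis Ints_minus Ints_of_int)
  then show "h \<in> turns \<Longrightarrow> pos (3 ^ n * h) h = 0" unfolding turns_def by (elim insertE emptyE) (simp_all only: pos_eq0, simp_all)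
qed

lemma pos_pow_half: "h \<in> turns \<Longrightarrow> pos (3 ^ n * (a + h)) (3 ^ n * a + h) = 0"
  using pos_half[of h n] pos_shift[of "3 ^ n * h" "3 ^ n * a" h] by (simp add: algebra_simps)

lemma K_cong: "pos a b = 0 \<Longrightarrow> K p e j a \<longleftrightarrow> K p e j b"
  unfolding K_def using pos_cong[of p p a b] by simp

lemma K_frac [simp]: "K p e j (frac a) \<longleftrightarrow> K p e j a" "K p e j (3 ^ n * frac a) \<longleftrightarrow> K p e j (3 ^ n * a)"
  by (simp_all add: K_def)

fun flip :: "sector \<Rightarrow> sector" where
  "flip Near = Far" | "flip Far = Near" | "flip Mid = Mid"

lemma flip_flip [simp]: "flip (flip j) = j"
  by (cases j) simp_all

lemma K_half: "0 \<le> e \<Longrightarrow> e \<le> 1/6 \<Longrightarrow> K p e (flip j) (t + 1/2) \<longleftrightarrow> K p e j t"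
  unfolding K_def using pos_add_right[of "1/2" p t] pos_ge0[of p t] pos_lt1[of p t]
  by (cases j) (auto split: if_splits)

lemma K_unique: "0 < e \<Longrightarrow> K p e i t \<Longrightarrow> K p e j t \<Longrightarrow> i = j"
  unfolding K_def using pos_ge0[of p t] pos_lt1[of p t] by (cases i; cases j) auto

text \<open>A common sector is demanded at each time instead of equality of itinerary functions: the
  sectors need not cover the circle, and at \<open>e = 0\<close> a point may lie in two of
  them.\<close>

definition sim :: "real \<Rightarrow> real \<Rightarrow> real \<Rightarrow> real \<Rightarrow> bool" where
  "sim p e a b \<longleftrightarrow> (\<forall>n. same p e (3 ^ n * a) (3 ^ n * b))"

lemma sim_sym: "sim p e a b \<Longrightarrow> sim p e b a"
  unfolding sim_def using same_sym by blast

lemma sim_trans: "0 < e \<Longrightarrow> sim p e a b \<Longrightarrow> sim p e b c \<Longrightarrow> sim p e a c"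
  unfolding sim_def same_def using K_unique by metis

lemma sim_frac [simp]: "sim p e (frac a) b \<longleftrightarrow> sim p e a b" "sim p e a (frac b) \<longleftrightarrow> sim p e a b"
  by (simp_all add: sim_def same_def)

lemma sim_cong: "pos a a' = 0 \<Longrightarrow> pos b b' = 0 \<Longrightarrow> sim p e a b \<longleftrightarrow> sim p e a' b'"
proof -
  assume *: "pos a a' = 0" "pos b b' = 0"
  have "K p e j (3 ^ n * a) \<longleftrightarrow> K p e j (3 ^ n * a')" "K p e j (3 ^ n * b) \<longleftrightarrow> K p e j (3 ^ n * b')" for j n
    using * by (simp_all add: K_cong pos0_mult)
  then show "sim p e a b \<longleftrightarrow> sim p e a' b'" by (simp add: sim_def same_def)
qed

lemma sim_pow: "sim p e a b \<Longrightarrow> sim p e (3 ^ n * a) (3 ^ n * b)"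
  unfolding sim_def by (metis mult.assoc power_add)

lemma same_half: "0 \<le> e \<Longrightarrow> e \<le> 1/6 \<Longrightarrow> same p e (a + 1/2) (b + 1/2) \<longleftrightarrow> same p e a b"
proof -
  assume *: "0 \<le> e" "e \<le> 1/6"
  have "K p e j (t + 1/2) \<longleftrightarrow> K p e (flip j) t" for j t
    using K_half[OF *, of p "flip j" t] by simp
  then show "same p e (a + 1/2) (b + 1/2) \<longleftrightarrow> same p e a b"
    unfolding same_def using flip_flip by (metis (no_types))
qed

lemma sim_half: "0 \<le> e \<Longrightarrow> e \<le> 1/6 \<Longrightarrow> sim p e a b \<Longrightarrow> h \<in> turns \<Longrightarrow> sim p e (a + h) (b + h)"
proof -
  assume *: "0 \<le> e" "e \<le> 1/6" "sim p e a b" "h \<in> turns"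
  have "same p e (3 ^ n * (a + h)) (3 ^ n * (b + h))" for n
  proof -
    have "same p e (3 ^ n * a + h) (3 ^ n * b + h)"
      using *(4) same_half[OF *(1,2)] *(3)[unfolded sim_def] unfolding turns_def by (elim insertE emptyE) (simp_all only: add_0_right)
    moreover have "pos (3 ^ n * (a + h)) (3 ^ n * a + h) = 0" "pos (3 ^ n * (b + h)) (3 ^ n * b + h) = 0"
      using * by (auto intro!: pos_pow_half)
    ultimately show ?thesis
      unfolding same_def using K_cong by blast
  qed
  then show ?thesis by (simp add: sim_def)
qed

text \<open>Two preimages of a point differ by a multiple of 1/3, and \<open>K_gap\<close> leaves
  only the multiple 0.\<close>

lemma K_inj:
  assumes "0 < e" "e \<le> 1/6" "same p e a b" "pos (3 * a) (3 * b) = 0"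
  shows "pos a b = 0"
proof -
  obtain j where "K p e j a" "K p e j b" using assms(3) unfolding same_def by blast
  from K_gap[OF _ _ this] assms show ?thesis
    unfolding pos_triple using pos_lt1[of a b] pos_ge0[of a b] by (auto split: if_splits)
qed

lemma sim_inj:
  assumes "0 < e" "e \<le> 1/6" "sim p e a b" "pos (3 ^ n * a) (3 ^ n * b) = 0"
  shows "pos a b = 0"
  using assms(4)
proof (induction n)
  case (Suc n)
  then show ?case
    using K_inj[OF assms(1,2), of p "3 ^ n * a" "3 ^ n * b"] assms(3) by (simp add: sim_def mult.assoc)
qed simp

lemma sim_order1:
  assumes "0 < e" "e \<le> 1/6" "sim p e a b" "sim p e a c" "cyc a b c"
  shows "cyc (3 * a) (3 * b) (3 * c)"
proof -
  have bc: "sim p e b c" using assms sim_sym sim_trans by blast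
  obtain j where j: "K p e j a" "K p e j b" using assms(3) unfolding sim_def same_def by (metis power_0 mult_1)
  obtain j' where j': "K p e j' a" "K p e j' c" using assms(4) unfolding sim_def same_def by (metis power_0 mult_1)
  have "j' = j" using K_unique j j' assms by blast
  have n: "pos a b \<noteq> 0" "pos a c \<noteq> 0" "pos b c \<noteq> 0"
    using assms(5) pos_base[of b c a] unfolding cyc_def by auto
  show ?thesis
    using K_order[OF _ j j'(2)[unfolded \<open>j' = j\<close>] assms(5)] assms n sim_inj[OF assms(1,2), of p _ _ 1] bc by auto
qed

lemma sim_order:
  assumes "0 < e" "e \<le> 1/6" "sim p e a b" "sim p e a c" "cyc a b c"
  shows "cyc (3 ^ n * a) (3 ^ n * b) (3 ^ n * c)"
proof (induction n)
  case (Suc n)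
  then show ?case
    using sim_order1[OF assms(1,2) sim_pow[OF assms(3), of n] sim_pow[OF assms(4), of n]] by (simp add: mult.assoc)
qed (use assms in simp)

section \<open>Crossing, expansion and finiteness for equal itineraries\<close>

lemma pos0_comm: "pos a b = 0 \<longleftrightarrow> pos b a = 0"
  using pos0_sym by blast

lemma cyc_distinct:
  assumes "cyc a b c"
  shows "pos a b \<noteq> 0" "pos b c \<noteq> 0" "pos c a \<noteq> 0" "pos b a \<noteq> 0" "pos c b \<noteq> 0" "pos a c \<noteq> 0"
  using assms cyc_rot[OF assms] pos0_sym unfolding cyc_def by force+

lemma linked_distinct:
  assumes "linked a b c d"
  shows "pos a c \<noteq> 0" "pos a d \<noteq> 0" "pos b c \<noteq> 0" "pos b d \<noteq> 0" "pos a b \<noteq> 0" "pos c d \<noteq> 0"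
proof -
  have "pos c d \<noteq> 0"
    using linked_sym[OF assms] cyc_distinct unfolding linked_def by blast
  then show "pos a c \<noteq> 0" "pos a d \<noteq> 0" "pos b c \<noteq> 0" "pos b d \<noteq> 0" "pos a b \<noteq> 0" "pos c d \<noteq> 0"
    using assms cyc_distinct unfolding linked_def by blast+
qed

lemma linked_triple:
  assumes "0 \<le> e" "K p e j a" "K p e j b" "K p e j c" "K p e j d" "linked a b c d"
    and "pos (3*a) (3*b) \<noteq> 0" "pos (3*a) (3*c) \<noteq> 0" "pos (3*a) (3*d) \<noteq> 0"
     "pos (3*b) (3*c) \<noteq> 0" "pos (3*b) (3*d) \<noteq> 0"
  shows "linked (3*a) (3*b) (3*c) (3*d)"
proof -
  have n: "pos (3*b) (3*a) \<noteq> 0" "pos (3*c) (3*a) \<noteq> 0" "pos (3*d) (3*a) \<noteq> 0"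
     "pos (3*c) (3*b) \<noteq> 0" "pos (3*d) (3*b) \<noteq> 0"
    using assms(7-) pos0_sym by blast+
  show ?thesis
    using assms(6) unfolding linked_def
    using K_order[OF assms(1,2,4,3) _ assms(8) n(4) assms(7)] K_order[OF assms(1,3,5,2) _ assms(11) n(3,1)]
      K_order[OF assms(1,2,5,3) _ assms(9) n(5) assms(7)] K_order[OF assms(1,3,4,2) _ assms(10) n(2,1)]
    by blast
qed

text \<open>Crossing chords lie in one sector, where tripling is injective and preserves the order,
  so their images cross again. By induction all four endpoints share one itinerary.\<close>

lemma linked_sim:
  assumes "0 < e" "e \<le> 1/6" "sim p e a b" "sim p e c d" "linked a b c d"
  shows "sim p e a c" "linked (3 ^ n * a) (3 ^ n * b) (3 ^ n * c) (3 ^ n * d)"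
proof -
  have *: "linked (3 ^ n * a) (3 ^ n * b) (3 ^ n * c) (3 ^ n * d) \<and> same p e (3 ^ n * a) (3 ^ n * c)" for n
  proof (induction n)
    case 0
    obtain i j where "K p e i a" "K p e i b" "K p e j c" "K p e j d"
      using assms(3,4) unfolding sim_def same_def by (metis power_0 mult_1)
    then show ?case
      using K_linked[of e p i a b j c d] assms unfolding same_def by auto
  next
    case (Suc n)
    let ?a = "3 ^ n * a" and ?b = "3 ^ n * b" and ?c = "3 ^ n * c" and ?d = "3 ^ n * d"
    obtain i j where k: "K p e i ?a" "K p e i ?b" "K p e j ?c" "K p e j ?d"
      using assms(3,4) unfolding sim_def same_def by metis
    have ij: "j = i" using K_linked[OF _ k] Suc assms by simp
    have ne: "pos (3 * x) (3 * y) \<noteq> 0" if "K p e i x" "K p e i y" "pos x y \<noteq> 0" for x y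
      using K_inj[OF assms(1,2), of p x y] that unfolding same_def by blast
    note k' = k(1,2) k(3,4)[unfolded ij] and d = linked_distinct[OF conjunct1[OF Suc]]
    have l: "linked (3 * ?a) (3 * ?b) (3 * ?c) (3 * ?d)"
      by (intro linked_triple[OF less_imp_le[OF assms(1)] k'] conjunct1[OF Suc]
          ne[OF k'(1,2) d(5)] ne[OF k'(1,3) d(1)] ne[OF k'(1,4) d(2)] ne[OF k'(2,3) d(3)] ne[OF k'(2,4) d(4)])
    obtain i j where k: "K p e i (3 * ?a)" "K p e i (3 * ?b)" "K p e j (3 * ?c)" "K p e j (3 * ?d)"
      using assms(3,4) unfolding sim_def same_def by (metis power_Suc mult.assoc)
    have ij: "i = j" using K_linked[OF _ k l] assms by simp
    then show ?case
      using k l unfolding same_def by (auto simp: mult.assoc)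
  qed
  then show "sim p e a c" "linked (3 ^ n * a) (3 ^ n * b) (3 ^ n * c) (3 ^ n * d)"
    by (auto simp: sim_def)
qed

lemma apart_mono: "apart r a b \<Longrightarrow> s \<le> r \<Longrightarrow> apart s a b"
  unfolding apart_def by linarith

text \<open>Distances triple as long as they are below \<open>e\<close>. Once a distance is at least
  \<open>e\<close>, each further step ends with at least \<open>3 * e\<close>.\<close>

lemma sim_apart:
  assumes "0 < e" "e \<le> 1/6" "sim p e a b" "pos a b \<noteq> 0"
  shows "\<exists>N. \<forall>n\<ge>N. apart (3 * e) (3 ^ n * a) (3 ^ n * b)"
proof -
  define r where "r = min (pos a b) (1 - pos a b)"
  have r: "0 < r" "apart r a b"
    using assms(4) pos_ge0[of a b] pos_lt1[of a b] by (auto simp: r_def apart_def)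
  have step: "apart (3 * s) (3 ^ Suc n * a) (3 ^ Suc n * b)"
    if "apart s (3 ^ n * a) (3 ^ n * b)" "0 < s" "s \<le> e" for n s
    using same_apart[OF assms(1,2), of p "3 ^ n * a" "3 ^ n * b" s s] that assms(3)
    by (simp add: sim_def mult.assoc)
  have *: "apart (min (3 ^ n * r) e) (3 ^ n * a) (3 ^ n * b)" for n
  proof (induction n)
    case 0
    then show ?case using apart_mono[OF r(2), of "min r e"] by simp
  next
    case (Suc n)
    have m: "0 < min (3 ^ n * r) e" using r assms by simp
    show ?case
      by (rule apart_mono[OF step[OF Suc m]]) (use assms(1) r(1) in auto)
  qed
  have "\<exists>N. e / r < 3 ^ N" by (rule real_arch_pow) simp
  then obtain N where N: "e / r < 3 ^ N" by blast
  have "apart (3 * e) (3 ^ n * a) (3 ^ n * b)" if "n \<ge> Suc N" for n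
  proof -
    define m where "m = n - 1"
    have m: "n = Suc m" "N \<le> m" using that unfolding m_def by linarith+
    have "e / r < 3 ^ m" using N power_increasing[OF m(2), of "3::real"] by linarith
    then have "e \<le> 3 ^ m * r" using r(1) by (simp add: pos_divide_less_eq)
    then have "apart e (3 ^ m * a) (3 ^ m * b)" using *[of m] by (simp add: min_absorb2)
    then show ?thesis using step[of e m] assms(1) unfolding m(1) by blast
  qed
  then show ?thesis by blast
qed

lemma separated_card:
  fixes F :: "real set"
  assumes "0 < d" "\<And>x. x \<in> F \<Longrightarrow> 0 \<le> x \<and> x < 1"
    and "\<And>x y. x \<in> F \<Longrightarrow> y \<in> F \<Longrightarrow> x \<noteq> y \<Longrightarrow> d \<le> \<bar>x - y\<bar>"
  shows "card F \<le> card {0..\<lfloor>1 / d\<rfloor>}"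
proof (rule card_inj_on_le[of "\<lambda>x. \<lfloor>x / d\<rfloor>"])
  show "inj_on (\<lambda>x. \<lfloor>x / d\<rfloor>) F"
  proof (rule inj_onI, rule ccontr)
    fix x y assume *: "x \<in> F" "y \<in> F" "\<lfloor>x / d\<rfloor> = \<lfloor>y / d\<rfloor>" "x \<noteq> y"
    then have "\<bar>x / d - y / d\<bar> < 1" by linarith
    then have "\<bar>x - y\<bar> < d" using assms(1) by (simp add: diff_divide_distrib[symmetric] abs_divide)
    then show False using assms(3) * by fastforce
  qed
  show "(\<lambda>x. \<lfloor>x / d\<rfloor>) ` F \<subseteq> {0..\<lfloor>1 / d\<rfloor>}"
  proof safe
    fix x assume "x \<in> F"
    then have "0 \<le> x / d" "x / d \<le> 1 / d" using assms(1) assms(2)[of x] by (simp_all add: divide_right_mono less_imp_le)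
    then show "\<lfloor>x / d\<rfloor> \<in> {0..\<lfloor>1 / d\<rfloor>}" by (auto intro: floor_mono)
  qed
qed simp

lemma apart_frac: "apart d a b \<Longrightarrow> 0 < d \<Longrightarrow> d \<le> \<bar>frac a - frac b\<bar> \<and> \<bar>frac a - frac b\<bar> \<le> 1 - d"
  unfolding apart_def using pos_base[of a b 0] by (auto simp: pos_0 split: if_splits)

text \<open>Finitely many points of one class are pairwise \<open>3 * e\<close> apart at some common
  time, and the circle has room for only a bounded number of such points.\<close>

lemma sim_finite:
  assumes "0 < e" "e \<le> 1/6"
  shows "finite {t. 0 \<le> t \<and> t < 1 \<and> sim p e a t}" (is "finite ?C")
proof (rule ccontr)
  let ?M = "card {0..\<lfloor>1 / (3 * e)\<rfloor>}"
  assume "infinite ?C"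
  then obtain F where F: "finite F" "card F = Suc ?M" "F \<subseteq> ?C"
    using infinite_arbitrarily_large by blast
  have sF: "sim p e x y" if "x \<in> F" "y \<in> F" for x y
    using F(3) that sim_sym sim_trans[OF assms(1)] by blast
  have "\<exists>N. \<forall>n\<ge>N. apart (3 * e) (3 ^ n * x) (3 ^ n * y)" if "x \<in> F" "y \<in> F" "x \<noteq> y" for x y
    using sim_apart[OF assms sF[OF that(1,2)]] pos0_frac[of x y] F(3) that by auto
  then obtain N where N: "\<And>x y n. x \<in> F \<Longrightarrow> y \<in> F \<Longrightarrow> x \<noteq> y \<Longrightarrow> N x y \<le> n \<Longrightarrow> apart (3 * e) (3 ^ n * x) (3 ^ n * y)"
    by metis
  define n where "n = Max ((\<lambda>(x, y). N x y) ` (F \<times> F))"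
  have ap: "apart (3 * e) (3 ^ n * x) (3 ^ n * y)" if "x \<in> F" "y \<in> F" "x \<noteq> y" for x y
  proof (rule N[OF that])
    show "N x y \<le> n"
      unfolding n_def using F(1) that by (intro Max_ge) force+
  qed
  let ?f = "\<lambda>t. frac (3 ^ n * t)"
  have sep: "3 * e \<le> \<bar>?f x - ?f y\<bar>" if "x \<in> F" "y \<in> F" "x \<noteq> y" for x y
    using apart_frac[OF ap[OF that]] assms by simp
  have "inj_on ?f F"
    using sep assms(1) by (fastforce intro!: inj_onI)
  then have "card (?f ` F) = Suc ?M" using F(2) by (simp add: card_image)
  moreover have "card (?f ` F) \<le> ?M"
  proof (rule separated_card)
    show "3 * e \<le> \<bar>u - v\<bar>" if "u \<in> ?f ` F" "v \<in> ?f ` F" "u \<noteq> v" for u v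
      using that sep by auto
  qed (use assms frac_lt_1 in auto)
  ultimately show False by simp
qed

text \<open>A form of the absence of wandering triangles. By the pigeonhole principle the triangle
  comes back close to an earlier position. Its three vertices move in only two directions, so either
  a vertex returns exactly, or two vertices move the same way; in the latter case the chord between
  them crosses its earlier copy, and \<open>linked_sim\<close> puts both into one class.\<close>

lemma sim_eventually_periodic:
  assumes e: "0 < e" "e \<le> 1/6" and ab: "sim p e a b" and ac: "sim p e a c"
    and ne: "pos a b \<noteq> 0" "pos a c \<noteq> 0" "pos b c \<noteq> 0"
  shows "\<exists>m n. m < n \<and> sim p e (3 ^ m * a) (3 ^ n * a)"
proof -
  have bc: "sim p e b c" using ab ac e sim_sym sim_trans by blast
  obtain N1 N2 N3 where N: "\<And>n. n \<ge> N1 \<Longrightarrow> apart (3 * e) (3 ^ n * a) (3 ^ n * b)"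
    "\<And>n. n \<ge> N2 \<Longrightarrow> apart (3 * e) (3 ^ n * a) (3 ^ n * c)"
    "\<And>n. n \<ge> N3 \<Longrightarrow> apart (3 * e) (3 ^ n * b) (3 ^ n * c)"
    using sim_apart[OF e ab ne(1)] sim_apart[OF e ac ne(2)] sim_apart[OF e bc ne(3)] by metis
  define N where "N = max N1 (max N2 N3)"
  let ?k = "\<lambda>t n. \<lfloor>frac (3 ^ n * t) / e\<rfloor>"
  let ?F = "\<lambda>n. (?k a n, ?k b n, ?k c n)"
  have in_rng: "?k t n \<in> {0..\<lfloor>1 / e\<rfloor>}" for t n
  proof -
    have "0 \<le> frac (3 ^ n * t) / e" "frac (3 ^ n * t) / e \<le> 1 / e"
      using e(1) frac_lt_1[of "3 ^ n * t"] by (simp_all add: divide_right_mono less_imp_le)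
    then show ?thesis by (auto intro: floor_mono)
  qed
  have "finite ({0..\<lfloor>1 / e\<rfloor>} \<times> {0..\<lfloor>1 / e\<rfloor>} \<times> {0..\<lfloor>1 / e\<rfloor>})" by simp
  moreover have "?F ` {N..} \<subseteq> {0..\<lfloor>1 / e\<rfloor>} \<times> {0..\<lfloor>1 / e\<rfloor>} \<times> {0..\<lfloor>1 / e\<rfloor>}"
    using in_rng by blast
  ultimately have "finite (?F ` {N..})" by (rule finite_subset[rotated])
  then have "\<not> inj_on ?F {N..}"
    using finite_imageD infinite_Ici by blast
  then obtain m n where mn: "m \<ge> N" "n \<ge> N" "m < n" "?F m = ?F n"
    unfolding inj_on_def by (metis atLeast_iff nat_neq_iff)
  have close: "\<bar>frac (3 ^ m * t) - frac (3 ^ n * t)\<bar> < e" if "?k t m = ?k t n" for t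
  proof -
    have "\<bar>frac (3 ^ m * t) / e - frac (3 ^ n * t) / e\<bar> < 1" using that by linarith
    then show ?thesis using e(1) by (simp add: diff_divide_distrib[symmetric] abs_divide)
  qed
  define x y z x' y' z' where d: "x = frac (3 ^ m * a)" "y = frac (3 ^ m * b)" "z = frac (3 ^ m * c)"
    "x' = frac (3 ^ n * a)" "y' = frac (3 ^ n * b)" "z' = frac (3 ^ n * c)"
  have cl: "\<bar>x - x'\<bar> < e" "\<bar>y - y'\<bar> < e" "\<bar>z - z'\<bar> < e" using close mn(4) unfolding d by auto
  have sep: "3 * e \<le> \<bar>x - y\<bar>" "3 * e \<le> \<bar>x - z\<bar>" "3 * e \<le> \<bar>y - z\<bar>"
    using N apart_frac mn(1) e(1) unfolding d N_def by auto
  have sm: "sim p e (3 ^ m * a) (3 ^ m * b)" "sim p e (3 ^ m * a) (3 ^ m * c)" "sim p e (3 ^ m * b) (3 ^ m * c)"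
    "sim p e (3 ^ n * a) (3 ^ n * b)" "sim p e (3 ^ n * a) (3 ^ n * c)" "sim p e (3 ^ n * b) (3 ^ n * c)"
    using ab ac bc sim_pow by blast+
  \<comment> \<open>Displacements are below \<open>e\<close> while the ends are \<open>3 * e\<close>
    apart, so a chord whose two ends move in the same direction crosses its old position.\<close>
  have lk: "linked u v u' v'"
    if "\<bar>frac u - frac u'\<bar> < e" "\<bar>frac v - frac v'\<bar> < e" "3 * e \<le> \<bar>frac u - frac v\<bar>"
      "frac u < frac u' \<and> frac v < frac v' \<or> frac u' < frac u \<and> frac v' < frac v" for u v u' v'
    using that e(1) unfolding linked_coord[of _ _ _ _ 0] pos_0 by (auto simp: abs_if split: if_splits)
  have eq0: "pos u v = 0" if "frac u = frac v" for u v
    using that by (metis pos_frac_left pos_frac_right pos_self)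
  consider "x = x'" | "y = y'" | "z = z'" | "linked (3 ^ m * a) (3 ^ m * b) (3 ^ n * a) (3 ^ n * b)"
    | "linked (3 ^ m * a) (3 ^ m * c) (3 ^ n * a) (3 ^ n * c)" | "linked (3 ^ m * b) (3 ^ m * c) (3 ^ n * b) (3 ^ n * c)"
    using lk[of "3 ^ m * a" "3 ^ n * a" "3 ^ m * b" "3 ^ n * b"] lk[of "3 ^ m * a" "3 ^ n * a" "3 ^ m * c" "3 ^ n * c"]
      lk[of "3 ^ m * b" "3 ^ n * b" "3 ^ m * c" "3 ^ n * c"] cl sep unfolding d[symmetric] by argo
  then have "sim p e (3 ^ m * a) (3 ^ n * a)"
  proof cases
    case 1
    then have "pos (3 ^ m * a) (3 ^ n * a) = 0" using eq0 d by simp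
    moreover have "sim p e (3 ^ m * a) (3 ^ m * a)" using sm(1) sim_sym sim_trans[OF e(1)] by blast
    ultimately show ?thesis using sim_cong[OF pos_self] by blast
  next
    case 2
    then have "pos (3 ^ m * b) (3 ^ n * b) = 0" using eq0 d by simp
    then have "sim p e (3 ^ m * a) (3 ^ n * b)" using sm(1) sim_cong[OF pos_self] by blast
    then show ?thesis using sm sim_sym sim_trans[OF e(1)] by blast
  next
    case 3
    then have "pos (3 ^ m * c) (3 ^ n * c) = 0" using eq0 d by simp
    then have "sim p e (3 ^ m * a) (3 ^ n * c)" using sm(2) sim_cong[OF pos_self] by blast
    then show ?thesis using sm sim_sym sim_trans[OF e(1)] by blast
  next
    case 4
    then show ?thesis using linked_sim(1)[OF e sm(1) sm(4)] by blast
  next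
    case 5
    then show ?thesis using linked_sim(1)[OF e sm(2) sm(5)] by blast
  next
    case 6
    then show ?thesis using linked_sim(1)[OF e sm(3) sm(6)] sm sim_sym sim_trans[OF e(1)] by blast
  qed
  then show ?thesis using mn(3) by blast
qed

section \<open>Transitivity of the return maps on a periodic class\<close>

text \<open>An arc of length at least 1/3 between two points of a sector covers an arc missing from
  the sector. The missing arcs have length \<open>1/3 + e\<close> or \<open>2/3 + e\<close>, so
  tripling turns them into full turns and a rest of length \<open>3 * e\<close>, which begins at
  \<open>3 * p\<close> or at its half turn.\<close>

lemma hole_drop:
  assumes "0 < e" "e \<le> 1/6" "K p e j x" "K p e j y" "1/3 \<le> pos x y"
  shows "pos (3*x) (3*p) + 3*e \<le> pos (3*x) (3*y) \<or> pos (3*x) (3*p + 1/2) + 3*e \<le> pos (3*x) (3*y)"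
proof -
  define u v where d: "u = pos p x" "v = pos p y"
  define u' v' where d': "u' = pos (3*p) (3*x)" "v' = pos (3*p) (3*y)"
  have f: "u' = (if u < 1/3 then 3 * u else if u < 2/3 then 3 * u - 1 else 3 * u - 2)"
    "v' = (if v < 1/3 then 3 * v else if v < 2/3 then 3 * v - 1 else 3 * v - 2)"
    unfolding d d' by (rule pos_triple)+
  have r: "0 \<le> u" "u < 1" "0 \<le> v" "v < 1" unfolding d by (auto simp: pos_ge0 pos_lt1)
  have s: "sec e j u" "sec e j v" using assms d by (auto simp: K_def)
  have h: "pos x y = (if u \<le> v then v - u else v - u + 1)" unfolding d by (rule pos_base)
  have h': "pos (3*x) (3*y) = (if u' \<le> v' then v' - u' else v' - u' + 1)" unfolding d' by (rule pos_base)
  have b: "pos (3*x) (3*p) = (if u' = 0 then 0 else 1 - u')" using pos_base[of "3*x" "3*p" "3*p"] pos_ge0[of "3*p" "3*x"] unfolding d' by auto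
  have b': "pos (3*x) (3*p + 1/2) = (if u' \<le> 1/2 then 1/2 - u' else 1/2 - u' + 1)"
    using pos_base[of "3*x" "3*p + 1/2" "3*p"] unfolding d' by (simp add: pos_self_add)
  show ?thesis
  proof (cases j)
    case Near
    have "u \<le> 1/6 \<and> u' = 3 * u \<or> e + 5/6 \<le> u \<and> u' = 3 * u - 2"
      "v \<le> 1/6 \<and> v' = 3 * v \<or> e + 5/6 \<le> v \<and> v' = 3 * v - 2" using s f assms(1) Near by auto
    with assms(1,2,5) r show ?thesis unfolding h h' b b' by (elim disjE conjE; hypsubst; auto split: if_splits)
  next
    case Far
    have "e + 1/3 \<le> u \<and> u < 2/3 \<and> u' = 3 * u - 1 \<or> u = 2/3 \<and> u' = 0"
       "e + 1/3 \<le> v \<and> v < 2/3 \<and> v' = 3 * v - 1 \<or> v = 2/3 \<and> v' = 0" using s f assms(1) Far by auto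
    with assms(1,2,5) r show ?thesis unfolding h h' b b' by (elim disjE conjE; hypsubst; auto split: if_splits)
  next
    case Mid
    have "e + 1/6 \<le> u \<and> u < 1/3 \<and> u' = 3 * u \<or> u = 1/3 \<and> u' = 0 \<or> e + 2/3 \<le> u \<and> u \<le> 5/6 \<and> u' = 3 * u - 2"
      "e + 1/6 \<le> v \<and> v < 1/3 \<and> v' = 3 * v \<or> v = 1/3 \<and> v' = 0 \<or> e + 2/3 \<le> v \<and> v \<le> 5/6 \<and> v' = 3 * v - 2"
      using s f assms(1) Mid by auto
    with assms(1,2,5) r show ?thesis unfolding h h' b b' by (elim disjE conjE; hypsubst; auto split: if_splits)
  qed
qed

lemma frac_eqI: "pos x y = 0 \<Longrightarrow> frac x = frac y"
  by (metis pos_0 pos_cong pos_self)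

section \<open>Periodic classes and the action of iterates and half turns\<close>

locale periodic_itinerary =
  fixes p e a :: real and N :: nat
  assumes e_pos: "0 < e" and e_le: "e \<le> 1/6" and N_pos: "0 < N" and periodic: "sim p e a (3 ^ N * a)"
begin

text \<open>Representatives of all points in all classes on the orbit of the class of
  \<open>a\<close>, half turns included. The set is finite, and every \<open>act i h\<close> with
  \<open>h\<close> in \<open>turns\<close> permutes it.\<close>

definition P :: "real set" where
  "P = {t. 0 \<le> t \<and> t < 1 \<and> (\<exists>i. \<exists>h\<in>turns. sim p e t (3 ^ i * a + h))}"

definition act :: "nat \<Rightarrow> real \<Rightarrow> real \<Rightarrow> real" where
  "act i h t = frac (3 ^ i * t + h)"

lemmas simt = sim_trans[OF e_pos]

lemma half_half: "h \<in> turns \<Longrightarrow> h' \<in> turns \<Longrightarrow> \<exists>k\<in>turns. \<forall>t. pos (t + h + h') (t + k) = 0"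
proof -
  assume "h \<in> turns" "h' \<in> turns"
  moreover have "pos (t + 1/2 + 1/2) (t + 0) = 0" for t
    by (simp add: pos_eq0)
  moreover have "pos (t + 0 + h') (t + h') = 0" "pos (t + h + 0) (t + h) = 0" for t by simp_all
  ultimately show ?thesis unfolding turns_def by (elim insertE emptyE; simp only:; blast)
qed

lemma periodic_mult: "sim p e (3 ^ (i + N * k) * a) (3 ^ i * a)"
proof (induction k)
  case 0
  have "sim p e a a" using periodic sim_sym simt by blast
  then show ?case using sim_pow by simp
next
  case (Suc k)
  have "sim p e (3 ^ (i + N * k) * (3 ^ N * a)) (3 ^ (i + N * k) * a)"
    using sim_pow[OF sim_sym[OF periodic]] .
  moreover have "3 ^ (i + N * k) * (3 ^ N * a) = 3 ^ (i + N * Suc k) * a"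
    by (simp add: power_add algebra_simps)
  ultimately show ?case using Suc simt by metis
qed

lemma sim_refl: "t \<in> P \<Longrightarrow> sim p e t t"
  unfolding P_def using sim_sym simt by blast

lemma sim_act0: "sim p e t u \<Longrightarrow> h \<in> turns \<Longrightarrow> sim p e (act i h t) (act i h u)"
  unfolding act_def using sim_half[OF _ e_le] sim_pow e_pos by simp

lemma act_act:
  assumes "h \<in> turns" "h' \<in> turns"
  shows "\<exists>k\<in>turns. \<forall>t. act i h (act i' h' t) = act (i + i') k t"
proof -
  obtain k where k: "k \<in> turns" "\<And>t. pos (t + h' + h) (t + k) = 0" using half_half[OF assms(2,1)] by blast
  have "act i h (act i' h' t) = act (i + i') k t" for t
  proof -
    have "pos (3 ^ i * (3 ^ i' * t + h') + h) (3 ^ i * (3 ^ i' * t) + h' + h) = 0"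
      using pos_pow_half[OF assms(2), of i "3 ^ i' * t"] pos_shift by metis
    then have "pos (3 ^ i * (3 ^ i' * t + h') + h) (3 ^ (i + i') * t + k) = 0"
      using pos0_trans[OF _ k(2)[of "3 ^ i * (3 ^ i' * t)"]] unfolding power_add mult.assoc by blast
    moreover have "pos (3 ^ i * frac (3 ^ i' * t + h') + h) (3 ^ i * (3 ^ i' * t + h') + h) = 0"
      by simp
    ultimately have "pos (3 ^ i * frac (3 ^ i' * t + h') + h) (3 ^ (i + i') * t + k) = 0"
      using pos0_trans by blast
    then show ?thesis
      unfolding act_def by (rule frac_eqI)
  qed
  then show ?thesis using k by blast
qed

lemma sim_act_a: "t \<in> P \<Longrightarrow> \<exists>i. \<exists>h\<in>turns. sim p e t (act i h a)"
  unfolding P_def act_def by (simp; blast)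

lemma actI: "sim p e t (act i h a) \<Longrightarrow> h \<in> turns \<Longrightarrow> 0 \<le> t \<Longrightarrow> t < 1 \<Longrightarrow> t \<in> P"
  unfolding P_def act_def by auto

lemma act_P:
  assumes "t \<in> P" "h \<in> turns"
  shows "act i h t \<in> P"
proof -
  obtain i' h' where s: "h' \<in> turns" "sim p e t (act i' h' a)" using sim_act_a assms by blast
  obtain k where k: "k \<in> turns" "\<And>t. act i h (act i' h' t) = act (i + i') k t"
    using act_act[OF assms(2) s(1)] by blast
  show ?thesis
    by (rule actI[OF sim_act0[OF s(2) assms(2), of i, unfolded k(2)] k(1)]) (auto simp: act_def frac_lt_1)
qed

lemma P_class: "t \<in> P \<Longrightarrow> sim p e t u \<Longrightarrow> 0 \<le> u \<Longrightarrow> u < 1 \<Longrightarrow> u \<in> P"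
  using sim_act_a actI sim_sym simt by meson

lemma sim_period: "t \<in> P \<Longrightarrow> sim p e (3 ^ N * t) t"
proof -
  assume "t \<in> P"
  then obtain i h where s: "h \<in> turns" "sim p e t (3 ^ i * a + h)" unfolding P_def by blast
  have "sim p e (3 ^ N * t) (3 ^ N * (3 ^ i * a + h))" using sim_pow s by blast
  moreover have "pos (3 ^ N * (3 ^ i * a + h)) (3 ^ (i + N * 1) * a + h) = 0"
    using pos_pow_half[OF s(1), of N "3 ^ i * a"] by (simp add: power_add algebra_simps)
  ultimately have "sim p e (3 ^ N * t) (3 ^ (i + N * 1) * a + h)"
    using sim_cong[OF pos_self] by blast
  moreover have "sim p e (3 ^ (i + N * 1) * a + h) (3 ^ i * a + h)"
    using sim_half[OF _ e_le periodic_mult[of i 1] s(1)] e_pos by simp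
  ultimately show ?thesis using s(2) sim_sym simt by blast
qed

lemma finite_P: "finite P"
proof -
  have "P \<subseteq> (\<Union>i<N. \<Union>h\<in>turns. {t. 0 \<le> t \<and> t < 1 \<and> sim p e (3 ^ i * a + h) t})"
  proof
    fix t assume "t \<in> P"
    then obtain i h where s: "h \<in> turns" "sim p e t (3 ^ i * a + h)" "0 \<le> t" "t < 1" unfolding P_def by blast
    have "sim p e (3 ^ i * a + h) (3 ^ (i mod N) * a + h)"
      using sim_half[OF _ e_le periodic_mult[of "i mod N" "i div N"] s(1)] e_pos by simp
    then have "sim p e (3 ^ (i mod N) * a + h) t" using s(2) sim_sym simt by blast
    moreover have "i mod N < N" using N_pos by simp
    ultimately show "t \<in> (\<Union>i<N. \<Union>h\<in>turns. {t. 0 \<le> t \<and> t < 1 \<and> sim p e (3 ^ i * a + h) t})"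
      using s by blast
  qed
  moreover have "finite (\<Union>i<N. \<Union>h\<in>turns. {t. 0 \<le> t \<and> t < 1 \<and> sim p e (3 ^ i * a + h) t})"
    by (intro finite_UN_I sim_finite e_pos e_le) (simp_all add: turns_def)
  ultimately show ?thesis by (rule finite_subset)
qed

lemma P_eq: "t \<in> P \<Longrightarrow> u \<in> P \<Longrightarrow> pos t u = 0 \<Longrightarrow> t = u"
  by (rule pos0_frac) (auto simp: P_def)

text \<open>Continuing the iteration up to a multiple of the period brings both points back to their
  own classes. Hence they share a class, and there \<open>sim_inj\<close> applies.\<close>

lemma inj_pow: "t \<in> P \<Longrightarrow> u \<in> P \<Longrightarrow> pos (3 ^ i * t) (3 ^ i * u) = 0 \<Longrightarrow> t = u"
proof -
  assume tu: "t \<in> P" "u \<in> P" and z: "pos (3 ^ i * t) (3 ^ i * u) = 0"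
  have per: "sim p e (3 ^ (N * k) * v) v" if "v \<in> P" for v k
  proof (induction k)
    case (Suc k)
    have "sim p e (3 ^ (N * k) * (3 ^ N * v)) (3 ^ (N * k) * v)" using sim_pow sim_period that by blast
    moreover have "3 ^ (N * Suc k) * v = 3 ^ (N * k) * (3 ^ N * v)" by (simp add: power_add)
    ultimately show ?case using Suc simt by metis
  qed (use that sim_refl in simp)
  have le: "i \<le> N * i" using N_pos by simp
  have "pos (3 ^ (N * i - i) * (3 ^ i * t)) (3 ^ (N * i - i) * (3 ^ i * u)) = 0" using z pos0_mult by blast
  moreover have "3 ^ (N * i - i) * (3 ^ i * v) = 3 ^ (N * i) * v" for v :: real
    using le by (simp add: mult.assoc[symmetric] power_add[symmetric])
  ultimately have "pos (3 ^ (N * i) * t) (3 ^ (N * i) * u) = 0" by simp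
  then have "sim p e (3 ^ (N * i) * t) u" using per[OF tu(2), of i] sim_cong pos_self by (metis)
  then have "sim p e t u" using per[OF tu(1), of i] sim_sym simt by blast
  then have "pos t u = 0" using sim_inj[OF e_pos e_le] z by blast
  then show "t = u" using P_eq tu by blast
qed

lemma act_inj: "h \<in> turns \<Longrightarrow> inj_on (act i h) P"
proof (rule inj_onI)
  fix t u assume *: "h \<in> turns" "t \<in> P" "u \<in> P" "act i h t = act i h u"
  then have "pos (3 ^ i * t + h) (3 ^ i * u + h) = 0"
    unfolding act_def by (metis pos_frac_left pos_frac_right pos_self)
  then show "t = u" using inj_pow * by simp
qed

lemma act_surj: "h \<in> turns \<Longrightarrow> u \<in> P \<Longrightarrow> \<exists>t\<in>P. act i h t = u"
  using endo_inj_surj[OF finite_P _ act_inj[of h i]] act_P by (metis image_iff image_subsetI)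

lemma sim_act: "t \<in> P \<Longrightarrow> u \<in> P \<Longrightarrow> h \<in> turns \<Longrightarrow> sim p e (act i h t) (act i h u) \<longleftrightarrow> sim p e t u"
proof
  assume tu: "t \<in> P" "u \<in> P" "h \<in> turns" and s: "sim p e (act i h t) (act i h u)"
  obtain k where k: "\<And>x. act 0 h (act i h x) = act i 0 x"
  proof -
    have "act 0 h (act i h x) = act i 0 x" for x
    proof -
      have "pos (frac (3 ^ i * x + h) + h) (3 ^ i * x + 0) = 0"
        using tu(3)
        unfolding turns_def by (elim insertE emptyE; simp add: pos_eq0 frac_def algebra_simps)
      then have "pos (3 ^ 0 * frac (3 ^ i * x + h) + h) (3 ^ i * x + 0) = 0" by simp
      then show ?thesis unfolding act_def by (rule frac_eqI)
    qed
    then show ?thesis using that by blast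
  qed
  have "sim p e (act i 0 t) (act i 0 u)" using sim_act0[OF s tu(3), of 0] k by simp
  then have s1: "sim p e (3 ^ i * t) (3 ^ i * u)" by (simp add: act_def)
  have per: "sim p e (3 ^ (N * k) * v) v" if "v \<in> P" for v k
  proof (induction k)
    case (Suc k)
    have "sim p e (3 ^ (N * k) * (3 ^ N * v)) (3 ^ (N * k) * v)" using sim_pow sim_period that by blast
    moreover have "3 ^ (N * Suc k) * v = 3 ^ (N * k) * (3 ^ N * v)" by (simp add: power_add)
    ultimately show ?case using Suc simt by metis
  qed (use that sim_refl in simp)
  have le: "i \<le> N * i" using N_pos by simp
  have "sim p e (3 ^ (N * i - i) * (3 ^ i * t)) (3 ^ (N * i - i) * (3 ^ i * u))" using s1 sim_pow by blast
  moreover have "3 ^ (N * i - i) * (3 ^ i * v) = 3 ^ (N * i) * v" for v :: real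
    using le by (simp add: mult.assoc[symmetric] power_add[symmetric])
  ultimately have "sim p e (3 ^ (N * i) * t) (3 ^ (N * i) * u)" by simp
  then show "sim p e t u" using per tu sim_sym simt by meson
qed (use sim_act0 in blast)

lemma cyc_act: "sim p e t u \<Longrightarrow> sim p e t v \<Longrightarrow> cyc t u v \<Longrightarrow> cyc (act i h t) (act i h u) (act i h v)"
  using sim_order[OF e_pos e_le, of p t u v i] unfolding act_def cyc_def by simp

end

lemma ex_minimal: "finite S \<Longrightarrow> S \<noteq> {} \<Longrightarrow> \<exists>v\<in>S. \<forall>w\<in>S. (f :: 'a \<Rightarrow> real) v \<le> f w"
proof -
  assume S: "finite S" "S \<noteq> {}"
  then have "Min (f ` S) \<in> f ` S" by (intro Min_in) auto
  then obtain v where v: "v \<in> S" "Min (f ` S) = f v" by blast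
  have "f v \<le> f w" if "w \<in> S" for w using Min_le[of "f ` S" "f w"] S that v(2) by simp
  with v(1) show ?thesis by blast
qed

section \<open>Orbits and gaps of periodic classes\<close>

context periodic_itinerary
begin

definition orb :: "real \<Rightarrow> real \<Rightarrow> bool" where
  "orb t u \<longleftrightarrow> (\<exists>i. \<exists>h\<in>turns. u = act i h t)"

lemma orb_refl: "t \<in> P \<Longrightarrow> orb t t"
proof -
  assume "t \<in> P"
  then have "act 0 0 t = t" unfolding P_def act_def by (simp add: frac_eq)
  then show ?thesis unfolding orb_def turns_def by (metis insertI1)
qed

lemma orb_trans: "orb t u \<Longrightarrow> orb u v \<Longrightarrow> orb t v"
  unfolding orb_def using act_act by metis

lemma orb_P: "orb t u \<Longrightarrow> t \<in> P \<Longrightarrow> u \<in> P"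
  unfolding orb_def using act_P by blast

text \<open>\<open>act i h\<close> commutes with the other maps of the action, so it sends the orbit
  of \<open>t\<close> injectively into the orbit of \<open>u\<close>, which is contained in that of
  \<open>t\<close>. Finiteness makes the two orbits equal.\<close>

lemma orb_sym:
  assumes "orb t u" "t \<in> P"
  shows "orb u t"
proof -
  have fin: "finite {w. orb v w}" if "v \<in> P" for v
    using finite_subset[OF _ finite_P] orb_P that by blast
  have sub: "{w. orb u w} \<subseteq> {w. orb t w}" using orb_trans assms by blast
  obtain i h where ih: "h \<in> turns" "u = act i h t" using assms unfolding orb_def by blast
  have "act i h ` {w. orb t w} \<subseteq> {w. orb u w}"
  proof safe
    fix w assume "orb t w"
    then obtain j k where jk: "k \<in> turns" "w = act j k t" unfolding orb_def by blast
    have "pos (3 ^ i * (3 ^ j * t + k) + h) (3 ^ j * (3 ^ i * t + h) + k) = 0"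
    proof -
      have 1: "pos (3 ^ i * (3 ^ j * t + k) + h) (3 ^ i * (3 ^ j * t) + k + h) = 0"
        using pos_pow_half[OF jk(1), of i "3 ^ j * t"] by simp
      have 2: "pos (3 ^ j * (3 ^ i * t) + h + k) (3 ^ j * (3 ^ i * t + h) + k) = 0"
        using pos0_sym[OF pos_pow_half[OF ih(1), of j "3 ^ i * t"]] by simp
      have "3 ^ i * (3 ^ j * t) + k + h = 3 ^ j * (3 ^ i * t) + h + k" by simp
      from pos0_trans[OF 1 2[folded this]] show ?thesis .
    qed
    note m = this
    have l: "pos (3 ^ i * frac (3 ^ j * t + k) + h) (3 ^ i * (3 ^ j * t + k) + h) = 0" by simp
    have r: "pos (3 ^ j * (3 ^ i * t + h) + k) (3 ^ j * frac (3 ^ i * t + h) + k) = 0" by simp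
    have "pos (3 ^ i * frac (3 ^ j * t + k) + h) (3 ^ j * frac (3 ^ i * t + h) + k) = 0"
      by (rule pos0_trans[OF pos0_trans[OF l m] r])
    then have "act i h w = act j k u" unfolding jk ih(2) unfolding act_def by (rule frac_eqI)
    then show "orb u (act i h w)" unfolding orb_def using jk by blast
  qed
  then have "card (act i h ` {w. orb t w}) \<le> card {w. orb u w}"
    using fin[OF orb_P[OF assms]] card_mono by blast
  moreover have "inj_on (act i h) {w. orb t w}"
    by (rule inj_on_subset[OF act_inj[OF ih(1)]]) (use orb_P assms in blast)
  ultimately have "card {w. orb t w} \<le> card {w. orb u w}" by (simp add: card_image)
  then have "{w. orb u w} = {w. orb t w}"
    using card_seteq[OF fin[OF assms(2)] sub] by blast
  then show ?thesis using orb_refl assms by blast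
qed

definition nxt :: "real \<Rightarrow> real \<Rightarrow> bool" where
  "nxt t u \<longleftrightarrow> u \<in> P \<and> sim p e t u \<and> u \<noteq> t \<and> (\<forall>v\<in>P. sim p e t v \<longrightarrow> v \<noteq> t \<longrightarrow> pos t u \<le> pos t v)"

text \<open>The length of the gap of the class that begins at \<open>t\<close>. The choice is
  harmless, because all successors of \<open>t\<close> have the same distance from it.\<close>

definition hole :: "real \<Rightarrow> real" where
  "hole t = pos t (SOME u. nxt t u)"

lemma pos_pos: "t \<in> P \<Longrightarrow> u \<in> P \<Longrightarrow> u \<noteq> t \<Longrightarrow> 0 < pos t u"
  using P_eq[of t u] pos_ge0[of t u] by fastforce

lemma ex_nxt:
  assumes "t \<in> P" "u \<in> P" "sim p e t u" "u \<noteq> t"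
  shows "\<exists>v. nxt t v"
proof -
  let ?S = "{v \<in> P. sim p e t v \<and> v \<noteq> t}"
  have "finite ?S" "?S \<noteq> {}" using finite_P assms by auto
  from ex_minimal[OF this, of "pos t"] obtain v where "v \<in> ?S" "\<forall>w\<in>?S. pos t v \<le> pos t w" by blast
  then show ?thesis unfolding nxt_def by blast
qed

lemma hole_nxt: "nxt t u \<Longrightarrow> t \<in> P \<Longrightarrow> hole t = pos t u"
  unfolding hole_def
proof (rule someI2[of "nxt t" u])
  fix v assume "nxt t u" "nxt t v"
  then show "pos t v = pos t u" unfolding nxt_def by (meson order_antisym)
qed

text \<open>On a class \<open>act i h\<close> is a bijection onto another class that preserves the
  cyclic order, so neighbours go to neighbours.\<close>

lemma nxt_act:
  assumes "t \<in> P" "nxt t u" "h \<in> turns"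
  shows "nxt (act i h t) (act i h u)"
proof -
  have u: "u \<in> P" "sim p e t u" "u \<noteq> t" using assms unfolding nxt_def by auto
  have "pos (act i h t) (act i h u) \<le> pos (act i h t) w"
    if w: "w \<in> P" "sim p e (act i h t) w" "w \<noteq> act i h t" for w
  proof -
    obtain v where v: "v \<in> P" "w = act i h v" using act_surj[OF assms(3) w(1)] by metis
    have s: "sim p e t v" "v \<noteq> t" using sim_act[OF assms(1) v(1) assms(3)] w v by auto
    then have le: "pos t u \<le> pos t v" using assms(2) v unfolding nxt_def by blast
    show ?thesis
    proof (cases "u = v")
      case False
      have "pos t u \<noteq> pos t v"
        using pos_base[of u v t] P_eq[OF u(1) v(1)] False by auto
      then have "cyc t u v" using le pos_pos[OF assms(1) u(1,3)] unfolding cyc_def by simp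
      then have "cyc (act i h t) (act i h u) (act i h v)" using cyc_act u s by blast
      then show ?thesis unfolding cyc_def v by simp
    qed (simp add: v)
  qed
  moreover have "act i h u \<noteq> act i h t" using inj_onD[OF act_inj[OF assms(3), of i]] u assms(1) by blast
  ultimately show ?thesis
    unfolding nxt_def using act_P[OF u(1) assms(3)] sim_act[OF assms(1) u(1) assms(3)] u by auto
qed

text \<open>The hole after \<open>t\<close> contains the image of the strip.\<close>

definition good :: "real \<Rightarrow> bool" where
  "good t \<longleftrightarrow> t \<in> P \<and> (\<forall>u. orb t u \<longrightarrow> hole t \<le> hole u) \<and> pos t (3 * p) + 3 * e \<le> hole t"

text \<open>Different classes are unlinked, so each lies in a single gap of the other; this records
  that the gap is the one behind \<open>u\<close>.\<close>

definition inside :: "real \<Rightarrow> real \<Rightarrow> bool" where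
  "inside t u \<longleftrightarrow> \<not> sim p e t u \<and> (\<forall>x\<in>P. sim p e t x \<longrightarrow> pos u x < hole u)"

end

locale periodic_class = periodic_itinerary +
  fixes b c :: real
  assumes ab: "sim p e a b" "pos a b \<noteq> 0" and ac: "sim p e a c" "pos a c \<noteq> 0" and bc: "pos b c \<noteq> 0"
begin

lemma ex_three: "t \<in> P \<Longrightarrow> \<exists>u v. u \<in> P \<and> v \<in> P \<and> sim p e t u \<and> sim p e t v \<and> u \<noteq> t \<and> v \<noteq> t \<and> u \<noteq> v"
proof -
  assume t: "t \<in> P"
  have "sim p e a a" using ab sim_sym simt by blast
  then have "sim p e a (3 ^ 0 * a + 0)" by simp
  then have aP: "frac a \<in> P" unfolding P_def turns_def by (auto simp: frac_lt_1 intro!: exI[of _ 0])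
  have bP: "frac b \<in> P" "frac c \<in> P" by (rule P_class[OF aP]; use ab ac in \<open>simp add: frac_lt_1\<close>)+
  have ne: "frac a \<noteq> frac b" "frac a \<noteq> frac c" "frac b \<noteq> frac c"
    using ab(2) ac(2) bc pos_frac_left[of a] pos_frac_right pos_self by metis+
  obtain i h where ih: "h \<in> turns" "sim p e t (act i h a)" using sim_act_a[OF t] by blast
  have "act i h (frac a) = act i h a" unfolding act_def by (rule frac_eqI) simp
  then have s: "sim p e t (act i h (frac a))" using ih by simp
  have "sim p e (frac a) (frac b)" "sim p e (frac a) (frac c)" using ab ac by simp_all
  then have s': "sim p e t (act i h (frac b))" "sim p e t (act i h (frac c))"
    using simt[OF s sim_act0[OF _ ih(1)]] by blast+
  have n: "act i h (frac a) \<noteq> act i h (frac b)" "act i h (frac a) \<noteq> act i h (frac c)" "act i h (frac b) \<noteq> act i h (frac c)"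
    using inj_onD[OF act_inj[OF ih(1), of i]] aP bP ne by blast+
  have "act i h (frac a) \<in> P" "act i h (frac b) \<in> P" "act i h (frac c) \<in> P" using act_P ih(1) aP bP by blast+
  with s s' n show ?thesis by metis
qed

lemma nxt_ex: "t \<in> P \<Longrightarrow> \<exists>u. nxt t u"
  using ex_three ex_nxt by metis

lemma hole_act: "t \<in> P \<Longrightarrow> nxt t u \<Longrightarrow> h \<in> turns \<Longrightarrow> hole (act i h t) = pos (act i h t) (act i h u)"
  using hole_nxt[OF nxt_act act_P] by blast

lemma hole_le: "t \<in> P \<Longrightarrow> x \<in> P \<Longrightarrow> sim p e t x \<Longrightarrow> x \<noteq> t \<Longrightarrow> hole t \<le> pos t x"
  using nxt_ex[of t] hole_nxt unfolding nxt_def by metis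

text \<open>A shortest gap of the orbit is the image of a gap that is at least as long. Such a
  shrinking gap has length at least 1/3, and \<open>hole_drop\<close> then places the image of a
  strip inside the shortest gap.\<close>

lemma ex_good:
  assumes "t \<in> P"
  shows "\<exists>u. orb t u \<and> good u"
proof -
  have "finite {u. orb t u}" "{u. orb t u} \<noteq> {}"
    using finite_subset[OF _ finite_P] orb_P[OF _ assms] orb_refl[OF assms] by blast+
  from ex_minimal[OF this, of hole] obtain m where m: "orb t m" "\<And>u. orb t u \<Longrightarrow> hole m \<le> hole u" by blast
  have mP: "m \<in> P" using orb_P m assms by blast
  have z: "0 \<in> turns" "1/2 \<in> turns" by (simp_all add: turns_def)
  obtain m0 where m0: "m0 \<in> P" "act 1 0 m0 = m" using act_surj[OF z(1) mP] by blast
  have "orb m0 m" unfolding orb_def using m0 z by blast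
  then have m0t: "orb t m0" using orb_sym[OF _ m0(1)] m(1) orb_trans by blast
  obtain n where n: "nxt m0 n" using nxt_ex[OF m0(1)] by blast
  have hm: "hole m = pos (3 * m0) (3 * n)"
    using hole_act[OF m0(1) n z(1), of 1] m0(2) unfolding act_def by simp
  have h0: "hole m0 = pos m0 n" using hole_nxt n m0 by blast
  have nP: "n \<in> P" "sim p e m0 n" "n \<noteq> m0" using n unfolding nxt_def by auto
  \<comment> \<open>A gap below 1/3 would be tripled in length, whereas the gap behind
    \<open>m\<close> is not longer than the one behind \<open>m0\<close>.\<close>
  have "1/3 \<le> pos m0 n"
    using m(2)[OF m0t] pos_pos[OF m0(1) nP(1,3)] unfolding hm h0 pos_triple by (auto split: if_splits)
  moreover obtain j where "K p e j m0" "K p e j n" using nP(2) unfolding sim_def same_def by (metis power_0 mult_1)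
  ultimately have "pos (3*m0) (3*p) + 3*e \<le> hole m \<or> pos (3*m0) (3*p + 1/2) + 3*e \<le> hole m"
    unfolding hm using hole_drop[OF e_pos e_le] by blast
  moreover have "pos (3 * m0) x = pos m x" for x using m0(2) unfolding act_def by (metis add_0_right pos_frac_left power_one_right)
  ultimately have "pos m (3*p) + 3*e \<le> hole m \<or> pos m (3*p + 1/2) + 3*e \<le> hole m" by simp
  then show ?thesis
  proof
    assume "pos m (3*p) + 3*e \<le> hole m"
    then have "good m" unfolding good_def using mP m orb_trans by blast
    then show ?thesis using m by blast
  next
    \<comment> \<open>A half turn moves the strip image from \<open>3 * p + 1/2\<close> to
      \<open>3 * p\<close>; it stays in the orbit and keeps the length of the gap.\<close>
    assume *: "pos m (3*p + 1/2) + 3*e \<le> hole m"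
    let ?m = "act 0 (1/2) m"
    obtain k where k: "nxt m k" using nxt_ex[OF mP] by blast
    have "hole ?m = pos ?m (act 0 (1/2) k)" using hole_act[OF mP k z(2)] .
    also have "\<dots> = pos m k" unfolding act_def by simp
    also have "\<dots> = hole m" using hole_nxt k mP by simp
    finally have hh: "hole ?m = hole m" .
    have "pos (m + 1/2) (3 * p + 0) = pos m (3 * p + 1/2)"
    proof -
      have "pos (m + 1/2) (3 * p + 1/2 + 1/2) = pos m (3 * p + 1/2)" by (rule pos_shift)
      moreover have "pos (3 * p + 1/2 + 1/2) (3 * p + 0) = 0" by (simp add: pos_eq0)
      ultimately show ?thesis using pos_cong[OF pos_self[of "m + 1/2"], of "3 * p + 1/2 + 1/2" "3 * p + 0"] by simp
    qed
    then have "pos ?m (3 * p) = pos m (3 * p + 1/2)" unfolding act_def by simp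
    moreover have "orb m ?m" unfolding orb_def using z by blast
    ultimately have "good ?m" unfolding good_def using act_P[OF mP z(2)] m hh * orb_trans by metis
    then show ?thesis using m \<open>orb m ?m\<close> orb_trans by blast
  qed
qed

end

context periodic_itinerary
begin

text \<open>Cutting the circle at the fixed point \<open>z\<close> turns the map into an order
  preserving permutation of a finite linear order, which is the identity. The first moved point
  \<open>y\<close> would be moved to a later point and would be the image of a later point
  \<open>w\<close>, so the order of \<open>y\<close> and \<open>w\<close> would be reversed.\<close>

lemma act_fix:
  assumes "h \<in> turns" "z \<in> P" "act i h z = z" "x \<in> P" "sim p e z x"
  shows "act i h x = x"
proof (rule ccontr)
  assume nx: "act i h x \<noteq> x"
  let ?S = "{y \<in> P. sim p e z y \<and> act i h y \<noteq> y}"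
  have S: "finite ?S" "?S \<noteq> {}" using finite_P assms nx by auto
  from ex_minimal[OF S, of "pos z"] obtain y where y: "y \<in> P" "sim p e z y" "act i h y \<noteq> y"
    and ymin: "\<And>w. w \<in> P \<Longrightarrow> sim p e z w \<Longrightarrow> act i h w \<noteq> w \<Longrightarrow> pos z y \<le> pos z w" by blast
  have stay: "act i h w \<in> P" "sim p e z (act i h w)" if "w \<in> P" "sim p e z w" for w
    using act_P[OF that(1) assms(1)] sim_act0[OF that(2) assms(1), of i] assms(3) by auto
  have inj: "u = v" if "act i h u = act i h v" "u \<in> P" "v \<in> P" for u v
    using inj_onD[OF act_inj[OF assms(1)] that] .
  have ne: "pos z u \<noteq> pos z v" if "u \<noteq> v" "u \<in> P" "v \<in> P" for u v
    using pos_base[of u v z] P_eq[OF that(2,3)] that(1) by auto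
  have y1: "pos z y < pos z (act i h y)"
  proof (rule ccontr)
    assume "\<not> ?thesis"
    then have "pos z (act i h y) < pos z y" using ne[OF y(3) stay(1)[OF y(1,2)] y(1)] by simp
    then have "act i h (act i h y) = act i h y" using ymin[OF stay[OF y(1,2)]] by force
    then show False using inj[OF _ stay(1)[OF y(1,2)] y(1)] y(3) by blast
  qed
  obtain w where w: "w \<in> P" "act i h w = y" using act_surj[OF assms(1) y(1)] by blast
  have "sim p e (act i h z) (act i h w)" using w assms(3) y by simp
  then have sw: "sim p e z w" using sim_act[OF assms(2) w(1) assms(1)] by blast
  have wy: "w \<noteq> y" using w y by blast
  then have "act i h w \<noteq> w" using w by simp
  then have lt: "pos z y < pos z w" using ymin[OF w(1) sw] ne[OF wy w(1) y(1)] by simp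
  have "y \<noteq> z" using y assms(3) by blast
  then have "cyc z y w" unfolding cyc_def using lt pos_pos assms(2) y(1) by blast
  then have "cyc (act i h z) (act i h y) (act i h w)" using cyc_act y(2) sw by blast
  then show False using y1 unfolding cyc_def w assms(3) by simp
qed

end

section \<open>Comparison of good gaps from different orbits\<close>

context periodic_class
begin

lemma good_P: "good x \<Longrightarrow> x \<in> P"
  unfolding good_def by blast

text \<open>Both gaps contain the arc of length \<open>3 * e\<close> that begins at
  \<open>3 * p\<close>, so neither can begin only after the other has ended.\<close>

lemma good_disjoint:
  assumes "good x" "good y" "x \<noteq> y" "hole y \<le> pos y x" "hole x \<le> pos x y"
  shows False
proof -
  have g: "pos x (3 * p) + 3 * e \<le> hole x" "pos y (3 * p) + 3 * e \<le> hole y"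
    using assms unfolding good_def by auto
  have "pos y x \<noteq> 0" using P_eq[of y x] assms good_P by blast
  then have 1: "pos x y = 1 - pos y x" using pos_swap[of x y] by simp
  have 2: "pos x (3 * p) = pos y (3 * p) - pos y x + 1 \<or> pos y x \<le> pos y (3 * p)"
    using pos_base[of x "3 * p" y] by auto
  show False
    using 2
  proof
    assume "pos x (3 * p) = pos y (3 * p) - pos y x + 1"
    then show False using g 1 assms(5) e_pos pos_ge0[of y "3 * p"] by linarith
  next
    assume "pos y x \<le> pos y (3 * p)"
    then show False using g assms(4) e_pos by linarith
  qed
qed

text \<open>A class with members both inside and outside the gap would have a chord crossing the
  chord that closes the gap, and \<open>linked_sim\<close> would merge the two classes.\<close>

lemma inside_if_one:
  assumes "x \<in> P" "y \<in> P" "\<not> sim p e x y" "z \<in> P" "sim p e x z" "pos y z < hole y"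
  shows "inside x y"
  unfolding inside_def
proof (intro conjI ballI impI)
  obtain n where n: "nxt y n" using nxt_ex assms by blast
  have h: "hole y = pos y n" using hole_nxt n assms by blast
  fix w assume w: "w \<in> P" "sim p e x w"
  show "pos y w < hole y"
  proof (rule ccontr)
    assume "\<not> pos y w < hole y"
    moreover have nP: "n \<in> P" "sim p e y n" using n unfolding nxt_def by auto
    moreover have "w \<noteq> n" using nP w assms(3) sim_sym simt by blast
    then have "pos y w \<noteq> pos y n" using pos_base[of w n y] P_eq[OF w(1) nP(1)] by auto
    ultimately have 1: "pos y n < pos y w" using h by simp
    have "z \<noteq> y" using assms by blast
    then have 2: "0 < pos y z" using pos_pos assms by blast
    have l: "linked y n z w" unfolding linked_base using 1 2 assms(6) h by simp
    have "sim p e z w" using assms(5) w(2) sim_sym simt by blast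
    from linked_sim(1)[OF e_pos e_le nP(2) this l] show False
      using assms(3,5) sim_sym simt by blast
  qed
qed (use assms in blast)

text \<open>Two good gaps overlap in the image of the strip, so one of the two classes must reach
  into the gap of the other.\<close>

lemma inside_total:
  assumes "good x" "good y" "\<not> orb x y"
  shows "inside x y \<or> inside y x"
proof (rule ccontr)
  assume n: "\<not> (inside x y \<or> inside y x)"
  have P: "x \<in> P" "y \<in> P" using assms good_P by auto
  have ne: "x \<noteq> y" using assms(3) orb_refl P by blast
  have "hole y \<le> pos y x \<and> hole x \<le> pos x y"
  proof (cases "sim p e x y")
    case True
    then show ?thesis using hole_le P ne sim_sym by metis
  next
    case False
    then have F: "\<not> sim p e y x" using sim_sym by blast
    show ?thesis
      using inside_if_one[OF P False P(1) sim_refl[OF P(1)]] inside_if_one[OF P(2,1) F P(2) sim_refl[OF P(2)]] n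
      by force
  qed
  then show False using good_disjoint assms ne by blast
qed

text \<open>Every gap of the class of \<open>x\<close> lies within the gap behind \<open>y\<close>,
  except the one behind the last member as seen from \<open>y\<close>, which reaches round past
  \<open>y\<close>. That \<open>w\<close> comes later than \<open>z\<close> says that
  \<open>z\<close> is not this last member.\<close>

lemma inside_hole:
  assumes "inside x y" "z \<in> P" "w \<in> P" "sim p e x z" "sim p e x w" "pos y z < pos y w"
  shows "hole z < hole y"
proof -
  have "pos y w < hole y" using assms unfolding inside_def by blast
  moreover have "sim p e z w" using assms sim_sym simt by blast
  then have "hole z \<le> pos z w" using hole_le[OF assms(2,3)] assms(6) by auto
  moreover have "pos z w = pos y w - pos y z" using pos_base[of z w y] assms(6) by simp
  ultimately show ?thesis using pos_ge0[of y z] by linarith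
qed

text \<open>A good gap is shortest in its orbit. A member coming from the orbit of \<open>y\<close>
  therefore cannot have a gap shorter than that behind \<open>y\<close>, so it must be the last
  one.\<close>

lemma inside_last:
  assumes "inside x y" "good y" "z \<in> P" "sim p e x z" "orb y z" "w \<in> P" "sim p e x w"
  shows "pos y w \<le> pos y z"
proof (rule ccontr)
  assume "\<not> pos y w \<le> pos y z"
  then have "hole z < hole y" using inside_hole[OF assms(1,3,6,4,7)] by simp
  moreover have "hole y \<le> hole z" using assms(2,5) unfolding good_def by blast
  ultimately show False by simp
qed

text \<open>Iterates and half turns carry the class of \<open>t\<close> to every class of
  \<open>P\<close>, and the orbit of \<open>t\<close> goes along.\<close>

lemma ex_orb:
  assumes "t \<in> P" "u \<in> P"
  shows "\<exists>z\<in>P. sim p e u z \<and> orb t z"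
proof -
  obtain i h where ih: "h \<in> turns" "sim p e t (act i h a)" using sim_act_a assms by blast
  obtain i' h' where ih': "h' \<in> turns" "sim p e u (act i' h' a)" using sim_act_a assms by blast
  obtain k where k: "k \<in> turns" "\<And>s. pos (s + h + k) (s + h') = 0"
  proof (cases "h = h'")
    case True
    show ?thesis by (rule that[of 0]) (simp_all add: turns_def True)
  next
    case False
    have "pos (s + h + 1/2) (s + h') = 0" for s
      using ih(1) ih'(1) False unfolding turns_def
      by (elim insertE emptyE; hypsubst) (simp_all add: pos_eq0)
    then show ?thesis by (intro that[of "1/2"]) (simp_all add: turns_def)
  qed
  \<comment> \<open>\<open>N * i\<close> is a multiple of the period and not below \<open>i\<close>,
    so the subtraction loses nothing: \<open>j\<close> further steps lead from time \<open>i\<close>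
    to time \<open>i'\<close> modulo the period.\<close>
  define j where "j = i' + N * i - i"
  have j: "j + i = i' + N * i" unfolding j_def using N_pos by (cases N) auto
  have "pos (3 ^ j * (3 ^ i * a + h) + k) (3 ^ j * (3 ^ i * a) + h + k) = 0"
    using pos_pow_half[OF ih(1), of j "3 ^ i * a"] by (simp only: pos_shift)
  from pos0_trans[OF this k(2)] have z: "pos (3 ^ j * (3 ^ i * a + h) + k) (3 ^ (j + i) * a + h') = 0"
    by (simp only: power_add mult.assoc)
  have "pos (3 ^ j * frac (3 ^ i * a + h) + k) (3 ^ j * (3 ^ i * a + h) + k) = 0" by simp
  from pos0_trans[OF this z] have "act j k (act i h a) = act (j + i) h' a" unfolding act_def by (rule frac_eqI)
  moreover have "sim p e (act j k t) (act j k (act i h a))" using sim_act0[OF ih(2) k(1)] .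
  moreover have "sim p e (act (j + i) h' a) (act i' h' a)"
    unfolding act_def j using sim_half[OF _ e_le periodic_mult[of i' i] ih'(1)] e_pos by simp
  ultimately have "sim p e u (act j k t)" using ih'(2) sim_sym simt by metis
  then show ?thesis using act_P[OF assms(1) k(1)] k(1) unfolding orb_def by blast
qed

text \<open>The last member of the class of \<open>x\<close>, as seen from \<open>y\<close>, comes
  from the orbit of \<open>y\<close>. So \<open>x\<close> is not the last one, and its gap is
  contained in that of \<open>y\<close>.\<close>

lemma inside_less:
  assumes "inside x y" "good x" "good y" "\<not> orb y x"
  shows "hole x < hole y"
proof -
  have P: "x \<in> P" "y \<in> P" using assms good_P by auto
  obtain z where z: "z \<in> P" "sim p e x z" "orb y z" using ex_orb[OF P(2,1)] by blast
  have "pos y x \<le> pos y z" using inside_last[OF assms(1,3) z P(1) sim_refl[OF P(1)]] .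
  moreover have "z \<noteq> x" using assms(4) z by blast
  then have "pos y x \<noteq> pos y z" using pos_base[of x z y] P_eq[OF P(1) z(1)] by auto
  ultimately show ?thesis using inside_hole[OF assms(1) P(1) z(1) sim_refl[OF P(1)] z(2)] by simp
qed

text \<open>The class of \<open>x\<close> has a member \<open>u\<close> from the orbit of
  \<open>y\<close> and a member \<open>v\<close> from the orbit of \<open>z\<close>. As
  \<open>u\<close> is last seen from \<open>y\<close>, the gap behind \<open>v\<close> is shorter
  than that behind \<open>y\<close>, hence shorter than that behind \<open>z\<close>, although the
  latter is shortest in the orbit of \<open>v\<close>.\<close>

lemma three_goods:
  assumes "good x" "good y" "good z" "inside x y" "inside y z" "inside x z" "\<not> orb y z" "\<not> orb z y"
  shows False
proof -
  have P: "x \<in> P" "y \<in> P" "z \<in> P" using assms good_P by auto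
  obtain u where u: "u \<in> P" "sim p e x u" "orb y u" using ex_orb[OF P(2,1)] by blast
  obtain v where v: "v \<in> P" "sim p e x v" "orb z v" using ex_orb[OF P(3,1)] by blast
  have "u \<noteq> v" using u v assms(7) orb_sym orb_trans P by blast
  then have "pos y v \<noteq> pos y u" using pos_base[of u v y] P_eq[OF u(1) v(1)] by auto
  moreover have "pos y v \<le> pos y u" using inside_last[OF assms(4,2) u v(1,2)] .
  ultimately have "hole v < hole y" using inside_hole[OF assms(4) v(1) u(1) v(2) u(2)] by simp
  moreover have "hole y < hole z" using inside_less assms by blast
  moreover have "hole z \<le> hole v" using assms(3) v unfolding good_def by blast
  ultimately show False by simp
qed

text \<open>\<open>inside\<close> relates any two of the points and strictly increases the gap, so
  it orders the three linearly; \<open>three_goods\<close> excludes that.\<close>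

lemma three_orbits:
  assumes "good x" "good y" "good z" "\<not> orb x y" "\<not> orb y z" "\<not> orb x z"
  shows False
proof -
  have P: "x \<in> P" "y \<in> P" "z \<in> P" using assms good_P by auto
  have n: "\<not> orb y x" "\<not> orb z y" "\<not> orb z x" using assms orb_sym P by blast+
  have l: "hole u < hole v" if "inside u v" "u \<in> {x, y, z}" "v \<in> {x, y, z}" "u \<noteq> v" for u v
    using inside_less[OF that(1)] assms n that by auto
  have t: "inside x y \<or> inside y x" "inside y z \<or> inside z y" "inside x z \<or> inside z x"
    using inside_total assms by blast+
  have d: "x \<noteq> y" "y \<noteq> z" "x \<noteq> z" using assms orb_refl P by blast+
  have "\<not> (inside x y \<and> inside y z \<and> inside z x)" "\<not> (inside y x \<and> inside z y \<and> inside x z)"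
    using l[of x y] l[of y z] l[of z x] l[of y x] l[of z y] l[of x z] d by auto
  then consider "inside x y" "inside y z" "inside x z" | "inside x z" "inside z y" "inside x y"
    | "inside y x" "inside x z" "inside y z" | "inside y z" "inside z x" "inside y x"
    | "inside z x" "inside x y" "inside z y" | "inside z y" "inside y x" "inside z x"
    using t by blast
  then show False
    by cases (use three_goods assms n in blast)+
qed

text \<open>The return maps to a class are rotations that all commute, and the class is one orbit:
  this is Milnor's argument that a periodic point with at least three rays has just one cycle of rays.\<close>

theorem orb_transitive:
  assumes "t \<in> P" "u \<in> P" "sim p e t u"
  shows "orb t u"
proof (rule ccontr)
  assume n: "\<not> orb t u"
  \<comment> \<open>The class of \<open>x\<close> has exactly one member \<open>z\<close> from the
    orbit of \<open>y\<close>. A map that returns this class to itself fixes \<open>z\<close>, hence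
    by \<open>act_fix\<close> every member, so the orbit of \<open>x\<close> meets the class in
    \<open>x\<close> only. A third member then belongs to a third orbit.\<close>
  have key: False if xy: "good x" "good y" "\<not> orb x y" "inside x y" for x y
  proof -
    have P: "x \<in> P" "y \<in> P" using xy good_P by auto
    have n': "\<not> orb y x" using xy orb_sym P by blast
    obtain z where z: "z \<in> P" "sim p e x z" "orb y z" using ex_orb[OF P(2,1)] by blast
    have zuniq: "w = z" if "w \<in> P" "sim p e x w" "orb y w" for w
    proof (rule ccontr)
      assume "w \<noteq> z"
      then have "pos y w \<noteq> pos y z" using pos_base[of w z y] P_eq[OF that(1) z(1)] by auto
      then show False
        using inside_last[OF xy(4,2) that z(1,2)] inside_last[OF xy(4,2) z that(1,2)] by simp
    qed
    have one: "w = x" if w: "w \<in> P" "sim p e x w" "orb x w" for w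
    proof -
      obtain i h where ih: "h \<in> turns" "w = act i h x" using w unfolding orb_def by blast
      have "sim p e (act i h x) (act i h z)" using sim_act0 z ih by blast
      then have "sim p e x (act i h z)" using w ih simt by blast
      moreover have "orb y (act i h z)" using z(3) orb_trans ih(1) unfolding orb_def by blast
      ultimately have fz: "act i h z = z" using zuniq act_P[OF z(1) ih(1)] by blast
      show ?thesis using act_fix[OF ih(1) z(1) fz P(1) sim_sym[OF z(2)]] ih by simp
    qed
    have "x \<noteq> z" using z n' by blast
    obtain r where r: "r \<in> P" "sim p e x r" "r \<noteq> x" "r \<noteq> z"
      using ex_three[OF P(1)] by metis
    have nr: "\<not> orb x r" "\<not> orb y r" using r one zuniq by blast+
    obtain c where c: "orb r c" "good c" using ex_good[OF r(1)] by blast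
    have "\<not> orb x c" "\<not> orb y c" using nr c orb_sym[OF c(1) r(1)] orb_trans by blast+
    then show False using three_orbits[OF xy(1,2) c(2) xy(3)] by blast
  qed
  obtain x where x: "orb t x" "good x" using ex_good assms by blast
  obtain y where y: "orb u y" "good y" using ex_good assms by blast
  have nxy: "\<not> orb x y" using n x y orb_sym assms orb_trans by meson
  moreover have "\<not> orb y x" using nxy orb_sym y good_P by blast
  ultimately show False using key x y inside_total by blast
qed

end

lemma (in periodic_class) diagonal_crosses:
  assumes A: "A \<in> P" and B: "B \<in> P" "sim p e A B" and U: "U \<in> P" "sim p e A U" and V: "V \<in> P" "sim p e A V"
    and l: "0 < pos A U" "pos A U < pos A B" "pos A B < pos A V"
  shows "\<exists>i. \<exists>h\<in>turns. linked A B (act i h A) (act i h B)"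
proof -
  obtain s where s: "nxt A s" using nxt_ex A by blast
  have sP: "s \<in> P" "sim p e A s" "s \<noteq> A" using s unfolding nxt_def by auto
  have sle: "pos A s \<le> pos A w" if "w \<in> P" "sim p e A w" "w \<noteq> A" for w using s that unfolding nxt_def by blast
  have "U \<noteq> A" "B \<noteq> A" "V \<noteq> A" using l by force+
  have s0: "0 < pos A s" using pos_pos A sP by blast
  have sB: "pos A s < pos A B" using sle[OF U \<open>U \<noteq> A\<close>] l by simp
  obtain i h where ih: "h \<in> turns" "s = act i h A" using orb_transitive[OF A sP(1,2)] unfolding orb_def by blast
  let ?g = "act i h"
  have gP: "?g w \<in> P" "sim p e A (?g w)" if "w \<in> P" "sim p e A w" for w
    using act_P[OF that(1) ih(1)] sim_act0[OF that(2) ih(1), of i] ih(2) sP(2) simt by auto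
  have ginj: "u = v" if "?g u = ?g v" "u \<in> P" "v \<in> P" for u v using inj_onD[OF act_inj[OF ih(1)] that] .
  have ne: "pos w u \<noteq> pos w v" if "u \<noteq> v" "u \<in> P" "v \<in> P" for u v w
    using pos_base[of u v w] P_eq[OF that(2,3)] that(1) by auto
  have bs: "pos s w = pos A w - pos A s" if "w \<in> P" "sim p e A w" "w \<noteq> A" for w
    using pos_base[of s w A] sle[OF that] by simp
  have gB: "?g B \<noteq> A"
  proof
    assume gBA: "?g B = A"
    have "cyc A B V" unfolding cyc_def using l by simp
    then have "cyc (?g A) (?g B) (?g V)" using cyc_act B V by blast
    then have "cyc A (?g V) s" unfolding ih(2)[symmetric] gBA by (rule cyc_rot)
    then have "0 < pos A (?g V)" "pos A (?g V) < pos A s" unfolding cyc_def by auto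
    then show False using sle[OF gP[OF V]] by force
  qed
  \<comment> \<open>Otherwise the members from \<open>A\<close> to \<open>B\<close> would be mapped
    injectively into themselves without hitting \<open>A\<close>, which is impossible for a finite
    set.\<close>
  have "pos A B < pos A (?g B)"
  proof (rule ccontr)
    assume n: "\<not> pos A B < pos A (?g B)"
    let ?F = "{w \<in> P. sim p e A w \<and> pos A w \<le> pos A B}"
    have "?g ` ?F \<subseteq> ?F - {A}"
    proof (rule image_subsetI)
      fix w assume "w \<in> ?F"
      then have w: "w \<in> P" "sim p e A w" "pos A w \<le> pos A B" by auto
      have *: "pos A (?g w) \<le> pos A B \<and> ?g w \<noteq> A"
      proof (cases "w = A \<or> w = B")
        case True
        then show ?thesis using n sB gB sP(3) ih(2) by auto
      next
        case False
        then have "pos A w < pos A B" using ne[of w B A] w(1,3) B(1) by force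
        then have "cyc A w B" unfolding cyc_def using pos_pos[OF A w(1)] False by simp
        then have c: "cyc s (?g w) (?g B)" using cyc_act[OF w(2) B(2)] ih(2) by simp
        have gwA: "?g w \<noteq> A"
        proof
          assume "?g w = A"
          then have "cyc s A (?g B)" using c by simp
          then show False unfolding cyc_def
            using bs[OF gP[OF B] gB] pos_swap[of s A] n s0 sB pos_lt1[of A B] by auto
        qed
        then show ?thesis
          using c bs[OF gP[OF w(1,2)] gwA] bs[OF gP[OF B] gB] n unfolding cyc_def by simp
      qed
      then show "?g w \<in> ?F - {A}" using gP[OF w(1,2)] by simp
    qed
    moreover have "finite ?F" using finite_P by simp
    moreover have "inj_on ?g ?F" using ginj by (blast intro: inj_onI)
    moreover have "A \<in> ?F" using A sim_refl pos_ge0 by simp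
    ultimately show False
      by (metis (no_types, lifting) card_Diff1_less card_image card_mono finite_Diff not_le)
  qed
  then have "linked A B s (?g B)" unfolding linked_base using s0 sB by simp
  then show ?thesis using ih by metis
qed

lemma linked_cong:
  assumes "pos a a' = 0" "pos b b' = 0" "pos c c' = 0" "pos d d' = 0"
  shows "linked a b c d \<longleftrightarrow> linked a' b' c' d'"
  unfolding linked_base pos_cong[OF assms(1,2)] pos_cong[OF assms(1,3)] pos_cong[OF assms(1,4)] by simp

lemma linked_frac [simp]: "linked (frac a) b c d = linked a b c d" "linked a (frac b) c d = linked a b c d"
  "linked a b (frac c) d = linked a b c d" "linked a b c (frac d) = linked a b c d"
  by (rule linked_cong; simp)+

text \<open>The third and fourth points make \<open>sim_eventually_periodic\<close> available. It
  moves the class to a periodic one, where \<open>diagonal_crosses\<close> applies.\<close>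

lemma class_diagonal_crosses:
  assumes e: "0 < e" "e \<le> 1/6" and s: "sim p e a b" "sim p e a u" "sim p e a v" and l: "linked a b u v"
  shows "\<exists>m n. \<exists>h\<in>turns. linked (3 ^ m * a) (3 ^ m * b) (3 ^ n * a + h) (3 ^ n * b + h)"
proof -
  have uv: "sim p e u v" using s sim_sym sim_trans[OF e(1)] by blast
  have key: ?thesis if su: "sim p e a u" "sim p e a v" and cy: "cyc a u b" "cyc b v a" and l: "linked a b u v" for u v
  proof -
    have uv: "sim p e u v" using su sim_sym sim_trans[OF e(1)] by blast
    note d = linked_distinct[OF l]
    have bu: "pos b u \<noteq> 0" by (rule d)
    obtain m n where mn: "m < n" "sim p e (3 ^ m * a) (3 ^ n * a)"
      using sim_eventually_periodic[OF e s(1) su(1) d(5,1,3)] by blast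
    let ?A = "3 ^ m * a" and ?B = "3 ^ m * b" and ?U = "3 ^ m * u" and ?V = "3 ^ m * v"
    have "3 ^ n = (3 ^ (n - m) * 3 ^ m :: real)" using mn(1) by (simp add: power_add[symmetric])
    then have per: "sim p e ?A (3 ^ (n - m) * ?A)" using mn(2) by (simp only: mult.assoc)
    have sm: "sim p e ?A ?B" "sim p e ?A ?U" "sim p e ?A ?V" using s su sim_pow by blast+
    have bu': "sim p e b u" using s(1) su(1) sim_sym sim_trans[OF e(1)] by blast
    interpret periodic_class p e ?A "n - m" ?B ?U
    proof
      show "pos ?A ?B \<noteq> 0" using sim_inj[OF e s(1)] d by blast
      show "pos ?A ?U \<noteq> 0" using sim_inj[OF e su(1)] d by blast
      show "pos ?B ?U \<noteq> 0" using sim_inj[OF e bu'] d by blast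
    qed (use e per sm mn in auto)
    have "sim p e ?A ?A" using per sim_sym simt by blast
    then have "sim p e ?A (3 ^ 0 * ?A + 0)" by simp
    then have aP: "frac ?A \<in> P" unfolding P_def turns_def by (auto simp: frac_lt_1 intro!: exI[of _ 0])
    have P: "frac ?B \<in> P" "frac ?U \<in> P" "frac ?V \<in> P"
      by (rule P_class[OF aP]; use sm in \<open>simp add: frac_lt_1\<close>)+
    have "cyc ?A ?U ?B" using sim_order[OF e su(1) s(1) cy(1)] .
    moreover have "cyc ?A ?B ?V" using sim_order[OF e s(1) su(2) cyc_rot[OF cyc_rot[OF cy(2)]]] .
    ultimately have "0 < pos (frac ?A) (frac ?U)" "pos (frac ?A) (frac ?U) < pos (frac ?A) (frac ?B)"
      "pos (frac ?A) (frac ?B) < pos (frac ?A) (frac ?V)" unfolding cyc_def by simp_all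
    from diagonal_crosses[OF aP P(1) _ P(2) _ P(3) _ this] sm
    obtain i h where ih: "h \<in> turns" "linked (frac ?A) (frac ?B) (act i h (frac ?A)) (act i h (frac ?B))" by auto
    have "linked ?A ?B (3 ^ i * frac ?A + h) (3 ^ i * frac ?B + h)" using ih(2) unfolding act_def by simp
    moreover have z: "pos (3 ^ i * frac (3 ^ m * y) + h) (3 ^ (i + m) * y + h) = 0" for y
      by (simp add: power_add mult.assoc)
    ultimately have "linked ?A ?B (3 ^ (i + m) * a + h) (3 ^ (i + m) * b + h)"
      using linked_cong[OF pos_self[of ?A] pos_self[of ?B] z[of a] z[of b]] by simp
    then show ?thesis using ih(1) by blast
  qed
  show ?thesis
    using l[unfolded linked_def] key[OF s(2,3) _ _ l] key[OF s(3,2) _ _ linked_swap2[OF l]] by blast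
qed

lemma turns_double: "h \<in> turns \<Longrightarrow> pos (t + h + h) t = 0"
  unfolding turns_def by (elim insertE emptyE) (simp_all only: pos_eq0, simp_all)

text \<open>By \<open>act_fix\<close> a return map that fixes one member of a class fixes all of
  them; doubling the time removes the half turn \<open>h\<close>. The return is stated for
  \<open>3 * y\<close> because \<open>y\<close> itself may come back to another preimage of
  \<open>3 * y\<close>.\<close>

lemma return_fixed:
  assumes e: "0 < e" "e \<le> 1/6" and s: "sim p e y x" and h: "h \<in> turns" and n: "0 < n"
    and r: "pos (3 ^ n * (3 * y)) (3 * y + h) = 0"
  shows "pos (3 ^ n * (3 * x)) (3 * x + h) = 0"
    "sim p e (3 * y) (3 ^ (2 * n) * (3 * y))" "pos (3 ^ (2 * n) * (3 * y)) (3 * y) = 0"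
proof -
  let ?a = "3 * y"
  note hh = turns_double[OF h]
  have 1: "pos (3 ^ n * (3 ^ n * ?a)) (3 ^ n * (?a + h)) = 0" using pos0_mult[OF r] .
  have 2: "pos (3 ^ n * (?a + h)) (3 ^ n * ?a + h) = 0" using pos_pow_half[OF h] .
  have 3: "pos (3 ^ n * ?a + h) (?a + h + h) = 0" using r by (simp only: pos_shift)
  have z: "pos (3 ^ (2 * n) * ?a) ?a = 0"
  proof -
    have eq: "3 ^ (2 * n) * ?a = 3 ^ n * (3 ^ n * ?a)" by (simp add: mult_2 power_add)
    show ?thesis unfolding eq by (rule pos0_trans[OF pos0_trans[OF pos0_trans[OF 1 2] 3] hh])
  qed
  then show "pos (3 ^ (2 * n) * (3 * y)) (3 * y) = 0" .
  have "sim p e y y" using s sim_sym sim_trans[OF e(1)] by blast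
  from sim_pow[OF this, of 1] have sa: "sim p e ?a ?a" by simp
  show per: "sim p e ?a (3 ^ (2 * n) * ?a)" using sa sim_cong[OF pos_self pos0_sym[OF z]] by blast
  interpret periodic_itinerary p e ?a "2 * n" by unfold_locales (use e n per in auto)
  have "sim p e ?a (3 ^ 0 * ?a + 0)" using sa by simp
  then have aP: "frac ?a \<in> P" unfolding P_def turns_def by (auto simp: frac_lt_1 intro!: exI[of _ 0])
  have sx: "sim p e (frac ?a) (frac (3 * x))" using sim_pow[OF s, of 1] by simp
  have xP: "frac (3 * x) \<in> P" by (rule P_class[OF aP sx]) (simp_all add: frac_lt_1)
  have "pos (3 ^ n * frac ?a + h) (3 ^ n * ?a + h) = 0" by simp
  from pos0_trans[OF pos0_trans[OF this 3] hh] have "act n h (frac ?a) = frac ?a"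
    unfolding act_def by (rule frac_eqI)
  from act_fix[OF h aP this xP sx] have "frac (3 ^ n * frac (3 * x) + h) = frac (3 * x)" unfolding act_def .
  then have "pos (3 ^ n * frac (3 * x) + h) (3 * x) = 0" by (metis pos_frac_left pos_frac_right pos_self)
  then have "pos (3 ^ n * frac (3 * x) + h + h) (3 * x + h) = 0" by (simp only: pos_shift)
  from pos0_trans[OF pos0_sym[OF hh] this] show "pos (3 ^ n * (3 * x)) (3 * x + h) = 0"
    by simp
qed

section \<open>Chords with equal itineraries at both ends\<close>

text \<open>Narrowing the strip enlarges its sectors: the strips of width \<open>e'\<close> based at
  \<open>P'\<close> lie inside those of width \<open>e\<close> based at \<open>P\<close>.\<close>

lemma K_sub:
  assumes "K P e j t" "0 \<le> e'" "pos P P' + e' \<le> e" "e \<le> 1/6"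
  shows "K P' e' j t"
proof -
  define u d where ud: "u = pos P t" "d = pos P P'"
  have "pos P' t = (if d \<le> u then u - d else u - d + 1)" unfolding ud by (rule pos_base)
  moreover have "0 \<le> d" "0 \<le> u" "u < 1" unfolding ud by (simp_all add: pos_ge0 pos_lt1)
  moreover have "sec e j u" using assms(1) unfolding K_def ud .
  ultimately show ?thesis
    using assms(2-4) unfolding K_def ud(2)[symmetric] by (cases j) auto
qed

lemma sim_sub: "sim P e a b \<Longrightarrow> 0 \<le> e' \<Longrightarrow> pos P P' + e' \<le> e \<Longrightarrow> e \<le> 1/6 \<Longrightarrow> sim P' e' a b"
  unfolding sim_def same_def using K_sub by meson

text \<open>A converse of \<open>K_sub\<close> for an arc divided at \<open>u\<close>: a point in
  the same sector for both parts lies in that sector for the whole arc.\<close>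

lemma K_inter:
  assumes "K p (pos p u) j t" "K u (pos u q) j t" "pos p u + pos u q \<le> 1/6"
  shows "K p (pos p u + pos u q) j t"
proof -
  define v d d' where ud: "v = pos p t" "d = pos p u" "d' = pos u q"
  have "pos u t = (if d \<le> v then v - d else v - d + 1)" unfolding ud by (rule pos_base)
  moreover have "0 \<le> d" "0 \<le> d'" "0 \<le> v" "v < 1" unfolding ud by (simp_all add: pos_ge0 pos_lt1)
  moreover have "sec d j v" "sec d' j (pos u t)" using assms(1,2) unfolding K_def ud by simp_all
  ultimately have "sec (d + d') j v"
    using assms(3)[folded ud] by (cases j) (auto split: if_splits)
  then show ?thesis unfolding K_def ud .
qed

definition Q :: "real \<Rightarrow> real \<Rightarrow> bool" where
  "Q p q \<longleftrightarrow> 0 < pos p q \<and> pos p q < 1/6 \<and> sim p (pos p q) p q"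

definition N :: "real \<Rightarrow> real \<Rightarrow> bool" where
  "N p q \<longleftrightarrow> (\<forall>m n. \<forall>h\<in>turns. \<not> linked (3 ^ m * p) (3 ^ m * q) (3 ^ n * p + h) (3 ^ n * q + h))"

text \<open>The image has length \<open>3 * e\<close> with \<open>e = pos p q\<close> and again lies
  in one sector, so \<open>K_gap\<close> gives \<open>3 * e \<le> 1/3 - e\<close>; its other ranges
  would need \<open>e \<ge> 1/6\<close>.\<close>

lemma Q_le: "Q p q \<Longrightarrow> pos p q \<le> 1/12"
proof -
  assume q: "Q p q"
  then have e: "0 < pos p q" "pos p q < 1/6" and s: "sim p (pos p q) p q" unfolding Q_def by auto
  obtain j where j: "K p (pos p q) j (3 ^ 1 * p)" "K p (pos p q) j (3 ^ 1 * q)" using s unfolding sim_def same_def by blast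
  have "pos (3 ^ 1 * p) (3 ^ 1 * q) = 3 * pos p q" using e pos_triple[of p q] by simp
  then show ?thesis using K_gap[OF _ _ j] e by auto
qed

section \<open>Endpoints whose orbit returns to a boundary point\<close>

definition bd :: "real \<Rightarrow> real \<Rightarrow> bool" where
  "bd y t \<longleftrightarrow> pos y t \<in> {1/6, 1/3, 2/3, 5/6}"

text \<open>The orbit returns to an end of one of the two critical chords into which the strips of
  width zero degenerate. Tripling maps these ends to \<open>3 * y\<close> up to a half turn, so
  \<open>3 * y\<close> is periodic up to a half turn, and at the time of return the sector of
  \<open>y\<close> is ambiguous.\<close>

definition hyp :: "real \<Rightarrow> bool" where
  "hyp y \<longleftrightarrow> (\<exists>n>0. bd y (3 ^ n * y))"

lemma pos0_of_eq: "pos u a = pos u b \<Longrightarrow> pos a b = 0"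
  using pos_base[of a b u] by simp

lemma bd_turn:
  assumes "bd y t"
  obtains c h where "c \<in> {1/3, 2/3}" "h \<in> turns" "pos t (y + c + h) = 0"
proof -
  have t: "0 \<in> turns" "1/2 \<in> turns" unfolding turns_def by simp_all
  have p: "pos y (y + 1/3 + 0) = 1/3" "pos y (y + 2/3 + 0) = 2/3" by (simp_all add: pos_self_add)
  have p': "pos y (y + 1/3 + 1/2) = 5/6" "pos y (y + 2/3 + 1/2) = 1/6"
    using pos_add_right[of "1/2" y "y + 1/3"] pos_add_right[of "1/2" y "y + 2/3"] by (simp_all add: pos_self_add)
  from assms consider "pos y t = 1/3" | "pos y t = 2/3" | "pos y t = 5/6" | "pos y t = 1/6"
    unfolding bd_def by blast
  then show thesis
  proof cases
    case 1 then show ?thesis using that[of "1/3" 0] t p pos0_of_eq[of y t] by simp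
  next
    case 2 then show ?thesis using that[of "2/3" 0] t p pos0_of_eq[of y t] by simp
  next
    case 3 then show ?thesis using that[of "1/3" "1/2"] t p' pos0_of_eq[of y t] by simp
  next
    case 4 then show ?thesis using that[of "2/3" "1/2"] t p' pos0_of_eq[of y t] by simp
  qed
qed

lemma triple_third:
  assumes "c \<in> {1/3, 2/3}" "h \<in> turns"
  shows "pos (3 * (z + c + h)) (3 * z + h) = 0"
proof -
  have "3 * c \<in> \<int>" using assms(1) by (elim insertE emptyE) (simp_all only:, simp_all)
  then have "pos (3 * z + 3 * c) (3 * z) = 0" by (simp add: pos_eq0)
  then have "pos (3 * z + 3 * c + h) (3 * z + h) = 0" by (simp only: pos_shift)
  moreover have "pos (3 * (z + c + h)) (3 * (z + c) + h) = 0" using pos_pow_half[OF assms(2), of 1 "z + c"] by simp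
  moreover have "3 * (z + c) + h = 3 * z + 3 * c + h" by simp
  ultimately show ?thesis using pos0_trans[of "3 * (z + c + h)" "3 * z + 3 * c + h" "3 * z + h"] by simp
qed

lemma third_of_triple:
  assumes "pos (3 * w) (3 * y) = 0"
  shows "pos y w = 0 \<or> pos y w = 1/3 \<or> pos y w = 2/3"
  using pos0_sym[OF assms] unfolding pos_triple by (auto split: if_splits)

lemma K_turn:
  assumes "0 \<le> e" "e \<le> 1/6" "h \<in> turns"
  obtains f where "\<And>j t. K p e j (t + h) \<longleftrightarrow> K p e (f j) t"
proof (cases "h = 0")
  case True
  then show thesis using that[of id] by simp
next
  case False
  then have "h = 1/2" using assms(3) unfolding turns_def by blast
  then have "K p e j (t + h) \<longleftrightarrow> K p e (flip j) t" for j t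
    using K_half[OF assms(1,2), of p "flip j" t] by (simp only: flip_flip)
  then show thesis by (rule that)
qed

text \<open>\<open>3 * z\<close>, \<open>3 * y\<close> and \<open>3 * x\<close> belong to a periodic
  class, so by transitivity \<open>3 * y\<close> lies on the orbit of \<open>3 * z\<close>. Hence an
  iterate of \<open>z\<close> meets, up to a half turn, \<open>y\<close> or a point a third away
  from it. The latter is excluded by the assumption on the orbit of \<open>z\<close>, the former
  because then \<open>y\<close> returns to \<open>y\<close> when \<open>z\<close> returns to
  \<open>z + c\<close>.\<close>

lemma hyper_no_third:
  assumes e: "0 < e" "e \<le> 1/6" and s: "sim p0 e z y" "sim p0 e z x" and d: "pos z y \<noteq> 0" "pos z x \<noteq> 0" "pos y x \<noteq> 0"
    and c: "c \<in> {1/3, 2/3}" and h: "h \<in> turns" and n: "0 < n" and ret: "pos (3 ^ n * z) (z + c + h) = 0"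
    and Ny: "K p0 e Near y" and Nz: "\<not> K p0 e Near (z + c)"
    and av: "\<And>i h' c'. h' \<in> turns \<Longrightarrow> c' \<in> {1/3, 2/3} \<Longrightarrow> 0 < i \<Longrightarrow> pos (3 ^ i * z) (y + c' + h') \<noteq> 0"
  shows False
proof -
  have r: "pos (3 ^ n * (3 * z)) (3 * z + h) = 0"
  proof -
    have "pos (3 * (3 ^ n * z)) (3 * (z + c + h)) = 0" using pos0_mult[OF ret, of 1] by (simp only: power_one_right)
    from pos0_trans[OF this triple_third[OF c h]] show ?thesis by (simp only: mult.left_commute)
  qed
  note rf = return_fixed[OF e s(1) h n r]
  have yx: "sim p0 e y x" using s sim_sym sim_trans[OF e(1)] by blast
  interpret periodic_class p0 e "3 * z" "2 * n" "3 * y" "3 * x"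
    by unfold_locales
      (use e n rf(2) sim_pow[OF s(1), of 1] sim_pow[OF s(2), of 1] sim_inj[OF e s(1), of 1] sim_inj[OF e s(2), of 1]
          sim_inj[OF e yx, of 1] d in auto)
  have sz: "sim p0 e (3 * z) (3 * z)" using ab sim_sym simt by blast
  then have "sim p0 e (3 * z) (3 ^ 0 * (3 * z) + 0)" by simp
  then have zP: "frac (3 * z) \<in> P" unfolding P_def turns_def by (auto simp: frac_lt_1 intro!: exI[of _ 0])
  have szy: "sim p0 e (frac (3 * z)) (frac (3 * y))" using ab by simp
  have yP: "frac (3 * y) \<in> P" by (rule P_class[OF zP szy]) (simp_all add: frac_lt_1)
  obtain i k where k: "k \<in> turns" and ik: "frac (3 * y) = act i k (frac (3 * z))"
    using orb_transitive[OF zP yP szy] unfolding orb_def by blast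
  \<comment> \<open>Adding a full period makes the exponent positive, as the assumption on the orbit
    of \<open>z\<close> requires.\<close>
  define I where "I = i + 2 * n"
  have I: "0 < I" using n unfolding I_def by simp
  have y1: "pos (3 * y) (3 ^ i * (3 * z) + k) = 0"
  proof -
    have "pos (3 * y) (3 ^ i * frac (3 * z) + k) = 0"
      using ik unfolding act_def by (metis pos_frac_left pos_frac_right pos_self)
    moreover have "pos (3 ^ i * frac (3 * z) + k) (3 ^ i * (3 * z) + k) = 0" by simp
    ultimately show ?thesis by (rule pos0_trans)
  qed
  have "pos (3 ^ i * (3 * z)) (3 ^ i * (3 ^ (2 * n) * (3 * z))) = 0" using pos0_mult[OF pos0_sym[OF rf(3)]] .
  then have "pos (3 ^ i * (3 * z) + k) (3 ^ I * (3 * z) + k) = 0" unfolding I_def power_add mult.assoc by (simp only: pos_shift)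
  from pos0_trans[OF y1 this] have y2: "pos (3 * y) (3 ^ I * (3 * z) + k) = 0" .
  define w where "w = 3 ^ I * z + k"
  have "pos (3 * w) (3 ^ I * (3 * z) + k) = 0"
    using pos_pow_half[OF k, of 1 "3 ^ I * z"] unfolding w_def by (simp add: mult.left_commute)
  from pos0_trans[OF this pos0_sym[OF y2]] have "pos (3 * w) (3 * y) = 0" .
  then consider "pos y w = 0" | c' where "c' \<in> {1/3, 2/3}" "pos y w = c'" using third_of_triple by blast
  then show False
  proof cases
    case (2 c')
    then have "pos y (y + c') = c'" using pos_self_add[of c' y] by auto
    then have "pos w (y + c') = 0" using pos0_of_eq[of y] 2 by simp
    then have "pos (3 ^ I * z + k + k) (y + c' + k) = 0" unfolding w_def by (simp only: pos_shift)
    from pos0_trans[OF pos0_sym[OF turns_double[OF k]] this] show False using av[OF k 2(1) I] by blast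
  next
    \<comment> \<open>Now \<open>y\<close> returns to itself, up to the half turn \<open>h\<close>,
      at the time when \<open>z\<close> returns to \<open>z + c\<close>. Equal itineraries would put
      \<open>z + c\<close> into the sector of \<open>y\<close>, which is
      \<open>Near\<close>.\<close>
    case 1
    have 2: "pos (3 ^ n * y) (3 ^ n * w) = 0" using pos0_mult[OF 1] .
    have 3: "pos (3 ^ n * w) (3 ^ n * (3 ^ I * z) + k) = 0" unfolding w_def using pos_pow_half[OF k] .
    have 4: "pos (3 ^ n * (3 ^ I * z) + k) (3 ^ I * z + h + k) = 0"
    proof -
      have eq: "3 ^ n * (3 ^ I * z) = 3 ^ (I - 1) * (3 ^ n * (3 * z))" "3 ^ I * z = 3 ^ (I - 1) * (3 * z)"
        using I by (cases I; simp)+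
      have "pos (3 ^ (I - 1) * (3 ^ n * (3 * z))) (3 ^ (I - 1) * (3 * z + h)) = 0" using pos0_mult[OF r] .
      from pos0_trans[OF this pos_pow_half[OF h]] show ?thesis unfolding eq(1) unfolding eq(2) pos_shift .
    qed
    have 5: "pos (3 ^ I * z + h + k) (y + h) = 0"
    proof -
      have eq: "3 ^ I * z + h + k = w + h" unfolding w_def by simp
      show ?thesis unfolding eq pos_shift by (rule pos0_sym[OF 1])
    qed
    have yy: "pos (3 ^ n * y) (y + h) = 0" using pos0_trans[OF pos0_trans[OF pos0_trans[OF 2 3] 4] 5] .
    obtain j where j: "K p0 e j (3 ^ n * z)" "K p0 e j (3 ^ n * y)" using s(1) unfolding sim_def same_def by blast
    obtain f where f: "\<And>j t. K p0 e j (t + h) \<longleftrightarrow> K p0 e (f j) t" using K_turn[OF less_imp_le[OF e(1)] e(2) h] by blast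
    have zc: "K p0 e (f j) (z + c)" using j(1) unfolding K_cong[OF ret] f .
    have "K p0 e (f j) y" using j(2) unfolding K_cong[OF yy] f .
    from K_unique[OF e(1) this Ny] show False using zc Nz by simp
  qed
qed

text \<open>\<open>y\<close> lies strictly inside the arc of the strip, so \<open>y + c + h\<close>
  lies strictly inside one of the strips and in no sector.\<close>

lemma K_avoid:
  assumes "K X E j t" "E \<le> 1/6" "0 < pos X y" "pos X y < E" "c \<in> {1/3, 2/3}" "h \<in> turns"
  shows "pos t (y + c + h) \<noteq> 0"
proof
  assume "pos t (y + c + h) = 0"
  then have k: "K X E j (y + c + h)" using assms(1) K_cong[of t "y + c + h"] by simp
  have "0 \<le> E" using assms(3,4) by linarith
  then obtain f where f: "\<And>j t. K X E j (t + h) \<longleftrightarrow> K X E (f j) t"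
    using K_turn[OF _ assms(2,6)] by blast
  have "K X E (f j) (y + c)" using k unfolding f .
  moreover have "pos X (y + c) = pos X y + c" using pos_add_right[of c X y] assms(2-5) by auto
  ultimately show False using assms(2-5) unfolding K_def by (cases "f j") auto
qed

text \<open>Relative to the narrower strip from \<open>p\<close> to \<open>y\<close> all three
  points share an itinerary, while the wider strip from \<open>p\<close> to \<open>x\<close> keeps
  the orbit of \<open>p\<close> off the boundary points of \<open>y\<close>. This is the situation
  of \<open>hyper_no_third\<close>.\<close>

lemma nested_left:
  assumes Qx: "Q p x" and Qy: "Q p y" and lt: "pos p y < pos p x" and "hyp p"
  shows False
proof -
  let ?e = "pos p y"
  have e: "0 < ?e" "?e \<le> 1/6" and E: "pos p x \<le> 1/6" using Qx Qy unfolding Q_def by auto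
  obtain n where n: "0 < n" "bd p (3 ^ n * p)" using assms(4) unfolding hyp_def by blast
  obtain c h where ch: "c \<in> {1/3, 2/3}" "h \<in> turns" "pos (3 ^ n * p) (p + c + h) = 0" using bd_turn[OF n(2)] .
  show False
  proof (rule hyper_no_third[OF e _ _ _ _ _ ch(1,2) n(1) ch(3)])
    show "sim p ?e p y" using Qy unfolding Q_def by blast
    show "sim p ?e p x" using sim_sub[of p "pos p x" p x ?e p] Qx lt e unfolding Q_def by auto
    show "pos p y \<noteq> 0" "pos p x \<noteq> 0" using e lt by auto
    show "pos y x \<noteq> 0" using pos_base[of y x p] lt by auto
    show "K p ?e Near y" unfolding K_def using e by simp
    show "\<not> K p ?e Near (p + c)" unfolding K_def using pos_self_add[of c p] ch(1) e by auto
    show "pos (3 ^ i * p) (y + c' + h') \<noteq> 0" if "h' \<in> turns" "c' \<in> {1/3, 2/3}" "0 < i" for i h' c'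
    proof -
      obtain j where "K p (pos p x) j (3 ^ i * p)" using Qx unfolding Q_def sim_def same_def by blast
      from K_avoid[OF this E e(1) lt that(2,1)] show ?thesis .
    qed
  qed
qed

lemma nested_right:
  assumes Qx: "Q x q" and Qy: "Q y q" and lt: "0 < pos x y" "pos x y < pos x q" and "hyp q"
  shows False
proof -
  let ?e = "pos y q"
  have e: "0 < ?e" "?e \<le> 1/6" and E: "pos x q \<le> 1/6" using Qx Qy unfolding Q_def by auto
  have eE: "pos x q = pos x y + ?e" using pos_base[of y q x] lt by auto
  obtain n where n: "0 < n" "bd q (3 ^ n * q)" using assms(5) unfolding hyp_def by blast
  obtain c h where ch: "c \<in> {1/3, 2/3}" "h \<in> turns" "pos (3 ^ n * q) (q + c + h) = 0" using bd_turn[OF n(2)] .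
  show False
  proof (rule hyper_no_third[OF e _ _ _ _ _ ch(1,2) n(1) ch(3)])
    show "sim y ?e q y" using Qy sim_sym unfolding Q_def by blast
    show "sim y ?e q x" using sim_sub[of x "pos x q" q x ?e y] Qx e eE sim_sym unfolding Q_def by auto
    show "pos q y \<noteq> 0" "pos q x \<noteq> 0" using Qx Qy pos0_sym unfolding Q_def by force+
    show "pos y x \<noteq> 0" using lt pos0_sym by force
    show "K y ?e Near y" unfolding K_def by simp
    show "\<not> K y ?e Near (q + c)" unfolding K_def using pos_add_right[of c y q] ch(1) e by auto
    show "pos (3 ^ i * q) (y + c' + h') \<noteq> 0" if "h' \<in> turns" "c' \<in> {1/3, 2/3}" "0 < i" for i h' c'
    proof -
      obtain j where "K x (pos x q) j (3 ^ i * q)" using Qx unfolding Q_def sim_def same_def by blast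
      from K_avoid[OF this E lt that(2,1)] show ?thesis .
    qed
  qed
qed

text \<open>Sectors of width zero overlap only in boundary points.\<close>

lemma K0_unique: "\<not> bd z t \<Longrightarrow> K z 0 i t \<Longrightarrow> K z 0 j t \<Longrightarrow> i = j"
  unfolding bd_def K_def using pos_ge0[of z t] by (cases i; cases j) auto

lemma cyc_cong: "pos a a' = 0 \<Longrightarrow> pos b b' = 0 \<Longrightarrow> pos c c' = 0 \<Longrightarrow> cyc a b c \<longleftrightarrow> cyc a' b' c'"
  unfolding cyc_def using pos_cong[of a a' b b'] pos_cong[of a a' c c'] by simp

text \<open>Before the first return of \<open>z\<close> to a boundary point its sectors of width
  zero are unambiguous, so the cyclic order of \<open>x\<close>, \<open>z\<close>, \<open>y\<close>
  is preserved up to that time. Then \<open>z\<close> comes back to \<open>z + c\<close>, whereas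
  the strips on either side of \<open>z\<close> send \<open>x\<close> and \<open>y\<close> to their
  shifts by \<open>1 - c\<close>. This breaks the order.\<close>

lemma opposite:
  assumes Qx: "Q x z" and Qy: "Q z y" and hz: "hyp z"
  shows False
proof -
  let ?e = "pos x z" and ?d = "pos z y"
  have e: "0 < ?e" "?e \<le> 1/12" and d: "0 < ?d" "?d \<le> 1/12" using Qx Qy Q_le unfolding Q_def by auto
  define n where "n = (LEAST n. 0 < n \<and> bd z (3 ^ n * z))"
  have n: "0 < n" "bd z (3 ^ n * z)" using LeastI_ex[OF hz[unfolded hyp_def]] unfolding n_def by auto
  have nb: "\<not> bd z (3 ^ k * z)" if "k < n" for k
  proof (cases "k = 0")
    case True
    then show ?thesis by (simp add: bd_def)
  next
    case False
    then show ?thesis using not_less_Least[of k "\<lambda>n. 0 < n \<and> bd z (3 ^ n * z)"] that unfolding n_def by auto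
  qed
  obtain c h where ch: "c \<in> {1/3, 2/3}" "h \<in> turns" "pos (3 ^ n * z) (z + c + h) = 0" using bd_turn[OF n(2)] .
  have r: "pos (3 ^ n * (3 * z)) (3 * z + h) = 0"
  proof -
    have "pos (3 * (3 ^ n * z)) (3 * (z + c + h)) = 0" using pos0_mult[OF ch(3), of 1] by (simp only: power_one_right)
    from pos0_trans[OF this triple_third[OF ch(1,2)]] show ?thesis by (simp only: mult.left_commute)
  qed
  have e6: "?e \<le> 1/6" "?d \<le> 1/6" using e d by simp_all
  have sx: "sim x ?e z x" and sy: "sim z ?d z y" using Qx Qy sim_sym unfolding Q_def by auto
  have thd: "pos t (3 ^ n * t + h) = 0 \<or> pos t (3 ^ n * t + h) = 1/3 \<or> pos t (3 ^ n * t + h) = 2/3"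
    if "pos (3 ^ n * (3 * t)) (3 * t + h) = 0" for t
  proof (rule third_of_triple)
    have "pos (3 * (3 ^ n * t + h)) (3 * (3 ^ n * t) + h) = 0" using pos_pow_half[OF ch(2), of 1 "3 ^ n * t"] by simp
    moreover have "pos (3 * (3 ^ n * t) + h) (3 * t + h + h) = 0" using that by (simp only: pos_shift mult.left_commute)
    ultimately show "pos (3 * (3 ^ n * t + h)) (3 * t) = 0" by (rule pos0_trans[OF _ pos0_trans[OF _ turns_double[OF ch(2)]]])
  qed
  have sect: "\<exists>j. K P f j (z + c) \<and> K P f j (3 ^ n * t + h)" if st: "sim P f z t" "0 \<le> f" "f \<le> 1/6" for P f t
  proof -
    obtain j where j: "K P f j (3 ^ n * z)" "K P f j (3 ^ n * t)" using st(1) unfolding sim_def same_def by blast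
    obtain g where g: "\<And>j t. K P f j (t + h) \<longleftrightarrow> K P f (g j) t" using K_turn[OF st(2,3) ch(2)] by blast
    have "K P f (g j) (z + c)" using j(1) unfolding K_cong[OF ch(3)] g .
    moreover have "K P f j (3 ^ n * t + h + h)" using j(2) by (simp only: K_cong[OF turns_double[OF ch(2)]])
    then have "K P f (g j) (3 ^ n * t + h)" unfolding g .
    ultimately show ?thesis by blast
  qed
  define x' y' where xy: "x' = 3 ^ n * x + h" "y' = 3 ^ n * y + h"
  have zc: "pos x (z + c) = ?e + c" "pos z (z + c) = c"
    using pos_add_right[of c x z] pos_self_add[of c z] ch(1) e by auto
  \<comment> \<open>Among the three candidates, which differ by thirds, only this one lies in the
    sector of \<open>z + c\<close>.\<close>
  have x': "pos x x' = 1 - c"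
  proof -
    obtain j where "K x ?e j (z + c)" "K x ?e j x'" using sect[OF sx _ e6(1)] e unfolding xy by auto
    then show ?thesis using thd[OF return_fixed(1)[OF e(1) e6(1) sx ch(2) n(1) r]] ch(1) e
      unfolding K_def zc xy[symmetric] by (cases j) auto
  qed
  have y': "pos y y' = 1 - c"
  proof -
    obtain j where j: "K z ?d j (z + c)" "K z ?d j y'" using sect[OF sy _ e6(2)] d unfolding xy by auto
    have t: "pos y y' = 0 \<or> pos y y' = 1/3 \<or> pos y y' = 2/3"
      using thd[OF return_fixed(1)[OF d(1) e6(2) sy ch(2) n(1) r]] unfolding xy .
    have "pos y y' = (if ?d \<le> pos z y' then pos z y' - ?d else pos z y' - ?d + 1)" by (rule pos_base)
    then show ?thesis using t j ch(1) d unfolding K_def zc by (cases j) (auto split: if_splits)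
  qed
  have xz0: "sim z 0 x z" using sim_sub[of x ?e x z 0 z] Qx e6 unfolding Q_def by auto
  have zy0: "sim z 0 z y" using sim_sub[of z ?d z y 0 z] Qy e6 unfolding Q_def by auto
  have pxy: "pos x y = ?e + ?d"
    using pos_base[of z y x] e d pos_lt1[of x y] pos_ge0[of x y] by (auto split: if_splits)
  have ne: "pos (3 ^ k * x) (3 ^ k * y) \<noteq> 0" if "k \<le> Suc n" for k
  proof
    assume "pos (3 ^ k * x) (3 ^ k * y) = 0"
    from pos0_mult[OF this, of "Suc n - k"] have "pos (3 ^ Suc n * x) (3 ^ Suc n * y) = 0"
      using that by (simp add: mult.assoc[symmetric] power_add[symmetric])
    then have "pos (3 ^ n * (3 * x)) (3 ^ n * (3 * y)) = 0" by (simp add: mult.left_commute mult.assoc)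
    with return_fixed(1)[OF e(1) e6(1) sx ch(2) n(1) r] return_fixed(1)[OF d(1) e6(2) sy ch(2) n(1) r]
    have "pos (3 * x + h) (3 * y + h) = 0"
      using pos0_trans[OF pos0_trans[OF pos0_sym]] \<open>pos (3 ^ n * (3 * x)) (3 ^ n * (3 * y)) = 0\<close> by blast
    then have "pos (3 * x) (3 * y) = 0" by simp
    then show False unfolding pos_triple pxy using e d by (auto split: if_splits)
  qed
  have "cyc (3 ^ k * x) (3 ^ k * z) (3 ^ k * y)" if "k \<le> n" for k
    using that
  proof (induction k)
    case 0
    then show ?case using e d pxy unfolding cyc_def by simp
  next
    case (Suc k)
    obtain i where i: "K z 0 i (3 ^ k * x)" "K z 0 i (3 ^ k * z)" using xz0 unfolding sim_def same_def by blast
    obtain j where j: "K z 0 j (3 ^ k * z)" "K z 0 j (3 ^ k * y)" using zy0 unfolding sim_def same_def by blast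
    have ij: "j = i" using K0_unique[OF nb j(1) i(2)] Suc.prems by simp
    have "pos (3 ^ Suc k * x) (3 ^ Suc k * z) \<noteq> 0" "pos (3 ^ Suc k * z) (3 ^ Suc k * y) \<noteq> 0"
      using sim_inj[OF e(1) e6(1) sx, of "Suc k"] sim_inj[OF d(1) e6(2) sy, of "Suc k"] e d pos0_sym by force+
    then have "cyc (3 * (3 ^ k * x)) (3 * (3 ^ k * z)) (3 * (3 ^ k * y))"
      using K_order[OF _ i j(2)[unfolded ij]] Suc ne[of "Suc k"] by (simp add: mult.assoc)
    then show ?case by (simp add: mult.assoc)
  qed
  then have "cyc (3 ^ n * x) (3 ^ n * z) (3 ^ n * y)" by simp
  then have "cyc x' (3 ^ n * z + h) y'" unfolding xy cyc_def by simp
  moreover have "pos (3 ^ n * z + h) (z + c) = 0"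
  proof -
    have "pos (3 ^ n * z + h) (z + c + h + h) = 0" using ch(3) by (simp only: pos_shift)
    from pos0_trans[OF this turns_double[OF ch(2)]] show ?thesis .
  qed
  ultimately have cy: "cyc x' (z + c) y'" using cyc_cong[OF pos_self[of x'] _ pos_self[of y'], of "3 ^ n * z + h" "z + c"] by simp
  have "pos x y' = (if ?e + ?d + (1 - c) < 1 then ?e + ?d + (1 - c) else ?e + ?d + (1 - c) - 1)"
  proof -
    have "pos y' (y + (1 - c)) = 0" using pos0_of_eq[of y y' "y + (1 - c)"] y' pos_self_add[of "1 - c" y] ch(1) by auto
    then have "pos x y' = pos x (y + (1 - c))" by (intro pos_cong pos_self)
    then show ?thesis using pos_add_right[of "1 - c" x y] ch(1) pxy by auto
  qed
  then show False using cy ch(1) e d x' unfolding cyc_base[of _ _ _ x] zc by (auto split: if_splits)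
qed

section \<open>Periodicity of the itinerary of an endpoint\<close>

lemma bd_turns:
  assumes "h \<in> turns"
  shows "bd y (t + h) \<longleftrightarrow> bd y t"
proof (cases "h = 0")
  case False
  then have h: "h = 1/2" using assms unfolding turns_def by blast
  have "pos y (t + 1/2) = (if pos y t + 1/2 < 1 then pos y t + 1/2 else pos y t + 1/2 - 1)"
    by (rule pos_add_right) simp_all
  then show ?thesis
    using pos_ge0[of y t] pos_lt1[of y t] unfolding h bd_def insert_iff empty_iff by (auto split: if_splits)
qed simp

text \<open>Time 0 is left out: periodicity is asked only of the itinerary of \<open>3 * y\<close>,
  since \<open>y\<close> itself may be merely preperiodic.\<close>

definition per :: "real \<Rightarrow> bool" where
  "per y \<longleftrightarrow> (\<exists>m>0. \<exists>h\<in>turns. \<forall>n>0. same y 0 (3 ^ n * y) (3 ^ (n + m) * y + h))"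

lemma same_turn: "0 \<le> e \<Longrightarrow> e \<le> 1/6 \<Longrightarrow> h \<in> turns \<Longrightarrow> same p e a b \<Longrightarrow> same p e (a + h) (b + h)"
  using same_half[of e p a b] unfolding turns_def by (elim insertE emptyE; hypsubst) simp_all

lemma same_cong: "pos a a' = 0 \<Longrightarrow> pos b b' = 0 \<Longrightarrow> same p e a b \<longleftrightarrow> same p e a' b'"
  unfolding same_def using K_cong[of a a'] K_cong[of b b'] by metis

text \<open>Off the boundary points the itinerary of width zero determines the one of width
  \<open>e\<close>. A periodic itinerary therefore puts \<open>3 * y\<close> into a finite periodic
  system, and \<open>y\<close> and \<open>x\<close> both turn out to be periodic. Their distance
  \<open>e\<close> then recurs for ever, against the expansion to \<open>3 * e\<close>.\<close>

lemma not_per: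
  assumes e: "0 < e" "e \<le> 1/12" and y: "pos p0 y \<le> e" and s: "sim p0 e y x" and ex: "pos y x = e \<or> pos x y = e"
    and nh: "\<not> hyp y"
  shows "\<not> per y"
proof
  assume "per y"
  then obtain m h where m: "0 < m" "h \<in> turns" "\<And>n. 0 < n \<Longrightarrow> same y 0 (3 ^ n * y) (3 ^ (n + m) * y + h)"
    unfolding per_def by blast
  have e6: "e \<le> 1/6" using e by simp
  have sub: "K y 0 j t" if "K p0 e j t" for j t using K_sub[OF that, of 0 y] y e6 by simp
  have yy: "sim p0 e y y" using s sim_sym sim_trans[OF e(1)] by blast
  obtain g where g: "\<And>j t. K p0 e j (t + h) \<longleftrightarrow> K p0 e (g j) t" using K_turn[OF less_imp_le[OF e(1)] e6 m(2)] by blast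
  have sm: "same p0 e (3 ^ n * y) (3 ^ (n + m) * y + h)" if "0 < n" for n
  proof -
    obtain i where i: "K p0 e i (3 ^ n * y)" using yy unfolding sim_def same_def by blast
    obtain j where j: "K p0 e j (3 ^ (n + m) * y)" using yy unfolding sim_def same_def by blast
    have "K p0 e j (3 ^ (n + m) * y + h + h)" using j by (simp only: K_cong[OF turns_double[OF m(2)]])
    then have j': "K p0 e (g j) (3 ^ (n + m) * y + h)" unfolding g .
    obtain k where k: "K y 0 k (3 ^ n * y)" "K y 0 k (3 ^ (n + m) * y + h)" using m(3)[OF \<open>0 < n\<close>] unfolding same_def by blast
    have nb: "\<not> bd y (3 ^ n * y)" "\<not> bd y (3 ^ (n + m) * y)"
      using nh that add_pos_pos[OF that m(1)] unfolding hyp_def by blast+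
    have nb': "\<not> bd y (3 ^ (n + m) * y + h)"
      using nb(2) bd_turns[OF m(2)] by blast
    have "i = k" using K0_unique[OF nb(1) sub[OF i] k(1)] .
    moreover have "g j = k" using K0_unique[OF nb' sub[OF j'] k(2)] .
    ultimately show ?thesis using i j' unfolding same_def by auto
  qed
  let ?a = "3 * y"
  have s1: "sim p0 e ?a (3 ^ m * ?a + h)"
    unfolding sim_def
  proof
    fix n
    have "same p0 e (3 ^ Suc n * y) (3 ^ (Suc n + m) * y + h)" using sm[of "Suc n"] by blast
    moreover have "pos (3 ^ (Suc n + m) * y + h) (3 ^ n * (3 ^ m * ?a + h)) = 0"
      using pos0_sym[OF pos_pow_half[OF m(2), of n "3 ^ m * ?a"]] by (simp add: power_add mult.assoc mult.left_commute)
    ultimately show "same p0 e (3 ^ n * ?a) (3 ^ n * (3 ^ m * ?a + h))"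
      using same_cong[OF pos_self] by (simp add: mult.assoc mult.left_commute)
  qed
  have s2: "sim p0 e ?a (3 ^ (2 * m) * ?a)"
  proof -
    have "sim p0 e (3 ^ m * ?a) (3 ^ m * (3 ^ m * ?a + h))" using sim_pow[OF s1] .
    then have "sim p0 e (3 ^ m * ?a) (3 ^ m * (3 ^ m * ?a) + h)" by (simp only: sim_cong[OF pos_self pos_pow_half[OF m(2)]])
    from sim_half[OF less_imp_le[OF e(1)] e6 this m(2)]
    have "sim p0 e (3 ^ m * ?a + h) (3 ^ m * (3 ^ m * ?a) + h + h)" .
    then have "sim p0 e (3 ^ m * ?a + h) (3 ^ m * (3 ^ m * ?a))" by (simp only: sim_cong[OF pos_self turns_double[OF m(2)]])
    from sim_trans[OF e(1) s1 this] show ?thesis by (simp only: mult_2 power_add mult.assoc)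
  qed
  interpret periodic_itinerary p0 e ?a "2 * m" by unfold_locales (use e e6 m s2 in auto)
  have saa: "sim p0 e ?a ?a" using s2 sim_sym simt by blast
  then have "sim p0 e ?a (3 ^ 0 * ?a + 0)" by simp
  then have aP: "frac ?a \<in> P" unfolding P_def turns_def by (auto simp: frac_lt_1 intro!: exI[of _ 0])
  have z: "0 \<in> turns" by (simp add: turns_def)
  have "(\<lambda>n. act n 0 (frac ?a)) ` UNIV \<subseteq> P" using act_P[OF aP z] by blast
  then have "\<not> inj (\<lambda>n. act n 0 (frac ?a))" using finite_P finite_subset finite_imageD infinite_UNIV_nat by blast
  then obtain i j where ij: "i < j" "act i 0 (frac ?a) = act j 0 (frac ?a)"
    unfolding inj_def by (metis nat_neq_iff)
  let ?J = "j - i"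
  have J: "0 < ?J" using ij by simp
  have "pos (3 ^ i * ?a) (3 ^ j * ?a) = 0" using ij(2) unfolding act_def
    by (metis add_0_right pos_frac_left pos_frac_right pos_frac_mult_left pos_frac_mult_right pos_self)
  moreover have "3 ^ j = (3 ^ i * 3 ^ ?J :: real)" using ij(1) by (simp add: power_add[symmetric])
  ultimately have "pos (3 ^ i * frac ?a) (3 ^ i * frac (3 ^ ?J * ?a)) = 0" by (simp add: mult.assoc)
  moreover have "frac (3 ^ ?J * ?a) \<in> P"
  proof -
    have "act ?J 0 (frac ?a) = frac (3 ^ ?J * ?a)" unfolding act_def by (rule frac_eqI) simp
    then show ?thesis using act_P[OF aP z] by metis
  qed
  ultimately have "frac ?a = frac (3 ^ ?J * ?a)" using inj_pow[OF aP] by blast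
  then have ry: "pos (3 ^ ?J * ?a) (?a + 0) = 0" by (metis add_0_right pos_frac_left pos_frac_right pos_self)
  have rx: "pos (3 ^ ?J * (3 * x)) (3 * x + 0) = 0" using return_fixed(1)[OF e(1) e6 s z J ry] .
  have "\<not> bd y (3 ^ ?J * y)" using nh J unfolding hyp_def by blast
  moreover have "pos (3 * (3 ^ ?J * y)) (3 * y) = 0" using ry by (simp add: mult.left_commute)
  \<comment> \<open>The return of \<open>3 * y\<close> is a return of \<open>y\<close> itself,
    because coming back to another preimage would make \<open>y\<close> satisfy
    \<open>hyp\<close>.\<close>
  ultimately have y0: "pos y (3 ^ ?J * y) = 0" using third_of_triple unfolding bd_def by blast
  have Ny: "K p0 e Near y" unfolding K_def using y e by simp
  have "K p0 e Near x" using s K_unique[OF e(1) _ Ny] unfolding sim_def same_def by (metis mult_1 power_0)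
  have "same p0 e (3 ^ ?J * y) (3 ^ ?J * x)" using s unfolding sim_def by blast
  then obtain k where k: "K p0 e k (3 ^ ?J * y)" "K p0 e k (3 ^ ?J * x)" unfolding same_def by blast
  have "K p0 e k y" using k(1) by (simp only: K_cong[OF y0])
  then have "k = Near" using K_unique[OF e(1) _ Ny] by blast
  then have Nx': "K p0 e Near (3 ^ ?J * x)" using k(2) by simp
  have x3: "pos x (3 ^ ?J * x) = 0 \<or> pos x (3 ^ ?J * x) = 1/3 \<or> pos x (3 ^ ?J * x) = 2/3"
    using third_of_triple[of "3 ^ ?J * x" x] rx by (simp add: mult.left_commute)
  have x0: "pos x (3 ^ ?J * x) = 0"
    using K_gap[OF _ e6 \<open>K p0 e Near x\<close> Nx'] e x3 by auto
  have yn: "pos (3 ^ (?J * k) * t) t = 0" if "pos t (3 ^ ?J * t) = 0" for k t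
  proof (induction k)
    case (Suc k)
    have "pos (3 ^ (?J * k) * (3 ^ ?J * t)) (3 ^ (?J * k) * t) = 0" using pos0_mult[OF pos0_sym[OF that]] .
    from pos0_trans[OF this Suc] show ?case by (simp add: power_add mult.assoc mult.left_commute)
  qed simp
  have "pos y x \<noteq> 0" using ex e pos0_sym by force
  from sim_apart[OF e(1) e6 s this] obtain M where M: "\<And>n. M \<le> n \<Longrightarrow> apart (3 * e) (3 ^ n * y) (3 ^ n * x)" by blast
  \<comment> \<open>\<open>?J * M\<close> is a common return time of \<open>y\<close> and
    \<open>x\<close> that is not before the time \<open>M\<close> from which the iterates are
    \<open>3 * e\<close> apart.\<close>
  have "1 * M \<le> ?J * M" using J by (intro mult_le_mono1) linarith
  then have "apart (3 * e) (3 ^ (?J * M) * y) (3 ^ (?J * M) * x)" by (intro M) simp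
  then have "apart (3 * e) y x" unfolding apart_def using pos_cong[OF yn[OF y0] yn[OF x0], of M M] by simp
  then show False using ex e pos_swap[of y x] unfolding apart_def by (auto split: if_splits)
qed

lemma open_sector:
  assumes "K y 0 j t" "\<not> bd y t"
  shows "j = Near \<Longrightarrow> pos y t < 1/6 \<or> 5/6 < pos y t" "j = Far \<Longrightarrow> 1/3 < pos y t \<and> pos y t < 2/3"
    "j = Mid \<Longrightarrow> (1/6 < pos y t \<and> pos y t < 1/3) \<or> (2/3 < pos y t \<and> pos y t < 5/6)"
  using assms unfolding bd_def K_def by (auto simp: less_le)

section \<open>The class of a point with an unambiguous aperiodic itinerary\<close>

locale aperiodic =
  fixes y :: real
  assumes nh: "\<not> hyp y" and np: "\<not> per y"
begin

lemma nbd: "\<not> bd y (3 ^ n * y)"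
proof (cases "n = 0")
  case True
  then show ?thesis by (simp add: bd_def)
next
  case False
  then show ?thesis using nh unfolding hyp_def by blast
qed

lemma perI:
  assumes "0 < m" "h \<in> turns" "\<And>k. 0 < k \<Longrightarrow> same y 0 (3 ^ k * y + h) (3 ^ (k + m) * y)"
  shows False
proof -
  have "same y 0 (3 ^ k * y) (3 ^ (k + m) * y + h)" if "0 < k" for k
  proof -
    have "same y 0 (3 ^ k * y + h + h) (3 ^ (k + m) * y + h)"
      by (rule same_turn[OF _ _ assms(2) assms(3)[OF that]]) simp_all
    then show ?thesis by (simp only: same_cong[OF turns_double[OF assms(2)] pos_self])
  qed
  then show False using np assms(1,2) unfolding per_def by blast
qed

lemma pow_shift:
  assumes "pos (3 ^ n * u) (3 ^ m * w + h) = 0" "h \<in> turns"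
  shows "pos (3 ^ (n + k) * u) (3 ^ (m + k) * w + h) = 0"
proof -
  have "pos (3 ^ k * (3 ^ n * u)) (3 ^ k * (3 ^ m * w + h)) = 0" using pos0_mult[OF assms(1)] .
  from pos0_trans[OF this pos_pow_half[OF assms(2)]] show ?thesis
    by (simp add: power_add mult.assoc mult.left_commute)
qed

text \<open>If a member \<open>a\<close> of the class reaches a boundary point after
  \<open>n\<close> steps, then \<open>n + 1\<close> steps lead to \<open>3 * y\<close> up to a half
  turn. So the itinerary of \<open>y\<close> agrees with its own shift by \<open>n\<close>, which
  \<open>per\<close> forbids if \<open>n > 0\<close>.\<close>

lemma orbit_nbd:
  assumes "sim y 0 y a"
  shows "\<not> bd y (3 ^ n * a)"
proof
  assume "bd y (3 ^ n * a)"
  then obtain c h where ch: "c \<in> {1/3, 2/3}" "h \<in> turns" "pos (3 ^ n * a) (y + c + h) = 0" by (rule bd_turn)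
  have "pos (3 * (3 ^ n * a)) (3 * (y + c + h)) = 0" using pos0_mult[OF ch(3), of 1] by (simp only: power_one_right)
  from pos0_trans[OF this triple_third[OF ch(1,2)]] have r: "pos (3 ^ Suc n * a) (3 ^ 1 * y + h) = 0" by (simp add: mult.assoc)
  have s: "same y 0 (3 ^ k * y + h) (3 ^ (k + n) * y)" if k: "0 < k" for k
  proof -
    obtain k' where k': "k = Suc k'" using k by (cases k) auto
    have "pos (3 ^ (k + n) * a) (3 ^ k * y + h) = 0"
      using pow_shift[OF r ch(2), of k'] unfolding k' by (simp add: add.commute)
    from iffD1[OF same_cong[OF pos_self this] assms[unfolded sim_def, rule_format]]
    have "same y 0 (3 ^ (k + n) * y) (3 ^ k * y + h)" .
    then show ?thesis by (rule same_sym)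
  qed
  show False
  proof (cases "n = 0")
    case False
    then show False using perI[of n h, OF _ ch(2) s] by simp
  next
    \<comment> \<open>Here \<open>a\<close> itself is a boundary point. Without the half turn it
      lies in another sector than \<open>y\<close>; with it, the itinerary agrees with its own flip
      from time 1 on, hence is constantly \<open>Mid\<close> and so periodic.\<close>
    case True
    show False
    proof (cases "h = 0")
      case True
      have "same y 0 (3 ^ n * y) (3 ^ n * a)" using assms unfolding sim_def by blast
      then have "same y 0 y (y + c)"
        using same_cong[OF pos_self ch(3), of y 0 "3 ^ n * y"] \<open>n = 0\<close> True by simp
      then obtain j where "K y 0 j y" "K y 0 j (y + c)" unfolding same_def by blast
      then show False using pos_self_add[of c y] ch(1) unfolding K_def by (cases j) auto
    next
      case False
      then have h: "h = 1/2" using ch(2) unfolding turns_def by blast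
      have mid: "K y 0 Mid (3 ^ k * y)" if k: "0 < k" for k
      proof -
        obtain j where j: "K y 0 j (3 ^ k * y + 1/2)" "K y 0 j (3 ^ k * y)"
          using s[OF k] unfolding same_def h \<open>n = 0\<close> by auto
        have "K y 0 (flip j) (3 ^ k * y)" using j(1) K_half[of 0 y "flip j" "3 ^ k * y"] by simp
        from K0_unique[OF nbd this j(2)] have "flip j = j" .
        then have "j = Mid" by (cases j) auto
        then show ?thesis using j by simp
      qed
      have "same y 0 (3 ^ k * y + 0) (3 ^ (k + 1) * y)" if "0 < k" for k
        using mid[OF that] mid[of "k + 1"] unfolding same_def by auto
      then show False using perI[of 1 0] by (simp add: turns_def)
    qed
  qed
qed

lemma class_sector:
  assumes "sim y 0 y a" "K y 0 j (3 ^ n * y)"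
  shows "K y 0 j (3 ^ n * a)"
proof -
  obtain i where i: "K y 0 i (3 ^ n * y)" "K y 0 i (3 ^ n * a)" using assms(1) unfolding sim_def same_def by blast
  then show ?thesis using K0_unique[OF nbd i(1) assms(2)] by simp
qed

lemma y_sector: "\<exists>j. K y 0 j (3 ^ n * y)" if "sim y 0 y a"
  using that unfolding sim_def same_def by blast

lemma open_inj:
  assumes "K y 0 j a" "K y 0 j b" "\<not> bd y a" "\<not> bd y b" "pos (3 * a) (3 * b) = 0"
  shows "pos a b = 0"
proof -
  define u v where uv: "u = pos y a" "v = pos y b"
  have f: "pos a b = (if u \<le> v then v - u else v - u + 1)" unfolding uv by (rule pos_base)
  have "pos a b = 0 \<or> pos a b = 1/3 \<or> pos a b = 2/3" by (rule third_of_triple[OF pos0_sym[OF assms(5)]])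
  then show ?thesis
    using open_sector[OF assms(1,3)] open_sector[OF assms(2,4)] pos_ge0[of y a] pos_ge0[of y b] pos_lt1[of y a] pos_lt1[of y b]
    unfolding uv[symmetric] unfolding f
    by (cases j; simp only: sector.distinct; argo)
qed

text \<open>A coincidence would make the itinerary of \<open>y\<close> agree with a shift of itself,
  up to a half turn.\<close>

lemma meet_False:
  assumes u: "sim y 0 y u" and w: "sim y 0 y w" and h: "h \<in> turns" and n: "0 < n"
  shows "pos (3 ^ Suc n * u) (3 * w + h) \<noteq> 0"
proof
  assume z: "pos (3 ^ Suc n * u) (3 * w + h) = 0"
  have "same y 0 (3 ^ k * y + h) (3 ^ (k + n) * y)" if k: "0 < k" for k
  proof -
    obtain k' where k': "k = Suc k'" using k by (cases k) auto
    have "pos (3 ^ Suc n * u) (3 ^ 1 * w + h) = 0" using z by simp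
    from pow_shift[OF this h, of k'] have e: "pos (3 ^ (k + n) * u) (3 ^ k * w + h) = 0" unfolding k' by (simp add: add.commute)
    obtain i where i: "K y 0 i (3 ^ (k + n) * y)" "K y 0 i (3 ^ (k + n) * u)" using u unfolding sim_def same_def by blast
    have "same y 0 (3 ^ k * y) (3 ^ k * w)" using w unfolding sim_def by blast
    then have "same y 0 (3 ^ k * y + h) (3 ^ k * w + h)" by (rule same_turn[OF _ _ h, rotated 2]) simp_all
    then obtain j where j: "K y 0 j (3 ^ k * y + h)" "K y 0 j (3 ^ k * w + h)" unfolding same_def by blast
    have "K y 0 j (3 ^ (k + n) * u)" using j(2) by (simp only: K_cong[OF e])
    then have "i = j" using K0_unique[OF orbit_nbd[OF u] i(2)] by simp
    then show ?thesis using i j unfolding same_def by blast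
  qed
  then show False by (rule perI[OF n h])
qed

text \<open>Crossing forces a common sector and is passed on by tripling. From the crossing on, both
  chords would follow one itinerary, so that of \<open>y\<close> would be periodic up to a half
  turn.\<close>

lemma linked_False:
  assumes a: "sim y 0 y a" and b: "sim y 0 y b" and c: "sim y 0 y c" and d: "sim y 0 y d"
    and h: "h \<in> turns" and n: "0 < n"
  shows "\<not> linked (3 ^ Suc n * a) (3 ^ Suc n * b) (3 * c + h) (3 * d + h)"
proof
  assume l: "linked (3 ^ Suc n * a) (3 ^ Suc n * b) (3 * c + h) (3 * d + h)"
  have *: "linked (3 ^ (k + n) * a) (3 ^ (k + n) * b) (3 ^ k * c + h) (3 ^ k * d + h) \<and>
      same y 0 (3 ^ k * y + h) (3 ^ (k + n) * y)" if "0 < k" for k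
    using that
  proof (induction k)
    case (Suc k)
    have L: "linked (3 ^ (Suc k + n) * a) (3 ^ (Suc k + n) * b) (3 ^ Suc k * c + h) (3 ^ Suc k * d + h)"
    proof (cases "k = 0")
      case True
      then show ?thesis using l by simp
    next
      case False
      let ?A = "3 ^ (k + n) * a" and ?B = "3 ^ (k + n) * b" and ?C = "3 ^ k * c + h" and ?D = "3 ^ k * d + h"
      from Suc False have IH: "linked ?A ?B ?C ?D" by simp
      obtain i where i: "K y 0 i (3 ^ (k + n) * y)" using y_sector[OF a] by blast
      obtain j where j: "K y 0 j (3 ^ k * y)" using y_sector[OF a] by blast
      have "same y 0 ?C ?D"
        by (rule same_turn[OF _ _ h]) (use class_sector[OF c j] class_sector[OF d j] in \<open>auto simp: same_def\<close>)
      then obtain j' where j': "K y 0 j' ?C" "K y 0 j' ?D" unfolding same_def by blast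
      have A: "K y 0 i ?A" "K y 0 i ?B" using class_sector[OF a i] class_sector[OF b i] by auto
      have "i = j'" using K_linked[OF _ A j' IH] by simp
      then have C: "K y 0 i ?C" "K y 0 i ?D" using j' by auto
      have nb: "\<not> bd y ?A" "\<not> bd y ?B" "\<not> bd y ?C" "\<not> bd y ?D"
        by (simp_all add: bd_turns[OF h] orbit_nbd[OF a] orbit_nbd[OF b] orbit_nbd[OF c] orbit_nbd[OF d])
      note dd = linked_distinct[OF IH]
      have "linked (3 * ?A) (3 * ?B) (3 * ?C) (3 * ?D)"
        by (rule linked_triple[OF _ A C IH])
          (use open_inj[OF A nb(1,2)] open_inj[OF A(1) C(1) nb(1,3)] open_inj[OF A(1) C(2) nb(1,4)]
             open_inj[OF A(2) C(1) nb(2,3)] open_inj[OF A(2) C(2) nb(2,4)] dd in auto)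
      moreover have "pos (3 * (3 ^ k * t + h)) (3 ^ Suc k * t + h) = 0" for t
        using pos_pow_half[OF h, of 1 "3 ^ k * t"] by (simp add: mult.assoc)
      ultimately show ?thesis
        using linked_cong[OF pos_self[of "3 * ?A"] pos_self[of "3 * ?B"], of "3 * ?C" "3 ^ Suc k * c + h" "3 * ?D" "3 ^ Suc k * d + h"]
        by (simp add: mult.assoc)
    qed
    let ?k = "Suc k"
    obtain i where i: "K y 0 i (3 ^ (?k + n) * y)" using y_sector[OF a] by blast
    have "same y 0 (3 ^ ?k * y + h) (3 ^ ?k * c + h)" "same y 0 (3 ^ ?k * y + h) (3 ^ ?k * d + h)"
      using same_turn[OF _ _ h c[unfolded sim_def, rule_format, of ?k]] same_turn[OF _ _ h d[unfolded sim_def, rule_format, of ?k]]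
      by (simp_all del: power_Suc)
    then obtain j j' where j: "K y 0 j (3 ^ ?k * y + h)" "K y 0 j (3 ^ ?k * c + h)"
      "K y 0 j' (3 ^ ?k * y + h)" "K y 0 j' (3 ^ ?k * d + h)" unfolding same_def by blast
    have nb: "\<not> bd y (3 ^ ?k * y + h)" by (simp only: nbd bd_turns[OF h] simp_thms)
    have "j' = j" using K0_unique[OF nb j(3,1)] .
    then have "i = j"
      using K_linked[OF _ class_sector[OF a i] class_sector[OF b i] j(2) _ L] j(4) by simp
    then show ?case using L i j unfolding same_def by blast
  qed simp
  show False by (rule perI[OF n h]) (use * in simp)
qed

end

section \<open>Classes of chords\<close>

lemma same_side:
  assumes "\<not> linked u1 u2 b s" "pos b u1 \<noteq> 0" "pos b u2 \<noteq> 0" "pos s u1 \<noteq> 0" "pos s u2 \<noteq> 0"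
  shows "pos b u1 < pos b s \<longleftrightarrow> pos b u2 < pos b s"
proof -
  have "pos b u1 \<noteq> pos b s" "pos b u2 \<noteq> pos b s"
    using pos0_of_eq[of b s u1] pos0_of_eq[of b s u2] assms(4,5) by metis+
  then show ?thesis
    using assms(1-3) pos_ge0[of b u1] pos_ge0[of b u2] unfolding linked_coord[of _ _ _ _ b] pos_self by argo
qed

context aperiodic
begin

text \<open>By \<open>linked_False\<close> and \<open>meet_False\<close> the points
  \<open>3 * ?A\<close> and \<open>3 * ?B\<close> are on the same side of the images of the chords
  from \<open>y\<close> to \<open>a\<close> and to \<open>b\<close>, and of their half turns. Hence
  the strips of the chord \<open>a b\<close> do not separate \<open>?A\<close> from
  \<open>?B\<close>, and two points that are three times the width apart cannot both be inside a
  strip.\<close>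

lemma close_step:
  assumes a: "sim y 0 y a" and b: "sim y 0 y b" and e: "0 < pos a b" "pos a b < 1/6" and n: "0 < n"
    and ap: "apart (3 * pos a b) (3 ^ n * a) (3 ^ n * b)"
  shows "same a (pos a b) (3 ^ n * a) (3 ^ n * b)"
proof -
  let ?A = "3 ^ n * a" and ?B = "3 ^ n * b"
  define \<alpha> \<beta> u v where d: "\<alpha> = pos y a" "\<beta> = pos y b" "u = pos y ?A" "v = pos y ?B"
  have nb: "\<not> bd y a" "\<not> bd y b" "\<not> bd y ?A" "\<not> bd y ?B"
    using orbit_nbd[OF a, of 0] orbit_nbd[OF b, of 0] orbit_nbd[OF a] orbit_nbd[OF b] by auto
  have yy: "sim y 0 y y" using a unfolding sim_def same_def by blast
  have Ny: "K y 0 Near (3 ^ 0 * y)" unfolding K_def by simp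
  have "K y 0 Near a" "K y 0 Near b" using class_sector[OF a Ny] class_sector[OF b Ny] by auto
  from open_sector(1)[OF this(1) nb(1)] open_sector(1)[OF this(2) nb(2)]
  have ab: "\<alpha> < 1/6 \<or> 5/6 < \<alpha>" "\<beta> < 1/6 \<or> 5/6 < \<beta>" unfolding d by auto
  obtain j where j: "K y 0 j (3 ^ n * y)" using y_sector[OF a] by blast
  have AB: "K y 0 j ?A" "K y 0 j ?B" using class_sector[OF a j] class_sector[OF b j] by auto
  define x z \<alpha>' \<beta>' where d': "x = pos (3 * y) (3 * ?A)" "z = pos (3 * y) (3 * ?B)" "\<alpha>' = pos (3 * y) (3 * a)" "\<beta>' = pos (3 * y) (3 * b)"
  have f: "x = (if u < 1/3 then 3 * u else if u < 2/3 then 3 * u - 1 else 3 * u - 2)"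
    "z = (if v < 1/3 then 3 * v else if v < 2/3 then 3 * v - 1 else 3 * v - 2)"
    "\<alpha>' = (if \<alpha> < 1/3 then 3 * \<alpha> else if \<alpha> < 2/3 then 3 * \<alpha> - 1 else 3 * \<alpha> - 2)"
    "\<beta>' = (if \<beta> < 1/3 then 3 * \<beta> else if \<beta> < 2/3 then 3 * \<beta> - 1 else 3 * \<beta> - 2)"
    unfolding d d' by (rule pos_triple)+
  have h: "0 \<in> turns" "1/2 \<in> turns" by (simp_all add: turns_def)
  have side: "pos (3 * y+h) (3 * ?A) < pos (3 * y+h) (3 * s+h) \<longleftrightarrow> pos (3 * y+h) (3 * ?B) < pos (3 * y+h) (3 * s+h)"
    if s: "sim y 0 y s" and h: "h \<in> turns" for s h
  proof (rule same_side)
    have eq: "3 ^ Suc n * t = 3 * (3 ^ n * t)" for t :: real by simp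
    show "\<not> linked (3 * ?A) (3 * ?B) (3 * y+h) (3 * s+h)" using linked_False[OF a b yy s h n] unfolding eq .
    show "pos (3 * y+h) (3 * ?A) \<noteq> 0" "pos (3 * y+h) (3 * ?B) \<noteq> 0" "pos (3 * s+h) (3 * ?A) \<noteq> 0" "pos (3 * s+h) (3 * ?B) \<noteq> 0"
      using meet_False[OF a yy h n] meet_False[OF b yy h n] meet_False[OF a s h n] meet_False[OF b s h n] pos0_sym
      unfolding eq by blast+
  qed
  have s0: "x < \<alpha>' \<longleftrightarrow> z < \<alpha>'" "x < \<beta>' \<longleftrightarrow> z < \<beta>'"
    using side[OF a h(1)] side[OF b h(1)] unfolding d' by simp_all
  have half: "pos (3 * y + 1/2) t = (if 1/2 \<le> pos (3 * y) t then pos (3 * y) t - 1/2 else pos (3 * y) t + 1/2)" for t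
    using pos_base[of "3 * y + 1/2" t "3 * y"] pos_self_add[of "1/2" "3 * y"] by simp
  have s1: "(if 1/2 \<le> x then x - 1/2 else x + 1/2) < \<alpha>' \<longleftrightarrow> (if 1/2 \<le> z then z - 1/2 else z + 1/2) < \<alpha>'"
    "(if 1/2 \<le> x then x - 1/2 else x + 1/2) < \<beta>' \<longleftrightarrow> (if 1/2 \<le> z then z - 1/2 else z + 1/2) < \<beta>'"
    using side[OF a h(2)] side[OF b h(2)] unfolding half[of "3 * ?A"] half[of "3 * ?B"] pos_shift d' by blast+
  have r: "0 \<le> u" "u < 1" "0 \<le> v" "v < 1" "0 \<le> \<alpha>" "\<alpha> < 1" "0 \<le> \<beta>" "\<beta> < 1"
    unfolding d by (simp_all add: pos_ge0 pos_lt1)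
  have g: "pos a b = (if \<alpha> \<le> \<beta> then \<beta> - \<alpha> else \<beta> - \<alpha> + 1)" unfolding d by (rule pos_base)
  have gu: "pos a ?A = (if \<alpha> \<le> u then u - \<alpha> else u - \<alpha> + 1)" "pos a ?B = (if \<alpha> \<le> v then v - \<alpha> else v - \<alpha> + 1)"
    "pos ?A ?B = (if u \<le> v then v - u else v - u + 1)" unfolding d by (rule pos_base)+
  define E where "E = pos a b"
  have apE: "3 * E \<le> (if u \<le> v then v - u else v - u + 1)" "(if u \<le> v then v - u else v - u + 1) \<le> 1 - 3 * E"
    using ap unfolding apart_def gu E_def by auto
  have E: "0 < E" "E < 1/6" using e unfolding E_def by auto
  consider "\<alpha> < 1/6" "\<beta> < 1/6" "E = \<beta> - \<alpha>" "\<alpha>' = 3 * \<alpha>" "\<beta>' = 3 * \<beta>"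
    | "5/6 < \<alpha>" "\<beta> < 1/6" "E = \<beta> - \<alpha> + 1" "\<alpha>' = 3 * \<alpha> - 2" "\<beta>' = 3 * \<beta>"
    | "5/6 < \<alpha>" "5/6 < \<beta>" "E = \<beta> - \<alpha>" "\<alpha>' = 3 * \<alpha> - 2" "\<beta>' = 3 * \<beta> - 2"
    using ab g e r f(3,4) unfolding E_def by (auto split: if_splits)
  note C = this
  have "(sec E Near (pos a ?A) \<and> sec E Near (pos a ?B)) \<or> (sec E Far (pos a ?A) \<and> sec E Far (pos a ?B))
      \<or> (sec E Mid (pos a ?A) \<and> sec E Mid (pos a ?B))"
  proof (cases j)
    case Far
    have uv: "1/3 < u" "u < 2/3" "1/3 < v" "v < 2/3"
      using open_sector(2)[OF AB(1) nb(3) Far] open_sector(2)[OF AB(2) nb(4) Far] unfolding d by auto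
    then have xz: "x = 3 * u - 1" "z = 3 * v - 1" using f by auto
    from C show ?thesis
      by cases (cases "x < \<alpha>'"; cases "x < \<beta>'"; cases "u \<le> v"; use uv xz r s0 apE E gu(1,2) in \<open>unfold sec.simps, argo\<close>)+
  next
    case Near
    have uv: "u < 1/6 \<and> x = 3 * u \<or> 5/6 < u \<and> x = 3 * u - 2" "v < 1/6 \<and> z = 3 * v \<or> 5/6 < v \<and> z = 3 * v - 2"
      using open_sector(1)[OF AB(1) nb(3) Near] open_sector(1)[OF AB(2) nb(4) Near] f(1,2) unfolding d by auto
    from C show ?thesis
      by cases (cases "u < 1/2"; cases "v < 1/2"; cases "u \<le> v"; use uv r s1 apE E gu(1,2) in \<open>unfold sec.simps, argo\<close>)+
  next
    case Mid
    have uv: "1/6 < u \<and> u < 1/3 \<and> x = 3 * u \<or> 2/3 < u \<and> u < 5/6 \<and> x = 3 * u - 2"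
      "1/6 < v \<and> v < 1/3 \<and> z = 3 * v \<or> 2/3 < v \<and> v < 5/6 \<and> z = 3 * v - 2"
      using open_sector(3)[OF AB(1) nb(3) Mid] open_sector(3)[OF AB(2) nb(4) Mid] f(1,2) unfolding d by auto
    from C show ?thesis
      by cases (cases "u < 1/2"; cases "v < 1/2"; cases "u \<le> v"; use uv r s0 s1 apE E gu(1,2) in \<open>unfold sec.simps, argo\<close>)+
  qed
  then show ?thesis unfolding same_def K_def E_def by blast
qed

text \<open>A joint induction: distance of the iterates gives their common sector through
  \<open>close_step\<close>, and the common sector gives the distance at the next time.\<close>

lemma close_Q:
  assumes a: "sim y 0 y a" and b: "sim y 0 y b" and e: "0 < pos a b" "pos a b < 1/6"
  shows "Q a b"
proof -
  let ?e = "pos a b"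
  have e6: "?e \<le> 1/6" using e by simp
  have "same a ?e (3 ^ n * a) (3 ^ n * b) \<and> apart ?e (3 ^ n * a) (3 ^ n * b) \<and> (0 < n \<longrightarrow> apart (3 * ?e) (3 ^ n * a) (3 ^ n * b))" for n
  proof (induction n)
    case 0
    have "K a ?e Near a" "K a ?e Near b" unfolding K_def using e by auto
    then show ?case using e unfolding same_def apart_def by auto
  next
    case (Suc n)
    then have "apart (3 * ?e) (3 * (3 ^ n * a)) (3 * (3 ^ n * b))"
      using same_apart[OF e(1) e6, of a "3 ^ n * a" "3 ^ n * b" ?e ?e] e by simp
    then have ap: "apart (3 * ?e) (3 ^ Suc n * a) (3 ^ Suc n * b)" by (simp add: mult.assoc)
    then show ?case using close_step[OF a b e _ ap] apart_mono[OF ap, of ?e] e by simp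
  qed
  then show ?thesis unfolding Q_def sim_def using e by blast
qed

text \<open>Members less than 1/6 apart are handled by \<open>close_Q\<close>. Otherwise
  \<open>y\<close> lies between them and, by \<open>Q_le\<close>, at most 1/12 from either, so
  exactly 1/12 from both. Then the tripled points lie a quarter turn to both sides of
  \<open>3 * y\<close>, too far apart for one sector.\<close>

lemma class_Q:
  assumes a: "sim y 0 y a" and b: "sim y 0 y b" and ne: "pos a b \<noteq> 0"
  shows "Q a b \<or> Q b a"
proof -
  have key: False if a: "sim y 0 y a" and b: "sim y 0 y b" and h: "1/6 \<le> pos a b" "pos y b < 1/6" "5/6 < pos y a" for a b
  proof -
    have yy: "sim y 0 y y" using a unfolding sim_def same_def by blast
    have ab: "pos a b = pos y b - pos y a + 1" using pos_base[of a b y] h by simp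
    have ay: "pos a y = 1 - pos y a" using pos_swap[of a y] h by simp
    have "0 < pos y b" using h ab by linarith
    then have "Q y b" using close_Q[OF yy b] h by simp
    moreover have "Q a y" using close_Q[OF a yy] ay h pos_lt1[of y a] by simp
    ultimately have "pos y b \<le> 1/12" "pos a y \<le> 1/12" using Q_le by auto
    then have p: "pos y b = 1/12" "pos y a = 11/12" using ab ay h by linarith+
    have q: "pos (3 * y) (3 * b) = 1/4" "pos (3 * y) (3 * a) = 3/4" unfolding pos_triple p by simp_all
    obtain j where j: "K y 0 j (3 ^ 1 * y)" using y_sector[OF a] by blast
    have k: "K y 0 j (3 * y)" "K y 0 j (3 * a)" "K y 0 j (3 * b)" using j class_sector[OF a j] class_sector[OF b j] by simp_all
    have nb: "\<not> bd y (3 * y)" "\<not> bd y (3 * a)" "\<not> bd y (3 * b)"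
      using orbit_nbd[OF yy, of 1] orbit_nbd[OF a, of 1] orbit_nbd[OF b, of 1] by simp_all
    define w s t where w: "w = pos y (3 * y)" "s = pos y (3 * a)" "t = pos y (3 * b)"
    have "(if w \<le> t then t - w else t - w + 1) = 1/4" "(if w \<le> s then s - w else s - w + 1) = 3/4"
      using q pos_base[of "3 * y" "3 * b" y] pos_base[of "3 * y" "3 * a" y] unfolding w by simp_all
    moreover have "0 \<le> w" "w < 1" "0 \<le> s" "s < 1" "0 \<le> t" "t < 1" unfolding w by (simp_all add: pos_ge0 pos_lt1)
    ultimately show False
      using open_sector[OF k(1) nb(1)] open_sector[OF k(2) nb(2)] open_sector[OF k(3) nb(3)] unfolding w[symmetric]
      by (cases j; simp only: sector.distinct; argo)
  qed
  have Ny: "K y 0 Near (3 ^ 0 * y)" unfolding K_def by simp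
  have "K y 0 Near a" "K y 0 Near b" using class_sector[OF a Ny] class_sector[OF b Ny] by auto
  then have ab: "pos y a < 1/6 \<or> 5/6 < pos y a" "pos y b < 1/6 \<or> 5/6 < pos y b"
    using open_sector(1) orbit_nbd[OF a, of 0] orbit_nbd[OF b, of 0] by auto
  have ba: "pos b a = 1 - pos a b" "0 < pos a b" using pos_swap[of b a] ne pos_ge0[of a b] by auto
  show ?thesis
  proof (cases "pos a b < 1/6 \<or> pos b a < 1/6")
    case True
    then show ?thesis using close_Q[OF a b] close_Q[OF b a] ba pos_lt1[of a b] by auto
  next
    case False
    have "pos a b = (if pos y a \<le> pos y b then pos y b - pos y a else pos y b - pos y a + 1)" by (rule pos_base)
    then show ?thesis using key[OF a b] key[OF b a] ab ba False pos_ge0[of y a] pos_ge0[of y b] pos_lt1[of y a] pos_lt1[of y b]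
      by (auto split: if_splits)
  qed
qed

end

definition QQ :: "real \<Rightarrow> real \<Rightarrow> bool" where
  "QQ x y \<longleftrightarrow> Q x y \<or> Q y x"

text \<open>A strip on either side of \<open>z\<close> can be narrowed to width zero at
  \<open>z\<close>, which gives all partners of \<open>z\<close> a common measure.\<close>

lemma QQ_sim: "QQ z x \<Longrightarrow> sim z 0 z x"
  unfolding QQ_def Q_def using sim_sub[of z "pos z x" z x 0 z] sim_sub[of x "pos x z" x z 0 z] sim_sym by auto

lemma QQ_not_per: "QQ z x \<Longrightarrow> \<not> hyp z \<Longrightarrow> \<not> per z"
  unfolding QQ_def
proof (elim disjE)
  assume q: "Q z x" and n: "\<not> hyp z"
  show "\<not> per z"
    by (rule not_per[of "pos z x" z z x]) (use q Q_le[OF q] n in \<open>auto simp: Q_def\<close>)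
next
  assume q: "Q x z" and n: "\<not> hyp z"
  show "\<not> per z"
    by (rule not_per[of "pos x z" x z x]) (use q Q_le[OF q] n sim_sym in \<open>auto simp: Q_def\<close>)
qed

text \<open>Two partners are nested with \<open>z\<close> as their first end, nested with
  \<open>z\<close> as their last end, or on different sides of \<open>z\<close>; each configuration
  has been excluded.\<close>

lemma QQ_hyp_unique:
  assumes "QQ z x" "QQ z y" "hyp z"
  shows "pos x y = 0"
proof (rule ccontr)
  assume ne: "pos x y \<noteq> 0"
  then have ne': "pos z x \<noteq> pos z y" "pos x z \<noteq> pos y z"
    using pos0_of_eq[of z x y] pos_cong[OF pos_self[of z]] pos_swap[of x z] pos_swap[of y z] pos_lt1 assms(1,2)
    unfolding QQ_def Q_def by (auto split: if_splits)
  have r: False if q: "Q x z" "Q y z" and lt: "pos y z < pos x z" for x y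
  proof -
    have b: "pos x y = pos x z - pos y z"
      using pos_swap[of x z] pos_swap[of y z] pos_base[of x y z] q lt unfolding Q_def by (auto split: if_splits)
    show False by (rule nested_right[OF q]) (use b lt q assms(3) in \<open>auto simp: Q_def\<close>)
  qed
  from assms(1,2) show False
    unfolding QQ_def
    using nested_left[of z x y] nested_left[of z y x] r[of x y] r[of y x] opposite[of x z y] opposite[of y z x] assms(3) ne'
    by (meson linorder_neqE_linordered_idom)
qed

text \<open>Having two different partners, \<open>z\<close> cannot satisfy \<open>hyp\<close>, so it
  is aperiodic. Both partners lie in its class of width zero, all of whose pairs have
  \<open>Q\<close> by \<open>class_Q\<close>.\<close>

theorem QQ_trans:
  assumes "QQ x z" "QQ z y" "pos x y \<noteq> 0"
  shows "QQ x y"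
proof -
  have zx: "QQ z x" using assms(1) unfolding QQ_def by blast
  have nh: "\<not> hyp z" using QQ_hyp_unique[OF zx assms(2)] assms(3) by blast
  interpret aperiodic z using nh QQ_not_per[OF zx nh] by unfold_locales
  show ?thesis using class_Q[OF QQ_sim[OF zx] QQ_sim[OF assms(2)] assms(3)] unfolding QQ_def .
qed

section \<open>Edges of classes and the pieces cut out by a strip\<close>

text \<open>The overlap from \<open>c\<close> to \<open>b\<close> carries strips contained in those
  of both chords. Relative to these both chords keep equal itineraries at their ends, and
  \<open>linked_sim\<close> merges them.\<close>

lemma Q_linked:
  assumes q: "Q a b" "Q c d" and l: "0 < pos a c" "pos a c < pos a b" "pos a b < pos a d"
  shows "Q c b"
proof -
  let ?e = "pos c b"
  have cb: "pos a b = pos a c + ?e" using pos_base[of c b a] l by simp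
  have e: "0 < ?e" "?e \<le> 1/6" using cb l q unfolding Q_def by linarith+
  have cd: "pos c d = pos a d - pos a c" using pos_base[of c d a] l by simp
  have s1: "sim c ?e a b" using sim_sub[of a "pos a b" a b ?e c] q cb e unfolding Q_def by auto
  have s2: "sim c ?e c d" using sim_sub[of c "pos c d" c d ?e c] q cb cd l e unfolding Q_def by auto
  have "linked a b c d" unfolding linked_base using l by simp
  from linked_sim(1)[OF e s1 s2 this] s1 have "sim c ?e c b" using sim_sym sim_trans[OF e(1)] by blast
  moreover have "?e < 1/6" using cb l q unfolding Q_def by linarith
  ultimately show ?thesis unfolding Q_def using e by simp
qed

lemma QQ_linked:
  assumes q: "Q a b" "Q c d" and l: "linked a b c d"
  shows "QQ a c"
proof -
  have r: "pos a b < 1/6" "pos c d < 1/6" using q unfolding Q_def by auto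
  note dd = linked_distinct[OF l]
  have cd: "pos c d = (if pos a c \<le> pos a d then pos a d - pos a c else pos a d - pos a c + 1)" by (rule pos_base)
  from l consider "0 < pos a c" "pos a c < pos a b" "pos a b < pos a d" | "0 < pos a d" "pos a d < pos a b" "pos a b < pos a c"
    unfolding linked_base by blast
  then show ?thesis
  proof cases
    case 1
    have "QQ a b" "QQ b c" using q Q_linked[OF q 1] unfolding QQ_def by blast+
    then show ?thesis using QQ_trans dd(1) by blast
  next
    case 2
    have ca: "pos c a = 1 - pos a c" using pos_swap[of c a] 2 by simp
    have "pos c b = (if pos a c \<le> pos a b then pos a b - pos a c else pos a b - pos a c + 1)" by (rule pos_base)
    then have "0 < pos c a" "pos c a < pos c d" "pos c d < pos c b" using ca cd 2 pos_lt1[of a c] by auto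
    from Q_linked[OF q(2,1) this] have "QQ a d" "QQ d c" using q unfolding QQ_def by blast+
    then show ?thesis using QQ_trans dd(1) by blast
  qed
qed

text \<open>\<open>K_sub\<close> shows that the itineraries for the three strips run through the
  same sectors, and \<open>K_inter\<close> then keeps \<open>u\<close> in the smaller sectors of the
  whole strip.\<close>

lemma class_sim_inside:
  assumes "Q p q" "Q p u" "Q u q" "pos p u < pos p q"
  shows "sim p (pos p q) p u"
  unfolding sim_def
proof
  fix n
  have e: "0 < pos p u" "0 < pos u q" "pos p q < 1/6" using assms unfolding Q_def by auto
  have eq: "pos p q = pos p u + pos u q" using pos_base[of u q p] assms(4) by simp
  obtain i where i: "K p (pos p q) i (3 ^ n * p)" "K p (pos p q) i (3 ^ n * q)" using assms(1) unfolding Q_def sim_def same_def by blast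
  obtain j where j: "K p (pos p u) j (3 ^ n * p)" "K p (pos p u) j (3 ^ n * u)" using assms(2) unfolding Q_def sim_def same_def by blast
  obtain k where k: "K u (pos u q) k (3 ^ n * u)" "K u (pos u q) k (3 ^ n * q)" using assms(3) unfolding Q_def sim_def same_def by blast
  have "j = i" using K_unique[OF e(1) j(1) K_sub[OF i(1)]] e eq by simp
  moreover have "k = i" using K_unique[OF e(2) k(2) K_sub[OF i(2)]] e eq by simp
  ultimately have "K p (pos p u + pos u q) i (3 ^ n * u)" using K_inter[of p u i "3 ^ n * u" q] j k e eq by simp
  then show "same p (pos p q) (3 ^ n * p) (3 ^ n * u)" using i unfolding same_def eq by blast
qed

text \<open>If \<open>v\<close> is a partner beyond \<open>q\<close>, its strip from
  \<open>p\<close> contains that of \<open>p q\<close>; if it precedes \<open>p\<close>, the strip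
  from \<open>v\<close> to \<open>q\<close> does.\<close>

lemma class_sim_outside:
  assumes "Q p q" "QQ p v" "QQ q v" "pos p q < pos p v"
  shows "sim p (pos p q) p v"
proof -
  have e: "0 < pos p q" "pos p q < 1/6" using assms unfolding Q_def by auto
  from assms(2) show ?thesis
    unfolding QQ_def
  proof
    assume "Q p v"
    then show ?thesis using sim_sub[of p "pos p v" p v "pos p q" p] assms(4) e unfolding Q_def by auto
  next
    assume v: "Q v p"
    have pv: "pos p v = 1 - pos v p" using pos_swap[of p v] v unfolding Q_def by auto
    have "pos v q = (if pos v p + pos p q < 1 then pos v p + pos p q else pos v p + pos p q - 1)"
      using pos_base[of p q v] pos_lt1[of v q] pos_ge0[of v q] by auto
    then have vq: "pos v q = pos v p + pos p q" using v e unfolding Q_def by auto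
    have "\<not> Q q v" using pos_swap[of q v] vq v e unfolding Q_def by auto
    then have "Q v q" using assms(3) unfolding QQ_def by blast
    then have s: "sim p (pos p q) v q" using sim_sub[of v "pos v q" v q "pos p q" p] vq e unfolding Q_def by auto
    have "sim p (pos p q) p q" using assms(1) unfolding Q_def by blast
    then show ?thesis using s sim_sym sim_trans[OF e(1)] by blast
  qed
qed

lemma leaf_class_edge:
  assumes Q: "Q p q" and N: "N p q" and u: "QQ p u" "QQ q u" and v: "QQ p v" "QQ q v"
  shows "\<not> linked p q u v"
proof
  assume l: "linked p q u v"
  have e: "0 < pos p q" "pos p q < 1/6" using Q unfolding Q_def by auto
  \<comment> \<open>Partners are given by strips of their own; this translates them into points with
    the itinerary of \<open>p\<close> for the single strip of \<open>p q\<close>, as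
    \<open>class_diagonal_crosses\<close> needs.\<close>
  have key: "sim p (pos p q) p w" if w: "QQ p w" "QQ q w" "pos p w \<noteq> pos p q" for w
  proof (cases "pos p w < pos p q")
    case False
    then show ?thesis using class_sim_outside[OF Q w(1,2)] w(3) by simp
  next
    case True
    have "\<not> Q w p" using True e pos_swap[of w p] unfolding Q_def by (auto split: if_splits)
    then have "Q p w" using w(1) unfolding QQ_def by blast
    moreover have "pos w q = pos p q - pos p w" using pos_base[of w q p] True by simp
    then have "\<not> Q q w" using True e pos_swap[of q w] pos_ge0[of p w] unfolding Q_def by (auto split: if_splits)
    then have "Q w q" using w(2) unfolding QQ_def by blast
    ultimately show ?thesis using class_sim_inside[OF Q _ _ True] by blast
  qed
  have "pos p u \<noteq> pos p q" "pos p v \<noteq> pos p q" using l unfolding linked_base by auto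
  then have "sim p (pos p q) p u" "sim p (pos p q) p v" using key u v by blast+
  moreover have "sim p (pos p q) p q" using Q unfolding Q_def by blast
  ultimately show False
    using class_diagonal_crosses[of "pos p q" p p q u v] l e N unfolding N_def by (meson less_imp_le)
qed

text \<open>Turns the edge property for \<open>QQ\<close> into the one used by the construction,
  which speaks of itineraries for the strip of \<open>p q\<close>. If \<open>p\<close> satisfies
  \<open>hyp\<close>, an end inside the arc would be a second, nested partner; otherwise all points
  concerned are partners of \<open>p\<close> by \<open>class_Q\<close>.\<close>

lemma class_edge_E:
  assumes Q: "Q p q" and E: "\<And>u v. QQ p u \<Longrightarrow> QQ p v \<Longrightarrow> \<not> linked p q u v"
    and u: "sim p (pos p q) p u" and v: "sim p (pos p q) p v"
  shows "\<not> linked p q u v"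
proof
  assume l: "linked p q u v"
  have e: "0 < pos p q" "pos p q < 1/6" using Q unfolding Q_def by auto
  have inner: "Q p w" if w: "sim p (pos p q) p w" "0 < pos p w" "pos p w < pos p q" for w
    using sim_sub[OF w(1), of "pos p w" p] w e unfolding Q_def by auto
  have nh: "\<not> hyp p"
  proof
    assume h: "hyp p"
    from l consider "0 < pos p u" "pos p u < pos p q" | "0 < pos p v" "pos p v < pos p q" unfolding linked_base by blast
    then show False
      by cases (use nested_left[OF Q inner[OF u]] nested_left[OF Q inner[OF v]] h in blast)+
  qed
  have "QQ p q" using Q unfolding QQ_def by blast
  then interpret aperiodic p using nh QQ_not_per by unfold_locales
  have pp: "sim p 0 p p" using u sim_sub[OF u, of 0 p] e unfolding sim_def same_def by auto
  have "QQ p w" if "sim p (pos p q) p w" "pos p w \<noteq> 0" for w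
    using class_Q[OF pp sim_sub[OF that(1)] that(2)] e unfolding QQ_def by auto
  moreover have "pos p u \<noteq> 0" "pos p v \<noteq> 0" using linked_distinct[OF l] by auto
  ultimately show False using E u v l by blast
qed

section \<open>Sectors and strips as pieces on which tripling is injective\<close>

datatype piece = Sec sector | Strip nat

text \<open>The arcs at 0 and 3 sixths are parts of \<open>Near\<close> and \<open>Far\<close>, so
  only four strips remain. The two ends of a band are separate pieces: no admissible chord runs from
  one to the other except along the border of a sector.\<close>

fun rg :: "real \<Rightarrow> piece \<Rightarrow> real \<Rightarrow> bool" where
  "rg e (Sec j) u \<longleftrightarrow> sec e j u"
| "rg e (Strip k) u \<longleftrightarrow> k \<in> {1, 2, 4, 5} \<and> real k / 6 \<le> u \<and> u \<le> real k / 6 + e"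

text \<open>The image of a piece under tripling, in the coordinate from \<open>3 * p\<close>. The
  isolated value 0 comes from the upper ends 1/3 and 2/3 of arcs, which wrap round to
  \<open>3 * p\<close>.\<close>

fun reg :: "real \<Rightarrow> piece \<Rightarrow> real \<Rightarrow> bool" where
  "reg e (Sec Far) v \<longleftrightarrow> v = 0 \<or> 3 * e \<le> v"
| "reg e (Sec Near) v \<longleftrightarrow> v \<le> 1/2 \<or> 1/2 + 3 * e \<le> v"
| "reg e (Sec Mid) v \<longleftrightarrow> v = 0 \<or> 3 * e \<le> v \<and> v \<le> 1/2 \<or> 1/2 + 3 * e \<le> v"
| "reg e (Strip k) v \<longleftrightarrow> (k = 2 \<or> k = 4) \<and> v \<le> 3 * e \<or> (k = 1 \<or> k = 5) \<and> 1/2 \<le> v \<and> v \<le> 1/2 + 3 * e"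

locale strip =
  fixes p q :: real
  assumes Qpq: "Q p q"
begin

abbreviation e where "e \<equiv> pos p q"

definition inp :: "piece \<Rightarrow> real \<Rightarrow> bool" where "inp i t \<longleftrightarrow> rg e i (pos p t)"

text \<open>In contrast to \<open>sim\<close>, strips count as pieces here, so every point is
  related to itself.\<close>

definition R :: "real \<Rightarrow> real \<Rightarrow> bool" where
  "R a b \<longleftrightarrow> (\<forall>n. \<exists>i. inp i (3 ^ n * a) \<and> inp i (3 ^ n * b))"

lemma e: "0 < e" "e \<le> 1/12" "e \<le> 1/6"
  using Qpq Q_le unfolding Q_def by auto

lemma strip_cases: "inp (Strip k) t \<Longrightarrow> k = 1 \<or> k = 2 \<or> k = 4 \<or> k = 5"
  unfolding inp_def by auto

lemma inp_cong: "pos a b = 0 \<Longrightarrow> inp i a \<longleftrightarrow> inp i b"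
  unfolding inp_def using pos_cong[OF pos_self] by metis

lemma inp_img: "inp i t \<Longrightarrow> reg e i (pos (3 * p) (3 * t))"
proof -
  assume a: "inp i t"
  show ?thesis
  proof (cases i)
    case (Sec j)
    then show ?thesis using a e pos_ge0[of p t] pos_lt1[of p t] unfolding inp_def pos_triple by (cases j) auto
  next
    case (Strip k)
    then show ?thesis using a e strip_cases[of k t] unfolding inp_def pos_triple by auto
  qed
qed

lemma pre_point:
  assumes "0 \<le> w" "w < 1" "rg e i w" "3 * w - pos (3 * p) t \<in> \<int>"
  shows "\<exists>t'. inp i t' \<and> pos (3 * t') t = 0"
proof (intro exI conjI)
  show "inp i (p + w)" unfolding inp_def using pos_self_add[OF assms(1,2)] assms(3) by simp
  have "t - 3 * p - pos (3 * p) t \<in> \<int>" by (rule pos_Ints)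
  from Ints_diff[OF this assms(4)] show "pos (3 * (p + w)) t = 0" unfolding pos_eq0 by (simp add: algebra_simps)
qed

lemma inp_pre:
  assumes "reg e i (pos (3 * p) t)"
  shows "\<exists>t'. inp i t' \<and> pos (3 * t') t = 0"
proof -
  define v where "v = pos (3 * p) t"
  have v: "0 \<le> v" "v < 1" unfolding v_def by (simp_all add: pos_ge0 pos_lt1)
  have P: ?thesis if "0 \<le> w" "w < 1" "rg e i w" "3 * w = v \<or> 3 * w = v + 1 \<or> 3 * w = v + 2" for w
    using pre_point[OF that(1-3)] that(4) unfolding v_def by auto
  have a: "reg e i v" using assms unfolding v_def .
  show ?thesis
  proof (cases i)
    case (Sec j)
    show ?thesis
    proof (cases j)
      case Near
      show ?thesis by (cases "v \<le> 1/2") (rule P[of "v/3"] P[of "(v+2)/3"]; use a v e Sec Near in auto)+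
    next
      case Far
      show ?thesis by (cases "v = 0") (rule P[of "2/3"] P[of "(v+1)/3"]; use a v e Sec Far in auto)+
    next
      case Mid
      consider "v = 0" | "3 * e \<le> v" "v \<le> 1/2" | "1/2 + 3 * e \<le> v" using a Sec Mid by auto
      then show ?thesis
        by cases (rule P[of "1/3"] P[of "(v+2)/3"] P[of "v/3"]; use v e Sec Mid in auto)+
    qed
  next
    case (Strip k)
    consider "k = 1" | "k = 2" | "k = 4" | "k = 5" using a Strip by auto
    then show ?thesis
      by cases (rule P[of "v/3"] P[of "(v+1)/3"] P[of "(v+2)/3"]; use a v e Strip in auto)+
  qed
qed

lemma inp_inj: "inp i a \<Longrightarrow> inp i b \<Longrightarrow> pos (3 * a) (3 * b) = 0 \<Longrightarrow> pos a b = 0"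
proof (cases i)
  case (Sec j)
  assume "inp i a" "inp i b" "pos (3 * a) (3 * b) = 0"
  then show ?thesis using K_inj[OF e(1,3), of p a b] Sec unfolding inp_def same_def K_def by auto
next
  case (Strip k)
  assume a: "inp i a" "inp i b" "pos (3 * a) (3 * b) = 0"
  have "pos a b = 0 \<or> pos a b = 1/3 \<or> pos a b = 2/3" by (rule third_of_triple[OF pos0_sym[OF a(3)]])
  then show ?thesis using a(1,2) Strip e pos_base[of a b p] unfolding inp_def by (auto split: if_splits)
qed

lemma inp_order:
  assumes "inp i a" "inp i b" "inp i c" "cyc a b c"
  shows "cyc (3 * a) (3 * b) (3 * c)"
proof (cases i)
  case (Sec j)
  have n: "pos (3 * a) (3 * b) \<noteq> 0" "pos (3 * b) (3 * c) \<noteq> 0" "pos (3 * a) (3 * c) \<noteq> 0"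
    using inp_inj assms cyc_distinct[OF assms(4)] by blast+
  show ?thesis using K_order[OF _ _ _ _ assms(4) n, of e p j] assms e Sec unfolding inp_def K_def by auto
next
  case (Strip k)
  have k: "k = 1 \<or> k = 2 \<or> k = 4 \<or> k = 5" using strip_cases assms Strip by blast
  have "\<exists>m. \<forall>t. inp i t \<longrightarrow> pos (3 * p) (3 * t) = 3 * pos p t - m"
    using k
  proof (elim disjE)
    assume "k = 1" then show ?thesis using Strip e unfolding inp_def pos_triple by (intro exI[of _ 0]) auto
  next
    assume "k = 2" then show ?thesis using Strip e unfolding inp_def pos_triple by (intro exI[of _ 1]) auto
  next
    assume "k = 4" then show ?thesis using Strip e unfolding inp_def pos_triple by (intro exI[of _ 2]) auto
  next
    assume "k = 5" then show ?thesis using Strip e unfolding inp_def pos_triple by (intro exI[of _ 2]) auto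
  qed
  then obtain m where m: "\<And>t. inp i t \<Longrightarrow> pos (3 * p) (3 * t) = 3 * pos p t - m" by blast
  show ?thesis
    using assms(4)[unfolded cyc_base[of a b c p]]
    unfolding cyc_base[of "3 * a" "3 * b" "3 * c" "3 * p"] m[OF assms(1)] m[OF assms(2)] m[OF assms(3)] by simp
qed

lemma cyc_total: "pos a b \<noteq> 0 \<Longrightarrow> pos b c \<noteq> 0 \<Longrightarrow> pos a c \<noteq> 0 \<Longrightarrow> cyc a b c \<or> cyc a c b"
  unfolding cyc_def using pos0_of_eq[of a b c] pos_ge0[of a b] pos_ge0[of a c] by linarith

lemma cyc_asym: "cyc a b c \<Longrightarrow> \<not> cyc a c b"
  unfolding cyc_def by linarith

lemma inp_order_iff:
  assumes "inp i a" "inp i b" "inp i c"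
  shows "cyc (3 * a) (3 * b) (3 * c) \<longleftrightarrow> cyc a b c"
proof
  assume c: "cyc (3 * a) (3 * b) (3 * c)"
  have "pos x y \<noteq> 0" if "pos (3 * x) (3 * y) \<noteq> 0" for x y
    using that pos0_mult[of x y 1] by auto
  then have "pos a b \<noteq> 0" "pos b c \<noteq> 0" "pos a c \<noteq> 0" using cyc_distinct[OF c] by blast+
  from cyc_total[OF this] show "cyc a b c"
    using inp_order[OF assms(1,3,2)] cyc_asym[OF c] by blast
qed (use inp_order[OF assms] in blast)

lemma inp_linked_iff:
  assumes "inp i a" "inp i b" "inp i c" "inp i d"
  shows "linked (3 * a) (3 * b) (3 * c) (3 * d) \<longleftrightarrow> linked a b c d"
  unfolding linked_def using inp_order_iff assms by simp

lemma unlinked_interval: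
  assumes "s \<le> pos p c" "pos p c \<le> r" "s \<le> pos p d" "pos p d \<le> r"
    and "\<not> (s < pos p a \<and> pos p a < r)" "\<not> (s < pos p b \<and> pos p b < r)"
  shows "\<not> linked a b c d"
  using assms unfolding linked_coord[of _ _ _ _ p] by argo

lemma inp_strip_outside:
  assumes "inp i t" "i \<noteq> Strip k" "k \<in> {1, 2, 4, 5}"
  shows "\<not> (real k / 6 < pos p t \<and> pos p t < real k / 6 + e)"
proof (cases i)
  case (Sec j)
  then show ?thesis using assms e unfolding inp_def by (cases j) auto
next
  case (Strip m)
  then show ?thesis using assms e unfolding inp_def by auto
qed

lemma strip_unlinked:
  assumes "inp i a" "inp i b" "inp (Strip k) c" "inp (Strip k) d" "i \<noteq> Strip k"
  shows "\<not> linked a b c d"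
proof (rule unlinked_interval)
  show "real k / 6 \<le> pos p c" "pos p c \<le> real k / 6 + e" "real k / 6 \<le> pos p d" "pos p d \<le> real k / 6 + e"
    using assms(3,4) unfolding inp_def by auto
  have "k \<in> {1, 2, 4, 5}" using assms(3) unfolding inp_def by simp
  then show "\<not> (real k / 6 < pos p a \<and> pos p a < real k / 6 + e)" "\<not> (real k / 6 < pos p b \<and> pos p b < real k / 6 + e)"
    using inp_strip_outside assms(1,2,5) by blast+
qed

lemma inp_linked:
  assumes "inp i a" "inp i b" "inp i' c" "inp i' d" "linked a b c d"
  shows "i' = i"
proof (rule ccontr)
  assume n: "i' \<noteq> i"
  show False
  proof (cases i')
    case (Strip k)
    then show False using strip_unlinked[of i a b k c d] assms n by simp
  next
    case i': (Sec j')
    show False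
    proof (cases i)
      case (Strip k)
      then show False using strip_unlinked[of i' c d k a b] linked_sym[OF assms(5)] assms n by simp
    next
      case (Sec j)
      then show False using K_linked[of e p j a b j' c d] assms e i' n unfolding inp_def K_def by auto
    qed
  qed
qed

end

section \<open>Chords that stay in the pieces\<close>

context strip
begin

lemma R_pow: "R a b \<Longrightarrow> R (3 ^ n * a) (3 ^ n * b)"
  unfolding R_def by (metis mult.assoc power_add)

lemma R_cong:
  assumes "pos a a' = 0" "pos b b' = 0" "R a b"
  shows "R a' b'"
  unfolding R_def
proof
  fix n
  obtain i where "inp i (3 ^ n * a)" "inp i (3 ^ n * b)" using assms(3) unfolding R_def by blast
  then show "\<exists>i. inp i (3 ^ n * a') \<and> inp i (3 ^ n * b')"
    using inp_cong[OF pos0_mult[OF assms(1)]] inp_cong[OF pos0_mult[OF assms(2)]] by auto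
qed

lemma R_sym: "R a b \<Longrightarrow> R b a"
  unfolding R_def by blast

lemma R_pre: "inp i a \<Longrightarrow> inp i b \<Longrightarrow> R (3 * a) (3 * b) \<Longrightarrow> R a b"
  unfolding R_def
proof
  fix n assume a: "inp i a" "inp i b" "\<forall>n. \<exists>i. inp i (3 ^ n * (3 * a)) \<and> inp i (3 ^ n * (3 * b))"
  show "\<exists>i. inp i (3 ^ n * a) \<and> inp i (3 ^ n * b)"
  proof (cases n)
    case (Suc m)
    have "3 ^ n * x = 3 ^ m * (3 * x)" for x :: real using Suc by simp
    then show ?thesis using a(3) by metis
  qed (use a in auto)
qed

lemma inp_half: "\<exists>i'. \<forall>t. inp i t \<longrightarrow> inp i' (t + 1/2)"
proof (cases i)
  case (Sec j)
  have "\<forall>t. inp i t \<longrightarrow> inp (Sec (flip j)) (t + 1/2)"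
    using K_half[OF _ e(3), of p j] e Sec unfolding inp_def K_def by simp
  then show ?thesis by blast
next
  case (Strip k)
  have h: "pos p (t + 1/2) = (if pos p t + 1/2 < 1 then pos p t + 1/2 else pos p t + 1/2 - 1)" for t
    by (rule pos_add_right) simp_all
  define m :: nat where "m = (if k = 1 then 4 else if k = 2 then 5 else if k = 4 then 1 else 2)"
  have "inp (Strip m) (t + 1/2)" if "inp i t" for t
    using strip_cases[OF that[unfolded Strip]] that Strip e unfolding inp_def h m_def
    by (elim disjE) (auto split: if_splits)
  then show ?thesis by blast
qed

lemma R_half: "R a b \<Longrightarrow> R (a + 1/2) (b + 1/2)"
proof -
  assume r: "R a b"
  have t: "1/2 \<in> turns" by (simp add: turns_def)
  show ?thesis
    unfolding R_def
  proof
    fix n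
    obtain i where i: "inp i (3 ^ n * a)" "inp i (3 ^ n * b)" using r unfolding R_def by blast
    obtain i' where i': "\<And>t. inp i t \<Longrightarrow> inp i' (t + 1/2)" using inp_half by blast
    show "\<exists>i. inp i (3 ^ n * (a + 1/2)) \<and> inp i (3 ^ n * (b + 1/2))"
      using i'[OF i(1)] i'[OF i(2)] inp_cong[OF pos_pow_half[OF t, of n a]] inp_cong[OF pos_pow_half[OF t, of n b]] by blast
  qed
qed

text \<open>A chord of \<open>R\<close> that crosses a chord with \<open>sim\<close> lies at each
  time in the sector of the latter and never in a strip, since crossing forces a common piece and is
  passed on by tripling.\<close>

lemma R_linked_sim:
  assumes s: "sim p e x y" and r: "R c d" and l: "linked x y c d"
  shows "sim p e x c" "sim p e x d"
proof -
  have *: "linked (3 ^ n * x) (3 ^ n * y) (3 ^ n * c) (3 ^ n * d) \<and>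
    (\<exists>j. K p e j (3 ^ n * x) \<and> K p e j (3 ^ n * c) \<and> K p e j (3 ^ n * d))" for n
  proof -
    have st: "\<exists>j. K p e j (3 ^ n * x) \<and> K p e j (3 ^ n * y) \<and> K p e j (3 ^ n * c) \<and> K p e j (3 ^ n * d)"
      if "linked (3 ^ n * x) (3 ^ n * y) (3 ^ n * c) (3 ^ n * d)" for n
    proof -
      obtain j where j: "K p e j (3 ^ n * x)" "K p e j (3 ^ n * y)" using s unfolding sim_def same_def by blast
      have j': "inp (Sec j) (3 ^ n * x)" "inp (Sec j) (3 ^ n * y)" using j unfolding inp_def K_def by auto
      obtain i where i: "inp i (3 ^ n * c)" "inp i (3 ^ n * d)" using r unfolding R_def by blast
      have "i = Sec j" using inp_linked[OF j' i] that by blast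
      then show ?thesis using j i unfolding inp_def K_def by auto
    qed
    have "linked (3 ^ n * x) (3 ^ n * y) (3 ^ n * c) (3 ^ n * d)"
    proof (induction n)
      case (Suc n)
      obtain j where j: "K p e j (3 ^ n * x)" "K p e j (3 ^ n * y)" "K p e j (3 ^ n * c)" "K p e j (3 ^ n * d)"
        using st[OF Suc] by blast
      have "inp (Sec j) (3 ^ n * x)" "inp (Sec j) (3 ^ n * y)" "inp (Sec j) (3 ^ n * c)" "inp (Sec j) (3 ^ n * d)"
        using j unfolding inp_def K_def by auto
      from inp_linked_iff[OF this] Suc show ?case by (simp add: mult.assoc)
    qed (use l in simp)
    with st show ?thesis by blast
  qed
  show "sim p e x c" "sim p e x d" unfolding sim_def same_def using * by blast+
qed

end

locale edge_strip = strip +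
  assumes E: "\<And>u v. sim p (pos p q) p u \<Longrightarrow> sim p (pos p q) p v \<Longrightarrow> \<not> linked p q u v"
begin

lemma spq: "sim p e p q"
  using Qpq unfolding Q_def by blast

lemma unlinked0: "R c d \<Longrightarrow> \<not> linked p q c d"
  using R_linked_sim[OF spq] E by blast

lemma pos3: "pos (3 * p) (3 * q) = 3 * e"
  using e pos_triple[of p q] by simp

text \<open>A chord leaving the image of the strip would cross the image of \<open>p q\<close>. It
  is lifted to a chord crossing \<open>p q\<close> itself, unless its other end lies over the half
  turn of the strip image, which no lift to \<open>Near\<close> reaches.\<close>

lemma unlinked_aux:
  assumes r: "R c d" and c: "0 < pos (3 * p) c" "pos (3 * p) c < 3 * e"
  shows "pos (3 * p) d \<le> 3 * e"
proof (rule ccontr)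
  assume n: "\<not> ?thesis"
  let ?h = "1/2 :: real"
  have l: "linked (3 * p) (3 * q) c d" unfolding linked_base pos3 using c n by simp
  have s3: "sim p e (3 * p) (3 * q)" using sim_pow[OF spq, of 1] by simp
  note s = R_linked_sim[OF s3 r l]
  show False
  proof (cases "pos (3 * p) d \<le> 1/2 \<or> 1/2 + 3 * e \<le> pos (3 * p) d")
    case True
    \<comment> \<open>Both ends lie in the image of \<open>Near\<close>, the sector of
      \<open>p\<close> and \<open>q\<close>.\<close>
    then have "reg e (Sec Near) (pos (3 * p) d)" "reg e (Sec Near) (pos (3 * p) c)" using c e by auto
    then obtain c' d' where cd: "inp (Sec Near) c'" "pos (3 * c') c = 0" "inp (Sec Near) d'" "pos (3 * d') d = 0"
      using inp_pre by blast
    have "R (3 * c') (3 * d')" using R_cong[OF pos0_sym[OF cd(2)] pos0_sym[OF cd(4)] r] .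
    from R_pre[OF cd(1,3) this] have "R c' d'" .
    moreover have "linked p q c' d'"
    proof -
      have "inp (Sec Near) p" "inp (Sec Near) q" unfolding inp_def using e by auto
      moreover have "linked (3 * p) (3 * q) (3 * c') (3 * d')"
        using l linked_cong[OF pos_self pos_self pos0_sym[OF cd(2)] pos0_sym[OF cd(4)]] by blast
      ultimately show ?thesis using inp_linked_iff[OF _ _ cd(1,3)] by blast
    qed
    ultimately show False using unlinked0 by blast
  next
    \<comment> \<open>The chord now crosses both the image of \<open>p q\<close> and its half turn,
      so these share a class and the itinerary of \<open>3 * p\<close> equals its own flip: it is
      constantly \<open>Mid\<close>. By permutation of the periodic system, \<open>c\<close> has a
      preimage in \<open>Mid\<close>; but the image of \<open>Mid\<close> avoids the open arc of
      length \<open>3 * e\<close> behind \<open>3 * p\<close>.\<close>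
    case False
    have h: "?h \<in> turns" by (simp add: turns_def)
    have "sim p e (3 * p + ?h) (3 * q + ?h)" using sim_half[OF _ e(3) s3 h] e by simp
    moreover have "linked (3 * p + ?h) (3 * q + ?h) c d"
    proof -
      have "pos (3 * p + ?h) t = (if 1/2 \<le> pos (3 * p) t then pos (3 * p) t - 1/2 else pos (3 * p) t + 1/2)" for t
        using pos_base[of "3 * p + ?h" t "3 * p"] pos_self_add[of ?h "3 * p"] by simp
      then show ?thesis unfolding linked_base pos_shift pos3 using c e False by auto
    qed
    ultimately have "sim p e (3 * p + ?h) c" using R_linked_sim r by blast
    then have sh: "sim p e (3 * p) (3 * p + ?h)" using s(1) sim_sym sim_trans[OF e(1)] by blast
    have mid: "K p e Mid (3 ^ n * (3 * p))" for n
    proof -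
      obtain j where j: "K p e j (3 ^ n * (3 * p))" "K p e j (3 ^ n * (3 * p + ?h))" using sh unfolding sim_def same_def by blast
      have "K p e j (3 ^ n * (3 * p) + ?h)" using j(2) by (simp only: K_cong[OF pos_pow_half[OF h]])
      then have "K p e (flip j) (3 ^ n * (3 * p))" using K_half[OF _ e(3), of p "flip j"] e by simp
      from K_unique[OF e(1) this j(1)] have "j = Mid" by (cases j) auto
      then show ?thesis using j by simp
    qed
    have per: "sim p e (3 * p) (3 ^ 1 * (3 * p))"
      unfolding sim_def same_def
    proof
      fix n
      have "3 ^ n * (3 ^ 1 * (3 * p)) = 3 ^ Suc n * (3 * p)" by simp
      then show "\<exists>j. K p e j (3 ^ n * (3 * p)) \<and> K p e j (3 ^ n * (3 ^ 1 * (3 * p)))" using mid by metis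
    qed
    interpret periodic_itinerary p e "3 * p" 1 by unfold_locales (use e per in auto)
    have "sim p e (3 * p) (3 ^ 0 * (3 * p) + 0)" using sim_trans[OF e(1) per sim_sym[OF per]] by simp
    then have aP: "frac (3 * p) \<in> P" unfolding P_def turns_def by (auto simp: frac_lt_1 intro!: exI[of _ 0])
    have "frac c \<in> P" by (rule P_class[OF aP]) (use s in \<open>simp_all add: frac_lt_1\<close>)
    moreover have z: "0 \<in> turns" by (simp add: turns_def)
    ultimately obtain t where t: "t \<in> P" "act 1 0 t = frac c" using act_surj by blast
    obtain i k where ik: "k \<in> turns" "sim p e t (3 ^ i * (3 * p) + k)" using t(1) unfolding P_def by blast
    obtain j where j: "K p e j t" "K p e j (3 ^ i * (3 * p) + k)" using ik(2) unfolding sim_def same_def by (metis mult_1 power_0)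
    have "K p e Mid (3 ^ i * (3 * p) + k)"
      using ik(1) mid[of i] K_half[OF _ e(3), of p Mid] e unfolding turns_def by (elim insertE emptyE; hypsubst) simp_all
    from K_unique[OF e(1) j(2) this] have "inp (Sec Mid) t" using j(1) unfolding inp_def K_def by simp
    from inp_img[OF this] have "reg e (Sec Mid) (pos (3 * p) (3 * t))" .
    moreover have "pos (3 * p) (3 * t) = pos (3 * p) c"
    proof -
      have "frac (3 ^ 1 * t + 0) = frac c" using t(2) unfolding act_def .
      then have "pos (3 * t) c = 0" by (metis add_0_right power_one_right pos_frac_left pos_frac_right pos_self)
      then show ?thesis by (intro pos_cong pos_self)
    qed
    ultimately show False using c e by simp
  qed
qed

lemma region:
  assumes r: "R c d"
  shows "0 < pos (3 * p) c \<and> pos (3 * p) c < 3 * e \<Longrightarrow> pos (3 * p) d \<le> 3 * e"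
    "1/2 < pos (3 * p) c \<and> pos (3 * p) c < 1/2 + 3 * e \<Longrightarrow> 1/2 \<le> pos (3 * p) d \<and> pos (3 * p) d \<le> 1/2 + 3 * e"
proof -
  show "0 < pos (3 * p) c \<and> pos (3 * p) c < 3 * e \<Longrightarrow> pos (3 * p) d \<le> 3 * e" using unlinked_aux[OF r] by blast
  have h: "pos (3 * p) (t + 1/2) = (if pos (3 * p) t + 1/2 < 1 then pos (3 * p) t + 1/2 else pos (3 * p) t + 1/2 - 1)" for t
    by (rule pos_add_right) simp_all
  show "1/2 < pos (3 * p) c \<and> pos (3 * p) c < 1/2 + 3 * e \<Longrightarrow> 1/2 \<le> pos (3 * p) d \<and> pos (3 * p) d \<le> 1/2 + 3 * e"
    using unlinked_aux[OF R_half[OF r]] e pos_ge0[of "3 * p" d] unfolding h by (auto split: if_splits)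
qed

section \<open>Invariance of the lamination of an edge\<close>

definition Lc :: "real \<Rightarrow> real \<Rightarrow> bool" where
  "Lc a b \<longleftrightarrow> R a b \<and> (\<forall>c d. R c d \<longrightarrow> \<not> linked a b c d)"

text \<open>By \<open>region\<close>, a chord of \<open>R\<close> with an end strictly inside a
  strip image has both ends in the closed strip image. So it cannot cross a chord with ends outside,
  and a chord of \<open>R\<close> crossing one inside stays inside.\<close>

lemma reg_transfer:
  assumes "reg e i (pos (3 * p) a)" "reg e i (pos (3 * p) b)" and l: "linked a b c d" and r: "R c d"
  shows "reg e i (pos (3 * p) c) \<and> reg e i (pos (3 * p) d)"
proof -
  define va vb vc vd where v: "va = pos (3 * p) a" "vb = pos (3 * p) b" "vc = pos (3 * p) c" "vd = pos (3 * p) d"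
  note rr = region[OF r] region[OF R_sym[OF r]]
  have g: "0 \<le> vc" "0 \<le> vd" "0 \<le> va" "0 \<le> vb" unfolding v by (simp_all add: pos_ge0)
  note l' = l[unfolded linked_coord[of a b c d "3 * p"]]
  show ?thesis
  proof (cases i)
    case (Sec j)
    show ?thesis
      using assms(1,2) rr l' g e unfolding Sec v[symmetric]
      by (cases j; simp only: reg.simps; argo)
  next
    case (Strip k)
    then consider "k = 1 \<or> k = 5" | "k = 2 \<or> k = 4" using assms(1) by auto
    then show ?thesis
    proof cases
      case 1
      then have "1/2 \<le> va" "va \<le> 1/2 + 3 * e" "1/2 \<le> vb" "vb \<le> 1/2 + 3 * e" using assms(1,2) Strip unfolding v by auto
      then have "1/2 \<le> vc \<and> vc \<le> 1/2 + 3 * e \<and> 1/2 \<le> vd \<and> vd \<le> 1/2 + 3 * e"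
        using rr l' g e unfolding v[symmetric] by argo
      then show ?thesis using 1 Strip unfolding v by auto
    next
      case 2
      then have "va \<le> 3 * e" "vb \<le> 3 * e" using assms(1,2) Strip e unfolding v by auto
      then have "vc \<le> 3 * e \<and> vd \<le> 3 * e"
        using rr l' g e unfolding v[symmetric] by argo
      then show ?thesis using 2 Strip unfolding v by auto
    qed
  qed
qed

text \<open>A chord of \<open>R\<close> crossing the lift would lie in the same piece, and its image
  would cross the original chord.\<close>

lemma Lc_pre:
  assumes L: "Lc a b" and i: "inp i a'" "inp i b'" and a: "pos (3 * a') a = 0" "pos (3 * b') b = 0"
  shows "Lc a' b'"
  unfolding Lc_def
proof (intro conjI allI impI notI)
  have "R (3 * a') (3 * b')" using R_cong[OF pos0_sym[OF a(1)] pos0_sym[OF a(2)]] L unfolding Lc_def by blast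
  from R_pre[OF i this] show "R a' b'" .
  fix c d assume r: "R c d" and l: "linked a' b' c d"
  obtain i' where i': "inp i' c" "inp i' d" using r unfolding R_def by (metis mult_1 power_0)
  have "i' = i" using inp_linked[OF i i' l] .
  then have "linked (3 * a') (3 * b') (3 * c) (3 * d)" using inp_linked_iff[OF i] i' l by blast
  then have "linked a b (3 * c) (3 * d)" using linked_cong[OF a pos_self pos_self] by blast
  moreover have "R (3 * c) (3 * d)" using R_pow[OF r, of 1] by simp
  ultimately show False using L unfolding Lc_def by blast
qed

text \<open>By \<open>reg_transfer\<close> a chord of \<open>R\<close> that crosses the image has
  both ends in the image of the same piece, so it lifts to a chord crossing
  \<open>a b\<close>.\<close>

lemma Lc_img:
  assumes L: "Lc a b"
  shows "Lc (3 * a) (3 * b)"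
  unfolding Lc_def
proof (intro conjI allI impI notI)
  have rab: "R a b" using L unfolding Lc_def by blast
  show "R (3 * a) (3 * b)" using R_pow[OF rab, of 1] by simp
  fix c d assume r: "R c d" and l: "linked (3 * a) (3 * b) c d"
  obtain i where i: "inp i a" "inp i b" using rab unfolding R_def by (metis mult_1 power_0)
  have "reg e i (pos (3 * p) c) \<and> reg e i (pos (3 * p) d)" using reg_transfer[OF inp_img[OF i(1)] inp_img[OF i(2)] l r] .
  then obtain c' d' where cd: "inp i c'" "pos (3 * c') c = 0" "inp i d'" "pos (3 * d') d = 0" using inp_pre by blast
  have "linked (3 * a) (3 * b) (3 * c') (3 * d')"
    using l linked_cong[OF pos_self pos_self pos0_sym[OF cd(2)] pos0_sym[OF cd(4)]] by blast
  then have "linked a b c' d'" using inp_linked_iff[OF i cd(1,3)] by blast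
  moreover have "R c' d'" using R_pre[OF cd(1,3) R_cong[OF pos0_sym[OF cd(2)] pos0_sym[OF cd(4)] r]] .
  ultimately show False using L unfolding Lc_def by blast
qed

lemma Lc_refl: "Lc a a"
proof -
  have "\<exists>i. inp i t" for t
  proof -
    define u where "u = pos p t"
    have "0 \<le> u" "u < 1" unfolding u_def by (simp_all add: pos_ge0 pos_lt1)
    then have "sec e Near u \<or> sec e Far u \<or> sec e Mid u \<or> (1/6 \<le> u \<and> u \<le> 1/6 + e) \<or> (1/3 \<le> u \<and> u \<le> 1/3 + e)
        \<or> (2/3 \<le> u \<and> u \<le> 2/3 + e) \<or> (5/6 \<le> u \<and> u \<le> 5/6 + e)"
      unfolding sec.simps by argo
    moreover have "1/6 \<le> u \<and> u \<le> 1/6 + e \<longleftrightarrow> rg e (Strip 1) u" "1/3 \<le> u \<and> u \<le> 1/3 + e \<longleftrightarrow> rg e (Strip 2) u"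
      "2/3 \<le> u \<and> u \<le> 2/3 + e \<longleftrightarrow> rg e (Strip 4) u" "5/6 \<le> u \<and> u \<le> 5/6 + e \<longleftrightarrow> rg e (Strip 5) u"
      by simp_all
    ultimately have "rg e (Sec Near) u \<or> rg e (Sec Far) u \<or> rg e (Sec Mid) u \<or> rg e (Strip 1) u \<or> rg e (Strip 2) u
        \<or> rg e (Strip 4) u \<or> rg e (Strip 5) u"
      unfolding rg.simps(1) by blast
    then have "\<exists>i. rg e i (pos p t)" unfolding u_def by blast
    then show ?thesis unfolding inp_def .
  qed
  then have "R a a" unfolding R_def by blast
  moreover have "\<not> linked a a c d" for c d unfolding linked_base by (simp add: pos_ge0 not_less)
  ultimately show ?thesis unfolding Lc_def by blast
qed

lemma Lc_half: "Lc a b \<Longrightarrow> Lc (a + 1/2) (b + 1/2)"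
  unfolding Lc_def
proof (intro conjI allI impI notI)
  assume L: "R a b \<and> (\<forall>c d. R c d \<longrightarrow> \<not> linked a b c d)"
  then show "R (a + 1/2) (b + 1/2)" using R_half by blast
  fix c d assume r: "R c d" and l: "linked (a + 1/2) (b + 1/2) c d"
  have "linked (a + 1/2 + 1/2) (b + 1/2 + 1/2) (c + 1/2) (d + 1/2)" using l unfolding linked_base pos_shift .
  moreover have "pos (t + 1/2 + 1/2) t = 0" for t by (rule turns_double) (simp add: turns_def)
  ultimately have "linked a b (c + 1/2) (d + 1/2)" using linked_cong[OF _ _ pos_self pos_self] by blast
  then show False using L R_half[OF r] by blast
qed

lemma Lc_cong: "pos a a' = 0 \<Longrightarrow> pos b b' = 0 \<Longrightarrow> Lc a b \<Longrightarrow> Lc a' b'"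
  unfolding Lc_def using R_cong linked_cong[of a a' b b'] pos_self by meson

lemma Lc_sym: "Lc a b \<Longrightarrow> Lc b a"
  unfolding Lc_def using R_sym linked_swap1 by blast

lemma Lc_pq: "Lc p q"
proof -
  have "R p q" unfolding R_def inp_def
    using spq[unfolded sim_def same_def K_def] by (metis rg.simps(1))
  then show ?thesis unfolding Lc_def using unlinked0 by blast
qed

lemma Lc_length:
  assumes "Lc a b"
  shows "pos a b \<le> 1/3 - e \<or> (1/3 + e \<le> pos a b \<and> pos a b \<le> 2/3 - e) \<or> 2/3 + e \<le> pos a b"
proof -
  obtain i where i: "inp i a" "inp i b" using assms unfolding Lc_def R_def by (metis mult_1 power_0)
  show ?thesis
  proof (cases i)
    case (Sec j)
    then show ?thesis using K_gap[OF _ e(3), of p j a b] i e unfolding inp_def K_def by auto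
  next
    case (Strip k)
    then show ?thesis using i e pos_base[of a b p] unfolding inp_def by (auto split: if_splits)
  qed
qed

lemma inp_disjoint:
  assumes "inp i a" "inp i' b" "(i, i') \<in> {(Sec Near, Sec Far), (Sec Near, Sec Mid), (Sec Far, Sec Mid),
     (Sec Near, Strip 2), (Sec Near, Strip 4), (Strip 2, Strip 4), (Sec Far, Strip 1), (Sec Far, Strip 5), (Strip 1, Strip 5)}"
  shows "pos a b \<noteq> 0"
proof
  assume "pos a b = 0"
  then have "inp i b" using inp_cong assms(1) by blast
  then show False using assms(2,3) e pos_ge0[of p b] unfolding inp_def by auto
qed

text \<open>Every chord has three disjoint preimages, obtained from one of the three triples of pieces
  on which tripling is injective and which do not separate the endpoints of the chord.\<close>

lemma triple_pieces:
  assumes "Lc a b" "inp i a" "inp i b"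
  shows "\<exists>i1 i2. reg e i1 (pos (3 * p) (3 * a)) \<and> reg e i1 (pos (3 * p) (3 * b)) \<and> reg e i2 (pos (3 * p) (3 * a)) \<and> reg e i2 (pos (3 * p) (3 * b))
    \<and> (\<forall>x y z. inp i x \<longrightarrow> inp i1 y \<longrightarrow> inp i2 z \<longrightarrow> pos x y \<noteq> 0 \<and> pos x z \<noteq> 0 \<and> pos y z \<noteq> 0)"
proof -
  have r: "R (3 * a) (3 * b)" using Lc_img[OF assms(1)] unfolding Lc_def by blast
  define va vb where v: "va = pos (3 * p) (3 * a)" "vb = pos (3 * p) (3 * b)"
  note rr = region[OF r, folded v] region[OF R_sym[OF r], folded v]
  have im: "reg e i va" "reg e i vb" using inp_img assms(2,3) unfolding v by blast+
  have D: "pos x y \<noteq> 0 \<and> pos x z \<noteq> 0 \<and> pos y z \<noteq> 0"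
    if "inp i x" "inp i1 y" "inp i2 z" "{i, i1, i2} = {Sec Near, Sec Far, Sec Mid} \<or> {i, i1, i2} = {Sec Near, Strip 2, Strip 4} \<or> {i, i1, i2} = {Sec Far, Strip 1, Strip 5}"
      "i \<noteq> i1" "i \<noteq> i2" "i1 \<noteq> i2" for x y z i1 i2
  proof -
    have "pos u w \<noteq> 0" if "inp k u" "inp k' w" "k \<in> {i, i1, i2}" "k' \<in> {i, i1, i2}" "k \<noteq> k'" for u w k k'
      using inp_disjoint[OF that(1,2)] inp_disjoint[OF that(2,1)] pos0_comm[of u w] that(3-5)
        \<open>{i, i1, i2} = {Sec Near, Sec Far, Sec Mid} \<or> {i, i1, i2} = {Sec Near, Strip 2, Strip 4} \<or> {i, i1, i2} = {Sec Far, Strip 1, Strip 5}\<close>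
      by (elim disjE; simp only: insert_iff empty_iff; elim disjE; simp)
    then show ?thesis using that by (metis insertCI)
  qed
  have W: ?thesis if "reg e i1 va" "reg e i1 vb" "reg e i2 va" "reg e i2 vb"
     "{i, i1, i2} = {Sec Near, Sec Far, Sec Mid} \<or> {i, i1, i2} = {Sec Near, Strip 2, Strip 4} \<or> {i, i1, i2} = {Sec Far, Strip 1, Strip 5}"
     "i \<noteq> i1" "i \<noteq> i2" "i1 \<noteq> i2" for i1 i2
    using that D[OF _ _ _ that(5-)] unfolding v by blast
  have g: "0 \<le> va" "0 \<le> vb" unfolding v by (simp_all add: pos_ge0)
  show ?thesis
  proof (cases i)
    case (Sec j)
    show ?thesis
    proof (cases j)
      case Mid
      show ?thesis by (rule W[of "Sec Near" "Sec Far"]) (use im Sec Mid e in auto)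
    next
      case Near
      show ?thesis
      proof (cases "(0 < va \<and> va < 3 * e) \<or> (0 < vb \<and> vb < 3 * e)")
        \<comment> \<open>An end strictly inside the strip image has no preimage in
          \<open>Far\<close> or \<open>Mid\<close>. But then both ends lie in the strip image, and
          the strips at 2 and 4 sixths supply the missing preimages.\<close>
        case True
        then have "va \<le> 3 * e" "vb \<le> 3 * e" using rr by linarith+
        then show ?thesis by (intro W[of "Strip 2" "Strip 4"]) (use Sec Near in auto)
      next
        case False
        then show ?thesis by (intro W[of "Sec Far" "Sec Mid"]) (use im Sec Near e g in auto)
      qed
    next
      case Far
      show ?thesis
      proof (cases "(1/2 < va \<and> va < 1/2 + 3 * e) \<or> (1/2 < vb \<and> vb < 1/2 + 3 * e)")
        case True
        then have "1/2 \<le> va" "va \<le> 1/2 + 3 * e" "1/2 \<le> vb" "vb \<le> 1/2 + 3 * e" using rr by linarith+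
        then show ?thesis by (intro W[of "Strip 1" "Strip 5"]) (use Sec Far in auto)
      next
        case False
        then show ?thesis by (intro W[of "Sec Near" "Sec Mid"]) (use im Sec Far e g in auto)
      qed
    qed
  next
    case (Strip k)
    then consider "k = 1" | "k = 5" | "k = 2" | "k = 4" using im(1) by auto
    then show ?thesis
    proof cases
      case 1 then show ?thesis by (intro W[of "Sec Far" "Strip 5"]) (use im Strip e in auto)
    next
      case 2 then show ?thesis by (intro W[of "Sec Far" "Strip 1"]) (use im Strip e in auto)
    next
      case 3 then show ?thesis by (intro W[of "Sec Near" "Strip 4"]) (use im Strip e in auto)
    next
      case 4 then show ?thesis by (intro W[of "Sec Near" "Strip 2"]) (use im Strip e in auto)
    qed
  qed
qed

text \<open>Three disjoint pieces give three preimages of each end, which are its shifts by thirds.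
  The pieces pair the shifts up, and \<open>c\<close> records whether the pairing keeps or exchanges
  the shifts by 1/3 and 2/3.\<close>

lemma Lc_siblings:
  assumes "Lc a b"
  shows "\<exists>c\<in>{1/3, 2/3}. Lc (a + 1/3) (b + c) \<and> Lc (a + 2/3) (b + (1 - c))"
proof -
  obtain i where i: "inp i a" "inp i b" using assms unfolding Lc_def R_def by (metis mult_1 power_0)
  from triple_pieces[OF assms i] obtain i1 i2 where
    r: "reg e i1 (pos (3 * p) (3 * a))" "reg e i1 (pos (3 * p) (3 * b))" "reg e i2 (pos (3 * p) (3 * a))" "reg e i2 (pos (3 * p) (3 * b))"
    and D: "\<And>x y z. inp i x \<Longrightarrow> inp i1 y \<Longrightarrow> inp i2 z \<Longrightarrow> pos x y \<noteq> 0 \<and> pos x z \<noteq> 0 \<and> pos y z \<noteq> 0" by blast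
  obtain a1 b1 a2 b2 where pre: "inp i1 a1" "pos (3 * a1) (3 * a) = 0" "inp i1 b1" "pos (3 * b1) (3 * b) = 0"
    "inp i2 a2" "pos (3 * a2) (3 * a) = 0" "inp i2 b2" "pos (3 * b2) (3 * b) = 0"
    using inp_pre[OF r(1)] inp_pre[OF r(2)] inp_pre[OF r(3)] inp_pre[OF r(4)] by blast
  have L1: "Lc a1 b1" using Lc_pre[OF Lc_img[OF assms] pre(1,3,2,4)] .
  have L2: "Lc a2 b2" using Lc_pre[OF Lc_img[OF assms] pre(5,7,6,8)] .
  have key: "(pos (x + 1/3) x1 = 0 \<and> pos (x + 2/3) x2 = 0) \<or> (pos (x + 2/3) x1 = 0 \<and> pos (x + 1/3) x2 = 0)"
    if "pos (3 * x1) (3 * x) = 0" "pos (3 * x2) (3 * x) = 0" "pos x x1 \<noteq> 0" "pos x x2 \<noteq> 0" "pos x1 x2 \<noteq> 0" for x x1 x2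
  proof -
    have c: "pos x x1 = 1/3 \<or> pos x x1 = 2/3" "pos x x2 = 1/3 \<or> pos x x2 = 2/3" using third_of_triple that by blast+
    have "pos x x1 \<noteq> pos x x2" using pos0_of_eq[of x x1 x2] that(5) by blast
    then consider "pos x x1 = 1/3" "pos x x2 = 2/3" | "pos x x1 = 2/3" "pos x x2 = 1/3" using c by argo
    then show ?thesis
    proof cases
      case 1
      then show ?thesis
        using pos0_of_eq[of x "x + 1/3" x1] pos_self_add[of "1/3" x] pos0_of_eq[of x "x + 2/3" x2] pos_self_add[of "2/3" x] by simp
    next
      case 2
      then show ?thesis
        using pos0_of_eq[of x "x + 1/3" x2] pos_self_add[of "1/3" x] pos0_of_eq[of x "x + 2/3" x1] pos_self_add[of "2/3" x] by simp
    qed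
  qed
  have ka: "(pos (a + 1/3) a1 = 0 \<and> pos (a + 2/3) a2 = 0) \<or> (pos (a + 2/3) a1 = 0 \<and> pos (a + 1/3) a2 = 0)"
    using key[OF pre(2,6)] D[OF i(1) pre(1,5)] by blast
  have kb: "(pos (b + 1/3) b1 = 0 \<and> pos (b + 2/3) b2 = 0) \<or> (pos (b + 2/3) b1 = 0 \<and> pos (b + 1/3) b2 = 0)"
    using key[OF pre(4,8)] D[OF i(2) pre(3,7)] by blast
  have s: "1 - 1/3 = (2/3::real)" "1 - 2/3 = (1/3::real)" by simp_all
  have M: "Lc (a + u) (b + w)" if "pos (a + u) x = 0" "pos (b + w) y = 0" "Lc x y" for u w x y
    using Lc_cong[OF pos0_sym[OF that(1)] pos0_sym[OF that(2)] that(3)] .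
  from ka kb show ?thesis
    by (elim disjE conjE)
      (rule bexI[of _ "1/3"] bexI[of _ "2/3"]; use M[OF _ _ L1] M[OF _ _ L2] in \<open>simp add: s\<close>)+
qed

text \<open>The image of \<open>Near\<close> misses only an open arc behind
  \<open>3 * p + 1/2\<close>. If one end lies there, both lie in its closure, which is part of the
  image of \<open>Far\<close>.\<close>

lemma Lc_preimage: "Lc a b \<Longrightarrow> \<exists>a' b'. Lc a' b' \<and> pos (3 * a') a = 0 \<and> pos (3 * b') b = 0"
proof -
  assume L: "Lc a b"
  then have r: "R a b" unfolding Lc_def by blast
  have "\<exists>i. reg e i (pos (3 * p) a) \<and> reg e i (pos (3 * p) b)"
  proof (cases "reg e (Sec Near) (pos (3 * p) a) \<and> reg e (Sec Near) (pos (3 * p) b)")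
    case False
    then have "1/2 \<le> pos (3 * p) a" "1/2 \<le> pos (3 * p) b" using region(2)[OF r] region(2)[OF R_sym[OF r]] by auto
    then show ?thesis using e by (intro exI[of _ "Sec Far"]) auto
  qed blast
  then show ?thesis using inp_pre Lc_pre[OF L] by meson
qed

end

section \<open>Chords in the plane\<close>

definition ex :: "real \<Rightarrow> complex" where "ex t = cis (2 * pi * t)"

definition seg :: "real \<Rightarrow> real \<Rightarrow> complex set" where "seg a b = closed_segment (ex a) (ex b)"

lemma ex_circle [simp]: "ex a \<in> circle" "norm (ex a) = 1"
  by (simp_all add: ex_def)

lemma ex_eq: "ex a = ex b \<longleftrightarrow> pos a b = 0"
proof -
  have "ex a = ex b \<longleftrightarrow> cis (2 * pi * (b - a)) = 1"
    unfolding ex_def by (auto simp: right_diff_distrib cis_divide[symmetric])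
  also have "\<dots> \<longleftrightarrow> pos a b = 0"
  proof
    assume "cis (2 * pi * (b - a)) = 1"
    then have "cos (2 * pi * (b - a)) = 1" by (metis cis.sel(1) one_complex.sel(1))
    then obtain n where "2 * pi * (b - a) = real_of_int n * 2 * pi" unfolding cos_one_2pi_int by blast
    then have "2 * pi * (b - a) = 2 * pi * real_of_int n" by simp
    then have "b - a = real_of_int n" by (metis mult_cancel_left pi_neq_zero mult_eq_0_iff zero_neq_numeral)
    then show "pos a b = 0" unfolding pos_eq0 by simp
  next
    assume "pos a b = 0"
    then obtain n :: int where "b - a = of_int n" unfolding pos_eq0 by (elim Ints_cases)
    then show "cis (2 * pi * (b - a)) = 1" by (simp add: cis_multiple_2pi)
  qed
  finally show ?thesis .
qed

lemma ex_cong: "pos a b = 0 \<Longrightarrow> ex a = ex b"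
  by (simp add: ex_eq)

lemma ex_surj:
  assumes "x \<in> circle"
  obtains t where "0 \<le> t" "t < 1" "x = ex t"
proof -
  have "x = cis (Arg x)" using assms cis_Arg[of x] by (cases "x = 0") (auto simp: sgn_div_norm)
  then have "x = ex (Arg x / (2 * pi))" unfolding ex_def by simp
  also have "\<dots> = ex (frac (Arg x / (2 * pi)))" by (rule ex_cong) simp
  finally show thesis by (intro that[of "frac (Arg x / (2 * pi))"]) (simp_all add: frac_lt_1)
qed

lemma sigma3_ex: "sigma3 (ex a) = ex (3 * a)"
  unfolding sigma3_def ex_def Complex.DeMoivre by (simp add: algebra_simps)

lemma minus_ex: "- ex a = ex (a + 1/2)"
  unfolding ex_def by (simp add: distrib_left cis_mult[symmetric])

section \<open>Signed areas and crossing chords\<close>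

lemma ex_diff: "ex b - ex a = 2 * \<i> * complex_of_real (sin (pi * (b - a))) * cis (pi * (a + b))"
proof -
  have s: "2 * \<i> * complex_of_real (sin t) = cis t - cis (- t)" for t
    by (simp add: complex_eq_iff)
  have "(cis (pi * (b - a)) - cis (- (pi * (b - a)))) * cis (pi * (a + b)) = cis (2 * pi * b) - cis (2 * pi * a)"
    by (simp add: left_diff_distrib cis_mult algebra_simps)
  then show ?thesis unfolding ex_def s by simp
qed

text \<open>Twice the signed area of the triangle \<open>A\<close>, \<open>B\<close>,
  \<open>z\<close>; its sign tells the side of the line through \<open>A\<close> and
  \<open>B\<close>.\<close>

definition side :: "complex \<Rightarrow> complex \<Rightarrow> complex \<Rightarrow> real" where
  "side A B z = Im (cnj (B - A) * (z - A))"

lemma side_ex: "side (ex a) (ex b) (ex c) = 4 * sin (pi * (b - a)) * sin (pi * (c - a)) * sin (pi * (c - b))"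
proof -
  have "cnj (ex b - ex a) * (ex c - ex a)
      = complex_of_real (4 * sin (pi * (b - a)) * sin (pi * (c - a))) * (cis (- (pi * (a + b))) * cis (pi * (a + c)))"
    unfolding ex_diff by (simp add: cis_cnj)
  also have "cis (- (pi * (a + b))) * cis (pi * (a + c)) = cis (pi * (c - b))"
    unfolding cis_mult by (simp add: algebra_simps)
  finally show ?thesis unfolding side_def by simp
qed

lemma side_affine: "side A B ((1 - u) *\<^sub>R C + u *\<^sub>R D) = (1 - u) * side A B C + u * side A B D"
  unfolding side_def by (simp add: algebra_simps)

lemma sin_shift_int: "sin (pi * (x + of_int k)) = sin (pi * x) * cos (pi * of_int k)"
  by (simp add: distrib_left sin_add)

lemma cos_int_sq: "cos (pi * of_int k) * cos (pi * of_int k) = 1"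
  using sin_cos_squared_add[of "pi * of_int k"] by (simp add: power2_eq_square)

text \<open>Crossing as a sign condition on continuous functions of the lifts. It connects the
  combinatorial notion with \<open>side\<close> and shows that being unlinked is a closed
  condition.\<close>

lemma linked_sin:
  "linked a b c d \<longleftrightarrow> sin (pi * (c - a)) * sin (pi * (c - b)) * (sin (pi * (d - a)) * sin (pi * (d - b))) < 0"
proof -
  define x \<beta> w where d: "x = pos a c" "\<beta> = pos a b" "w = pos a d"
  have r: "0 \<le> x" "x < 1" "0 \<le> \<beta>" "\<beta> < 1" "0 \<le> w" "w < 1" unfolding d by (simp_all add: pos_ge0 pos_lt1)
  obtain k m l :: int where k: "c - a = x + of_int k" "b - a = \<beta> + of_int m" "d - a = w + of_int l"
    unfolding d using pos_Ints[of c a] pos_Ints[of b a] pos_Ints[of d a] by (elim Ints_cases) (metis add.commute diff_add_cancel)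
  let ?C = "\<lambda>j::int. cos (pi * of_int j)"
  have one: "sin (pi * (t - a)) * sin (pi * (t - b)) = sin (pi * y) * sin (pi * (y - \<beta>)) * ?C m" if "t - a = y + of_int j" for t y j
  proof -
    have 1: "t - b = (y - \<beta>) + of_int (j - m)" using that k(2) by simp
    have "?C (j - m) = ?C j * ?C m" by (simp add: right_diff_distrib cos_diff)
    then have "sin (pi * (t - a)) * sin (pi * (t - b)) = sin (pi * y) * sin (pi * (y - \<beta>)) * ?C m * (?C j * ?C j)"
      unfolding that 1 sin_shift_int by simp
    then show ?thesis unfolding cos_int_sq by simp
  qed
  have "sin (pi * (c - a)) * sin (pi * (c - b)) * (sin (pi * (d - a)) * sin (pi * (d - b)))
      = sin (pi * x) * sin (pi * (x - \<beta>)) * (sin (pi * w) * sin (pi * (w - \<beta>))) * (?C m * ?C m)"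
    unfolding one[OF k(1)] one[OF k(3)] by simp
  also have "\<dots> = sin (pi * x) * sin (pi * (x - \<beta>)) * (sin (pi * w) * sin (pi * (w - \<beta>)))" unfolding cos_int_sq by simp
  finally have eq: "sin (pi * (c - a)) * sin (pi * (c - b)) * (sin (pi * (d - a)) * sin (pi * (d - b)))
      = sin (pi * x) * sin (pi * (x - \<beta>)) * (sin (pi * w) * sin (pi * (w - \<beta>)))" .
  have pos: "0 < sin (pi * t)" if "0 < t" "t < 1" for t using that by (intro sin_gt_zero) auto
  have neg: "sin (pi * t) < 0" if "-1 < t" "t < 0" for t using pos[of "- t"] that by simp
  have sgn: "sgn (sin (pi * t)) = sgn t" if "-1 < t" "t < 1" for t
  proof -
    consider "t < 0" | "t = 0" | "0 < t" by linarith
    then show ?thesis by cases (use pos[of t] neg[of t] that in auto)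
  qed
  let ?S = "sin (pi * x) * sin (pi * (x - \<beta>)) * (sin (pi * w) * sin (pi * (w - \<beta>)))"
  have "?S < 0 \<longleftrightarrow> sgn ?S = -1" by (metis sgn_neg sgn_1_neg)
  also have "sgn ?S = sgn x * sgn (x - \<beta>) * (sgn w * sgn (w - \<beta>))"
    unfolding sgn_mult using sgn[of x] sgn[of w] sgn[of "x - \<beta>"] sgn[of "w - \<beta>"] r by simp
  also have "sgn x * sgn (x - \<beta>) * (sgn w * sgn (w - \<beta>)) = -1 \<longleftrightarrow> (0 < x \<and> x < \<beta> \<and> \<beta> < w) \<or> (0 < w \<and> w < \<beta> \<and> \<beta> < x)"
    using r unfolding sgn_real_def by auto
  finally show ?thesis unfolding eq linked_base d by blast
qed

lemma norm_seg: "norm ((1 - s) *\<^sub>R ex a + s *\<^sub>R ex b) ^ 2 = 1 - s * (1 - s) * norm (ex b - ex a) ^ 2"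
proof -
  have n: "Re (ex t) ^ 2 + Im (ex t) ^ 2 = 1" for t by (simp add: ex_def)
  have 1: "norm ((1 - s) *\<^sub>R ex a + s *\<^sub>R ex b) ^ 2 = (1 - s)^2 * (Re (ex a) ^ 2 + Im (ex a) ^ 2) + s^2 * (Re (ex b) ^ 2 + Im (ex b) ^ 2)
      + 2 * s * (1 - s) * (Re (ex a) * Re (ex b) + Im (ex a) * Im (ex b))"
    unfolding cmod_power2 by (simp add: power2_eq_square algebra_simps)
  have 2: "norm (ex b - ex a) ^ 2 = (Re (ex a) ^ 2 + Im (ex a) ^ 2) + (Re (ex b) ^ 2 + Im (ex b) ^ 2)
      - 2 * (Re (ex a) * Re (ex b) + Im (ex a) * Im (ex b))"
    unfolding cmod_power2 by (simp add: power2_eq_square algebra_simps)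
  show ?thesis unfolding 1 2 n by (simp add: power2_eq_square algebra_simps)
qed

lemma side_self: "side A B A = 0" "side A B B = 0"
  unfolding side_def by (simp_all add: algebra_simps)

lemma on_line:
  assumes "side (ex a) (ex b) z = 0" "norm z < 1" "ex a \<noteq> ex b"
  shows "z \<in> seg a b"
proof -
  let ?v = "ex b - ex a"
  have v: "?v \<noteq> 0" using assms(3) by simp
  define s where "s = Re (cnj ?v * (z - ex a)) / norm ?v ^ 2"
  have "cnj ?v * (z - ex a) = complex_of_real (Re (cnj ?v * (z - ex a)))"
    using assms(1) unfolding side_def by (simp add: complex_eq_iff)
  then have e1: "?v * (cnj ?v * (z - ex a)) = ?v * complex_of_real (s * norm ?v ^ 2)" using v unfolding s_def by simp
  have e2: "?v * (cnj ?v * (z - ex a)) = complex_of_real (norm ?v ^ 2) * (z - ex a)"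
    using complex_norm_square[of ?v] by (simp add: mult.assoc)
  have "complex_of_real (norm ?v ^ 2) * (z - ex a) = ?v * complex_of_real (s * norm ?v ^ 2)"
    using e2[symmetric] e1 by (rule trans)
  also have "\<dots> = complex_of_real (norm ?v ^ 2) * (complex_of_real s * ?v)" by (simp only: of_real_mult mult_ac)
  finally have "complex_of_real (norm ?v ^ 2) * (z - ex a) = complex_of_real (norm ?v ^ 2) * (complex_of_real s * ?v)" .
  then have "z - ex a = complex_of_real s * ?v" using v by (metis mult_left_cancel norm_eq_zero of_real_eq_0_iff power_not_zero)
  then have z: "z = (1 - s) *\<^sub>R ex a + s *\<^sub>R ex b" by (simp add: scaleR_conv_of_real algebra_simps)
  have "norm z ^ 2 < 1" using assms(2) by (simp add: power_less_one_iff abs_square_less_1)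
  then have "0 < s * (1 - s) * norm ?v ^ 2" unfolding z norm_seg by simp
  then have "0 < s * (1 - s)" using v by (simp add: zero_less_mult_iff)
  then have "0 \<le> s" "s \<le> 1" by (auto simp: zero_less_mult_iff)
  then show ?thesis unfolding seg_def in_segment z by blast
qed

lemma on_line_circle:
  assumes "side (ex a) (ex b) (ex c) = 0" "ex a \<noteq> ex b"
  shows "ex c = ex a \<or> ex c = ex b"
proof -
  have z: "pos u v = 0" if z0: "sin (pi * (v - u)) = 0" for u v
  proof -
    obtain n :: int where "pi * (v - u) = of_int n * pi" using z0 unfolding sin_zero_iff_int2 by blast
    then have "v - u = of_int n" by simp
    then show ?thesis unfolding pos_eq0 by simp
  qed
  have "sin (pi * (b - a)) \<noteq> 0" using z[of b a] assms(2) unfolding ex_eq by blast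
  then have "sin (pi * (c - a)) = 0 \<or> sin (pi * (c - b)) = 0" using assms(1) unfolding side_ex by simp
  then show ?thesis using z[of c a] z[of c b] unfolding ex_eq using pos0_sym by blast
qed

lemma seg_endpoints: "endpoints (seg a b) = {ex a, ex b}"
  unfolding seg_def by (rule endpoints_closed_segment) simp_all

lemma seg_eq: "seg a b = seg c d \<longleftrightarrow> {ex a, ex b} = {ex c, ex d}"
proof
  assume "seg a b = seg c d"
  then show "{ex a, ex b} = {ex c, ex d}" using seg_endpoints by metis
next
  assume "{ex a, ex b} = {ex c, ex d}"
  then show "seg a b = seg c d" unfolding seg_def segment_convex_hull by simp
qed

lemma seg_ball: "z \<in> seg a b \<Longrightarrow> norm z < 1 \<or> z = ex a \<or> z = ex b"
proof -
  assume z: "z \<in> seg a b"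
  have "seg a b \<subseteq> cball 0 1" unfolding seg_def by (rule closed_segment_subset) auto
  then have "norm z \<le> 1" using z by auto
  moreover have "norm z = 1 \<Longrightarrow> z \<in> endpoints (seg a b)" using z unfolding endpoints_def by simp
  ultimately show ?thesis using seg_endpoints by (metis insert_iff order_le_less singletonD)
qed

lemma linked_side:
  assumes "ex a \<noteq> ex b"
  shows "linked a b c d \<longleftrightarrow> side (ex a) (ex b) (ex c) * side (ex a) (ex b) (ex d) < 0"
proof -
  have "sin (pi * (b - a)) \<noteq> 0"
  proof
    assume "sin (pi * (b - a)) = 0"
    then have "side (ex a) (ex b) (ex t) = 0" for t unfolding side_ex by simp
    then have "ex t = ex a \<or> ex t = ex b" for t using on_line_circle assms by blast
    moreover have "ex (a + 1/3) \<noteq> ex a" "ex (a + 2/3) \<noteq> ex a" "ex (a + 1/3) \<noteq> ex (a + 2/3)"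
      using pos_self_add[of "1/3" a] pos_self_add[of "2/3" a] pos_self_add[of "1/3" "a + 1/3"] pos0_comm
      unfolding ex_eq by (force simp: add.assoc)+
    ultimately show False by metis
  qed
  then have p: "0 < 16 * (sin (pi * (b - a)) * sin (pi * (b - a)))" by (simp add: zero_less_mult_iff) linarith
  have "side (ex a) (ex b) (ex c) * side (ex a) (ex b) (ex d)
     = 16 * (sin (pi * (b - a)) * sin (pi * (b - a))) * (sin (pi * (c - a)) * sin (pi * (c - b)) * (sin (pi * (d - a)) * sin (pi * (d - b))))"
    unfolding side_ex by simp
  then show ?thesis unfolding linked_sin using p by (simp add: mult_less_0_iff zero_less_mult_iff)
qed

lemma linked_meet:
  assumes l: "linked a b c d"
  shows "\<exists>z. z \<in> seg a b \<and> z \<in> seg c d \<and> norm z < 1"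
proof -
  have n: "ex a \<noteq> ex b" "ex c \<noteq> ex d" using linked_distinct[OF l] unfolding ex_eq by auto
  let ?s = "side (ex a) (ex b)"
  have lt: "?s (ex c) * ?s (ex d) < 0" using l linked_side[OF n(1)] by blast
  define u where "u = ?s (ex c) / (?s (ex c) - ?s (ex d))"
  have u: "0 < u" "u < 1" using lt unfolding u_def by (auto simp: mult_less_0_iff divide_simps)
  define z where "z = (1 - u) *\<^sub>R ex c + u *\<^sub>R ex d"
  have "?s (ex c) - ?s (ex d) \<noteq> 0" using lt by (auto simp: mult_less_0_iff)
  then have "?s z = 0" unfolding z_def side_affine u_def by (simp add: field_simps)
  moreover have "norm z ^ 2 < 1"
    unfolding z_def norm_seg using u n(2) by (simp add: zero_less_mult_iff)
  then have nz: "norm z < 1" by (simp add: abs_square_less_1)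
  ultimately have "z \<in> seg a b" using on_line n(1) by blast
  moreover have "z \<in> seg c d" unfolding seg_def in_segment z_def using u by (intro exI[of _ u]) simp
  ultimately show ?thesis using nz by blast
qed

text \<open>At a common point inside the disk the values of \<open>side\<close> at \<open>c\<close>
  and \<open>d\<close> cancel with positive weights. So they have opposite signs, or both vanish and
  the chords have the same ends.\<close>

lemma meet_linked:
  assumes z: "z \<in> seg a b" "z \<in> seg c d" "norm z < 1" and ne: "seg a b \<noteq> seg c d"
  shows "linked a b c d"
proof (rule ccontr)
  assume nl: "\<not> linked a b c d"
  have deg: "ex x \<noteq> ex y" if "z \<in> seg x y" for x y
  proof
    assume "ex x = ex y"
    then have "z = ex x" using that unfolding seg_def by simp
    then show False using z(3) by simp
  qed
  note ab = deg[OF z(1)] and cd = deg[OF z(2)]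
  let ?s = "side (ex a) (ex b)"
  have line: "?s z = 0"
  proof -
    obtain u where "z = (1 - u) *\<^sub>R ex a + u *\<^sub>R ex b" using z(1) unfolding seg_def in_segment by blast
    then show ?thesis by (simp add: side_affine side_self)
  qed
  obtain u where u: "0 \<le> u" "u \<le> 1" "z = (1 - u) *\<^sub>R ex c + u *\<^sub>R ex d" using z(2) unfolding seg_def in_segment by blast
  have u01: "u \<noteq> 0" "u \<noteq> 1" using u(3) z(3) by auto
  have sum: "(1 - u) * ?s (ex c) + u * ?s (ex d) = 0" using line unfolding u(3) side_affine .
  have "\<not> ?s (ex c) * ?s (ex d) < 0" using nl linked_side[OF ab] by blast
  then have "?s (ex c) = 0 \<and> ?s (ex d) = 0"
  proof -
    assume a: "\<not> ?s (ex c) * ?s (ex d) < 0"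
    have m: "(1 - u) * ?s (ex c) = - (u * ?s (ex d))" using sum by linarith
    have "(1 - u) * (?s (ex c) * ?s (ex c)) = ((1 - u) * ?s (ex c)) * ?s (ex c)" by simp
    also have "\<dots> = - (u * (?s (ex c) * ?s (ex d)))" unfolding m by simp
    finally have "(1 - u) * (?s (ex c) * ?s (ex c)) = - (u * (?s (ex c) * ?s (ex d)))" .
    moreover have "0 \<le> u * (?s (ex c) * ?s (ex d))" using a u by (simp add: not_less)
    moreover have "0 < 1 - u" using u u01 by simp
    ultimately have "?s (ex c) * ?s (ex c) \<le> 0" by (smt (verit) mult_pos_pos)
    then have "?s (ex c) = 0" by (metis mult_eq_0_iff not_less order_antisym zero_le_square)
    then show ?thesis using sum u01 by simp
  qed
  then have "ex c = ex a \<or> ex c = ex b" "ex d = ex a \<or> ex d = ex b" using on_line_circle ab by blast+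
  then have "{ex c, ex d} = {ex a, ex b}" using cd by auto
  then show False using ne unfolding seg_eq by simp
qed

lemma linked_ne: "linked a b c d \<Longrightarrow> seg a b \<noteq> seg c d"
  unfolding seg_eq using linked_distinct[of a b c d] by (auto simp: ex_eq doubleton_eq_iff)

lemma crossing_seg: "crossing (seg a b) (seg c d) \<longleftrightarrow> linked a b c d"
proof
  assume "crossing (seg a b) (seg c d)"
  then obtain z where "seg a b \<noteq> seg c d" "z \<in> seg a b" "z \<in> seg c d" "norm z < 1" unfolding crossing_def by auto
  then show "linked a b c d" using meet_linked by blast
next
  assume "linked a b c d"
  then show "crossing (seg a b) (seg c d)" using linked_meet linked_ne unfolding crossing_def by fastforce
qed

lemma seg_degenerate: "degenerate (seg a b) \<longleftrightarrow> pos a b = 0"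
proof
  assume "degenerate (seg a b)"
  then show "pos a b = 0" unfolding degenerate_def seg_def by (metis ex_eq ends_in_segment singletonD)
next
  assume "pos a b = 0"
  then have "seg a b = {ex a}" unfolding seg_def using ex_cong by simp
  then show "degenerate (seg a b)" unfolding degenerate_def using ex_circle by blast
qed

lemma seg_self: "seg a a = {ex a}"
  unfolding seg_def by simp

lemma seg_cong: "pos a a' = 0 \<Longrightarrow> pos b b' = 0 \<Longrightarrow> seg a b = seg a' b'"
  unfolding seg_def using ex_cong by metis

lemma seg_commute: "seg a b = seg b a"
  unfolding seg_def by (rule closed_segment_commute)

lemma seg_image: "chord_image (seg a b) = seg (3 * a) (3 * b)"
  unfolding seg_def by (simp add: chord_image_closed_segment sigma3_ex)

lemma seg_chord: "seg a b \<in> chords"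
  unfolding chords_def seg_def using ex_circle by blast

lemma chord_seg: "l \<in> chords \<Longrightarrow> \<exists>a b. 0 \<le> a \<and> a < 1 \<and> 0 \<le> b \<and> b < 1 \<and> l = seg a b"
  unfolding chords_def seg_def using ex_surj by (smt (verit) mem_Collect_eq)

lemma seg_minus: "uminus ` seg a b = seg (a + 1/2) (b + 1/2)"
  unfolding seg_def minus_ex[symmetric]
  using closed_segment_linear_image[of uminus "ex a" "ex b"] by (simp add: linear_uminus)

lemma arc_dist_ex: "arc_dist (ex a) (ex b) = min (pos a b) (1 - pos a b)"
proof -
  define h where "h = pos a b"
  have h: "0 \<le> h" "h < 1" unfolding h_def by (simp_all add: pos_ge0 pos_lt1)
  have "pos b (a + h) = 0" using pos0_of_eq[of a b "a + h"] pos_self_add[OF h] unfolding h_def by simp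
  then have "ex b / ex a = ex (a + h) / ex a" using ex_cong by metis
  also have "\<dots> = cis (2 * pi * h)" unfolding ex_def by (simp add: cis_divide algebra_simps)
  finally have eq: "ex b / ex a = cis (2 * pi * h)" .
  show ?thesis
  proof (cases "h \<le> 1/2")
    case True
    have "2 * pi * h \<le> pi" using True by simp
    moreover have "- pi < 2 * pi * h" using h pi_gt_zero by (smt (verit) mult_nonneg_nonneg)
    ultimately have "Arg (cis (2 * pi * h)) = 2 * pi * h" by (intro Arg_cis) auto
    then show ?thesis unfolding arc_dist_def eq h_def[symmetric] using True h by (simp add: abs_mult)
  next
    case False
    have "cis (2 * pi * h) = cis (2 * pi * (h - 1))" by (simp add: right_diff_distrib cis_divide[symmetric])
    moreover have "Arg (cis (2 * pi * (h - 1))) = 2 * pi * (h - 1)"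
    proof (rule Arg_cis)
      show "2 * pi * (h - 1) \<in> {- pi<..pi}" using False h by (simp add: algebra_simps)
    qed
    ultimately have "Arg (cis (2 * pi * h)) = 2 * pi * (h - 1)" by simp
    then show ?thesis unfolding arc_dist_def eq h_def[symmetric] using False h by (simp add: abs_mult)
  qed
qed

lemma seg_length: "chord_length (seg a b) = min (pos a b) (1 - pos a b)"
  unfolding seg_def by (simp add: chord_length_closed_segment arc_dist_ex)

lemma disjnt_seg:
  assumes "ex a \<noteq> ex b" "ex c \<noteq> ex d"
  shows "disjnt (seg a b) (seg c d) \<longleftrightarrow> \<not> linked a b c d \<and> {ex a, ex b} \<inter> {ex c, ex d} = {}"
proof
  assume d: "disjnt (seg a b) (seg c d)"
  have "ex a \<in> seg a b" "ex b \<in> seg a b" "ex c \<in> seg c d" "ex d \<in> seg c d" unfolding seg_def by simp_all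
  then show "\<not> linked a b c d \<and> {ex a, ex b} \<inter> {ex c, ex d} = {}" using d linked_meet[of a b c d] unfolding disjnt_iff by auto
next
  assume n: "\<not> linked a b c d \<and> {ex a, ex b} \<inter> {ex c, ex d} = {}"
  then have ne: "seg a b \<noteq> seg c d" unfolding seg_eq by auto
  show "disjnt (seg a b) (seg c d)"
    unfolding disjnt_iff
  proof (intro allI notI)
    fix z assume z: "z \<in> seg a b \<and> z \<in> seg c d"
    have "\<not> norm z < 1" using meet_linked[of z a b c d] z ne n by blast
    then have "z \<in> {ex a, ex b}" "z \<in> {ex c, ex d}" using seg_ball[of z a b] seg_ball[of z c d] z by auto
    then show False using n by blast
  qed
qed

section \<open>From relations on the line to laminations\<close>

definition leaves :: "(real \<Rightarrow> real \<Rightarrow> bool) \<Rightarrow> complex set set" where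
  "leaves P = {seg a b | a b. P a b}"

lemma thirds_pos: "h \<in> {1/3, 2/3} \<Longrightarrow> pos a (a + h) = h"
  by (auto simp: pos_self_add)

lemma third_image: "h \<in> {1/3, 2/3} \<Longrightarrow> pos (3 * (a + h)) (3 * a) = 0"
proof -
  assume "h \<in> {1/3, 2/3}"
  then have "3 * h = 1 \<or> 3 * h = 2" by auto
  then have "3 * a - 3 * (a + h) = -1 \<or> 3 * a - 3 * (a + h) = -2" by (auto simp: algebra_simps)
  then show ?thesis unfolding pos_eq0 by auto
qed

lemma seg_image_third: "h \<in> {1/3, 2/3} \<Longrightarrow> k \<in> {1/3, 2/3} \<Longrightarrow> chord_image (seg (a + h) (b + k)) = chord_image (seg a b)"
  unfolding seg_image by (intro seg_cong third_image)

text \<open>The ends of a sibling are shifts by thirds of the ends of \<open>seg a b\<close>.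
  Disjointness makes the two siblings use different thirds at each end, so only the pairing
  \<open>c\<close> is free. Conversely, leaves that do not cross and have distinct ends are
  disjoint.\<close>

lemma triple_iff:
  assumes L: "L \<subseteq> chords" "\<And>l m. l \<in> L \<Longrightarrow> m \<in> L \<Longrightarrow> \<not> crossing l m" and ab: "seg a b \<in> L" "pos (3 * a) (3 * b) \<noteq> 0"
  shows "sibling_triple L (seg a b) T \<longleftrightarrow>
    (\<exists>c\<in>{1/3, 2/3}. T = {seg a b, seg (a + 1/3) (b + c), seg (a + 2/3) (b + (1 - c))} \<and>
      seg (a + 1/3) (b + c) \<in> L \<and> seg (a + 2/3) (b + (1 - c)) \<in> L)"
  (is "_ \<longleftrightarrow> ?C")
proof
  assume s: "sibling_triple L (seg a b) T"
  have T: "seg a b \<in> T" "card T = 3" "T \<subseteq> L" "pairwise disjnt T" "\<forall>m\<in>T. chord_image m = chord_image (seg a b)"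
    using s unfolding sibling_triple_def by blast+
  have other: "\<exists>i\<in>{1/3, 2/3}. \<exists>j\<in>{1/3, 2/3}. m = seg (a + i) (b + j)" if m: "m \<in> T" "m \<noteq> seg a b" for m
  proof -
    have mL: "m \<in> L" "disjnt m (seg a b)" "chord_image m = chord_image (seg a b)"
      using T m pairwiseD[OF T(4) m(1) T(1) m(2)] by blast+
    obtain u' v' where uv': "m = seg u' v'" using L(1) mL(1) chord_seg by blast
    have "{ex (3 * u'), ex (3 * v')} = {ex (3 * a), ex (3 * b)}" using mL(3) unfolding uv' seg_image seg_eq .
    then have "ex (3 * u') = ex (3 * a) \<and> ex (3 * v') = ex (3 * b) \<or> ex (3 * v') = ex (3 * a) \<and> ex (3 * u') = ex (3 * b)"
      unfolding doubleton_eq_iff by blast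
    then obtain u v where uv: "m = seg u v" "ex (3 * u) = ex (3 * a)" "ex (3 * v) = ex (3 * b)"
      using uv' seg_commute[of u' v'] by blast
    have thr: "\<exists>i\<in>{1/3, 2/3}. pos t (s + i) = 0" if t: "ex (3 * t) = ex (3 * s)" "ex t \<noteq> ex s" for s t
    proof -
      have "pos s t = 0 \<or> pos s t = 1/3 \<or> pos s t = 2/3"
        by (rule third_of_triple) (use t(1) in \<open>simp add: ex_eq pos0_comm\<close>)
      moreover have "pos s t \<noteq> 0" using t(2) ex_eq pos0_comm by metis
      ultimately have "pos s t \<in> {1/3, 2/3}" by auto
      moreover have "pos t (s + pos s t) = 0"
        using pos0_of_eq[of s t "s + pos s t"] pos_self_add[OF pos_ge0 pos_lt1, of s s t] by simp
      ultimately show ?thesis by blast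
    qed
    have ends: "ex u \<in> m" "ex v \<in> m" "ex a \<in> seg a b" "ex b \<in> seg a b" unfolding uv(1) seg_def by simp_all
    have "ex u \<noteq> ex a" "ex v \<noteq> ex b" using ends mL(2) unfolding disjnt_iff by metis+
    then obtain i j where ij: "i \<in> {1/3, 2/3}" "j \<in> {1/3, 2/3}" "pos u (a + i) = 0" "pos v (b + j) = 0"
      using thr[OF uv(2)] thr[OF uv(3)] by blast
    then have "m = seg (a + i) (b + j)" unfolding uv(1) by (intro seg_cong)
    then show ?thesis using ij by blast
  qed
  have "card (T - {seg a b}) = 2" using T by (simp add: card_Diff_singleton)
  then obtain m n where mn: "T - {seg a b} = {m, n}" "m \<noteq> n" unfolding card_2_iff by blast
  then have mT: "m \<in> T" "n \<in> T" "m \<noteq> seg a b" "n \<noteq> seg a b" by blast+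
  obtain i j where m: "i \<in> {1/3, 2/3}" "j \<in> {1/3, 2/3}" "m = seg (a + i) (b + j)" using other[OF mT(1,3)] by blast
  obtain k l where n: "k \<in> {1/3, 2/3}" "l \<in> {1/3, 2/3}" "n = seg (a + k) (b + l)" using other[OF mT(2,4)] by blast
  have dis: "disjnt m n" using pairwiseD[OF T(4) mT(1,2) mn(2)] .
  have "i \<noteq> k" "j \<noteq> l" using dis unfolding m n seg_def disjnt_iff by (metis ends_in_segment)+
  then have "i = 1/3 \<and> k = 2/3 \<and> l = 1 - j \<or> i = 2/3 \<and> k = 1/3 \<and> j = 1 - l" using m n by auto
  moreover have "T = {seg a b, m, n}" using mn T(1) by blast
  ultimately show ?C
  proof (elim disjE conjE)
    assume e: "i = 1/3" "k = 2/3" "l = 1 - j" and TT: "T = {seg a b, m, n}"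
    have "m \<in> L" "n \<in> L" using mT T(3) by blast+
    then show ?C using m(2) TT unfolding m(3) n(3) e by blast
  next
    assume e: "i = 2/3" "k = 1/3" "j = 1 - l" and TT: "T = {seg a b, m, n}"
    have "m \<in> L" "n \<in> L" using mT T(3) by blast+
    moreover have "T = {seg a b, n, m}" using TT by blast
    ultimately show ?C using n(2) unfolding m(3) n(3) e by blast
  qed
next
  assume "\<exists>c\<in>{1/3, 2/3}. T = {seg a b, seg (a + 1/3) (b + c), seg (a + 2/3) (b + (1 - c))} \<and>
      seg (a + 1/3) (b + c) \<in> L \<and> seg (a + 2/3) (b + (1 - c)) \<in> L"
  then obtain c where c: "c \<in> {1/3, 2/3}" and T: "T = {seg a b, seg (a + 1/3) (b + c), seg (a + 2/3) (b + (1 - c))}"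
    and cL: "seg (a + 1/3) (b + c) \<in> L" "seg (a + 2/3) (b + (1 - c)) \<in> L" by blast
  define f where "f = (\<lambda>k::nat. seg (a + real k / 3) (b + (if k = 0 then 0 else if k = 1 then c else 1 - c)))"
  have f: "f 0 = seg a b" "f 1 = seg (a + 1/3) (b + c)" "f 2 = seg (a + 2/3) (b + (1 - c))" unfolding f_def by simp_all
  have "pos a b \<noteq> 0 \<and> pos a b \<noteq> 1/3 \<and> pos a b \<noteq> 2/3" using ab(2) unfolding pos_triple by auto
  have D: "disjnt (seg u v) (seg u' v')"
    if "seg u v \<in> L" "seg u' v' \<in> L" "pos (3 * u) (3 * a) = 0" "pos (3 * u') (3 * a) = 0" "pos (3 * v) (3 * b) = 0" "pos (3 * v') (3 * b) = 0"
      "pos u u' \<noteq> 0" "pos v v' \<noteq> 0" for u v u' v'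
  proof -
    have x: "pos s t \<noteq> 0" if "pos (3 * s) (3 * a) = 0" "pos (3 * t) (3 * b) = 0" for s t
    proof
      assume "pos s t = 0"
      then have "pos (3 * s) (3 * t) = 0" using pos0_mult[of s t 1] by simp
      then show False using ab(2) pos_cong[OF that] by simp
    qed
    have "ex u \<noteq> ex v" "ex u' \<noteq> ex v'" "ex u \<noteq> ex v'" "ex u' \<noteq> ex v" "ex u \<noteq> ex u'" "ex v \<noteq> ex v'"
      unfolding ex_eq using x that by blast+
    moreover have "\<not> linked u v u' v'" using L(2)[OF that(1,2)] crossing_seg by blast
    ultimately show ?thesis by (subst disjnt_seg) auto
  qed
  have c': "1 - c \<in> {1/3, 2/3}" "c \<noteq> 1 - c" using c by auto
  note t = third_image[of "1/3" a, simplified] third_image[of "2/3" a, simplified] third_image[OF c, of b] third_image[OF c'(1), of b]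
  have 1: "pos a (a + 1/3) \<noteq> 0" "pos a (a + 2/3) \<noteq> 0" "pos b (b + c) \<noteq> 0" "pos b (b + (1 - c)) \<noteq> 0"
    using thirds_pos[of "1/3" a] thirds_pos[of "2/3" a] thirds_pos[OF c, of b] thirds_pos[OF c'(1), of b] c by auto
  have 2: "pos (a + 1/3) (a + 2/3) \<noteq> 0" "pos (b + c) (b + (1 - c)) \<noteq> 0"
    using pos_base[of "a + 1/3" "a + 2/3" a] pos_base[of "b + c" "b + (1 - c)" b]
      thirds_pos[of "1/3" a] thirds_pos[of "2/3" a] thirds_pos[OF c, of b] thirds_pos[OF c'(1), of b] c by (auto split: if_splits)
  have d: "disjnt (seg a b) (seg (a + 1/3) (b + c))" "disjnt (seg a b) (seg (a + 2/3) (b + (1 - c)))"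
    "disjnt (seg (a + 1/3) (b + c)) (seg (a + 2/3) (b + (1 - c)))"
    by (rule D; use ab cL t 1 2 in simp)+
  have ne: "seg x y \<noteq> {}" for x y unfolding seg_def by auto
  have "seg a b \<noteq> seg (a + 1/3) (b + c)" "seg a b \<noteq> seg (a + 2/3) (b + (1 - c))" "seg (a + 1/3) (b + c) \<noteq> seg (a + 2/3) (b + (1 - c))"
    using d ne unfolding disjnt_def by (metis Int_absorb)+
  then have "card T = 3" unfolding T by simp
  moreover have "pairwise disjnt T" unfolding T pairwise_insert using d by (auto simp: disjnt_sym)
  moreover have "\<forall>m\<in>T. chord_image m = chord_image (seg a b)"
    unfolding T using seg_image_third[of "1/3" c a b] seg_image_third[of "2/3" "1 - c" a b] c c' by auto
  moreover have "T \<subseteq> L" "seg a b \<in> T" unfolding T using ab cL by auto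
  ultimately show "sibling_triple L (seg a b) T" unfolding sibling_triple_def by blast
qed

text \<open>Symmetric cubic laminations described by pairs of real lifts. Closedness is that of a
  subset of the plane; \<open>cong\<close> allows the lifts to be restricted to a compact
  square.\<close>

locale leaf_relation =
  fixes P :: "real \<Rightarrow> real \<Rightarrow> bool"
  assumes refl: "P a a"
    and sym: "P a b \<Longrightarrow> P b a"
    and cong: "pos a a' = 0 \<Longrightarrow> pos b b' = 0 \<Longrightarrow> P a b \<Longrightarrow> P a' b'"
    and unlinked: "P a b \<Longrightarrow> P c d \<Longrightarrow> \<not> linked a b c d"
    and closed: "closed {(a, b). P a b}"
    and image: "P a b \<Longrightarrow> P (3 * a) (3 * b)"
    and half: "P a b \<Longrightarrow> P (a + 1/2) (b + 1/2)"
    and preimage: "P a b \<Longrightarrow> \<exists>a' b'. P a' b' \<and> pos (3 * a') a = 0 \<and> pos (3 * b') b = 0"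
    and siblings: "P a b \<Longrightarrow> pos (3 * a) (3 * b) \<noteq> 0 \<Longrightarrow> \<exists>c\<in>{1/3, 2/3}. P (a + 1/3) (b + c) \<and> P (a + 2/3) (b + (1 - c))"
begin

lemma seg_leaves: "seg a b \<in> leaves P \<longleftrightarrow> P a b"
proof
  assume "seg a b \<in> leaves P"
  then obtain u v where "P u v" "{ex a, ex b} = {ex u, ex v}" unfolding leaves_def seg_eq[symmetric] by blast
  then have "pos u a = 0 \<and> pos v b = 0 \<or> pos v a = 0 \<and> pos u b = 0" unfolding doubleton_eq_iff ex_eq using pos0_comm by metis
  then show "P a b" using cong[of u a v b] cong[of v a u b] sym \<open>P u v\<close> by blast
qed (auto simp: leaves_def)

lemma leavesE:
  assumes "l \<in> leaves P" obtains a b where "l = seg a b" "P a b"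
  using assms unfolding leaves_def by blast

lemma not_crossing: "l \<in> leaves P \<Longrightarrow> m \<in> leaves P \<Longrightarrow> \<not> crossing l m"
  by (elim leavesE) (simp add: crossing_seg unlinked)

lemma leaves_chords: "leaves P \<subseteq> chords"
  unfolding leaves_def using seg_chord by blast

text \<open>Every leaf has lifts in the unit square, so the union of the leaves is a continuous
  image of a compact set.\<close>

lemma closed_Union: "closed (\<Union>(leaves P))"
proof -
  let ?g = "\<lambda>((a, b), s). (1 - s) *\<^sub>R ex a + s *\<^sub>R ex b"
  let ?K = "({(a, b). P a b} \<inter> ({0..1} \<times> {0..1})) \<times> {0..1::real}"
  have "\<Union>(leaves P) = ?g ` ?K"
  proof (intro set_eqI iffI)
    fix z assume "z \<in> \<Union>(leaves P)"
    then obtain a b where ab: "P a b" "z \<in> seg a b" unfolding leaves_def by blast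
    have f: "pos a (frac a) = 0" "pos b (frac b) = 0" by (simp_all add: pos0_sym)
    have z: "z \<in> seg (frac a) (frac b)" using seg_cong[OF f] ab by simp
    then obtain s where "0 \<le> s" "s \<le> 1" "z = (1 - s) *\<^sub>R ex (frac a) + s *\<^sub>R ex (frac b)" unfolding seg_def in_segment by blast
    moreover have "P (frac a) (frac b)" using cong[OF f ab(1)] .
    ultimately show "z \<in> ?g ` ?K"
      by (intro image_eqI[of _ _ "((frac a, frac b), s)"]) (auto simp: frac_lt_1 less_imp_le)
  next
    fix z assume "z \<in> ?g ` ?K"
    then obtain a b s where ab: "P a b" and s: "0 \<le> s" "s \<le> 1" "z = (1 - s) *\<^sub>R ex a + s *\<^sub>R ex b" by auto
    have "z \<in> seg a b" unfolding seg_def in_segment using s by (intro exI[of _ s]) simp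
    moreover have "seg a b \<in> leaves P" using ab by (simp add: seg_leaves)
    ultimately show "z \<in> \<Union>(leaves P)" by (rule UnionI[rotated])
  qed
  moreover have "compact ?K" by (intro compact_Times closed_Int_compact closed compact_Icc)
  moreover have "continuous_on ?K ?g"
    unfolding ex_def case_prod_beta by (intro continuous_intros)
  ultimately show ?thesis using compact_imp_closed[OF compact_continuous_image[of ?K ?g]] by simp
qed

lemma lamination_leaves: "lamination (leaves P)"
  unfolding lamination_def
proof (intro conjI ballI leaves_chords not_crossing closed_Union)
  fix x assume "x \<in> circle"
  then obtain t where "x = ex t" by (rule ex_surj)
  then show "{x} \<in> leaves P" using seg_leaves[of t t] refl seg_self by metis
qed

lemma triple_leaves:
  assumes "P a b" "pos (3 * a) (3 * b) \<noteq> 0"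
  shows "sibling_triple (leaves P) (seg a b) T \<longleftrightarrow>
    (\<exists>c\<in>{1/3, 2/3}. T = {seg a b, seg (a + 1/3) (b + c), seg (a + 2/3) (b + (1 - c))} \<and>
      P (a + 1/3) (b + c) \<and> P (a + 2/3) (b + (1 - c)))"
  using triple_iff[OF leaves_chords not_crossing, of a b T] assms unfolding seg_leaves by blast

lemma symmetric_cubic_leaves: "symmetric_cubic_lamination (leaves P)"
  unfolding symmetric_cubic_lamination_def cubic_lamination_def
proof (intro conjI ballI lamination_leaves impI)
  fix l assume "l \<in> leaves P"
  then obtain a b where l: "l = seg a b" and P: "P a b" by (rule leavesE)
  show "chord_image l \<in> leaves P \<or> degenerate (chord_image l)" unfolding l seg_image seg_leaves using image[OF P] by blast
  show "\<exists>l'\<in>leaves P. chord_image l' = l"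
  proof -
    obtain a' b' where "P a' b'" "pos (3 * a') a = 0" "pos (3 * b') b = 0" using preimage[OF P] by blast
    then show ?thesis by (intro bexI[of _ "seg a' b'"]) (simp_all add: seg_leaves seg_image l seg_cong)
  qed
  show "uminus ` l \<in> leaves P" unfolding l seg_minus seg_leaves by (rule half[OF P])
  assume "\<not> degenerate (chord_image l)"
  then have n: "pos (3 * a) (3 * b) \<noteq> 0" unfolding l seg_image seg_degenerate .
  show "\<exists>T. sibling_triple (leaves P) l T" using siblings[OF P n] unfolding l triple_leaves[OF P n] by blast
qed

section \<open>Majors and comajors in terms of the deviation from one third\<close>

definition dev :: "real \<Rightarrow> real \<Rightarrow> real" where "dev a b = \<bar>min (pos a b) (1 - pos a b) - 1/3\<bar>"

lemma major_leaves:
  "major (leaves P) (seg a b) \<longleftrightarrow> P a b \<and> pos a b \<noteq> 0 \<and> (\<forall>u v. P u v \<longrightarrow> pos u v \<noteq> 0 \<longrightarrow> dev a b \<le> dev u v)"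
proof -
  have "major (leaves P) (seg a b) \<longleftrightarrow> P a b \<and> pos a b \<noteq> 0 \<and> (\<forall>l\<in>leaves P. \<not> degenerate l \<longrightarrow> dev a b \<le> \<bar>chord_length l - 1/3\<bar>)"
    unfolding major_def is_arg_min_linorder seg_leaves seg_degenerate seg_length dev_def by blast
  also have "\<dots> \<longleftrightarrow> P a b \<and> pos a b \<noteq> 0 \<and> (\<forall>u v. P u v \<longrightarrow> pos u v \<noteq> 0 \<longrightarrow> dev a b \<le> dev u v)"
  proof -
    have "(\<forall>l\<in>leaves P. Q l) \<longleftrightarrow> (\<forall>u v. P u v \<longrightarrow> Q (seg u v))" for Q unfolding leaves_def by blast
    then show ?thesis by (simp add: seg_degenerate seg_length dev_def)
  qed
  finally show ?thesis .
qed

text \<open>The sibling choice \<open>c\<close> is forced on every non-critical major by \<open>u\<close>.\<close>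

lemma comajor_noncritical:
  assumes ab: "P a b" "pos a b \<noteq> 0" "dev a b \<noteq> 0" "\<And>u v. P u v \<Longrightarrow> pos u v \<noteq> 0 \<Longrightarrow> dev a b \<le> dev u v"
    and u: "\<And>u v c c'. P u v \<Longrightarrow> dev u v = dev a b \<Longrightarrow> c \<in> {1/3, 2/3} \<Longrightarrow> c' \<in> {1/3, 2/3} \<Longrightarrow>
        P (u + 1/3) (v + c) \<Longrightarrow> P (u + 2/3) (v + (1 - c)) \<Longrightarrow> P (u + 1/3) (v + c') \<Longrightarrow> P (u + 2/3) (v + (1 - c')) \<Longrightarrow> c' = c"
    and pq: "P (a + 1/3) (b + 2/3)" "P (a + 2/3) (b + 1/3)" "pos (a + 2/3) (b + 1/3) \<le> 1/6" "pos a b \<noteq> pos (a + 2/3) (b + 1/3)" "pos b a \<noteq> pos (a + 2/3) (b + 1/3)"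
  shows "comajor (leaves P) (seg (a + 2/3) (b + 1/3))"
proof -
  have M: "major (leaves P) (seg a b)" unfolding major_leaves using ab by blast
  have im: "pos (3 * u) (3 * v) \<noteq> 0" if "pos u v \<noteq> 0" "dev u v \<noteq> 0" for u v
    using that unfolding dev_def pos_triple by auto
  have ncrit: "critical (seg u v) \<longleftrightarrow> dev u v = 0" for u v unfolding critical_def seg_length dev_def by auto
  have "unique_major_triples (leaves P)"
    unfolding unique_major_triples_def
  proof (intro allI impI)
    fix l assume l: "major (leaves P) l \<and> \<not> critical l"
    then have "l \<in> leaves P" unfolding major_def is_arg_min_def by blast
    then obtain u v where uv: "l = seg u v" by (rule leavesE)
    have P: "P u v" "pos u v \<noteq> 0" "dev u v \<noteq> 0" "dev u v \<le> dev a b"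
      using l ab(1,2) unfolding uv major_leaves ncrit by blast+
    then have d: "dev u v = dev a b" using ab(4)[OF P(1,2)] by simp
    note n = im[OF P(2,3)]
    obtain c where c: "c \<in> {1/3, 2/3}" "P (u + 1/3) (v + c)" "P (u + 2/3) (v + (1 - c))" using siblings[OF P(1) n] by blast
    show "\<exists>!T. sibling_triple (leaves P) l T"
      unfolding uv triple_leaves[OF P(1) n]
    proof (rule ex1I[of _ "{seg u v, seg (u + 1/3) (v + c), seg (u + 2/3) (v + (1 - c))}"])
      fix T assume "\<exists>c\<in>{1/3, 2/3}. T = {seg u v, seg (u + 1/3) (v + c), seg (u + 2/3) (v + (1 - c))} \<and>
        P (u + 1/3) (v + c) \<and> P (u + 2/3) (v + (1 - c))"
      then obtain c' where c': "c' \<in> {1/3, 2/3}" "T = {seg u v, seg (u + 1/3) (v + c'), seg (u + 2/3) (v + (1 - c'))}"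
        "P (u + 1/3) (v + c')" "P (u + 2/3) (v + (1 - c'))" by blast
      then have "c' = c" using u[OF P(1) d c(1) c'(1) c(2,3)] by blast
      then show "T = {seg u v, seg (u + 1/3) (v + c), seg (u + 2/3) (v + (1 - c))}" using c'(2) by simp
    qed (use c in blast)
  qed
  moreover have "sibling_triple (leaves P) (seg a b) {seg a b, seg (a + 1/3) (b + 2/3), seg (a + 2/3) (b + (1 - 2/3))}"
    unfolding triple_leaves[OF ab(1) im[OF ab(2,3)]] by (intro bexI[of _ "2/3"] conjI refl) (use pq in auto)
  moreover have "chord_length (seg (a + 2/3) (b + 1/3)) \<le> 1/6" unfolding seg_length using pq(3) by simp
  moreover have "seg (a + 2/3) (b + 1/3) \<noteq> seg a b"
    unfolding seg_eq doubleton_eq_iff ex_eq using pos_cong[of "a + 2/3" a "b + 1/3" b] pos_cong[of "a + 2/3" b "b + 1/3" a] pq by metis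
  moreover have "\<not> critical (seg a b)" using ab(3) ncrit by blast
  ultimately show ?thesis unfolding comajor_def using M by (intro conjI exI[of _ "seg a b"]) auto
qed

text \<open>A leaf of deviation 0 makes all majors critical, so the condition on unique triples
  holds vacuously.\<close>

lemma comajor_critical:
  assumes "P (x + 1/3) (x + 2/3)"
  shows "comajor (leaves P) {ex x}"
proof -
  have p: "pos (x + 1/3) (x + 2/3) = 1/3" by (intro pos_unique) simp_all
  have ncrit: "critical (seg u v) \<longleftrightarrow> dev u v = 0" for u v unfolding critical_def seg_length dev_def by auto
  have d: "dev (x + 1/3) (x + 2/3) = 0" unfolding dev_def p by simp
  have "0 \<le> dev u v" for u v unfolding dev_def by simp
  then have M: "major (leaves P) (seg (x + 1/3) (x + 2/3))" unfolding major_leaves d p using assms by simp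
  have "unique_major_triples (leaves P)"
    unfolding unique_major_triples_def
  proof (intro allI impI)
    fix l assume l: "major (leaves P) l \<and> \<not> critical l"
    then have "l \<in> leaves P" unfolding major_def is_arg_min_def by blast
    then obtain u v where uv: "l = seg u v" by (rule leavesE)
    have "dev u v \<le> 0" "dev u v \<noteq> 0" using l p d assms unfolding uv major_leaves ncrit by (metis zero_neq_one divide_eq_0_iff zero_neq_numeral)+
    then show "\<exists>!T. sibling_triple (leaves P) l T" using \<open>0 \<le> dev u v\<close> by simp
  qed
  moreover have "ex x \<notin> endpoints (seg (x + 1/3) (x + 2/3))"
    unfolding seg_endpoints using pos_self_add[of "1/3" x] pos_self_add[of "2/3" x] by (simp add: ex_eq)
  moreover have "chord_image {ex x} = chord_image (seg (x + 1/3) (x + 2/3))"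
    unfolding seg_self[symmetric] seg_image using third_image[of "1/3" x] third_image[of "2/3" x]
    by (intro seg_cong) (simp_all add: pos0_comm)
  moreover have "critical (seg (x + 1/3) (x + 2/3))" unfolding ncrit d ..
  ultimately show ?thesis unfolding comajor_def using M by (intro conjI exI[of _ "seg (x + 1/3) (x + 2/3)"]) auto
qed

end

section \<open>Degenerate comajors\<close>

lemma ex_continuous [continuous_intros]: "continuous_on S f \<Longrightarrow> continuous_on S (\<lambda>z. ex (f z))"
  unfolding ex_def by (intro continuous_intros)

lemma closed_unlinked: "closed {(a, b). \<not> linked a b c d}" "closed {(c, d). \<not> linked a b c d}"
  unfolding linked_sin not_less case_prod_beta by (intro closed_Collect_le continuous_intros)+

lemma closed_pos0: "closed {(a, b). pos (3 * a) (3 * b) = 0}"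
  unfolding ex_eq[symmetric] case_prod_beta by (intro closed_Collect_eq continuous_intros)

lemma third_preimage:
  assumes "pos (3 * a') a = 0"
  shows "\<exists>k\<in>{0, 1, 2}. pos a' ((a + k) / 3) = 0"
proof -
  obtain m :: int where m: "a - 3 * a' = of_int m" using assms unfolding pos_eq0 by (elim Ints_cases)
  define r where "r = (- m) mod 3"
  have r: "r \<in> {0, 1, 2}" unfolding r_def by auto
  have "(m + r) mod 3 = 0" unfolding r_def by (simp add: mod_simps)
  then obtain q where q: "m + r = 3 * q" by auto
  have "real_of_int m + of_int r = 3 * of_int q" using arg_cong[OF q, of real_of_int] by simp
  then have "(a + of_int r) / 3 - a' = of_int q" using m by (simp add: field_simps)
  then have "pos a' ((a + of_int r) / 3) = 0" unfolding pos_eq0 by simp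
  then show ?thesis using r by auto
qed

section \<open>Passing from a relation to its closure\<close>

locale pre_leaf_relation =
  fixes P :: "real \<Rightarrow> real \<Rightarrow> bool"
  assumes refl: "P a a"
    and sym: "P a b \<Longrightarrow> P b a"
    and cong: "pos a a' = 0 \<Longrightarrow> pos b b' = 0 \<Longrightarrow> P a b \<Longrightarrow> P a' b'"
    and unlinked: "P a b \<Longrightarrow> P c d \<Longrightarrow> \<not> linked a b c d"
    and image: "P a b \<Longrightarrow> P (3 * a) (3 * b)"
    and half: "P a b \<Longrightarrow> P (a + 1/2) (b + 1/2)"
    and preimage: "P a b \<Longrightarrow> \<exists>a' b'. P a' b' \<and> pos (3 * a') a = 0 \<and> pos (3 * b') b = 0"
    and siblings: "P a b \<Longrightarrow> pos (3 * a) (3 * b) \<noteq> 0 \<Longrightarrow> \<exists>c\<in>{1/3, 2/3}. P (a + 1/3) (b + c) \<and> P (a + 2/3) (b + (1 - c))"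
begin

abbreviation C where "C \<equiv> closure {(a, b). P a b}"

text \<open>Each property defines a closed set. For the existence statements the witnesses come from
  finite lists, three preimages of each end and two sibling pairings, so the sets are finite unions
  of closed ones. Pairs with equal images are added in the sibling condition, because a limit may
  have a degenerate image.\<close>

lemma closure_leaf_relation: "leaf_relation (\<lambda>a b. (a, b) \<in> C)"
proof
  have sub: "(a, b) \<in> C" if "P a b" for a b using that closure_subset by fastforce
  have vim: "closed {z. f z \<in> C}" if "continuous_on UNIV f" for f :: "real \<times> real \<Rightarrow> real \<times> real"
    using closed_vimage[OF closed_closure that, of "{(a, b). P a b}"] by (simp add: vimage_def)
  have ext: "z \<in> T" if "z \<in> C" "closed T" "\<And>a b. P a b \<Longrightarrow> (a, b) \<in> T" for z T
    using closure_minimal[of "{(a, b). P a b}" T] that by blast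
  have map: "f z \<in> C" if "z \<in> C" "continuous_on UNIV f" "\<And>a b. P a b \<Longrightarrow> case f (a, b) of (c, d) \<Rightarrow> P c d" for f z
    using ext[OF that(1) vim[OF that(2)]] that(3) sub by (fastforce split: prod.splits)
  show "(a, a) \<in> C" for a using sub refl by blast
  show "(b, a) \<in> C" if "(a, b) \<in> C" for a b
    using map[OF that, of "\<lambda>z. (snd z, fst z)"] sym by (simp add: continuous_intros)
  show "(a', b') \<in> C" if "pos a a' = 0" "pos b b' = 0" "(a, b) \<in> C" for a b a' b'
  proof -
    have "P (u + (a' - a)) (v + (b' - b))" if "P u v" for u v
      by (rule cong[OF _ _ that]) (use \<open>pos a a' = 0\<close> \<open>pos b b' = 0\<close> in \<open>simp_all add: pos_eq0\<close>)
    then show ?thesis using map[OF that(3), of "\<lambda>z. (fst z + (a' - a), snd z + (b' - b))"] by (simp add: continuous_intros)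
  qed
  show "\<not> linked a b c d" if "(a, b) \<in> C" "(c, d) \<in> C" for a b c d
  proof -
    have "\<not> linked u v c d" if "P u v" for u v
      using ext[OF \<open>(c, d) \<in> C\<close> closed_unlinked(2)[of u v]] unlinked[OF that] by simp
    then show ?thesis using ext[OF that(1) closed_unlinked(1)[of c d]] by simp
  qed
  show "closed {(a, b). (a, b) \<in> C}" by simp
  show "(3 * a, 3 * b) \<in> C" if "(a, b) \<in> C" for a b
    using map[OF that, of "\<lambda>z. (3 * fst z, 3 * snd z)"] image by (simp add: continuous_intros)
  show "(a + 1/2, b + 1/2) \<in> C" if "(a, b) \<in> C" for a b
    using map[OF that, of "\<lambda>z. (fst z + 1/2, snd z + 1/2)"] half by (simp add: continuous_intros)
  show "\<exists>a' b'. (a', b') \<in> C \<and> pos (3 * a') a = 0 \<and> pos (3 * b') b = 0" if "(a, b) \<in> C" for a b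
  proof -
    let ?T = "\<Union>k\<in>{0, 1, 2}. \<Union>l\<in>{0, 1, 2}. {z. ((fst z + k) / 3, (snd z + l) / 3) \<in> C}"
    have "closed ?T" by (auto intro!: closed_Un vim continuous_intros)
    moreover have "(u, v) \<in> ?T" if uv: "P u v" for u v
    proof -
      obtain u' v' where u': "P u' v'" "pos (3 * u') u = 0" "pos (3 * v') v = 0" using preimage[OF uv] by blast
      obtain k where k: "k \<in> {0, 1, 2}" "pos u' ((u + k) / 3) = 0" using third_preimage[OF u'(2)] by blast
      obtain l where l: "l \<in> {0, 1, 2}" "pos v' ((v + l) / 3) = 0" using third_preimage[OF u'(3)] by blast
      have "((u + k) / 3, (v + l) / 3) \<in> C" using sub[OF cong[OF k(2) l(2) u'(1)]] .
      then show ?thesis using k(1) l(1) by fastforce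
    qed
    ultimately have "(a, b) \<in> ?T" using ext[OF that] by blast
    then obtain k l where k: "k \<in> {0, 1, 2}" "l \<in> {0, 1, 2}" "((a + k) / 3, (b + l) / 3) \<in> C"
      unfolding UN_iff mem_Collect_eq fst_conv snd_conv by blast
    have p: "pos (3 * ((s + k) / 3)) s = 0" if "k \<in> {0, 1, 2}" for s k :: real
    proof -
      have "k \<in> \<int>" using that by auto
      moreover have "s - 3 * ((s + k) / 3) = - k" by (simp add: field_simps)
      ultimately show ?thesis unfolding pos_eq0 by simp
    qed
    show ?thesis using k(3) p[OF k(1)] p[OF k(2)] by (intro exI[of _ "(a + k) / 3"] exI[of _ "(b + l) / 3"] conjI)
  qed
  show "\<exists>c\<in>{1/3, 2/3}. (a + 1/3, b + c) \<in> C \<and> (a + 2/3, b + (1 - c)) \<in> C" if "(a, b) \<in> C" "pos (3 * a) (3 * b) \<noteq> 0" for a b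
  proof -
    let ?T = "{(a, b). pos (3 * a) (3 * b) = 0} \<union> (\<Union>c\<in>{1/3, 2/3}.
      {z. (fst z + 1/3, snd z + c) \<in> C} \<inter> {z. (fst z + 2/3, snd z + (1 - c)) \<in> C})"
    have "closed ?T" by (auto intro!: closed_Un closed_Int closed_pos0 vim continuous_intros)
    moreover have "(u, v) \<in> ?T" if uv: "P u v" for u v
    proof (cases "pos (3 * u) (3 * v) = 0")
      case False
      then obtain c where "c \<in> {1/3, 2/3}" "(u + 1/3, v + c) \<in> C" "(u + 2/3, v + (1 - c)) \<in> C" using siblings[OF uv] sub by blast
      then show ?thesis unfolding Un_iff UN_iff Int_iff mem_Collect_eq fst_conv snd_conv by blast
    qed simp
    ultimately have "(a, b) \<in> ?T" using ext[OF that(1)] by blast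
    then show ?thesis using that(2) unfolding Un_iff UN_iff Int_iff mem_Collect_eq fst_conv snd_conv case_prod_conv by blast
  qed
qed

end

lemma linked_interval:
  assumes "linked a b c d" "pos x a = s \<and> pos x b = r \<or> pos x a = r \<and> pos x b = s" "s < r"
  shows "(s < pos x c \<and> pos x c < r \<and> (pos x d < s \<or> r < pos x d)) \<or> (s < pos x d \<and> pos x d < r \<and> (pos x c < s \<or> r < pos x c))"
  using assms(2)
proof
  assume "pos x a = s \<and> pos x b = r"
  then show ?thesis using assms(1,3) unfolding linked_coord[of _ _ _ _ x] by argo
next
  assume "pos x a = r \<and> pos x b = s"
  then show ?thesis using assms(1,3) unfolding linked_coord[of _ _ _ _ x] by argo
qed

lemma sector_third: "i \<noteq> j \<Longrightarrow> i' \<noteq> j \<Longrightarrow> i' \<noteq> i \<Longrightarrow> k \<noteq> j \<Longrightarrow> k \<noteq> i \<Longrightarrow> k = (i'::sector)"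
  by (cases i; cases j; cases k; cases i') auto

text \<open>Half-open sectors, so that tripling maps each of them bijectively onto the circle.\<close>

fun hsec :: "sector \<Rightarrow> real \<Rightarrow> bool" where
  "hsec Near v \<longleftrightarrow> v < 1/6 \<or> 5/6 \<le> v"
| "hsec Far v \<longleftrightarrow> 1/3 \<le> v \<and> v < 2/3"
| "hsec Mid v \<longleftrightarrow> 1/6 \<le> v \<and> v < 1/3 \<or> 2/3 \<le> v \<and> v < 5/6"

section \<open>The lamination generated by two critical chords\<close>

locale critical_pair =
  fixes x :: real
begin

definition H :: "sector \<Rightarrow> real \<Rightarrow> bool" where "H j t \<longleftrightarrow> hsec j (pos x t)"

text \<open>Besides the points, the critical chord whose ends have the same image as
  \<open>x\<close>, and its half turn.\<close>

definition S :: "real \<Rightarrow> real \<Rightarrow> bool" where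
  "S a b \<longleftrightarrow> pos a b = 0 \<or> pos x a = 1/3 \<and> pos x b = 2/3 \<or> pos x a = 2/3 \<and> pos x b = 1/3
     \<or> pos x a = 5/6 \<and> pos x b = 1/6 \<or> pos x a = 1/6 \<and> pos x b = 5/6"

text \<open>Pullbacks through one sector at both ends. As tripling is bijective on a half-open
  sector, each chord has exactly one pullback per sector.\<close>

inductive Lam :: "real \<Rightarrow> real \<Rightarrow> bool" where
  base: "S a b \<Longrightarrow> Lam a b"
| lift: "H j a \<Longrightarrow> H j b \<Longrightarrow> Lam (3 * a) (3 * b) \<Longrightarrow> Lam a b"

lemma H_K: "H j t \<Longrightarrow> K x 0 j t"
  unfolding H_def K_def by (cases j) auto

lemma H_ex: "\<exists>j. H j t"
proof -
  have "H Near t \<or> H Far t \<or> H Mid t" unfolding H_def by auto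
  then show ?thesis by blast
qed

lemma H_unique: "H i t \<Longrightarrow> H j t \<Longrightarrow> i = j"
  unfolding H_def by (cases i; cases j) auto

lemma H_cong: "pos a b = 0 \<Longrightarrow> H j a \<longleftrightarrow> H j b"
  unfolding H_def using pos_cong[OF pos_self] by metis

lemma H_half: "H j t \<Longrightarrow> H (flip j) (t + 1/2)"
  unfolding H_def using pos_add_right[of "1/2" x t] pos_ge0[of x t] pos_lt1[of x t]
  by (cases j) (auto split: if_splits)

lemma H_inj: "H j a \<Longrightarrow> H j b \<Longrightarrow> pos (3 * a) (3 * b) = 0 \<Longrightarrow> pos a b = 0"
proof -
  assume *: "H j a" "H j b" "pos (3 * a) (3 * b) = 0"
  have "pos a b = 0 \<or> pos a b = 1/3 \<or> pos a b = 2/3" by (rule third_of_triple[OF pos0_sym[OF *(3)]])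
  then show ?thesis using *(1,2) pos_base[of a b x] pos_ge0[of x a] pos_lt1[of x a] pos_ge0[of x b] pos_lt1[of x b]
    unfolding H_def by (cases j) (auto split: if_splits)
qed

lemma H_lift: "\<exists>t'. H j t' \<and> pos (3 * t') t = 0"
proof -
  define v where "v = pos (3 * x) t"
  have v: "0 \<le> v" "v < 1" unfolding v_def by (simp_all add: pos_ge0 pos_lt1)
  have "\<exists>w. 0 \<le> w \<and> w < 1 \<and> hsec j w \<and> 3 * w - v \<in> \<int>"
  proof (cases j)
    case Near
    show ?thesis
    proof (cases "v < 1/2")
      case True then show ?thesis using Near v by (intro exI[of _ "v/3"]) auto
    next
      case False then show ?thesis using Near v by (intro exI[of _ "(v+2)/3"]) (auto simp: add_divide_distrib)
    qed
  next
    case Far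
    then show ?thesis by (intro exI[of _ "(v+1)/3"]) (use v in \<open>simp add: add_divide_distrib\<close>)
  next
    case Mid
    show ?thesis
    proof (cases "v < 1/2")
      case True then show ?thesis using Mid v by (intro exI[of _ "(v+2)/3"]) (auto simp: add_divide_distrib)
    next
      case False then show ?thesis using Mid v by (intro exI[of _ "v/3"]) auto
    qed
  qed
  then obtain w where w: "0 \<le> w" "w < 1" "hsec j w" "3 * w - v \<in> \<int>" by blast
  have "H j (x + w)" unfolding H_def using pos_self_add[OF w(1,2)] w(3) by simp
  moreover have "t - 3 * x - v \<in> \<int>" unfolding v_def by (rule pos_Ints)
  from Ints_diff[OF this w(4)] have "pos (3 * (x + w)) t = 0" unfolding pos_eq0 by (simp add: algebra_simps)
  ultimately show ?thesis by blast
qed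

lemma S_cong: "pos a a' = 0 \<Longrightarrow> pos b b' = 0 \<Longrightarrow> S a b \<Longrightarrow> S a' b'"
  unfolding S_def using pos_cong[of a a' b b'] pos_cong[of x x a a'] pos_cong[of x x b b'] by simp

lemma S_sym: "S a b \<Longrightarrow> S b a"
  unfolding S_def using pos0_sym[of a b] by blast

lemma S_half: "S a b \<Longrightarrow> S (a + 1/2) (b + 1/2)"
proof -
  assume S: "S a b"
  have h: "pos x (t + 1/2) = (if pos x t < 1/2 then pos x t + 1/2 else pos x t - 1/2)" for t
    using pos_add_right[of "1/2" x t] by simp
  show ?thesis using S unfolding S_def h pos_shift by (elim disjE conjE) simp_all
qed

lemma S_image: "S a b \<Longrightarrow> pos (3 * a) (3 * b) = 0"
proof -
  assume S: "S a b"
  show ?thesis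
  proof (cases "pos a b = 0")
    case True
    then show ?thesis using pos0_mult[of a b 1] by simp
  next
    case False
    then have "pos (3 * x) (3 * a) = pos (3 * x) (3 * b)" using S unfolding S_def pos_triple[of x] by auto
    then show ?thesis by (rule pos0_of_eq)
  qed
qed

lemma S_unlinked_H: "S a b \<Longrightarrow> H j c \<Longrightarrow> H j d \<Longrightarrow> \<not> linked a b c d"
proof
  assume *: "S a b" "H j c" "H j d" and l: "linked a b c d"
  have "pos a b \<noteq> 0" using linked_distinct[OF l] by auto
  then have "(pos x a = 1/3 \<and> pos x b = 2/3 \<or> pos x a = 2/3 \<and> pos x b = 1/3) \<or> (pos x a = 1/6 \<and> pos x b = 5/6 \<or> pos x a = 5/6 \<and> pos x b = 1/6)"
    using *(1) unfolding S_def by blast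
  then show False
  proof
    assume "pos x a = 1/3 \<and> pos x b = 2/3 \<or> pos x a = 2/3 \<and> pos x b = 1/3"
    from linked_interval[OF l this] show False using *(2,3) unfolding H_def by (cases j) auto
  next
    assume "pos x a = 1/6 \<and> pos x b = 5/6 \<or> pos x a = 5/6 \<and> pos x b = 1/6"
    from linked_interval[OF l this] show False using *(2,3) unfolding H_def by (cases j) auto
  qed
qed

lemma S_unlinked: "S a b \<Longrightarrow> S c d \<Longrightarrow> \<not> linked a b c d"
proof
  assume *: "S a b" "S c d" and l: "linked a b c d"
  have "pos a b \<noteq> 0" "pos c d \<noteq> 0" using linked_distinct[OF l] by auto
  then have S': "(pos x a = 1/3 \<and> pos x b = 2/3 \<or> pos x a = 2/3 \<and> pos x b = 1/3) \<or> (pos x a = 1/6 \<and> pos x b = 5/6 \<or> pos x a = 5/6 \<and> pos x b = 1/6)"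
    and "(pos x c, pos x d) \<in> {(1/3, 2/3), (2/3, 1/3), (1/6, 5/6), (5/6, 1/6)}"
    using * unfolding S_def by blast+
  then show False using linked_interval[OF l, of x "1/3" "2/3"] linked_interval[OF l, of x "1/6" "5/6"] by auto
qed

lemma Lam_cong: "Lam a b \<Longrightarrow> pos a a' = 0 \<Longrightarrow> pos b b' = 0 \<Longrightarrow> Lam a' b'"
proof (induction arbitrary: a' b' rule: Lam.induct)
  case (base a b)
  then show ?case using S_cong Lam.base by blast
next
  case (lift j a b)
  have "pos (3 * a) (3 * a') = 0" "pos (3 * b) (3 * b') = 0" using pos0_mult[of _ _ 1] lift.prems by auto
  then have "Lam (3 * a') (3 * b')" by (rule lift.IH)
  then show ?case using Lam.lift[of j a' b'] H_cong lift by blast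
qed

lemma Lam_sym: "Lam a b \<Longrightarrow> Lam b a"
  by (induction rule: Lam.induct) (use Lam.intros S_sym in blast)+

lemma Lam_half: "Lam a b \<Longrightarrow> Lam (a + 1/2) (b + 1/2)"
proof (induction rule: Lam.induct)
  case (base a b)
  then show ?case using S_half Lam.base by blast
next
  case (lift j a b)
  have "pos (3 * t + 1/2) (3 * (t + 1/2)) = 0" for t unfolding pos_eq0 by (simp add: algebra_simps)
  then have "Lam (3 * (a + 1/2)) (3 * (b + 1/2))" using Lam_cong[OF lift.IH] by blast
  then show ?case using Lam.lift H_half lift by blast
qed

text \<open>Pullbacks in different sectors are separated, pullbacks in the same sector are unlinked
  because their images are, and no chord within a sector crosses the two critical chords.\<close>

lemma Lam_unlinked: "Lam a b \<Longrightarrow> Lam c d \<Longrightarrow> \<not> linked a b c d"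
proof (induction arbitrary: c d rule: Lam.induct)
  case (base a b)
  show ?case
    using base.prems
  proof (cases rule: Lam.cases)
    case base
    then show ?thesis using S_unlinked[OF \<open>S a b\<close>] by blast
  next
    case (lift j)
    then show ?thesis using S_unlinked_H[OF \<open>S a b\<close>] by blast
  qed
next
  case (lift j a b)
  show ?case
    using lift.prems
  proof (cases rule: Lam.cases)
    case base
    then show ?thesis using S_unlinked_H[of c d j a b] lift linked_sym by blast
  next
    case (lift i)
    show ?thesis
    proof
      assume l: "linked a b c d"
      have "j = i" using K_linked[OF _ _ _ _ _ l, of 0 x j i] H_K lift \<open>H j a\<close> \<open>H j b\<close> by simp
      then have H: "H j a" "H j b" "H j c" "H j d" using lift \<open>H j a\<close> \<open>H j b\<close> by simp_all
      have cyc: "cyc (3 * u) (3 * v) (3 * w)" if "cyc u v w" "H j u" "H j v" "H j w" for u v w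
      proof -
        have "pos (3 * u) (3 * v) \<noteq> 0" "pos (3 * v) (3 * w) \<noteq> 0" "pos (3 * u) (3 * w) \<noteq> 0"
          using H_inj that cyc_distinct[OF that(1)] by blast+
        then show ?thesis using K_order[of 0 x j u v w] H_K that by simp
      qed
      have "linked (3 * a) (3 * b) (3 * c) (3 * d)" using l cyc H unfolding linked_def by blast
      then show False using \<open>\<And>c d. Lam c d \<Longrightarrow> \<not> linked (3 * a) (3 * b) c d\<close> lift by blast
    qed
  qed
qed

lemma H_third: "H i t \<Longrightarrow> H j (t + h) \<Longrightarrow> h \<in> {1/3, 2/3} \<Longrightarrow> i \<noteq> j"
  using H_inj[of i t "t + h"] third_image[of h t] thirds_pos[of h t] pos0_comm by auto

text \<open>The shifts of \<open>a\<close> by thirds lie in the two other sectors, and so do the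
  shifts of \<open>b\<close>. The sectors determine the pairing.\<close>

lemma Lam_siblings:
  assumes L: "Lam a b" and n: "pos (3 * a) (3 * b) \<noteq> 0"
  shows "\<exists>c\<in>{1/3, 2/3}. Lam (a + 1/3) (b + c) \<and> Lam (a + 2/3) (b + (1 - c))"
proof -
  have "\<exists>j. H j a \<and> H j b \<and> Lam (3 * a) (3 * b)"
    using L
  proof (cases rule: Lam.cases)
    case base
    then show ?thesis using S_image n by blast
  qed blast
  then obtain j where j: "H j a" "H j b" "Lam (3 * a) (3 * b)" by blast
  obtain i k where i: "H i (a + 1/3)" "H k (a + 2/3)" using H_ex by blast
  have jk: "i \<noteq> j" "k \<noteq> j" using H_third[OF j(1) i(1)] H_third[OF j(1) i(2)] by auto
  have "a + 2/3 = (a + 1/3) + 1/3" by simp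
  then have "H k ((a + 1/3) + 1/3)" using i(2) by (rule subst)
  then have ik: "k \<noteq> i" using H_third[OF i(1), of k "1/3"] by auto
  obtain b' where b': "H i b'" "pos (3 * b') (3 * b) = 0" using H_lift by blast
  have "pos b b' = 0 \<or> pos b b' = 1/3 \<or> pos b b' = 2/3" by (rule third_of_triple[OF b'(2)])
  moreover have "pos b b' \<noteq> 0" using H_cong[of b b' i] b'(1) j(2) H_unique jk(1) by blast
  ultimately have c: "pos b b' \<in> {1/3, 2/3}" by auto
  define c where "c = pos b b'"
  have "pos b' (b + c) = 0" using pos0_of_eq[of b b' "b + c"] thirds_pos[OF c, of b] unfolding c_def by simp
  then have Hc: "H i (b + c)" using H_cong b'(1) by blast
  have c2: "c \<in> {1/3, 2/3}" "1 - c \<in> {1/3, 2/3}" using c unfolding c_def[symmetric] by auto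
  obtain i' where i': "H i' (b + (1 - c))" using H_ex by blast
  have "i' \<noteq> j" using H_third[OF j(2) i' c2(2)] by simp
  moreover have "i' \<noteq> i"
  proof
    assume "i' = i"
    then have "pos (b + c) (b + (1 - c)) = 0"
      using H_inj[of i "b + c" "b + (1 - c)"] i' Hc pos0_trans[OF third_image[OF c2(1), of b] pos0_sym[OF third_image[OF c2(2), of b]]] by simp
    moreover have "pos (b + c) (b + (1 - c)) \<noteq> 0"
      using pos_base[of "b + c" "b + (1 - c)" b] thirds_pos[OF c2(1), of b] thirds_pos[OF c2(2), of b] c2(1) by (auto split: if_splits)
    ultimately show False by simp
  qed
  ultimately have "k = i'" using sector_third jk ik by blast
  then have Hk: "H k (b + (1 - c))" using i' by simp
  have im: "Lam (3 * (a + s)) (3 * (b + t))" if "s \<in> {1/3, 2/3}" "t \<in> {1/3, 2/3}" for s t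
    using Lam_cong[OF j(3)] third_image[OF that(1), of a] third_image[OF that(2), of b] pos0_comm by blast
  have "Lam (a + 1/3) (b + c)" by (rule Lam.lift[OF i(1) Hc im]) (use c2 in simp_all)
  moreover have "Lam (a + 2/3) (b + (1 - c))" by (rule Lam.lift[OF i(2) Hk im]) (use c2 in simp_all)
  ultimately show ?thesis using c2 by blast
qed

sublocale pre_leaf_relation Lam
proof
  show "Lam a a" for a by (rule Lam.base) (simp add: S_def)
  show "Lam b a" if "Lam a b" for a b using that by (rule Lam_sym)
  show "Lam a' b'" if "pos a a' = 0" "pos b b' = 0" "Lam a b" for a b a' b' using Lam_cong that by blast
  show "\<not> linked a b c d" if "Lam a b" "Lam c d" for a b c d using that by (rule Lam_unlinked)
  show "Lam (3 * a) (3 * b)" if "Lam a b" for a b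
    using that
  proof (cases rule: Lam.cases)
    case base
    then show ?thesis using S_image Lam.base S_def by blast
  qed
  show "Lam (a + 1/2) (b + 1/2)" if "Lam a b" for a b using that by (rule Lam_half)
  show "\<exists>a' b'. Lam a' b' \<and> pos (3 * a') a = 0 \<and> pos (3 * b') b = 0" if "Lam a b" for a b
  proof -
    obtain a' b' where "H Far a'" "pos (3 * a') a = 0" "H Far b'" "pos (3 * b') b = 0" using H_lift by metis
    moreover have "Lam (3 * a') (3 * b')" using Lam_cong[OF that] calculation pos0_comm by blast
    ultimately show ?thesis using Lam.lift by blast
  qed
  show "\<exists>c\<in>{1/3, 2/3}. Lam (a + 1/3) (b + c) \<and> Lam (a + 2/3) (b + (1 - c))" if "Lam a b" "pos (3 * a) (3 * b) \<noteq> 0" for a b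
    using that by (rule Lam_siblings)
qed

lemma point_comajor: "{ex x} \<in> CsCL"
proof -
  interpret leaf_relation "\<lambda>a b. (a, b) \<in> C" by (rule closure_leaf_relation)
  have "S (x + 1/3) (x + 2/3)" unfolding S_def by (simp add: pos_self_add)
  then have "(x + 1/3, x + 2/3) \<in> C" using closure_subset Lam.base by fastforce
  then show ?thesis using comajor_critical[of x] symmetric_cubic_leaves unfolding CsCL_def by blast
qed

end

text \<open>Describes arcs by continuous functions of the lift, where \<open>pos\<close> itself
  jumps; closedness of the later constructions rests on this.\<close>

lemma arc_sin:
  assumes "0 \<le> s" "s < 1" "0 \<le> r" "r < 1"
  shows "sgn (sin (pi * (t - u - s)) * sin (pi * (t - u - r))) = sgn (pos u t - s) * sgn (pos u t - r)"
proof -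
  define v where "v = pos u t"
  have v: "0 \<le> v" "v < 1" unfolding v_def by (simp_all add: pos_ge0 pos_lt1)
  obtain k :: int where k: "t - u - v = of_int k" unfolding v_def using pos_Ints[of t u] by (elim Ints_cases)
  have 1: "sin (pi * (t - u - h)) = sin (pi * (v - h)) * cos (pi * of_int k)" for h
    using sin_shift_int[of "v - h" k] k by (simp add: algebra_simps)
  have 2: "sgn (sin (pi * h)) = sgn h" if "-1 < h" "h < 1" for h :: real
  proof -
    have pos: "0 < sin (pi * t)" if "0 < t" "t < 1" for t :: real using that by (intro sin_gt_zero) auto
    consider "h < 0" | "h = 0" | "0 < h" by linarith
    then show ?thesis by cases (use pos[of h] pos[of "- h"] that in auto)
  qed
  have "sin (pi * (t - u - s)) * sin (pi * (t - u - r)) = sin (pi * (v - s)) * sin (pi * (v - r)) * (cos (pi * of_int k) * cos (pi * of_int k))"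
    unfolding 1 by simp
  also have "\<dots> = sin (pi * (v - s)) * sin (pi * (v - r))" unfolding cos_int_sq by simp
  finally have eq: "sin (pi * (t - u - s)) * sin (pi * (t - u - r)) = sin (pi * (v - s)) * sin (pi * (v - r))" .
  have "sgn (sin (pi * (v - s))) = sgn (v - s)" "sgn (sin (pi * (v - r))) = sgn (v - r)"
    using 2 v assms by simp_all
  then show ?thesis unfolding eq v_def[symmetric] sgn_mult by (simp only:)
qed

lemma arc_inside:
  assumes "0 \<le> s" "s \<le> r" "r < 1"
  shows "s \<le> pos u t \<and> pos u t \<le> r \<longleftrightarrow> sin (pi * (t - u - s)) * sin (pi * (t - u - r)) \<le> 0"
proof -
  have A: "x \<le> 0 \<longleftrightarrow> sgn x \<le> 0" for x :: real by (simp add: sgn_real_def)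
  have B: "sgn a * sgn b \<le> 0 \<longleftrightarrow> 0 \<le> a \<and> b \<le> 0" if "b \<le> a" for a b :: real
    using that by (auto simp: sgn_real_def)
  have "sgn (sin (pi * (t - u - s)) * sin (pi * (t - u - r))) = sgn (pos u t - s) * sgn (pos u t - r)"
    by (rule arc_sin) (use assms in auto)
  then have "sin (pi * (t - u - s)) * sin (pi * (t - u - r)) \<le> 0 \<longleftrightarrow> sgn (pos u t - s) * sgn (pos u t - r) \<le> 0"
    using A[of "sin (pi * (t - u - s)) * sin (pi * (t - u - r))"] by (simp only:)
  also have "\<dots> \<longleftrightarrow> 0 \<le> pos u t - s \<and> pos u t - r \<le> 0" by (rule B) (use assms in simp)
  finally show ?thesis by auto
qed

lemma arc_outside:
  assumes "0 \<le> s" "s \<le> r" "r < 1"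
  shows "pos u t \<le> s \<or> r \<le> pos u t \<longleftrightarrow> 0 \<le> sin (pi * (t - u - s)) * sin (pi * (t - u - r))"
proof -
  have A: "0 \<le> x \<longleftrightarrow> 0 \<le> sgn x" for x :: real by (simp add: sgn_real_def)
  have B: "0 \<le> sgn a * sgn b \<longleftrightarrow> a \<le> 0 \<or> 0 \<le> b" if "b \<le> a" for a b :: real
    using that by (auto simp: sgn_real_def)
  have "sgn (sin (pi * (t - u - s)) * sin (pi * (t - u - r))) = sgn (pos u t - s) * sgn (pos u t - r)"
    by (rule arc_sin) (use assms in auto)
  then have "0 \<le> sin (pi * (t - u - s)) * sin (pi * (t - u - r)) \<longleftrightarrow> 0 \<le> sgn (pos u t - s) * sgn (pos u t - r)"
    using A[of "sin (pi * (t - u - s)) * sin (pi * (t - u - r))"] by (simp only:)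
  also have "\<dots> \<longleftrightarrow> pos u t - s \<le> 0 \<or> 0 \<le> pos u t - r" by (rule B) (use assms in simp)
  finally show ?thesis by auto
qed

lemma degenerate_CsCL: "y \<in> circle \<Longrightarrow> {y} \<in> CsCL"
  using critical_pair.point_comajor ex_surj by metis

section \<open>Comajors shorter than one sixth\<close>

context edge_strip
begin

lemma closed_inp: "closed {t. inp i t}"
proof (cases i)
  case (Sec j)
  show ?thesis
  proof (cases j)
    case Near
    have "inp i t \<longleftrightarrow> 0 \<le> sin (pi * (t - p - 1/6)) * sin (pi * (t - p - (e + 5/6)))" for t
      using arc_outside[of "1/6" "e + 5/6" p t] e Sec Near unfolding inp_def by simp
    then show ?thesis by (simp only:) (intro closed_Collect_le continuous_intros)
  next
    case Far
    have "inp i t \<longleftrightarrow> sin (pi * (t - p - (e + 1/3))) * sin (pi * (t - p - 2/3)) \<le> 0" for t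
      using arc_inside[of "e + 1/3" "2/3" p t] e Sec Far unfolding inp_def by simp
    then show ?thesis by (simp only:) (intro closed_Collect_le continuous_intros)
  next
    case Mid
    have "inp i t \<longleftrightarrow> sin (pi * (t - p - (e + 1/6))) * sin (pi * (t - p - 1/3)) \<le> 0 \<or>
        sin (pi * (t - p - (e + 2/3))) * sin (pi * (t - p - 5/6)) \<le> 0" for t
      using arc_inside[of "e + 1/6" "1/3" p t] arc_inside[of "e + 2/3" "5/6" p t] e Sec Mid unfolding inp_def by simp
    then show ?thesis by (simp only:) (intro closed_Collect_disj closed_Collect_le continuous_intros)
  qed
next
  case (Strip k)
  show ?thesis
  proof (cases "k = 1 \<or> k = 2 \<or> k = 4 \<or> k = 5")
    case True
    then have "real k / 6 + e < 1" using e by auto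
    then have "inp i t \<longleftrightarrow> sin (pi * (t - p - real k / 6)) * sin (pi * (t - p - (real k / 6 + e))) \<le> 0" for t
      using arc_inside[of "real k / 6" "real k / 6 + e" p t] e Strip True unfolding inp_def by auto
    then show ?thesis by (simp only:) (intro closed_Collect_le continuous_intros)
  next
    case False
    then have "{t. inp i t} = {}" using Strip unfolding inp_def by auto
    then show ?thesis by simp
  qed
qed

lemma closed_R: "closed {(a, b). R a b}"
proof -
  let ?I = "{Sec Near, Sec Far, Sec Mid, Strip 1, Strip 2, Strip 4, Strip 5}"
  have I: "i \<in> ?I" if "inp i t" for i t
  proof (cases i)
    case (Sec j) then show ?thesis by (cases j) auto
  next
    case (Strip k) then show ?thesis using strip_cases that by blast
  qed
  have "{(a, b). R a b} = (\<Inter>n. \<Union>i\<in>?I. {z. inp i (3 ^ n * fst z)} \<inter> {z. inp i (3 ^ n * snd z)})"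
    (is "_ = ?X")
  proof (intro set_eqI iffI)
    fix z :: "real \<times> real" assume "z \<in> {(a, b). R a b}"
    then have "R (fst z) (snd z)" by (simp add: case_prod_beta)
    then show "z \<in> ?X" unfolding R_def INT_iff UN_iff Int_iff mem_Collect_eq using I by blast
  next
    fix z :: "real \<times> real" assume z: "z \<in> ?X"
    then have "R (fst z) (snd z)" unfolding R_def INT_iff UN_iff Int_iff mem_Collect_eq by blast
    then show "z \<in> {(a, b). R a b}" by (simp add: case_prod_beta)
  qed
  moreover have cl: "closed {z. inp i (f z)}" if "continuous_on UNIV f" for i and f :: "real \<times> real \<Rightarrow> real"
    using closed_vimage[OF closed_inp that, of i] by (simp add: vimage_def)
  have "closed ?X"
    by (auto intro!: closed_INT closed_Un closed_Int cl continuous_intros)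
  ultimately show ?thesis by (simp only:)
qed

lemma closed_Lc: "closed {(a, b). Lc a b}"
proof -
  have "{(a, b). Lc a b} = {(a, b). R a b} \<inter> (\<Inter>z\<in>{(c, d). R c d}. {(a, b). \<not> linked a b (fst z) (snd z)})"
    unfolding Lc_def by fastforce
  also have "closed \<dots>" by (intro closed_Int closed_R closed_INT ballI closed_unlinked)
  finally show ?thesis .
qed

sublocale L: leaf_relation Lc
proof
  show "\<not> linked a b c d" if "Lc a b" "Lc c d" for a b c d using that unfolding Lc_def by blast
  show "Lc a' b'" if "pos a a' = 0" "pos b b' = 0" "Lc a b" for a b a' b' using that by (rule Lc_cong)
qed (use Lc_refl Lc_sym closed_Lc Lc_img Lc_half Lc_preimage Lc_siblings in auto)

lemma dev_values:
  assumes "L.dev u v = e"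
  shows "pos u v = 1/3 + e \<or> pos u v = 2/3 - e \<or> pos u v = 2/3 + e \<or> pos u v = 1/3 - e"
proof -
  have "\<bar>min (pos u v) (1 - pos u v) - 1/3\<bar> = e" using assms unfolding L.dev_def .
  then show ?thesis using e by (auto simp: min_def abs_if split: if_splits)
qed

text \<open>A leaf of length \<open>1/3 + e\<close> crosses its rotation by 1/3, one of length
  \<open>1/3 - e\<close> its rotation by 5/6, the half turn of the former. So the siblings of such a
  leaf are paired by \<open>c = 2/3\<close>, which gives the uniqueness of triples.\<close>

lemma no_rotation:
  assumes L: "Lc u v" "Lc (u + 1/3) (v + 1/3)" and d: "L.dev u v = e"
  shows False
proof -
  have L': "Lc (u + 5/6) (v + 5/6)" using Lc_half[OF L(2)] by (simp add: add.assoc)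
  have p: "pos u (u + 1/3) = 1/3" "pos u (u + 5/6) = 5/6" by (simp_all add: pos_self_add)
  have s: "pos u (v + 1/3) = (if pos u v < 2/3 then pos u v + 1/3 else pos u v - 2/3)"
    "pos u (v + 5/6) = (if pos u v < 1/6 then pos u v + 5/6 else pos u v - 1/6)"
    using pos_add_right[of "1/3" u v] pos_add_right[of "5/6" u v] by simp_all
  have "linked u v (u + 1/3) (v + 1/3) \<or> linked u v (u + 5/6) (v + 5/6)"
    using dev_values[OF d] e unfolding linked_base p s by (elim disjE) simp_all
  then show False using L.unlinked[OF L(1) L(2)] L.unlinked[OF L(1) L'] by blast
qed

lemma major_leaf: "Lc (p + 1/3) (q + 2/3)"
proof (rule Lc_pre[OF Lc_img[OF Lc_pq]])
  show "inp (Sec Mid) (p + 1/3)" unfolding inp_def using e by (simp add: pos_self_add)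
  have "pos p (q + 2/3) = e + 2/3" using pos_add_right[of "2/3" p q] e by simp
  then show "inp (Sec Mid) (q + 2/3)" unfolding inp_def using e by simp
qed (use third_image[of "1/3" p] third_image[of "2/3" q] in simp_all)

lemma seg_CsCL: "seg p q \<in> CsCL"
proof -
  \<comment> \<open>The ends of a major, of length \<open>1/3 + e\<close>; shifting them by 2/3 and
    1/3 leads back to \<open>p\<close> and \<open>q\<close>.\<close>
  let ?a = "p + 1/3" and ?b = "q + 2/3"
  have "pos p (q + 1/3) = e + 1/3" using pos_add_right[of "1/3" p q] e by simp
  moreover have "?b = (q + 1/3) + 1/3" by simp
  ultimately have pab: "pos ?a ?b = e + 1/3" using pos_shift[of p "1/3" "q + 1/3"] by (simp only:)
  have dab: "L.dev ?a ?b = e" unfolding L.dev_def pab using e by simp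
  have one: "pos s (s + 2/3 + 1/3) = 0" "pos s (s + 1/3 + 2/3) = 0" for s unfolding pos_eq0 by simp_all
  have pc: "pos (?a + 2/3) (?b + 1/3) = e" using pos_cong[OF one(2)[of p] one(1)[of q]] by simp
  have "pos (3 * ?a) (3 * ?b) \<noteq> 0" unfolding pos_triple pab using e by auto
  then obtain c where c: "c \<in> {1/3, 2/3}" "Lc (?a + 1/3) (?b + c)" "Lc (?a + 2/3) (?b + (1 - c))" using L.siblings[OF major_leaf] by blast
  have "c \<noteq> 1/3" using no_rotation[OF major_leaf _ dab] c(2) by blast
  then have c2: "c = 2/3" using c(1) by blast
  have "comajor (leaves Lc) (seg (?a + 2/3) (?b + 1/3))"
  proof (rule L.comajor_noncritical[OF major_leaf])
    show "pos ?a ?b \<noteq> 0" "L.dev ?a ?b \<noteq> 0" unfolding dab pab using e by simp_all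
    show "L.dev ?a ?b \<le> L.dev u v" if "Lc u v" "pos u v \<noteq> 0" for u v
    proof -
      have "e \<le> L.dev u v" using Lc_length[OF that(1)] e unfolding L.dev_def by (auto simp: min_def abs_if)
      then show ?thesis unfolding dab .
    qed
    show "Lc (?a + 1/3) (?b + 2/3)" "Lc (?a + 2/3) (?b + 1/3)" using c unfolding c2 by simp_all
    show "pos (?a + 2/3) (?b + 1/3) \<le> 1/6" "pos ?a ?b \<noteq> pos (?a + 2/3) (?b + 1/3)" unfolding pc pab using e by simp_all
    have "pos ?b ?a = 2/3 - e" using pos_swap[of ?b ?a] pab e by simp
    then show "pos ?b ?a \<noteq> pos (?a + 2/3) (?b + 1/3)" unfolding pc using e by simp
  next
    fix u v k k' :: real assume uv: "Lc u v" "L.dev u v = L.dev ?a ?b" and k: "k \<in> {1/3, 2/3}" "k' \<in> {1/3, 2/3}"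
      "Lc (u + 1/3) (v + k)" "Lc (u + 1/3) (v + k')"
    have "\<not> Lc (u + 1/3) (v + 1/3)" using no_rotation[OF uv(1)] uv(2) dab by auto
    then have "k \<noteq> 1/3" "k' \<noteq> 1/3" using k(3,4) by blast+
    then show "k' = k" using k(1,2) by blast
  qed
  moreover have "seg (?a + 2/3) (?b + 1/3) = seg p q"
    by (rule HOL.sym[OF seg_cong[OF one(2) one(1)]])
  ultimately show ?thesis unfolding CsCL_def using L.symmetric_cubic_leaves by auto
qed

end

section \<open>Comajors of length one sixth\<close>

text \<open>The condition says that \<open>3 * p\<close> is \<open>p + 1/3\<close> or
  \<open>p + 5/6\<close> modulo one, that is, tripling maps the diameter between these two points to
  itself. Modulo one there are four such \<open>p\<close>.\<close>

locale special =
  fixes p :: real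
  assumes special: "4 * p - 2/3 \<in> \<int>"
begin

definition D :: "real \<Rightarrow> real \<Rightarrow> bool" where
  "D a b \<longleftrightarrow> pos p a = 1/3 \<and> pos p b = 5/6 \<or> pos p a = 5/6 \<and> pos p b = 1/3"

text \<open>The siblings of the diameter \<open>D\<close>; the one at \<open>p\<close> becomes the
  comajor.\<close>

definition B :: "real \<Rightarrow> real \<Rightarrow> bool" where
  "B a b \<longleftrightarrow> pos p a = 0 \<and> pos p b = 1/6 \<or> pos p a = 1/6 \<and> pos p b = 0 \<or>
     pos p a = 1/2 \<and> pos p b = 2/3 \<or> pos p a = 2/3 \<and> pos p b = 1/2"

text \<open>The open arcs between the six preimages of the ends of \<open>D\<close>.\<close>

definition arc :: "nat \<Rightarrow> real \<Rightarrow> bool" where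
  "arc i t \<longleftrightarrow> real i / 6 < pos p t \<and> pos p t < (real i + 1) / 6"

inductive G :: "real \<Rightarrow> real \<Rightarrow> bool" where
  base: "B a b \<Longrightarrow> G a b"
| lift: "arc i a \<Longrightarrow> arc i b \<Longrightarrow> G (3 * a) (3 * b) \<Longrightarrow> G a b"

definition P :: "real \<Rightarrow> real \<Rightarrow> bool" where "P a b \<longleftrightarrow> pos a b = 0 \<or> D a b \<or> G a b"

lemma pos_p3: "pos p (3 * p) = 1/3 \<or> pos p (3 * p) = 5/6"
proof -
  obtain m :: int where m: "4 * p - 2/3 = of_int m" using special by (elim Ints_cases)
  show ?thesis
  proof (cases "even m")
    case True
    then obtain k where "m = 2 * k" by blast
    then have "3 * p - p - 1/3 = of_int k" using m by simp
    then have "pos p (3 * p) = 1/3" by (intro pos_unique) auto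
    then show ?thesis ..
  next
    case False
    then obtain k where "m = 2 * k + 1" using oddE by blast
    then have "3 * p - p - 5/6 = of_int k" using m by simp
    then have "pos p (3 * p) = 5/6" by (intro pos_unique) auto
    then show ?thesis ..
  qed
qed

lemma coord3: "(pos p (3 * p) = 1/3 \<and> pos (3 * p) t = (if 1/3 \<le> pos p t then pos p t - 1/3 else pos p t + 2/3)) \<or>
   (pos p (3 * p) = 5/6 \<and> pos (3 * p) t = (if 5/6 \<le> pos p t then pos p t - 5/6 else pos p t + 1/6))"
  using pos_p3 pos_base[of "3 * p" t p] by auto

lemma arc_index: "arc i t \<Longrightarrow> i = 0 \<or> i = 1 \<or> i = 2 \<or> i = 3 \<or> i = 4 \<or> i = 5"
proof -
  assume "arc i t"
  then have "real i < 6" using pos_lt1[of p t] unfolding arc_def by simp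
  then have "i < 6" by simp
  then show ?thesis by linarith
qed

lemma arc_cong: "pos a b = 0 \<Longrightarrow> arc i a \<longleftrightarrow> arc i b"
  unfolding arc_def using pos_cong[OF pos_self] by metis

lemma D_cong: "pos a a' = 0 \<Longrightarrow> pos b b' = 0 \<Longrightarrow> D a b \<Longrightarrow> D a' b'"
  unfolding D_def using pos_cong[of p p a a'] pos_cong[of p p b b'] by simp

lemma B_cong: "pos a a' = 0 \<Longrightarrow> pos b b' = 0 \<Longrightarrow> B a b \<Longrightarrow> B a' b'"
  unfolding B_def using pos_cong[of p p a a'] pos_cong[of p p b b'] by simp

lemma G_cong: "G a b \<Longrightarrow> pos a a' = 0 \<Longrightarrow> pos b b' = 0 \<Longrightarrow> G a' b'"
proof (induction arbitrary: a' b' rule: G.induct)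
  case (base a b)
  show ?case by (rule G.base[OF B_cong[OF base(2,3,1)]])
next
  case (lift i a b)
  have "pos (3 * a) (3 * a') = 0" "pos (3 * b) (3 * b') = 0" using pos0_mult[of _ _ 1] lift.prems by auto
  then have "G (3 * a') (3 * b')" by (rule lift.IH)
  then show ?case using G.lift[of i a' b'] arc_cong lift.prems lift.hyps by blast
qed

lemma G_sym: "G a b \<Longrightarrow> G b a"
proof (induction rule: G.induct)
  case (base a b)
  then have "B b a" unfolding B_def by blast
  then show ?case by (rule G.base)
next
  case (lift i a b)
  then show ?case using G.lift by blast
qed

lemma half_coord: "pos p (t + 1/2) = (if pos p t < 1/2 then pos p t + 1/2 else pos p t - 1/2)"
  using pos_add_right[of "1/2" p t] by simp

lemma arc_half: "arc i a \<Longrightarrow> arc (if i < 3 then i + 3 else i - 3) (a + 1/2)"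
proof -
  assume a: "arc i a"
  show ?thesis using arc_index[OF a] a unfolding arc_def half_coord by (elim disjE) simp_all
qed

lemma G_half: "G a b \<Longrightarrow> G (a + 1/2) (b + 1/2)"
proof (induction rule: G.induct)
  case (base a b)
  then have "B (a + 1/2) (b + 1/2)" unfolding B_def half_coord by (elim disjE conjE) simp_all
  then show ?case by (rule G.base)
next
  case (lift i a b)
  have "pos (3 * t + 1/2) (3 * (t + 1/2)) = 0" for t unfolding pos_eq0 by (simp add: algebra_simps)
  then have "G (3 * (a + 1/2)) (3 * (b + 1/2))" using G_cong[OF lift.IH] by blast
  then show ?case by (rule G.lift[OF arc_half[OF lift.hyps(1)] arc_half[OF lift.hyps(2)]])
qed

lemma G_side: "G a b \<Longrightarrow> (1/3 < pos p a \<and> pos p a < 5/6 \<and> 1/3 < pos p b \<and> pos p b < 5/6) \<or>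
   ((pos p a < 1/3 \<or> 5/6 < pos p a) \<and> (pos p b < 1/3 \<or> 5/6 < pos p b))"
proof (induction rule: G.induct)
  case (base a b)
  then show ?case unfolding B_def by (elim disjE conjE) simp_all
next
  case (lift i a b)
  then show ?case using arc_index[OF lift.hyps(1)] unfolding arc_def by (elim disjE) simp_all
qed

text \<open>The two sides of \<open>D\<close>, in the coordinate from its end \<open>3 * p\<close>.
  Tripling maps arcs with even index onto one side and arcs with odd index onto the other, so each
  chord of \<open>G\<close> can be pulled back again.\<close>

lemma G_half_plane: "G a b \<Longrightarrow> (0 < pos (3 * p) a \<and> pos (3 * p) a < 1/2 \<and> 0 < pos (3 * p) b \<and> pos (3 * p) b < 1/2) \<or>
   (1/2 < pos (3 * p) a \<and> 1/2 < pos (3 * p) b)"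
proof -
  assume "G a b"
  note s = G_side[OF this] pos_ge0[of p a] pos_lt1[of p a] pos_ge0[of p b] pos_lt1[of p b]
  from pos_p3 show ?thesis
  proof
    assume "pos p (3 * p) = 1/3"
    then have "pos (3 * p) t = (if 1/3 \<le> pos p t then pos p t - 1/3 else pos p t + 2/3)" for t using coord3[of t] by auto
    then show ?thesis using s by auto
  next
    assume "pos p (3 * p) = 5/6"
    then have "pos (3 * p) t = (if 5/6 \<le> pos p t then pos p t - 5/6 else pos p t + 1/6)" for t using coord3[of t] by auto
    then show ?thesis using s by auto
  qed
qed

lemma D_coord3: "D a b \<longleftrightarrow> pos (3 * p) a = 0 \<and> pos (3 * p) b = 1/2 \<or> pos (3 * p) a = 1/2 \<and> pos (3 * p) b = 0"
proof -
  note s = pos_ge0[of p a] pos_lt1[of p a] pos_ge0[of p b] pos_lt1[of p b]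
  from pos_p3 show ?thesis
  proof
    assume "pos p (3 * p) = 1/3"
    then have "pos (3 * p) t = (if 1/3 \<le> pos p t then pos p t - 1/3 else pos p t + 2/3)" for t using coord3[of t] by auto
    then show ?thesis using s unfolding D_def by auto
  next
    assume "pos p (3 * p) = 5/6"
    then have "pos (3 * p) t = (if 5/6 \<le> pos p t then pos p t - 5/6 else pos p t + 1/6)" for t using coord3[of t] by auto
    then show ?thesis using s unfolding D_def by auto
  qed
qed

lemma image_D: "D a b \<or> B a b \<Longrightarrow> D (3 * a) (3 * b)"
proof -
  assume "D a b \<or> B a b"
  then have "pos (3 * p) (3 * a) = 0 \<and> pos (3 * p) (3 * b) = 1/2 \<or> pos (3 * p) (3 * a) = 1/2 \<and> pos (3 * p) (3 * b) = 0"
    unfolding pos_triple[of p] D_def B_def by (elim disjE conjE) simp_all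
  then show ?thesis unfolding D_coord3 .
qed

text \<open>The integer by which tripling the coordinate must be corrected on each arc.\<close>

definition par :: "nat \<Rightarrow> real" where "par i = (if i < 2 then 0 else if i < 4 then 1 else 2)"

lemma arc_image: "arc i t \<Longrightarrow> pos (3 * p) (3 * t) = 3 * pos p t - par i"
proof -
  assume a: "arc i t"
  show ?thesis using arc_index[OF a] a unfolding arc_def pos_triple par_def by (elim disjE) simp_all
qed

lemma arc_lift:
  assumes i: "i = 0 \<or> i = 1 \<or> i = 2 \<or> i = 3 \<or> i = 4 \<or> i = 5"
    and w: "if even i then 0 < pos (3 * p) t \<and> pos (3 * p) t < 1/2 else 1/2 < pos (3 * p) t"
  shows "\<exists>t'. arc i t' \<and> pos (3 * t') t = 0"
proof -
  define v where "v = (pos (3 * p) t + par i) / 3"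
  have v: "real i / 6 < v \<and> v < (real i + 1) / 6" using i w pos_lt1[of "3 * p" t] unfolding v_def par_def by (elim disjE) simp_all
  have v01: "0 \<le> v" "v < 1" using v i by auto
  have "arc i (p + v)" unfolding arc_def using pos_self_add[OF v01, of p] v by simp
  moreover have "pos (3 * (p + v)) t = 0"
  proof -
    have "par i \<in> \<int>" unfolding par_def by simp
    from Ints_diff[OF pos_Ints[of t "3 * p"] this] have "t - 3 * p - pos (3 * p) t - par i \<in> \<int>" .
    moreover have "t - 3 * (p + v) = t - 3 * p - pos (3 * p) t - par i" unfolding v_def by (simp add: field_simps)
    ultimately show ?thesis unfolding pos_eq0 by (simp only:)
  qed
  ultimately show ?thesis by blast
qed

lemma G_unlinked: "G a b \<Longrightarrow> G c d \<Longrightarrow> \<not> linked a b c d"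
proof (induction arbitrary: c d rule: G.induct)
  case (base a b)
  show ?case
  proof
    assume l: "linked a b c d"
    have ab: "(pos p a = 0 \<and> pos p b = 1/6 \<or> pos p a = 1/6 \<and> pos p b = 0) \<or> (pos p a = 1/2 \<and> pos p b = 2/3 \<or> pos p a = 2/3 \<and> pos p b = 1/2)"
      using base.hyps unfolding B_def by blast
    have "(\<exists>i. arc i c \<and> arc i d) \<or> B c d" using base.prems by (cases rule: G.cases) blast+
    then show False
    proof
      assume "B c d"
      then have "(pos p c, pos p d) \<in> {(0, 1/6), (1/6, 0), (1/2, 2/3), (2/3, 1/2)}" unfolding B_def by blast
      then show False using ab linked_interval[OF l, of p 0 "1/6"] linked_interval[OF l, of p "1/2" "2/3"] by auto
    next
      assume "\<exists>i. arc i c \<and> arc i d"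
      then obtain i where i: "arc i c" "arc i d" by blast
      from ab show False
      proof
        assume "pos p a = 0 \<and> pos p b = 1/6 \<or> pos p a = 1/6 \<and> pos p b = 0"
        from linked_interval[OF l this] show False using arc_index[OF i(1)] i unfolding arc_def by (elim disjE) simp_all
      next
        assume "pos p a = 1/2 \<and> pos p b = 2/3 \<or> pos p a = 2/3 \<and> pos p b = 1/2"
        from linked_interval[OF l this] show False using arc_index[OF i(1)] i unfolding arc_def by (elim disjE) simp_all
      qed
    qed
  qed
next
  case (lift i a b)
  note ab = lift.hyps(1,2) and IH = lift.IH
  show ?case
    using lift.prems
  proof (cases rule: G.cases)
    case base
    show ?thesis
    proof
      assume "linked a b c d"
      then have l: "linked c d a b" by (rule linked_sym)
      have "(pos p c = 0 \<and> pos p d = 1/6 \<or> pos p c = 1/6 \<and> pos p d = 0) \<or> (pos p c = 1/2 \<and> pos p d = 2/3 \<or> pos p c = 2/3 \<and> pos p d = 1/2)"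
        using base unfolding B_def by blast
      then show False
      proof
        assume "pos p c = 0 \<and> pos p d = 1/6 \<or> pos p c = 1/6 \<and> pos p d = 0"
        from linked_interval[OF l this] show False using arc_index[OF ab(1)] ab unfolding arc_def by (elim disjE) simp_all
      next
        assume "pos p c = 1/2 \<and> pos p d = 2/3 \<or> pos p c = 2/3 \<and> pos p d = 1/2"
        from linked_interval[OF l this] show False using arc_index[OF ab(1)] ab unfolding arc_def by (elim disjE) simp_all
      qed
    qed
  next
    case (lift j)
    show ?thesis
    proof
      assume l: "linked a b c d"
      show False
      proof (cases "i = j")
        case True
        have im: "pos (3 * p) (3 * t) = 3 * pos p t - par i" if "arc i t" for t using arc_image[OF that] .
        have "linked (3 * a) (3 * b) (3 * c) (3 * d)"
          using l lift(1,2) ab unfolding linked_coord[of "3 * a" _ _ _ "3 * p"] linked_coord[of a _ _ _ p] True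
          by (simp add: arc_image)
        then show False using IH[OF lift(3)] by blast
      next
        case False
        then consider "real i + 1 \<le> real j" | "real j + 1 \<le> real i" by linarith
        then show False
        proof cases
          case 1
          then have "(real i + 1) / 6 \<le> real j / 6" by simp
          then show False using l ab lift(1,2) unfolding linked_coord[of a _ _ _ p] arc_def by argo
        next
          case 2
          then have "(real j + 1) / 6 \<le> real i / 6" by simp
          then show False using l ab lift(1,2) unfolding linked_coord[of a _ _ _ p] arc_def by argo
        qed
      qed
    qed
  qed
qed

lemma D_unlinked: "D a b \<Longrightarrow> D c d \<or> G c d \<Longrightarrow> \<not> linked a b c d"
proof
  assume D: "D a b" and c: "D c d \<or> G c d" and l: "linked a b c d"
  have "pos p a = 1/3 \<and> pos p b = 5/6 \<or> pos p a = 5/6 \<and> pos p b = 1/3" using D unfolding D_def .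
  from linked_interval[OF l this] have i: "(1/3 < pos p c \<and> pos p c < 5/6 \<and> (pos p d < 1/3 \<or> 5/6 < pos p d)) \<or>
      (1/3 < pos p d \<and> pos p d < 5/6 \<and> (pos p c < 1/3 \<or> 5/6 < pos p c))" by simp
  from c show False
  proof
    assume "D c d" then show False using i unfolding D_def by auto
  next
    assume "G c d" then show False using i G_side[of c d] by auto
  qed
qed

lemma third_coord: "pos p (t + 1/3) = (if pos p t < 2/3 then pos p t + 1/3 else pos p t - 2/3)"
  "pos p (t + 2/3) = (if pos p t < 1/3 then pos p t + 2/3 else pos p t - 1/3)"
  using pos_add_right[of "1/3" p t] pos_add_right[of "2/3" p t] by simp_all

lemma arc_third: "arc i t \<Longrightarrow> arc (if i < 4 then i + 2 else i - 4) (t + 1/3)"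
  "arc i t \<Longrightarrow> arc (if i < 2 then i + 4 else i - 2) (t + 2/3)"
proof -
  assume a: "arc i t"
  show "arc (if i < 4 then i + 2 else i - 4) (t + 1/3)" using arc_index[OF a] a unfolding arc_def third_coord by (elim disjE) simp_all
  show "arc (if i < 2 then i + 4 else i - 2) (t + 2/3)" using arc_index[OF a] a unfolding arc_def third_coord by (elim disjE) simp_all
qed

lemma siblings_DB:
  assumes "D a b \<or> B a b"
  shows "P (a + 1/3) (b + 2/3) \<and> P (a + 2/3) (b + 1/3)"
proof -
  have "(D (a + 1/3) (b + 2/3) \<or> B (a + 1/3) (b + 2/3)) \<and> (D (a + 2/3) (b + 1/3) \<or> B (a + 2/3) (b + 1/3))"
    using assms unfolding D_def B_def third_coord by (elim disjE conjE) simp_all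
  then show ?thesis unfolding P_def using G.base by blast
qed

lemma P_siblings:
  assumes "P a b" "pos (3 * a) (3 * b) \<noteq> 0"
  shows "\<exists>c\<in>{1/3, 2/3}. P (a + 1/3) (b + c) \<and> P (a + 2/3) (b + (1 - c))"
proof -
  have "pos a b \<noteq> 0" using assms(2) pos0_mult[of a b 1] by auto
  then have dg: "D a b \<or> G a b" using assms(1) unfolding P_def by blast
  show ?thesis
  proof (cases "D a b \<or> B a b")
    case True
    then show ?thesis using siblings_DB by (intro bexI[of _ "2/3"]) simp_all
  next
    case False
    then have "G a b" using dg by blast
    then obtain i where i: "arc i a" "arc i b" "G (3 * a) (3 * b)" using False by (cases rule: G.cases) blast+
    have im: "G (3 * (a + s)) (3 * (b + s))" if "s \<in> {1/3, 2/3}" for s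
      using G_cong[OF i(3)] third_image[OF that, of a] third_image[OF that, of b] pos0_comm by blast
    have "G (a + 1/3) (b + 1/3)" by (rule G.lift[OF arc_third(1)[OF i(1)] arc_third(1)[OF i(2)] im]) simp
    moreover have "G (a + 2/3) (b + 2/3)" by (rule G.lift[OF arc_third(2)[OF i(1)] arc_third(2)[OF i(2)] im]) simp
    ultimately show ?thesis unfolding P_def by (intro bexI[of _ "1/3"]) simp_all
  qed
qed

sublocale pre_leaf_relation P
proof
  show "P a a" for a unfolding P_def by simp
  show "P b a" if "P a b" for a b using that G_sym pos0_sym[of a b] unfolding P_def D_def by blast
  show "P a' b'" if "pos a a' = 0" "pos b b' = 0" "P a b" for a b a' b'
    using that(3) G_cong[OF _ that(1,2)] D_cong[OF that(1,2)] pos_cong[OF that(1,2)] unfolding P_def by auto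
  show "\<not> linked a b c d" if "P a b" "P c d" for a b c d
  proof
    assume l: "linked a b c d"
    have "D a b \<or> G a b" "D c d \<or> G c d" using linked_distinct[OF l] that unfolding P_def by auto
    then show False using D_unlinked[of a b c d] D_unlinked[of c d a b] G_unlinked[of a b c d] l linked_sym[OF l] by blast
  qed
  show "P (3 * a) (3 * b)" if ab: "P a b" for a b
  proof -
    consider "pos a b = 0" | "D a b \<or> B a b" | "G (3 * a) (3 * b)" using ab unfolding P_def by (blast elim: G.cases)
    then show ?thesis
    proof cases
      case 1 then show ?thesis using pos0_mult[of a b 1] unfolding P_def by simp
    next
      case 2 then show ?thesis using image_D unfolding P_def by blast
    next
      case 3 then show ?thesis unfolding P_def by blast
    qed
  qed
  show "P (a + 1/2) (b + 1/2)" if "P a b" for a b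
  proof -
    have "D a b \<Longrightarrow> D (a + 1/2) (b + 1/2)" unfolding D_def half_coord by (elim disjE conjE) simp_all
    then show ?thesis using that G_half[of a b] pos_shift[of a "1/2" b] unfolding P_def by auto
  qed
  show "\<exists>a' b'. P a' b' \<and> pos (3 * a') a = 0 \<and> pos (3 * b') b = 0" if ab: "P a b" for a b
  proof -
    consider "pos a b = 0" | "D a b" | "G a b" using ab unfolding P_def by blast
    then show ?thesis
    proof cases
      case 1
      then show ?thesis by (intro exI[of _ "a / 3"]) (simp add: P_def)
    next
      case 2
      have pp: "pos p (p + 1/3) = 1/3" "pos p (p + 5/6) = 5/6" by (simp_all add: pos_self_add)
      have d: "D (p + 1/3) (p + 5/6)" "D (p + 5/6) (p + 1/3)" unfolding D_def pp by simp_all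
      have w: "pos (3 * p) (3 * (p + 1/3)) = 0" "pos (3 * p) (3 * (p + 5/6)) = 1/2" unfolding pos_triple pp by simp_all
      from 2[unfolded D_coord3] show ?thesis
      proof
        assume "pos (3 * p) a = 0 \<and> pos (3 * p) b = 1/2"
        then have "pos (3 * (p + 1/3)) a = 0" "pos (3 * (p + 5/6)) b = 0" using w pos0_of_eq by metis+
        then show ?thesis using d(1) unfolding P_def by blast
      next
        assume "pos (3 * p) a = 1/2 \<and> pos (3 * p) b = 0"
        then have "pos (3 * (p + 5/6)) a = 0" "pos (3 * (p + 1/3)) b = 0" using w pos0_of_eq by metis+
        then show ?thesis using d(2) unfolding P_def by blast
      qed
    next
      case 3
      from G_half_plane[OF 3] obtain i where i: "i = 0 \<or> i = 1 \<or> i = 2 \<or> i = 3 \<or> i = 4 \<or> i = (5::nat)"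
        "if even i then 0 < pos (3 * p) a \<and> pos (3 * p) a < 1/2 else 1/2 < pos (3 * p) a"
        "if even i then 0 < pos (3 * p) b \<and> pos (3 * p) b < 1/2 else 1/2 < pos (3 * p) b"
      proof
        assume "0 < pos (3 * p) a \<and> pos (3 * p) a < 1/2 \<and> 0 < pos (3 * p) b \<and> pos (3 * p) b < 1/2"
        then show thesis by (intro that[of 0]) simp_all
      next
        assume "1/2 < pos (3 * p) a \<and> 1/2 < pos (3 * p) b"
        then show thesis by (intro that[of 1]) simp_all
      qed
      obtain a' b' where a': "arc i a'" "pos (3 * a') a = 0" "arc i b'" "pos (3 * b') b = 0"
        using arc_lift[OF i(1,2)] arc_lift[OF i(1,3)] by blast
      have "G (3 * a') (3 * b')" by (rule G_cong[OF 3 pos0_sym[OF a'(2)] pos0_sym[OF a'(4)]])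
      then have "G a' b'" by (rule G.lift[OF a'(1,3)])
      then show ?thesis using a' unfolding P_def by blast
    qed
  qed
  show "\<exists>c\<in>{1/3, 2/3}. P (a + 1/3) (b + c) \<and> P (a + 2/3) (b + (1 - c))" if "P a b" "pos (3 * a) (3 * b) \<noteq> 0" for a b
    using that by (rule P_siblings)
qed

section \<open>Lengths of the leaves and the comajor of length one sixth\<close>

lemma G_length: "G a b \<Longrightarrow> pos a b \<le> 1/6 \<or> 5/6 \<le> pos a b"
proof (induction rule: G.induct)
  case (base a b)
  then show ?case unfolding B_def pos_base[of a b p] by (elim disjE conjE) simp_all
next
  case (lift i a b)
  then show ?case unfolding arc_def pos_base[of a b p] by (auto simp: field_simps)
qed

text \<open>A pulled back chord has length below 1/6 and an image of length at most 1/6, so its own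
  length is a third of that of the image.\<close>

lemma G_short:
  assumes "G a b"
  shows "B a b \<or> pos a b \<le> 1/18 \<or> 17/18 \<le> pos a b"
  using assms
proof (cases rule: G.cases)
  case (lift i)
  have "pos a b \<le> 1/6 \<or> 5/6 \<le> pos a b" using lift(1,2) unfolding arc_def pos_base[of a b p] by (auto simp: field_simps)
  then show ?thesis using G_length[OF lift(3)] pos_ge0[of a b] pos_lt1[of a b] unfolding pos_triple[of a] by (auto split: if_splits)
qed blast

text \<open>The dichotomy of \<open>G_short\<close> describes a closed set, so limits are short as
  well. The only majors are therefore \<open>D\<close> and the two chords of \<open>B\<close>, all
  with deviation 1/6.\<close>

lemma closure_leaf: "(a, b) \<in> C \<Longrightarrow> D a b \<or> B a b \<or> pos a b \<le> 1/18 \<or> 17/18 \<le> pos a b"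
proof -
  assume ab: "(a, b) \<in> C"
  let ?I = "{(1/3, 5/6), (5/6, 1/3), (0, 1/6), (1/6, 0), (1/2, 2/3), (2/3, 1/2)} :: (real \<times> real) set"
  let ?U = "\<Union>i\<in>?I. {z. ex (fst z) = ex (p + fst i) \<and> ex (snd z) = ex (p + snd i)}"
  let ?V = "{z. 0 \<le> sin (pi * (snd z - fst z - 1/18)) * sin (pi * (snd z - fst z - 17/18))}"
  have V: "(u, v) \<in> ?V \<longleftrightarrow> pos u v \<le> 1/18 \<or> 17/18 \<le> pos u v" for u v
    using arc_outside[of "1/18" "17/18" u v] by simp
  have pt: "ex u = ex (p + s) \<longleftrightarrow> pos p u = s" if "0 \<le> s" "s < 1" for u s
    unfolding ex_eq using pos0_of_eq[of p u "p + s"] pos_self_add[OF that, of p] pos_cong[of p p u "p + s"] by auto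
  have U: "(u, v) \<in> ?U \<longleftrightarrow> D u v \<or> B u v" for u v
    unfolding D_def B_def by (auto simp: pt[of 0, simplified] pt)
  have "closed ?V" by (intro closed_Collect_le continuous_intros)
  moreover have "closed {z::real \<times> real. ex (fst z) = ex (p + fst i) \<and> ex (snd z) = ex (p + snd i)}" for i
    by (intro closed_Collect_conj closed_Collect_eq continuous_intros)
  then have "closed ?U" by (intro closed_UN) auto
  ultimately have cl: "closed (?U \<union> ?V)" by (rule closed_Un[rotated])
  have "(u, v) \<in> ?U \<union> ?V" if "P u v" for u v
    using that G_short[of u v] unfolding P_def Un_iff U V by auto
  then have "{(a, b). P a b} \<subseteq> ?U \<union> ?V" by blast
  then have "C \<subseteq> ?U \<union> ?V" by (rule closure_minimal[OF _ cl])
  then have "(a, b) \<in> ?U \<union> ?V" using ab by blast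
  then show ?thesis unfolding Un_iff U V by blast
qed

lemma special_CsCL: "seg p (p + 1/6) \<in> CsCL"
proof -
  interpret L: leaf_relation "\<lambda>a b. (a, b) \<in> C" by (rule closure_leaf_relation)
  have sub: "(a, b) \<in> C" if "P a b" for a b using that closure_subset by fastforce
  let ?a = "p + 1/3" and ?b = "p + 5/6"
  have pp: "pos p ?a = 1/3" "pos p ?b = 5/6" by (simp_all add: pos_self_add)
  have Dab: "D ?a ?b" unfolding D_def pp by simp
  have pab: "pos ?a ?b = 1/2" "pos ?b ?a = 1/2" by (intro pos_unique; simp)+
  have dab: "L.dev ?a ?b = 1/6" unfolding L.dev_def pab by simp
  have one: "pos p (?a + 2/3) = 0" "pos (p + 1/6) (?b + 1/3) = 0" unfolding pos_eq0 by simp_all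
  have pc: "pos (?a + 2/3) (?b + 1/3) = 1/6"
    using pos_cong[OF one] pos_self_add[of "1/6" p] by simp
  have len: "pos u v = 1/2 \<or> pos u v = 1/6 \<or> pos u v = 5/6" if "D u v \<or> B u v" for u v
    using that unfolding D_def B_def pos_base[of u v p] by (elim disjE conjE) simp_all
  have "comajor (leaves (\<lambda>a b. (a, b) \<in> C)) (seg (?a + 2/3) (?b + 1/3))"
  proof (rule L.comajor_noncritical)
    show "(?a, ?b) \<in> C" by (rule sub) (use Dab in \<open>simp add: P_def\<close>)
    show "pos ?a ?b \<noteq> 0" "L.dev ?a ?b \<noteq> 0" unfolding dab pab by simp_all
    show "L.dev ?a ?b \<le> L.dev u v" if uv: "(u, v) \<in> C" "pos u v \<noteq> 0" for u v
    proof -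
      have "1/6 \<le> L.dev u v" using closure_leaf[OF uv(1)] len[of u v] uv(2) unfolding L.dev_def by (auto simp: min_def abs_if)
      then show ?thesis unfolding dab .
    qed
    show "(?a + 1/3, ?b + 2/3) \<in> C" "(?a + 2/3, ?b + 1/3) \<in> C" using siblings_DB[of ?a ?b] Dab sub by blast+
    show "pos (?a + 2/3) (?b + 1/3) \<le> 1/6" "pos ?a ?b \<noteq> pos (?a + 2/3) (?b + 1/3)" "pos ?b ?a \<noteq> pos (?a + 2/3) (?b + 1/3)"
      unfolding pc pab by simp_all
  next
    fix u v k k' :: real assume uv: "(u, v) \<in> C" "L.dev u v = L.dev ?a ?b" and k: "k \<in> {1/3, 2/3}" "k' \<in> {1/3, 2/3}"
      "(u + 1/3, v + k) \<in> C" "(u + 1/3, v + k') \<in> C"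
    have d6: "L.dev u v = 1/6" using uv(2) dab by simp
    have big: "\<not> (pos u v \<le> 1/18 \<or> 17/18 \<le> pos u v)" using d6 unfolding L.dev_def by (auto simp: min_def abs_if split: if_splits)
    then have db: "D u v \<or> B u v" using closure_leaf[OF uv(1)] by blast
    \<comment> \<open>Only \<open>D\<close> and \<open>B\<close> are long leaves, and neither is
      carried to a long leaf by a rotation by 1/3.\<close>
    have "(u + 1/3, v + 1/3) \<notin> C"
    proof
      assume "(u + 1/3, v + 1/3) \<in> C"
      then have "D (u + 1/3) (v + 1/3) \<or> B (u + 1/3) (v + 1/3)" using closure_leaf[of "u + 1/3" "v + 1/3"] big by simp
      then show False using db unfolding D_def B_def third_coord by (elim disjE conjE) simp_all
    qed
    then have "k \<noteq> 1/3" "k' \<noteq> 1/3" using k(3,4) by blast+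
    then show "k' = k" using k(1,2) by blast
  qed
  moreover have "seg (?a + 2/3) (?b + 1/3) = seg p (p + 1/6)"
    by (rule HOL.sym[OF seg_cong[OF one]])
  ultimately show ?thesis unfolding CsCL_def using L.symmetric_cubic_leaves by auto
qed

end

section \<open>Necessary conditions for comajors\<close>

lemma unlinked_separates:
  assumes "\<not> linked a b c d" "pos x a = s \<and> pos x b = r \<or> pos x a = r \<and> pos x b = s" "s < r"
  shows "\<not> (s < pos x c \<and> pos x c < r \<and> (pos x d < s \<or> r < pos x d)) \<and> \<not> (s < pos x d \<and> pos x d < r \<and> (pos x c < s \<or> r < pos x c))"
  using assms(2)
proof
  assume "pos x a = s \<and> pos x b = r"
  then show ?thesis using assms(1,3) unfolding linked_coord[of _ _ _ _ x] by argo
next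
  assume "pos x a = r \<and> pos x b = s"
  then show ?thesis using assms(1,3) unfolding linked_coord[of _ _ _ _ x] by argo
qed

text \<open>No crossing with the chord whose ends have coordinates \<open>s\<close> and
  \<open>r\<close>.\<close>

definition sepfree :: "real \<Rightarrow> real \<Rightarrow> real \<Rightarrow> real \<Rightarrow> bool" where
  "sepfree s r u v \<longleftrightarrow> \<not> (s < u \<and> u < r \<and> (v < s \<or> r < v)) \<and> \<not> (s < v \<and> v < r \<and> (u < s \<or> r < u))"

lemma sepfree_sym: "sepfree s r u v \<Longrightarrow> sepfree s r v u"
  unfolding sepfree_def by blast

lemma sepfree_in: "sepfree s r u v \<Longrightarrow> s < u \<and> u < r \<Longrightarrow> s \<le> v \<and> v \<le> r"
  unfolding sepfree_def by (auto simp: not_less)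

lemma sepfree_out: "sepfree s r u v \<Longrightarrow> u < s \<or> r < u \<Longrightarrow> v \<le> s \<or> r \<le> v"
  unfolding sepfree_def by (auto simp: not_less)

text \<open>The six chords are the comajor, its two siblings and the negatives of these three. They
  confine a leaf with an end strictly inside a strip to that strip and the other end of its band, so
  that the coordinates differ by less than \<open>3 * e\<close> or by less than \<open>e\<close>
  from 1/3 or 2/3.\<close>

lemma strip_avoid:
  assumes e: "0 < e" "e \<le> 1/12"
    and S: "sepfree 0 e u v" "sepfree (1/2) (1/2 + e) u v" "sepfree (1/3) (2/3 + e) u v" "sepfree (1/3 + e) (2/3) u v"
      "sepfree (1/6 + e) (5/6) u v" "sepfree (1/6) (5/6 + e) u v"
    and g: "\<bar>v - u\<bar> \<ge> 3 * e" "\<bar>v - u\<bar> \<le> 1/3 - e \<or> (1/3 + e \<le> \<bar>v - u\<bar> \<and> \<bar>v - u\<bar> \<le> 2/3 - e) \<or> 2/3 + e \<le> \<bar>v - u\<bar>"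
  shows "\<not> (0 < u \<and> u < e)" "\<not> (1/2 < u \<and> u < 1/2 + e)" "\<not> (1/3 < u \<and> u < 1/3 + e)" "\<not> (2/3 < u \<and> u < 2/3 + e)"
    "\<not> (1/6 < u \<and> u < 1/6 + e)" "\<not> (5/6 < u \<and> u < 5/6 + e)"
proof -
  show "\<not> (0 < u \<and> u < e)"
  proof
    assume u: "0 < u \<and> u < e"
    then have "0 \<le> v \<and> v \<le> e" using sepfree_in[OF S(1)] by blast
    then show False using u g(1) e by linarith
  qed
  show "\<not> (1/2 < u \<and> u < 1/2 + e)"
  proof
    assume u: "1/2 < u \<and> u < 1/2 + e"
    then have "1/2 \<le> v \<and> v \<le> 1/2 + e" using sepfree_in[OF S(2)] by blast
    then show False using u g(1) e by linarith
  qed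
  show "\<not> (1/3 < u \<and> u < 1/3 + e)"
  proof
    assume u: "1/3 < u \<and> u < 1/3 + e"
    have r1: "1/3 \<le> v \<and> v \<le> 2/3 + e" by (rule sepfree_in[OF S(3)]) (use u e in auto)
    have r2: "v \<le> 1/3 + e \<or> 2/3 \<le> v" by (rule sepfree_out[OF S(4)]) (use u e in auto)
    show False using r1 r2 u g e by (elim disjE conjE; linarith)
  qed
  show "\<not> (2/3 < u \<and> u < 2/3 + e)"
  proof
    assume u: "2/3 < u \<and> u < 2/3 + e"
    have r1: "1/3 \<le> v \<and> v \<le> 2/3 + e" by (rule sepfree_in[OF S(3)]) (use u e in auto)
    have r2: "v \<le> 1/3 + e \<or> 2/3 \<le> v" by (rule sepfree_out[OF S(4)]) (use u e in auto)
    show False using r1 r2 u g e by (elim disjE conjE; linarith)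
  qed
  show "\<not> (1/6 < u \<and> u < 1/6 + e)"
  proof
    assume u: "1/6 < u \<and> u < 1/6 + e"
    have r1: "1/6 \<le> v \<and> v \<le> 5/6 + e" by (rule sepfree_in[OF S(6)]) (use u e in auto)
    have r2: "v \<le> 1/6 + e \<or> 5/6 \<le> v" by (rule sepfree_out[OF S(5)]) (use u e in auto)
    show False using r1 r2 u g e by (elim disjE conjE; linarith)
  qed
  show "\<not> (5/6 < u \<and> u < 5/6 + e)"
  proof
    assume u: "5/6 < u \<and> u < 5/6 + e"
    have r1: "1/6 \<le> v \<and> v \<le> 5/6 + e" by (rule sepfree_in[OF S(6)]) (use u e in auto)
    have r2: "v \<le> 1/6 + e \<or> 5/6 \<le> v" by (rule sepfree_out[OF S(5)]) (use u e in auto)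
    show False using r1 r2 u g e by (elim disjE conjE; linarith)
  qed
qed

lemma sector_of: "0 < e \<Longrightarrow> e \<le> 1/12 \<Longrightarrow>
    \<not> (0 < u \<and> u < e) \<Longrightarrow> \<not> (1/2 < u \<and> u < 1/2 + e) \<Longrightarrow> \<not> (1/3 < u \<and> u < 1/3 + e) \<Longrightarrow> \<not> (2/3 < u \<and> u < 2/3 + e) \<Longrightarrow>
    \<not> (1/6 < u \<and> u < 1/6 + e) \<Longrightarrow> \<not> (5/6 < u \<and> u < 5/6 + e) \<Longrightarrow> 0 \<le> u \<Longrightarrow> u < 1 \<Longrightarrow>
    sec e Near u \<or> sec e Far u \<or> sec e Mid u"
  by (simp add: not_less) linarith

text \<open>Ends in different sectors would have to be corners of a common band, joined by a short
  side of length \<open>e\<close> or by a diagonal of length 1/3; both lengths are excluded.\<close>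

lemma same_sector:
  assumes e: "0 < e" "e \<le> 1/12"
    and S: "sepfree 0 e u v" "sepfree (1/2) (1/2 + e) u v" "sepfree (1/3) (2/3 + e) u v" "sepfree (1/3 + e) (2/3) u v"
      "sepfree (1/6 + e) (5/6) u v" "sepfree (1/6) (5/6 + e) u v"
    and g: "\<bar>v - u\<bar> \<ge> 3 * e" "\<bar>v - u\<bar> \<le> 1/3 - e \<or> (1/3 + e \<le> \<bar>v - u\<bar> \<and> \<bar>v - u\<bar> \<le> 2/3 - e) \<or> 2/3 + e \<le> \<bar>v - u\<bar>"
    and b: "0 \<le> u" "u < 1" "0 \<le> v" "v < 1"
  shows "\<exists>j. sec e j u \<and> sec e j v"
proof -
  have g': "\<bar>u - v\<bar> \<ge> 3 * e" "\<bar>u - v\<bar> \<le> 1/3 - e \<or> (1/3 + e \<le> \<bar>u - v\<bar> \<and> \<bar>u - v\<bar> \<le> 2/3 - e) \<or> 2/3 + e \<le> \<bar>u - v\<bar>"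
    using g by (simp_all add: abs_minus_commute)
  have u: "sec e Near u \<or> sec e Far u \<or> sec e Mid u" by (rule sector_of[OF e strip_avoid[OF e S g] b(1,2)])
  have v: "sec e Near v \<or> sec e Far v \<or> sec e Mid v"
    by (rule sector_of[OF e strip_avoid[OF e S[THEN sepfree_sym] g'] b(3,4)])
  have NF: False if "sec e Near x" "sec e Far y" "sepfree (1/6 + e) (5/6) x y" for x y
  proof -
    have "1/6 + e < y \<and> y < 5/6" using that(2) e by auto
    then have "1/6 + e \<le> x \<and> x \<le> 5/6" using sepfree_in[OF sepfree_sym[OF that(3)]] by blast
    then show False using that(1) e by auto
  qed
  have NM: False if "sec e Near x" "sec e Mid y" "sepfree (1/6 + e) (5/6) x y" "sepfree (1/6) (5/6 + e) x y"
    "\<bar>y - x\<bar> \<ge> 3 * e" "\<bar>y - x\<bar> \<le> 1/3 - e \<or> (1/3 + e \<le> \<bar>y - x\<bar> \<and> \<bar>y - x\<bar> \<le> 2/3 - e) \<or> 2/3 + e \<le> \<bar>y - x\<bar>" for x y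
  proof -
    have y: "1/6 < y \<and> y < 5/6 + e" "1/6 + e \<le> y \<and> y \<le> 5/6" using that(2) e by auto
    have "1/6 \<le> x \<and> x \<le> 5/6 + e" by (rule sepfree_in[OF sepfree_sym[OF that(4)] y(1)])
    then have x: "x = 1/6 \<or> x = 5/6 + e" using that(1) by auto
    then have "\<not> (1/6 + e \<le> x \<and> x \<le> 5/6)" using e by auto
    then have "y = 1/6 + e \<or> y = 5/6" using sepfree_in[OF sepfree_sym[OF that(3)]] y(2) by (auto simp: not_less order_le_less)
    then show False using x that(5,6) e by (elim disjE) (simp_all add: abs_if split: if_splits)
  qed
  have FM: False if "sec e Far x" "sec e Mid y" "sepfree (1/3 + e) (2/3) x y" "sepfree (1/3) (2/3 + e) x y"
    "\<bar>y - x\<bar> \<ge> 3 * e" "\<bar>y - x\<bar> \<le> 1/3 - e \<or> (1/3 + e \<le> \<bar>y - x\<bar> \<and> \<bar>y - x\<bar> \<le> 2/3 - e) \<or> 2/3 + e \<le> \<bar>y - x\<bar>" for x y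
  proof -
    have x: "1/3 < x \<and> x < 2/3 + e" "1/3 + e \<le> x \<and> x \<le> 2/3" using that(1) e by auto
    have "1/3 \<le> y \<and> y \<le> 2/3 + e" by (rule sepfree_in[OF that(4) x(1)])
    then have y: "y = 1/3 \<or> y = 2/3 + e" using that(2) by auto
    then have "\<not> (1/3 + e \<le> y \<and> y \<le> 2/3)" using e by auto
    then have "x = 1/3 + e \<or> x = 2/3" using sepfree_in[OF that(3)] x(2) by (auto simp: not_less order_le_less)
    then show False using y that(5,6) e by (elim disjE) (simp_all add: abs_if split: if_splits)
  qed
  note S' = S[THEN sepfree_sym]
  show ?thesis
    using u v NF[of u v, OF _ _ S(5)] NF[of v u, OF _ _ S'(5)] NM[of u v, OF _ _ S(5,6) g] NM[of v u, OF _ _ S'(5,6) g']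
      FM[of u v, OF _ _ S(4,3) g] FM[of v u, OF _ _ S'(4,3) g'] by blast
qed

section \<open>Leaves of an arbitrary symmetric cubic lamination\<close>

locale symmetric_leaves =
  fixes L :: "complex set set"
  assumes SL: "symmetric_cubic_lamination L"
begin

definition P :: "real \<Rightarrow> real \<Rightarrow> bool" where "P a b \<longleftrightarrow> seg a b \<in> L"

definition dv :: "real \<Rightarrow> real \<Rightarrow> real" where "dv a b = \<bar>min (pos a b) (1 - pos a b) - 1/3\<bar>"

lemma cubic: "cubic_lamination L"
  using SL unfolding symmetric_cubic_lamination_def by (rule conjunct1)

lemma lam: "lamination L"
  using cubic unfolding cubic_lamination_def by (rule conjunct1)

lemma L: "L \<subseteq> chords" "\<And>l m. l \<in> L \<Longrightarrow> m \<in> L \<Longrightarrow> \<not> crossing l m"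
  using lam unfolding lamination_def by blast+

lemma unl: "P a b \<Longrightarrow> P c d \<Longrightarrow> \<not> linked a b c d"
  using L(2)[of "seg a b" "seg c d"] unfolding P_def crossing_seg .

lemma sym: "P a b \<Longrightarrow> P b a"
  unfolding P_def by (subst seg_commute)

lemma cong: "P a b \<Longrightarrow> pos a a' = 0 \<Longrightarrow> pos b b' = 0 \<Longrightarrow> P a' b'"
  unfolding P_def using seg_cong[of a a' b b'] by simp

lemma img: "P a b \<Longrightarrow> pos (3 * a) (3 * b) \<noteq> 0 \<Longrightarrow> P (3 * a) (3 * b)"
proof -
  assume ab: "P a b" "pos (3 * a) (3 * b) \<noteq> 0"
  have "\<forall>l\<in>L. chord_image l \<in> L \<or> degenerate (chord_image l)" using cubic unfolding cubic_lamination_def by (elim conjE)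
  then have "chord_image (seg a b) \<in> L \<or> degenerate (chord_image (seg a b))" using ab(1) unfolding P_def by (rule bspec)
  then show ?thesis using ab(2) unfolding seg_image seg_degenerate P_def by blast
qed

lemma half: "P a b \<Longrightarrow> P (a + 1/2) (b + 1/2)"
proof -
  assume ab: "P a b"
  have "\<forall>l\<in>L. uminus ` l \<in> L" using SL unfolding symmetric_cubic_lamination_def by (elim conjE)
  then have "uminus ` seg a b \<in> L" using ab unfolding P_def by (rule bspec)
  then show ?thesis unfolding seg_minus P_def .
qed

lemma major: "major L M \<longleftrightarrow> M \<in> L \<and> \<not> degenerate M \<and> (\<forall>u v. P u v \<longrightarrow> pos u v \<noteq> 0 \<longrightarrow> \<bar>chord_length M - 1/3\<bar> \<le> dv u v)"
proof -
  have all: "(\<forall>l\<in>L. X l) \<longleftrightarrow> (\<forall>u v. P u v \<longrightarrow> X (seg u v))" for X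
  proof (intro iffI ballI allI impI)
    fix l assume a: "\<forall>u v. P u v \<longrightarrow> X (seg u v)" and l: "l \<in> L"
    obtain u v where "l = seg u v" using chord_seg[of l] L(1) l by blast
    then show "X l" using a l unfolding P_def by blast
  qed (simp add: P_def)
  have "major L M \<longleftrightarrow> M \<in> L \<and> \<not> degenerate M \<and> (\<forall>l\<in>L. \<not> degenerate l \<longrightarrow> \<bar>chord_length M - 1/3\<bar> \<le> \<bar>chord_length l - 1/3\<bar>)"
    unfolding major_def is_arg_min_linorder by blast
  then show ?thesis unfolding all by (simp add: seg_degenerate seg_length dv_def)
qed

lemma seg_dv: "\<bar>chord_length (seg a b) - 1/3\<bar> = dv a b"
  unfolding seg_length dv_def ..

lemma critical_dv: "critical M \<longleftrightarrow> \<bar>chord_length M - 1/3\<bar> = 0"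
  unfolding critical_def by simp

lemma im: "pos u v \<noteq> 0 \<Longrightarrow> dv u v \<noteq> 0 \<Longrightarrow> pos (3 * u) (3 * v) \<noteq> 0"
  unfolding dv_def pos_triple by auto

lemma tri:
  assumes "P u v" "pos (3 * u) (3 * v) \<noteq> 0"
  shows "sibling_triple L (seg u v) T \<longleftrightarrow> (\<exists>k\<in>{1/3, 2/3}. T = {seg u v, seg (u + 1/3) (v + k), seg (u + 2/3) (v + (1 - k))} \<and>
        P (u + 1/3) (v + k) \<and> P (u + 2/3) (v + (1 - k)))"
  using triple_iff[OF L, of u v T] assms unfolding P_def by blast

lemma image_pos:
  assumes "0 < pos p q" "pos p q \<le> 1/6" "P p q"
  shows "pos (3 * p) (3 * q) = 3 * pos p q" "P (3 * p) (3 * q)"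
proof -
  show "pos (3 * p) (3 * q) = 3 * pos p q" unfolding pos_triple using assms by simp
  then show "P (3 * p) (3 * q)" using img[OF assms(3)] assms(1) by simp
qed

lemma hexagon:
  assumes t: "P p q" and P2: "P (p + 1/3) (q + 1/3)" "P (p + 2/3) (q + 2/3)" and pq: "pos p q = 1/6"
    and uniq: "unique_major_triples L" and ge: "\<And>u v. P u v \<Longrightarrow> pos u v \<noteq> 0 \<Longrightarrow> 1/6 \<le> dv u v"
  shows False
proof -
  have i3: "pos (3 * p) (3 * q) = 1/2" and P3: "P (3 * p) (3 * q)" using image_pos[of p q] t pq by simp_all
      have D1: "pos (3 * p) (3 * q) = 1/2" by (rule i3)
      have D2: "pos (3 * (3 * p)) (3 * (3 * q)) = 1/2" unfolding pos_triple[of "3 * p"] D1 by simp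
      have "P (3 * (3 * p)) (3 * (3 * q))" by (rule img[OF P3]) (use D2 in simp)
      from unl[OF P3 this] have nl: "\<not> linked (3 * p) (3 * q) (3 * (3 * p)) (3 * (3 * q))" .
      have hq: "pos (3 * p) (3 * (3 * q)) = (if pos (3 * p) (3 * (3 * p)) < 1/2 then pos (3 * p) (3 * (3 * p)) + 1/2 else pos (3 * p) (3 * (3 * p)) - 1/2)"
        using pos_base[of "3 * (3 * p)" "3 * (3 * q)" "3 * p"] D2 pos_lt1[of "3 * p" "3 * (3 * q)"] pos_ge0[of "3 * p" "3 * (3 * q)"]
          pos_lt1[of "3 * p" "3 * (3 * p)"] pos_ge0[of "3 * p" "3 * (3 * p)"] by (auto split: if_splits)
      have "pos (3 * p) (3 * (3 * p)) = 0 \<or> pos (3 * p) (3 * (3 * p)) = 1/2"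
        using nl pos_ge0[of "3 * p" "3 * (3 * p)"] pos_lt1[of "3 * p" "3 * (3 * p)"] unfolding linked_base D1 hq by (auto split: if_splits)
      \<comment> \<open>So \<open>3 * p - p\<close> is a multiple of 1/6, and \<open>3 * p\<close>
        is a vertex of the hexagon.\<close>
      then obtain m :: int where m: "12 * p = of_int m"
      proof
        assume "pos (3 * p) (3 * (3 * p)) = 0"
        then obtain n :: int where "6 * p = of_int n" unfolding pos_eq0 by (elim Ints_cases) simp
        then have "12 * p = of_int (2 * n)" by simp
        then show thesis by (rule that)
      next
        assume h: "pos (3 * p) (3 * (3 * p)) = 1/2"
        then obtain n :: int where "6 * p - 1/2 = of_int n" using pos_Ints[of "3 * (3 * p)" "3 * p"] unfolding h by (elim Ints_cases) simp
        then have "12 * p = of_int (2 * n + 1)" by simp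
        then show thesis by (rule that)
      qed
      have side: "P (p + of_int i / 6) (p + of_int i / 6 + 1/6)" for i :: int
      proof -
        define r where "r = i mod 6"
        have r: "r = 0 \<or> r = 1 \<or> r = 2 \<or> r = 3 \<or> r = 4 \<or> r = 5" unfolding r_def by presburger
        have ir: "real_of_int i / 6 = of_int (i div 6) + of_int r / 6"
        proof -
          have "i = i div 6 * 6 + r" unfolding r_def by simp
          then have "real_of_int i = real_of_int (i div 6 * 6 + r)" by (rule arg_cong)
          then show ?thesis by (simp add: field_simps)
        qed
        have q6: "pos q (p + 1/6) = 0" using pos0_of_eq[of p q "p + 1/6"] pos_self_add[of "1/6" p] pq by simp
        have qq: "pos (q + s) (p + s + 1/6) = 0" for s
        proof -
          have "p + s + 1/6 = (p + 1/6) + s" by simp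
          then show ?thesis using q6 pos_shift by metis
        qed
        have base: "P (p + s) (p + s + 1/6)" if "P (p + s) (q + s)" for s using cong[OF that pos_self qq] .
        have hs: "P (p + (s + 1/2)) (q + (s + 1/2))" if "P (p + s) (q + s)" for s using half[OF that] by (simp add: add.assoc)
        have o: "pos (t + 1) t = 0" for t unfolding pos_eq0 by simp
        have c0: "P (p + s) (q + s)" if "P (p + s + 1) (q + s + 1)" for s by (rule cong[OF that o o])
        have b: "P (p + 0) (q + 0)" "P (p + 1/3) (q + 1/3)" "P (p + 2/3) (q + 2/3)" using t P2 by simp_all
        have "P (p + 1/6) (q + 1/6)" using c0[of "1/6"] hs[OF b(3)] by (simp add: add.assoc)
        then have "P (p + of_int r / 6) (q + of_int r / 6)" using r hs[OF b(1)] hs[OF b(2)] b by (elim disjE) simp_all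
        from base[OF this] show ?thesis
          by (rule cong) (simp_all add: ir pos_eq0)
      qed
      \<comment> \<open>The diameter runs from \<open>w\<close> to \<open>w + 1/2\<close>; the side
        from \<open>w + 1/6\<close> to \<open>w + 1/3\<close>, parallel to it, is the one with two
        triples.\<close>
      define w where "w = 3 * p"
      have w: "w = p + of_int m / 6" unfolding w_def using m by simp
      have ws: "P (w + of_int i / 6) (w + of_int i / 6 + 1/6)" for i :: int
        using side[of "m + i"] unfolding w by (simp add: add_divide_distrib add.assoc)
      have w1: "P (w + 1/6) (w + 1/3)" using ws[of 1] by (simp add: add.assoc)
      have w3: "P (w + 1/6 + 1/3) (w + 1/3 + 1/3)" using ws[of 3] by (simp add: add.assoc)
      have w5: "P (w + 1/6 + 2/3) (w + 1/3 + 2/3)" using ws[of 5] by (simp add: add.assoc)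
      have w3': "P (w + 1/6 + 2/3) (w + 1/3 + 1/3)" using sym[OF ws[of 4]] by (simp add: add.assoc)
      have wD: "P (w + 1/6 + 1/3) (w + 1/3 + 2/3)"
      proof (rule cong[OF sym[OF P3]])
        have "pos (3 * p) (w + 1/2) = 1/2" unfolding w_def by (simp add: pos_self_add)
        then have "pos (3 * q) (w + 1/2) = 0" using pos0_of_eq[of "3 * p" "3 * q" "w + 1/2"] D1 by simp
        then show "pos (3 * q) (w + 1/6 + 1/3) = 0" by (simp add: add.assoc)
        show "pos (3 * p) (w + 1/3 + 2/3) = 0" unfolding pos_eq0 w_def by simp
      qed
      have pw: "pos (w + 1/6) (w + 1/3) = 1/6" by (intro pos_unique) simp_all
      have dw: "dv (w + 1/6) (w + 1/3) = 1/6" unfolding dv_def pw by simp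
      have "seg (w + 1/6) (w + 1/3) \<in> L" using w1 unfolding P_def .
      moreover have "\<not> degenerate (seg (w + 1/6) (w + 1/3))" unfolding seg_degenerate pw by simp
      ultimately have mj: "major L (seg (w + 1/6) (w + 1/3))" unfolding major seg_dv dw using ge by blast
      have "\<not> critical (seg (w + 1/6) (w + 1/3))" unfolding critical_dv seg_dv dw by simp
      with mj have ex1: "\<exists>!T. sibling_triple L (seg (w + 1/6) (w + 1/3)) T" using uniq unfolding unique_major_triples_def by blast
      have pw0: "pos (3 * (w + 1/6)) (3 * (w + 1/3)) \<noteq> 0" by (rule im) (simp_all add: pw dw)
      let ?T1 = "{seg (w + 1/6) (w + 1/3), seg (w + 1/6 + 1/3) (w + 1/3 + 1/3), seg (w + 1/6 + 2/3) (w + 1/3 + (1 - 1/3))}"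
      let ?T2 = "{seg (w + 1/6) (w + 1/3), seg (w + 1/6 + 1/3) (w + 1/3 + 2/3), seg (w + 1/6 + 2/3) (w + 1/3 + (1 - 2/3))}"
      have "sibling_triple L (seg (w + 1/6) (w + 1/3)) ?T1"
        unfolding tri[OF w1 pw0] by (intro bexI[of _ "1/3"] conjI refl) (use w3 w5 in simp_all)
      moreover have "sibling_triple L (seg (w + 1/6) (w + 1/3)) ?T2"
        unfolding tri[OF w1 pw0] by (intro bexI[of _ "2/3"] conjI refl) (use wD w3' in simp_all)
      ultimately have "?T1 = ?T2" using ex1 by blast
      then have "seg (w + 1/6 + 1/3) (w + 1/3 + 2/3) \<in> ?T1" by blast
      then have "chord_length (seg (w + 1/6 + 1/3) (w + 1/3 + 2/3)) \<in> chord_length ` ?T1" by (rule imageI)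
      moreover have "pos (w + 1/6 + 1/3) (w + 1/3 + 2/3) = 1/2" "pos (w + 1/6 + 1/3) (w + 1/3 + 1/3) = 1/6" "pos (w + 1/6 + 2/3) (w + 1/3 + (1 - 1/3)) = 1/6"
        by (intro pos_unique; simp)+
      ultimately show False using pw by (simp add: seg_length)
qed

text \<open>The sibling and the image of the comajor are both diameters. Diameters that do not cross
  coincide, so \<open>3 * p\<close> is an end of the sibling.\<close>

lemma diameter_case:
  assumes t: "P p q" "P (p + 1/3) (q + 2/3)" and pq: "pos p q = 1/6" and D2: "pos (p + 1/3) (q + 2/3) = 1/2"
  shows "4 * p - 2/3 \<in> \<int>"
proof -
  have D1: "pos (3 * p) (3 * q) = 1/2" and P3: "P (3 * p) (3 * q)" using image_pos[of p q] t pq by simp_all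
        have nl: "\<not> linked (p + 1/3) (q + 2/3) (3 * p) (3 * q)" by (rule unl[OF t(2) P3])
        have hq: "pos (p + 1/3) (3 * q) = (if pos (p + 1/3) (3 * p) < 1/2 then pos (p + 1/3) (3 * p) + 1/2 else pos (p + 1/3) (3 * p) - 1/2)"
          using pos_base[of "3 * p" "3 * q" "p + 1/3"] D1 pos_lt1[of "p + 1/3" "3 * q"] pos_ge0[of "p + 1/3" "3 * q"]
            pos_lt1[of "p + 1/3" "3 * p"] pos_ge0[of "p + 1/3" "3 * p"] by (auto split: if_splits)
        have h: "pos (p + 1/3) (3 * p) = 0 \<or> pos (p + 1/3) (3 * p) = 1/2"
          using nl pos_ge0[of "p + 1/3" "3 * p"] pos_lt1[of "p + 1/3" "3 * p"] unfolding linked_base D2 hq by (auto split: if_splits)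
        have I: "3 * p - (p + 1/3) - pos (p + 1/3) (3 * p) \<in> \<int>" by (rule pos_Ints)
        have "2 * (3 * p - (p + 1/3) - pos (p + 1/3) (3 * p)) \<in> \<int>" by (rule Ints_mult[OF _ I]) simp
        moreover have "2 * pos (p + 1/3) (3 * p) \<in> \<int>"
        proof -
          have "2 * pos (p + 1/3) (3 * p) = 0 \<or> 2 * pos (p + 1/3) (3 * p) = 1" using h by auto
          then show ?thesis by (elim disjE) simp_all
        qed
        ultimately have "2 * (3 * p - (p + 1/3) - pos (p + 1/3) (3 * p)) + 2 * pos (p + 1/3) (3 * p) \<in> \<int>" by (rule Ints_add)
        moreover have "2 * (3 * p - (p + 1/3) - pos (p + 1/3) (3 * p)) + 2 * pos (p + 1/3) (3 * p) = 4 * p - 2/3" by (simp add: algebra_simps)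
        ultimately show "4 * p - 2/3 \<in> \<int>" by (simp only:)
qed

text \<open>No iterate has smaller deviation than \<open>e\<close>, so a circle distance of at least
  \<open>3 * e\<close>, present after one step, persists. Together with the six chords that no
  iterate crosses, this is what \<open>same_sector\<close> needs at every time.\<close>

lemma strip_case:
  assumes t: "P p q" and P2: "P (p + 1/3) (q + 2/3)" "P (p + 2/3) (q + 1/3)" and e_def: "e = pos p q" and e12: "0 < e" "e \<le> 1/12"
    and ge: "\<And>u v. P u v \<Longrightarrow> pos u v \<noteq> 0 \<Longrightarrow> e \<le> dv u v"
  shows "Q p q \<and> N p q"
proof -
  have pq: "pos p q = e" by (simp add: e_def)
  have q1: "pos p (q + 1/3) = e + 1/3" "pos p (q + 2/3) = e + 2/3"
    using pos_add_right[of "1/3" p q] pos_add_right[of "2/3" p q] e12 pq by simp_all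
  have i3: "pos (3 * p) (3 * q) = 3 * e" and P3: "P (3 * p) (3 * q)" using image_pos[of p q] t pq e12 by simp_all
        have orbit: "P (3 ^ n * p) (3 ^ n * q) \<and> 3 * e \<le> pos (3 ^ n * p) (3 ^ n * q) \<and> pos (3 ^ n * p) (3 ^ n * q) \<le> 1 - 3 * e" if "0 < n" for n
          using that
        proof (induction n)
          case (Suc n)
          show ?case
          proof (cases "n = 0")
            case True
            then show ?thesis using P3 i3 e12 by simp
          next
            case False
            define h where "h = pos (3 ^ n * p) (3 ^ n * q)"
            have IH: "P (3 ^ n * p) (3 ^ n * q)" "3 * e \<le> h" "h \<le> 1 - 3 * e" using Suc.IH False unfolding h_def by simp_all
            have "e \<le> dv (3 ^ n * p) (3 ^ n * q)" by (rule ge[OF IH(1)]) (use IH(2) e12 in \<open>simp add: h_def\<close>)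
            then have g: "h \<le> 1/3 - e \<or> (1/3 + e \<le> h \<and> h \<le> 2/3 - e) \<or> 2/3 + e \<le> h"
              unfolding dv_def h_def[symmetric] by (auto simp: min_def abs_if split: if_splits)
            have h3: "3 * e \<le> pos (3 * (3 ^ n * p)) (3 * (3 ^ n * q)) \<and> pos (3 * (3 ^ n * p)) (3 * (3 ^ n * q)) \<le> 1 - 3 * e"
              unfolding pos_triple[of "3 ^ n * p"] h_def[symmetric] using g IH(2,3) e12 by auto
            moreover have "P (3 * (3 ^ n * p)) (3 * (3 ^ n * q))" by (rule img[OF IH(1)]) (use h3 e12 in linarith)
            ultimately show ?thesis by (simp add: mult.assoc)
          qed
        qed simp
        have leaf: "P (3 ^ n * p) (3 ^ n * q)" for n using orbit[of n] t by (cases "n = 0") auto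
        have ph: "P (p + 1/2) (q + 1/2)" by (rule half[OF t])
        have pm: "P (p + 5/6) (q + 1/6)" by (rule cong[OF half[OF P2(1)]]) (simp_all add: pos_eq0)
        have pm': "P (p + 1/6) (q + 5/6)" by (rule cong[OF half[OF P2(2)]]) (simp_all add: pos_eq0)
        have cp: "pos p (p + 1/2) = 1/2" "pos p (p + 1/3) = 1/3" "pos p (p + 2/3) = 2/3" "pos p (p + 5/6) = 5/6" "pos p (p + 1/6) = 1/6"
          by (simp_all add: pos_self_add)
        have cq: "pos p (q + 1/2) = 1/2 + e" "pos p (q + 1/6) = 1/6 + e" "pos p (q + 5/6) = 5/6 + e" "pos p (q + 1/3) = 1/3 + e" "pos p (q + 2/3) = 2/3 + e"
          using pos_add_right[of "1/2" p q] pos_add_right[of "1/6" p q] pos_add_right[of "5/6" p q] q1 pq e12 by simp_all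
        have "same p e (3 ^ n * p) (3 ^ n * q)" for n
        proof (cases "n = 0")
          case True
          have "K p e Near p" "K p e Near q" unfolding K_def using pq e12 by simp_all
          then show ?thesis using True unfolding same_def by auto
        next
          case False
          let ?a = "3 ^ n * p" and ?b = "3 ^ n * q"
          define u v where uv: "u = pos p ?a" "v = pos p ?b"
          have b: "0 \<le> u" "u < 1" "0 \<le> v" "v < 1" unfolding uv by (simp_all add: pos_ge0 pos_lt1)
          have o: "3 * e \<le> pos ?a ?b" "pos ?a ?b \<le> 1 - 3 * e" "P ?a ?b" using orbit[of n] False by simp_all
          have "e \<le> dv ?a ?b" by (rule ge[OF o(3)]) (use o(1) e12 in simp)
          then have g: "pos ?a ?b \<le> 1/3 - e \<or> (1/3 + e \<le> pos ?a ?b \<and> pos ?a ?b \<le> 2/3 - e) \<or> 2/3 + e \<le> pos ?a ?b"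
            unfolding dv_def by (auto simp: min_def abs_if split: if_splits)
          have duv: "pos ?a ?b = (if u \<le> v then v - u else v - u + 1)" unfolding uv by (rule pos_base)
          have sp: "sepfree s r u v" if "P x y" "pos p x = s \<and> pos p y = r \<or> pos p x = r \<and> pos p y = s" "s < r" for x y s r
            using unlinked_separates[OF unl[OF that(1) o(3)] that(2,3)] unfolding sepfree_def uv .
          have S: "sepfree 0 e u v" "sepfree (1/2) (1/2 + e) u v" "sepfree (1/3) (2/3 + e) u v" "sepfree (1/3 + e) (2/3) u v"
            "sepfree (1/6 + e) (5/6) u v" "sepfree (1/6) (5/6 + e) u v"
            using sp[OF t, of 0 e] sp[OF ph, of "1/2" "1/2 + e"] sp[OF P2(1), of "1/3" "2/3 + e"] sp[OF P2(2), of "1/3 + e" "2/3"]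
              sp[OF pm, of "1/6 + e" "5/6"] sp[OF pm', of "1/6" "5/6 + e"] e12 unfolding cp cq pq by simp_all
          have "\<bar>v - u\<bar> \<ge> 3 * e" "\<bar>v - u\<bar> \<le> 1/3 - e \<or> (1/3 + e \<le> \<bar>v - u\<bar> \<and> \<bar>v - u\<bar> \<le> 2/3 - e) \<or> 2/3 + e \<le> \<bar>v - u\<bar>"
            using o(1,2) g e12 unfolding duv by (auto split: if_splits)
          from same_sector[OF e12 S this b] show ?thesis unfolding same_def K_def uv .
        qed
        then have "Q p q" using e12 unfolding Q_def sim_def e_def[symmetric] by auto
        moreover have "N p q"
          unfolding N_def
        proof (intro allI ballI)
          fix m n h assume "h \<in> turns"
          then have "h = 0 \<or> h = 1/2" unfolding turns_def by blast
          moreover have "P (3 ^ n * p + 0) (3 ^ n * q + 0)" using leaf[of n] by simp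
          ultimately have "P (3 ^ n * p + h) (3 ^ n * q + h)" using half[OF leaf[of n]] by blast
          then show "\<not> linked (3 ^ m * p) (3 ^ m * q) (3 ^ n * p + h) (3 ^ n * q + h)" using unl leaf by blast
        qed
        ultimately show ?thesis by blast
qed

end

text \<open>The image of the comajor has length \<open>3 * e\<close> if this is at most 1/2, and its
  deviation is at least the deviation \<open>d\<close> of the major. If the triple arises by
  rotation, all its members have length \<open>e\<close>, so \<open>d = 1/3 - e\<close> and
  \<open>e = 1/6\<close>. With the other pairing \<open>d = e\<close>, so
  \<open>e \<le> 1/12\<close> or \<open>e = 1/6\<close>.\<close>

lemma comajor_cases:
  assumes SL: "symmetric_cubic_lamination L" and cm: "comajor L c"
  shows "(\<exists>x\<in>circle. c = {x}) \<or> (\<exists>p. 4 * p - 2/3 \<in> \<int> \<and> c = seg p (p + 1/6)) \<or> (\<exists>p q. c = seg p q \<and> Q p q \<and> N p q)"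
proof -
  interpret symmetric_leaves L by unfold_locales (rule SL)
  obtain M where M: "major L M" and uniq: "unique_major_triples L" and Mc: "if critical M
        then \<exists>x\<in>circle. c = {x} \<and> x \<notin> endpoints M \<and> chord_image {x} = chord_image M
        else \<exists>T. sibling_triple L M T \<and> c \<in> T \<and> c \<noteq> M \<and> chord_length c \<le> 1/6"
    using cm unfolding comajor_def by (elim conjE exE)
  show ?thesis
  proof (cases "critical M")
    case True
    then have "\<exists>x\<in>circle. c = {x}" using Mc by auto
    then show ?thesis by blast
  next
    case False
    define d where "d = \<bar>chord_length M - 1/3\<bar>"
    have d0: "d \<noteq> 0" using False unfolding critical_dv d_def .
    have ge: "d \<le> dv u v" if "P u v" "pos u v \<noteq> 0" for u v using M that unfolding major d_def by blast
    have "\<exists>T. sibling_triple L M T \<and> c \<in> T \<and> c \<noteq> M \<and> chord_length c \<le> 1/6" using Mc False by simp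
    then obtain T where T: "sibling_triple L M T" "c \<in> T" "c \<noteq> M" "chord_length c \<le> 1/6" by blast
    have T': "T \<subseteq> L" "M \<in> T" "card T = 3" "pairwise disjnt T" "\<forall>m\<in>T. chord_image m = chord_image M"
      using T(1) unfolding sibling_triple_def by blast+
    have ci: "chord_image c = chord_image M" using T'(5) T(2) by blast
    have cT: "sibling_triple L c T"
      unfolding sibling_triple_def ci by (intro conjI T' T(2))
    obtain a b where Mab: "M = seg a b" using chord_seg[of M] L(1) T'(1,2) by blast
    have "\<not> degenerate M" using M unfolding major by blast
    then have "pos a b \<noteq> 0" unfolding Mab seg_degenerate .
    then have imM: "pos (3 * a) (3 * b) \<noteq> 0" using im d0 unfolding d_def Mab seg_dv by blast
    have nd: "\<not> degenerate (chord_image c)" unfolding ci Mab seg_image seg_degenerate by (rule imM)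
    obtain p0 q0 where c0: "c = seg p0 q0" using chord_seg[of c] L(1) T'(1) T(2) by blast
    have "\<exists>p q. c = seg p q \<and> pos p q \<le> 1/6"
    proof (cases "pos p0 q0 \<le> 1/6")
      case False
      then have "5/6 \<le> pos p0 q0" using T(4) unfolding c0 seg_length by (auto simp: min_def split: if_splits)
      then have "pos q0 p0 \<le> 1/6" using pos_swap[of q0 p0] pos_lt1[of p0 q0] by simp
      then show ?thesis using c0 seg_commute[of p0 q0] by blast
    qed (use c0 in blast)
    then obtain p q where c: "c = seg p q" and e6: "pos p q \<le> 1/6" by blast
    have n3: "pos (3 * p) (3 * q) \<noteq> 0" using nd unfolding c seg_image seg_degenerate .
    have Pc: "P p q" using T'(1) T(2) unfolding P_def c by blast
    have e0: "0 < pos p q"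
    proof -
      have "pos p q \<noteq> 0" using n3 pos0_mult[of p q 1] by auto
      then show ?thesis using pos_ge0[of p q] by simp
    qed
    obtain k where k: "k \<in> {1/3, 2/3}" "T = {seg p q, seg (p + 1/3) (q + k), seg (p + 2/3) (q + (1 - k))}"
      "P (p + 1/3) (q + k)" "P (p + 2/3) (q + (1 - k))" using cT unfolding c tri[OF Pc n3] by blast
    have "M = seg (p + 1/3) (q + k) \<or> M = seg (p + 2/3) (q + (1 - k))" using T'(2) T(3) unfolding k(2) c by blast
    then have dk: "d = dv (p + 1/3) (q + k) \<or> d = dv (p + 2/3) (q + (1 - k))" unfolding d_def using seg_dv by blast
    define e where "e = pos p q"
    have e: "0 < e" "e \<le> 1/6" and pq: "pos p q = e" using e0 e6 unfolding e_def by simp_all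
    have i3: "pos (3 * p) (3 * q) = 3 * e" "P (3 * p) (3 * q)" using image_pos[OF e0 e6 Pc] pq by simp_all
    have d3: "dv (3 * p) (3 * q) = \<bar>3 * e - 1/3\<bar>" unfolding dv_def i3 using e by (simp add: min_def)
    have le3: "d \<le> \<bar>3 * e - 1/3\<bar>" using ge[OF i3(2) n3] unfolding d3 .
    show ?thesis
      using k(1)
    proof (elim insertE emptyE)
      assume kk: "k = 1/3"
      then have k1: "1 - k = 2/3" by simp
      have P2: "P (p + 1/3) (q + 1/3)" "P (p + 2/3) (q + 2/3)" using k(3,4) unfolding k1 unfolding kk .
      have d: "d = 1/3 - e" using dk e unfolding k1 unfolding kk dv_def pos_shift pq by (simp add: min_def)
      then have e16: "e = 1/6" using le3 e by (simp add: abs_if split: if_splits)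
      have "1/6 \<le> dv u v" if "P u v" "pos u v \<noteq> 0" for u v using ge[OF that] d e16 by simp
      then show ?thesis using hexagon[OF Pc P2 _ uniq] pq e16 by simp
    next
      assume kk: "k = 2/3"
      then have k1: "1 - k = 1/3" by simp
      have P2: "P (p + 1/3) (q + 2/3)" "P (p + 2/3) (q + 1/3)" using k(3,4) unfolding k1 unfolding kk .
      have q1: "pos p (q + 1/3) = e + 1/3" "pos p (q + 2/3) = e + 2/3" using pos_add_right[of "1/3" p q] pos_add_right[of "2/3" p q] e pq by simp_all
      have sh: "pos (p + h) (q + h') = pos p (q + (h' - h))" for h h' by (simp add: pos_def algebra_simps)
      have q2: "pos (p + 1/3) (q + 2/3) = e + 1/3" using sh[of "1/3" "2/3"] q1 by simp
      have "pos (p + 2/3) (q + 1/3) = pos p (q + 2/3)" unfolding sh by (rule pos_cong[OF pos_self]) (simp add: pos_eq0)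
      then have q3: "pos (p + 2/3) (q + 1/3) = e + 2/3" using q1 by simp
      have d: "d = e" using dk e unfolding k1 unfolding kk dv_def q2 q3 by (auto simp: min_def abs_if split: if_splits)
      then have e12: "e \<le> 1/12 \<or> e = 1/6" using le3 e by (auto simp: abs_if split: if_splits)
      show ?thesis
      proof (cases "e = 1/6")
        case True
        have "4 * p - 2/3 \<in> \<int>" by (rule diameter_case[OF Pc P2(1)]) (use pq q2 True in simp_all)
        moreover have "c = seg p (p + 1/6)" unfolding c
          by (rule seg_cong[OF pos_self]) (use pos0_of_eq[of p q "p + 1/6"] pos_self_add[of "1/6" p] pq True in simp)
        ultimately show ?thesis by blast
      next
        case False
        have "Q p q \<and> N p q" by (rule strip_case[OF Pc P2 e_def]) (use ge d False e12 e in auto)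
        then show ?thesis using c by blast
      qed
    qed
  qed
qed

section \<open>Convex hulls of subsets of the circle\<close>

lemma side_inner: "side A B z = Complex (- Im (B - A)) (Re (B - A)) \<bullet> z - Complex (- Im (B - A)) (Re (B - A)) \<bullet> A"
  unfolding side_def inner_complex_def by (simp add: algebra_simps)

lemma convex_side: "convex {z. side A B z \<le> 0}" "convex {z. 0 < side A B z}"
proof -
  let ?n = "Complex (- Im (B - A)) (Re (B - A))"
  have "{z. side A B z \<le> 0} = {z. ?n \<bullet> z \<le> ?n \<bullet> A}" unfolding side_inner by auto
  then show "convex {z. side A B z \<le> 0}" using convex_halfspace_le[of ?n "?n \<bullet> A"] by simp
  have "{z. 0 < side A B z} = {z. ?n \<bullet> z > ?n \<bullet> A}" unfolding side_inner by auto
  then show "convex {z. 0 < side A B z}" using convex_halfspace_gt[of "?n \<bullet> A" ?n] by simp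
qed

lemma hull_circle:
  assumes "A \<subseteq> circle" "z \<in> convex hull A"
  shows "norm z \<le> 1"
proof -
  have "convex hull A \<subseteq> cball 0 1" using assms(1) by (intro hull_minimal) auto
  then show ?thesis using assms(2) by auto
qed

lemma hull_line:
  assumes A: "A \<subseteq> circle" and z: "z \<in> convex hull A" "side (ex p) (ex q) z = 0" and n: "ex p \<noteq> ex q"
  shows "z \<in> seg p q"
proof (cases "norm z < 1")
  case True
  show ?thesis by (rule on_line[OF z(2) True n])
next
  case False
  then have "z \<in> circle" using hull_circle[OF A z(1)] by simp
  then obtain c where c: "z = ex c" by (rule ex_surj)
  have "ex c = ex p \<or> ex c = ex q" using on_line_circle z(2) n unfolding c by blast
  then show ?thesis unfolding c seg_def by auto
qed

text \<open>Without crossings all of \<open>A\<close> lies on one side of the line through the two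
  points, so the line supports the hull and meets it exactly in the chord.\<close>

lemma edge_of_hull:
  assumes A: "A \<subseteq> circle" and pq: "ex p \<in> A" "ex q \<in> A" "ex p \<noteq> ex q"
    and unl: "\<And>u v. ex u \<in> A \<Longrightarrow> ex v \<in> A \<Longrightarrow> \<not> linked p q u v"
  shows "seg p q edge_of convex hull A"
proof -
  let ?s = "side (ex p) (ex q)"
  let ?n = "Complex (- Im (ex q - ex p)) (Re (ex q - ex p))"
  have seg_hull: "seg p q \<subseteq> convex hull A"
    unfolding seg_def by (rule closed_segment_subset) (use pq in \<open>auto intro: hull_inc\<close>)
  have zero: "?s z = 0" if "z \<in> seg p q" for z
  proof -
    obtain u where "z = (1 - u) *\<^sub>R ex p + u *\<^sub>R ex q" using \<open>z \<in> seg p q\<close> unfolding seg_def in_segment by blast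
    then show ?thesis by (simp add: side_affine side_self)
  qed
  have eq: "convex hull A \<inter> {z. ?n \<bullet> z = ?n \<bullet> ex p} = seg p q"
  proof (intro set_eqI iffI)
    fix z assume "z \<in> convex hull A \<inter> {z. ?n \<bullet> z = ?n \<bullet> ex p}"
    then show "z \<in> seg p q" using hull_line[OF A _ _ pq(3)] unfolding side_inner by auto
  next
    fix z assume "z \<in> seg p q"
    then show "z \<in> convex hull A \<inter> {z. ?n \<bullet> z = ?n \<bullet> ex p}" using seg_hull zero[of z] unfolding side_inner by auto
  qed
  have "(\<forall>x\<in>A. ?s x \<le> 0) \<or> (\<forall>x\<in>A. 0 \<le> ?s x)"
  proof (rule ccontr)
    assume "\<not> ?thesis"
    then obtain x y where xy: "x \<in> A" "y \<in> A" "0 < ?s x" "?s y < 0" by (auto simp: not_le)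
    obtain u where u: "x = ex u" using A xy(1) ex_surj by blast
    obtain v where v: "y = ex v" using A xy(2) ex_surj by blast
    have "?s (ex u) * ?s (ex v) < 0" using xy(3,4) unfolding u v by (simp add: mult_less_0_iff)
    then have "linked p q u v" unfolding linked_side[OF pq(3)] .
    then show False using unl xy(1,2) unfolding u v by blast
  qed
  then have "convex hull A \<inter> {z. ?n \<bullet> z = ?n \<bullet> ex p} face_of convex hull A"
  proof
    assume a: "\<forall>x\<in>A. ?s x \<le> 0"
    have "convex hull A \<subseteq> {z. ?s z \<le> 0}" by (intro hull_minimal convex_side) (use a in auto)
    then show ?thesis unfolding side_inner by (intro face_of_Int_supporting_hyperplane_le convex_convex_hull) auto
  next
    assume a: "\<forall>x\<in>A. 0 \<le> ?s x"
    have c: "convex {z. 0 \<le> ?s z}"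
    proof -
      have "{z. 0 \<le> ?s z} = {z. ?n \<bullet> z \<ge> ?n \<bullet> ex p}" unfolding side_inner by auto
      then show ?thesis using convex_halfspace_ge[of "?n \<bullet> ex p" ?n] by simp
    qed
    have "convex hull A \<subseteq> {z. 0 \<le> ?s z}" by (intro hull_minimal c) (use a in auto)
    then show ?thesis unfolding side_inner by (intro face_of_Int_supporting_hyperplane_ge convex_convex_hull) auto
  qed
  moreover have "aff_dim (seg p q) = 1" unfolding seg_def segment_convex_hull aff_dim_convex_hull using pq(3) by (simp add: aff_dim_2)
  ultimately show ?thesis unfolding edge_of_def eq by simp
qed

text \<open>A face of the hull is the hull of some of the points; in dimension one these are
  collinear, and a line meets the circle at most twice. A chord between points of \<open>A\<close>
  that crossed the edge would have a relative interior point in the face, hence its ends as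
  well.\<close>

lemma edge_of_hull_cases:
  assumes A: "A \<subseteq> circle" "finite A" and e: "e edge_of convex hull A"
  shows "\<exists>p q. ex p \<in> A \<and> ex q \<in> A \<and> ex p \<noteq> ex q \<and> e = seg p q \<and> (\<forall>u v. ex u \<in> A \<longrightarrow> ex v \<in> A \<longrightarrow> \<not> linked p q u v)"
proof -
  have face: "e face_of convex hull A" and dim: "aff_dim e = 1" using e unfolding edge_of_def by auto
  obtain S where S: "S \<subseteq> A" "e = convex hull S" using face_of_convex_hull_subset[OF finite_imp_compact[OF A(2)] face] by blast
  have dS: "aff_dim S = 1" using dim unfolding S(2) aff_dim_convex_hull .
  have "\<exists>x\<in>S. \<exists>y\<in>S. x \<noteq> y"
  proof (rule ccontr)
    assume n: "\<not> ?thesis"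
    then have "S = {} \<or> (\<exists>x. S = {x})" by blast
    then show False using dS by auto
  qed
  then obtain x y where xy: "x \<in> S" "y \<in> S" "x \<noteq> y" by blast
  have xyc: "x \<in> circle" "y \<in> circle" using xy S(1) A(1) by blast+
  obtain p where p: "x = ex p" using ex_surj[OF xyc(1)] by blast
  obtain q where q: "y = ex q" using ex_surj[OF xyc(2)] by blast
  have "S \<subseteq> {ex p, ex q}"
  proof
    fix c assume c: "c \<in> S"
    then have "c \<in> circle" using S(1) A(1) by blast
    then obtain r where r: "c = ex r" by (rule ex_surj)
    have "collinear S" unfolding collinear_aff_dim using dS by simp
    then have "collinear {ex p, ex r, ex q}" by (rule collinear_subset) (use c xy p q r in auto)
    then obtain u where u: "ex p = ex q \<or> ex r = u *\<^sub>R ex p + (1 - u) *\<^sub>R ex q" unfolding collinear_3_expand by blast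
    then have "ex r = (1 - (1 - u)) *\<^sub>R ex p + (1 - u) *\<^sub>R ex q" using xy(3) p q by simp
    then have "side (ex p) (ex q) (ex r) = (1 - (1 - u)) * side (ex p) (ex q) (ex p) + (1 - u) * side (ex p) (ex q) (ex q)"
      using side_affine by metis
    then have "side (ex p) (ex q) (ex r) = 0" by (simp add: side_self)
    then show "c \<in> {ex p, ex q}" using on_line_circle xy(3) unfolding p q r by blast
  qed
  then have "S = {ex p, ex q}" using xy p q by blast
  then have eseg: "e = seg p q" unfolding S(2) seg_def segment_convex_hull by simp
  have "\<not> linked p q u v" if uv: "ex u \<in> A" "ex v \<in> A" for u v
  proof
    assume l: "linked p q u v"
    obtain z where z: "z \<in> seg p q" "z \<in> seg u v" "norm z < 1" using linked_meet[OF l] by blast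
    have "z \<noteq> ex u" "z \<noteq> ex v" using z(3) by auto
    then have o: "z \<in> open_segment (ex u) (ex v)" using z(2) unfolding seg_def open_segment_def by simp
    have "ex u \<in> convex hull A" "ex v \<in> convex hull A" using uv by (auto intro: hull_inc)
    then have "ex u \<in> e" using face_ofD[OF face o] z(1) unfolding eseg by blast
    then have "ex u \<in> endpoints (seg p q)" unfolding eseg endpoints_def by simp
    then have "ex u = ex p \<or> ex u = ex q" unfolding seg_endpoints by blast
    then show False using linked_distinct[OF l] unfolding ex_eq using pos0_comm by auto
  qed
  then show ?thesis using xy p q S(1) eseg by blast
qed

lemma point_not_in_hull:
  assumes B: "B \<subseteq> circle" and x: "x \<in> circle" "x \<notin> B"
  shows "x \<notin> convex hull B"
proof
  assume h: "x \<in> convex hull B"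
  have sub: "convex hull B \<subseteq> cball 0 1" using B by (intro hull_minimal) auto
  have "x extreme_point_of convex hull B"
    unfolding extreme_point_of_def
  proof (intro conjI ballI notI h)
    fix a b assume ab: "a \<in> convex hull B" "b \<in> convex hull B" "x \<in> open_segment a b"
    then have "dist x 0 < dist a 0 \<or> dist x 0 < dist b 0"
      using dist_decreases_open_segment[of x a b 0] by (simp add: dist_commute)
    moreover have "dist a 0 \<le> 1" "dist b 0 \<le> 1" using ab(1,2) sub by (auto simp: dist_commute)
    ultimately show False using x(1) by (auto simp: dist_commute)
  qed
  then have "x \<in> B" by (rule extreme_point_of_convex_hull)
  then show False using x(2) by blast
qed

text \<open>Seen from a point of \<open>B\<close>, the set \<open>A\<close> has a first and a last
  member. The chord between them has all of \<open>A\<close> on its closed side, while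
  \<open>B\<close>, unlinked with it, lies strictly on the other side.\<close>

lemma hulls_disjoint:
  assumes A: "A \<subseteq> circle" "finite A" and B: "B \<subseteq> circle" and d: "A \<inter> B = {}"
    and unl: "\<And>a b c d. ex a \<in> A \<Longrightarrow> ex b \<in> A \<Longrightarrow> ex c \<in> B \<Longrightarrow> ex d \<in> B \<Longrightarrow> \<not> linked a b c d"
  shows "convex hull A \<inter> convex hull B = {}"
proof (cases "\<exists>x\<in>A. \<exists>y\<in>A. x \<noteq> y")
  case False
  then have "A = {} \<or> (\<exists>x. A = {x})" by blast
  then show ?thesis
  proof
    assume "\<exists>x. A = {x}"
    then obtain x where x: "A = {x}" by blast
    then show ?thesis using point_not_in_hull[OF B, of x] A(1) d by simp
  qed simp
next
  case True
  show ?thesis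
  proof (cases "B = {}")
    case False
    then obtain y where y: "y \<in> B" by blast
    then have "y \<in> circle" using B by blast
    then obtain \<beta> where \<beta>: "y = ex \<beta>" by (rule ex_surj)
    define \<Theta> where "\<Theta> = {\<theta>. 0 \<le> \<theta> \<and> \<theta> < 1 \<and> ex (\<beta> + \<theta>) \<in> A}"
    have inj: "inj_on (\<lambda>\<theta>. ex (\<beta> + \<theta>)) {\<theta>. 0 \<le> \<theta> \<and> \<theta> < 1}"
    proof (rule inj_onI)
      fix a b :: real assume *: "a \<in> {\<theta>. 0 \<le> \<theta> \<and> \<theta> < 1}" "b \<in> {\<theta>. 0 \<le> \<theta> \<and> \<theta> < 1}" "ex (\<beta> + a) = ex (\<beta> + b)"
      then have "pos (\<beta> + a) (\<beta> + b) = 0" unfolding ex_eq by blast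
      then have "pos a b = 0" unfolding pos_eq0 by simp
      then show "a = b" using pos0_frac[of a b] * by simp
    qed
    have "finite \<Theta>"
    proof (rule finite_imageD)
      show "finite ((\<lambda>\<theta>. ex (\<beta> + \<theta>)) ` \<Theta>)" by (rule finite_subset[OF _ A(2)]) (auto simp: \<Theta>_def)
      show "inj_on (\<lambda>\<theta>. ex (\<beta> + \<theta>)) \<Theta>" by (rule inj_on_subset[OF inj]) (auto simp: \<Theta>_def)
    qed
    have coord: "\<exists>\<theta>. 0 \<le> \<theta> \<and> \<theta> < 1 \<and> x = ex (\<beta> + \<theta>)" if xc: "x \<in> circle" for x
    proof -
      obtain t where t: "x = ex t" using ex_surj[OF xc] by blast
      have "pos t (\<beta> + pos \<beta> t) = 0" using pos0_of_eq[of \<beta> t "\<beta> + pos \<beta> t"] pos_self_add[OF pos_ge0 pos_lt1, of \<beta> \<beta> t] by simp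
      then show ?thesis using ex_cong[of t] pos_ge0[of \<beta> t] pos_lt1[of \<beta> t] t by blast
    qed
    obtain x1 x2 where x12: "x1 \<in> A" "x2 \<in> A" "x1 \<noteq> x2" using True by blast
    obtain t1 where t1: "t1 \<in> \<Theta>" "x1 = ex (\<beta> + t1)" using coord[of x1] x12(1) A(1) unfolding \<Theta>_def by blast
    obtain t2 where t2: "t2 \<in> \<Theta>" "x2 = ex (\<beta> + t2)" using coord[of x2] x12(2) A(1) unfolding \<Theta>_def by blast
    have ne: "\<Theta> \<noteq> {}" using t1 by blast
    define lo hi where lh: "lo = Min \<Theta>" "hi = Max \<Theta>"
    have lo: "lo \<in> \<Theta>" "hi \<in> \<Theta>" unfolding lh using Min_in Max_in \<open>finite \<Theta>\<close> ne by blast+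
    have bnd: "lo \<le> \<theta>" "\<theta> \<le> hi" if "\<theta> \<in> \<Theta>" for \<theta> unfolding lh using Min_le Max_ge \<open>finite \<Theta>\<close> that by blast+
    have "t1 \<noteq> t2" using t1 t2 x12(3) by blast
    then have lt: "lo < hi" using bnd[OF t1(1)] bnd[OF t2(1)] by linarith
    have l01: "0 \<le> lo" "hi < 1" using lo unfolding \<Theta>_def by auto
    have "lo \<noteq> 0"
    proof
      assume "lo = 0"
      then have "y \<in> A" using lo(1) \<beta> unfolding \<Theta>_def by simp
      then show False using y d by blast
    qed
    then have l0: "0 < lo" using l01 by simp
    have sp: "0 < sin (pi * t)" if "0 < t" "t < 1" for t :: real using that by (intro sin_gt_zero) auto
    have sn: "sin (pi * t) < 0" if "-1 < t" "t < 0" for t :: real using sp[of "- t"] that by simp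
    let ?s = "side (ex (\<beta> + lo)) (ex (\<beta> + hi))"
    have sv: "?s (ex (\<beta> + \<theta>)) = 4 * sin (pi * (hi - lo)) * sin (pi * (\<theta> - lo)) * sin (pi * (\<theta> - hi))" for \<theta>
      unfolding side_ex by simp
    have s0: "0 < sin (pi * (hi - lo))" using sp[of "hi - lo"] lt l01 by simp
    have inside: "?s (ex (\<beta> + \<theta>)) \<le> 0" if "lo \<le> \<theta>" "\<theta> \<le> hi" for \<theta>
    proof -
      have "0 \<le> sin (pi * (\<theta> - lo))" using sp[of "\<theta> - lo"] that lt l01 l0 by (cases "\<theta> = lo") auto
      moreover have "sin (pi * (\<theta> - hi)) \<le> 0" using sn[of "\<theta> - hi"] that lt l01 l0 by (cases "\<theta> = hi") auto
      ultimately show ?thesis unfolding sv using s0 by (simp add: mult_nonneg_nonpos)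
    qed
    have outside: "0 < ?s (ex (\<beta> + \<theta>))" if "0 \<le> \<theta>" "\<theta> < 1" "\<theta> < lo \<or> hi < \<theta>" for \<theta>
      using that(3)
    proof
      assume "\<theta> < lo"
      then have "sin (pi * (\<theta> - lo)) < 0" "sin (pi * (\<theta> - hi)) < 0" using sn[of "\<theta> - lo"] sn[of "\<theta> - hi"] that lt l01 by auto
      then show ?thesis unfolding sv using s0 by (simp add: mult_neg_neg mult_pos_neg)
    next
      assume "hi < \<theta>"
      then have "0 < sin (pi * (\<theta> - lo))" "0 < sin (pi * (\<theta> - hi))" using sp[of "\<theta> - lo"] sp[of "\<theta> - hi"] that lt l01 l0 by auto
      then show ?thesis unfolding sv using s0 by simp
    qed
    have "?s x \<le> 0" if xA: "x \<in> A" for x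
    proof -
      obtain \<theta> where \<theta>: "0 \<le> \<theta>" "\<theta> < 1" "x = ex (\<beta> + \<theta>)" using coord[of x] xA A(1) by blast
      then have "\<theta> \<in> \<Theta>" using xA unfolding \<Theta>_def by simp
      then show ?thesis using inside bnd unfolding \<theta>(3) by blast
    qed
    then have hA: "convex hull A \<subseteq> {z. ?s z \<le> 0}" by (intro hull_minimal convex_side) auto
    have "0 < ?s x" if xB: "x \<in> B" for x
    proof -
      obtain \<theta> where \<theta>: "0 \<le> \<theta>" "\<theta> < 1" "x = ex (\<beta> + \<theta>)" using coord[of x] xB B by blast
      have "\<theta> \<noteq> lo" "\<theta> \<noteq> hi" using lo xB \<theta>(3) d unfolding \<Theta>_def by auto
      moreover have "\<not> (lo < \<theta> \<and> \<theta> < hi)"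
      proof
        assume m: "lo < \<theta> \<and> \<theta> < hi"
        have c: "pos \<beta> (\<beta> + lo) = lo" "pos \<beta> (\<beta> + hi) = hi" "pos \<beta> (\<beta> + \<theta>) = \<theta>" using pos_self_add l0 l01 lt \<theta>(1,2) by simp_all
        have "linked (\<beta> + lo) (\<beta> + hi) (\<beta> + \<theta>) \<beta>" unfolding linked_coord[of _ _ _ _ \<beta>] c using m l0 by simp
        moreover have "ex (\<beta> + lo) \<in> A" "ex (\<beta> + hi) \<in> A" using lo unfolding \<Theta>_def by auto
        ultimately show False using unl[of "\<beta> + lo" "\<beta> + hi" "\<beta> + \<theta>" \<beta>] xB y unfolding \<theta>(3) \<beta> by blast
      qed
      ultimately show ?thesis using outside[of \<theta>] \<theta> by auto
    qed
    then have hB: "convex hull B \<subseteq> {z. 0 < ?s z}" by (intro hull_minimal convex_side) auto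
    show ?thesis using hA hB by fastforce
  qed simp
qed

section \<open>The comajor relation\<close>

lemma linked_swap_left: "linked a b c d \<longleftrightarrow> linked b a c d"
  unfolding linked_sin by (simp only: mult_ac)

lemma linked_swap_right: "linked a b c d \<longleftrightarrow> linked a b d c"
  unfolding linked_sin by (simp only: mult_ac)

lemma Q_cong:
  assumes "pos a a' = 0" "pos b b' = 0" "Q a b"
  shows "Q a' b'"
proof -
  have e: "pos a' b' = pos a b" using pos_cong[OF assms(1,2)] by simp
  have q: "0 < pos a b" "pos a b < 1/6" "sim a (pos a b) a b" using assms(3) unfolding Q_def by blast+
  have "sim a' (pos a b) a b" by (rule sim_sub[OF q(3)]) (use q assms(1) in auto)
  then have "sim a' (pos a b) a' b'" using sim_cong[OF assms(1,2)] by blast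
  then show ?thesis unfolding Q_def e using q by blast
qed

lemma QQ_cong: "pos a a' = 0 \<Longrightarrow> pos b b' = 0 \<Longrightarrow> QQ a b \<Longrightarrow> QQ a' b'"
  unfolding QQ_def using Q_cong[of a a' b b'] Q_cong[of b b' a a'] by blast

lemma QQ_sym: "QQ a b \<Longrightarrow> QQ b a"
  unfolding QQ_def by blast

lemma QQ_join: "QQ x z \<Longrightarrow> QQ z y \<Longrightarrow> pos x y \<noteq> 0 \<Longrightarrow> QQ x y"
  using QQ_trans by blast

lemma class_sim:
  assumes Q: "Q p q" and w: "QQ p w" "QQ q w" "pos p w \<noteq> pos p q"
  shows "sim p (pos p q) p w"
proof (cases "pos p w < pos p q")
  case False
  then show ?thesis using class_sim_outside[OF Q w(1,2)] w(3) by simp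
next
  case True
  have e: "0 < pos p q" "pos p q < 1/6" using Q unfolding Q_def by auto
  have "\<not> Q w p" using True e pos_swap[of w p] unfolding Q_def by (auto split: if_splits)
  then have "Q p w" using w(1) unfolding QQ_def by blast
  moreover have "pos w q = pos p q - pos p w" using pos_base[of w q p] True by simp
  then have "\<not> Q q w" using True e pos_swap[of q w] pos_ge0[of p w] unfolding Q_def by (auto split: if_splits)
  then have "Q w q" using w(2) unfolding QQ_def by blast
  ultimately show ?thesis using class_sim_inside[OF Q _ _ True] by blast
qed

text \<open>Apart from \<open>p\<close> and \<open>q\<close>, all partners of either end have the
  itinerary of \<open>p\<close> for the one strip of \<open>p q\<close>, so
  \<open>sim_finite\<close> applies.\<close>

lemma finite_QQ: "finite {t. 0 \<le> t \<and> t < 1 \<and> QQ x t}"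
proof (cases "\<exists>y. QQ x y")
  case False
  then have "{t. 0 \<le> t \<and> t < 1 \<and> QQ x t} = {}" by blast
  then show ?thesis by (simp only: finite.emptyI)
next
  case True
  then obtain p q where pq: "Q p q" "x = p \<or> x = q" unfolding QQ_def by blast
  have e: "0 < pos p q" "pos p q \<le> 1/6" using pq(1) unfolding Q_def by auto
  have QQpq: "QQ p q" "QQ q p" using pq(1) unfolding QQ_def by blast+
  have "t \<in> {frac p, frac q} \<union> {t. 0 \<le> t \<and> t < 1 \<and> sim p (pos p q) p t}" if t: "0 \<le> t" "t < 1" "QQ x t" for t
  proof -
    have fr: "t = frac s" if "pos s t = 0" for s
      using pos0_frac[of "frac s" t] t that by (simp add: frac_lt_1)
    show ?thesis
    proof (cases "pos p t = 0 \<or> pos q t = 0")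
      case True
      then show ?thesis using fr by blast
    next
      case False
      have "QQ p t" "QQ q t" using pq(2) t(3) QQ_join[OF QQpq(1), of t] QQ_join[OF QQpq(2), of t] False by blast+
      moreover have "pos p t \<noteq> pos p q" using pos0_of_eq[of p t q] pos0_comm[of q t] False by auto
      ultimately show ?thesis using class_sim[OF pq(1)] t by blast
    qed
  qed
  then have "{t. 0 \<le> t \<and> t < 1 \<and> QQ x t} \<subseteq> {frac p, frac q} \<union> {t. 0 \<le> t \<and> t < 1 \<and> sim p (pos p q) p t}" by blast
  then show ?thesis by (rule finite_subset) (use sim_finite[OF e] in simp)
qed

text \<open>Testing against all chords with \<open>Q\<close>, not only those of the class, makes
  this an intersection of closed conditions; by \<open>edgeQ_class\<close> the class is
  enough.\<close>

definition edgeQ :: "real \<Rightarrow> real \<Rightarrow> bool" where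
  "edgeQ p q \<longleftrightarrow> Q p q \<and> (\<forall>u v. Q u v \<longrightarrow> \<not> linked p q u v)"

lemma edgeQ_class:
  assumes "Q p q" "\<And>u v. QQ p u \<Longrightarrow> QQ p v \<Longrightarrow> \<not> linked p q u v"
  shows "edgeQ p q"
  unfolding edgeQ_def
proof (intro conjI allI impI notI assms(1))
  fix u v assume uv: "Q u v" and l: "linked p q u v"
  have u: "QQ p u" by (rule QQ_linked[OF assms(1) uv l])
  have "pos p v \<noteq> 0" using linked_distinct[OF l] pos0_comm by auto
  then have "QQ p v" using QQ_join[OF u, of v] uv unfolding QQ_def by blast
  then show False using assms(2) u l by blast
qed

lemma edgeQ_N: "Q p q \<Longrightarrow> N p q \<Longrightarrow> edgeQ p q"
proof (rule edgeQ_class)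
  fix u v assume a: "Q p q" "N p q" "QQ p u" "QQ p v"
  show "\<not> linked p q u v"
  proof
    assume l: "linked p q u v"
    have "pos q u \<noteq> 0" "pos q v \<noteq> 0" using linked_distinct[OF l] pos0_comm by auto
    moreover have "QQ q p" using a(1) unfolding QQ_def by blast
    ultimately have "QQ q u" "QQ q v" using QQ_join a(3,4) by blast+
    then show False using leaf_class_edge[OF a(1,2,3) _ a(4)] l by blast
  qed
qed

lemma edgeQ_CsCL: "edgeQ p q \<Longrightarrow> seg p q \<in> CsCL"
proof -
  assume e: "edgeQ p q"
  then have Q: "Q p q" unfolding edgeQ_def by blast
  have C: "\<not> linked p q u v" if "QQ p u" "QQ p v" for u v
  proof
    assume l: "linked p q u v"
    have "pos u v \<noteq> 0" using linked_distinct[OF l] pos0_comm by auto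
    then have "QQ u v" by (rule QQ_join[OF QQ_sym[OF that(1)] that(2)])
    then show False using e l linked_swap_right[of p q u v] unfolding QQ_def edgeQ_def by blast
  qed
  interpret edge_strip p q
    by unfold_locales (rule Q, rule class_edge_E[OF Q C])
  show ?thesis by (rule seg_CsCL)
qed

abbreviation Sx :: "real \<Rightarrow> bool" where "Sx p \<equiv> 4 * p - 2/3 \<in> \<int>"

text \<open>Everything after this point works with the explicit description and no longer with
  laminations that realise the comajors.\<close>

lemma CsCL_iff: "c \<in> CsCL \<longleftrightarrow> (\<exists>x\<in>circle. c = {x}) \<or> (\<exists>p. Sx p \<and> c = seg p (p + 1/6)) \<or> (\<exists>p q. c = seg p q \<and> edgeQ p q)"
proof
  assume "c \<in> CsCL"
  then obtain L where "symmetric_cubic_lamination L" "comajor L c" unfolding CsCL_def by blast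
  from comajor_cases[OF this] show "(\<exists>x\<in>circle. c = {x}) \<or> (\<exists>p. Sx p \<and> c = seg p (p + 1/6)) \<or> (\<exists>p q. c = seg p q \<and> edgeQ p q)"
    using edgeQ_N by blast
next
  assume "(\<exists>x\<in>circle. c = {x}) \<or> (\<exists>p. Sx p \<and> c = seg p (p + 1/6)) \<or> (\<exists>p q. c = seg p q \<and> edgeQ p q)"
  then show "c \<in> CsCL"
    using degenerate_CsCL special.special_CsCL[OF special.intro] edgeQ_CsCL by blast
qed

section \<open>Separating the special chords from those with property Q\<close>

definition Zpt :: "real \<Rightarrow> bool" where
  "Zpt z \<longleftrightarrow> pos z (3 * z) = 1/6 \<or> pos z (3 * z) = 1/3 \<or> pos z (3 * z) = 2/3 \<or> pos z (3 * z) = 5/6"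

lemma Zpt_cong: "pos a b = 0 \<Longrightarrow> Zpt a \<Longrightarrow> Zpt b"
  unfolding Zpt_def using pos_cong[of a b "3 * a" "3 * b"] pos0_mult[of a b 1] by simp

text \<open>If \<open>z\<close> has coordinate \<open>v\<close> on the arc, then
  \<open>3 * a\<close> and \<open>3 * b\<close> have coordinates \<open>h - 2 * v\<close> and
  \<open>h - 2 * v + 3 * e\<close> modulo one. As \<open>v\<close> is between 0 and
  \<open>e\<close>, the strip at \<open>h\<close> lies between them, so no sector contains
  both.\<close>

lemma Q_avoid:
  assumes Q: "Q a b" and z: "pos a z \<le> pos a b" "Zpt z"
  shows False
proof -
  define e v w h where d: "e = pos a b" "v = pos a z" "w = pos a (3 * z)" "h = pos z (3 * z)"
  have e: "0 < e" "e \<le> 1/12" using Q Q_le[OF Q] unfolding d Q_def by auto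
  have v: "0 \<le> v" "v \<le> e" using z(1) pos_ge0 unfolding d by auto
  have h: "h = 1/6 \<or> h = 1/3 \<or> h = 2/3 \<or> h = 5/6" using z(2) unfolding Zpt_def d .
  obtain j where j: "K a e j (3 * a)" "K a e j (3 * b)"
  proof -
    have "same a e (3 ^ 1 * a) (3 ^ 1 * b)" using Q unfolding Q_def sim_def d by blast
    then show thesis using that unfolding same_def by auto
  qed
  define A B where AB: "A = pos a (3 * a)" "B = pos a (3 * b)"
  have r: "0 \<le> w" "w < 1" "0 \<le> A" "A < 1" "0 \<le> B" "B < 1" unfolding AB d by (simp_all add: pos_ge0 pos_lt1)
  have "h = (if v \<le> w then w - v else w - v + 1)" unfolding d by (rule pos_base)
  then have w: "w = v + h" using h v e r by (auto split: if_splits)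
  have "pos (3 * a) (3 * z) = 3 * v" unfolding pos_triple d[symmetric] using v e by simp
  then have "3 * v = (if A \<le> w then w - A else w - A + 1)" using pos_base[of "3 * a" "3 * z" a] unfolding AB d by simp
  then have A: "A = h - 2 * v" using w h v e r by (auto split: if_splits)
  have "pos z b = e - v" using pos_base[of z b a] z(1) unfolding d by simp
  then have "pos (3 * z) (3 * b) = 3 * (e - v)" unfolding pos_triple using v e by simp
  then have "3 * (e - v) = (if w \<le> B then B - w else B - w + 1)" using pos_base[of "3 * z" "3 * b" a] unfolding AB d by simp
  then have B: "B = h - 2 * v + 3 * e \<or> B = h - 2 * v + 3 * e - 1" using w by (auto split: if_splits)
  have s: "sec e j A" "sec e j B" using j unfolding K_def AB .
  show False
    using h
  proof (elim disjE)
    assume h: "h = 1/6" then show False using s B v e r unfolding A by (cases j) auto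
  next
    assume h: "h = 1/3" then show False using s B v e r unfolding A by (cases j) auto
  next
    assume h: "h = 2/3" then show False using s B v e r unfolding A by (cases j) auto
  next
    assume h: "h = 5/6" then show False using s B v e r unfolding A by (cases j) auto
  qed
qed

lemma QQ_Zpt: "QQ x y \<Longrightarrow> \<not> Zpt x \<and> \<not> Zpt y"
proof -
  have "\<not> Zpt a \<and> \<not> Zpt b" if q: "Q a b" for a b
  proof -
    have "pos a a \<le> pos a b" by (simp add: pos_ge0)
    then show ?thesis using Q_avoid[OF q, of a] Q_avoid[OF q, of b] by blast
  qed
  then show "QQ x y \<Longrightarrow> \<not> Zpt x \<and> \<not> Zpt y" unfolding QQ_def by blast
qed

definition SP :: "real \<Rightarrow> real \<Rightarrow> bool" where
  "SP x y \<longleftrightarrow> (Sx x \<and> pos x y = 1/6) \<or> (Sx y \<and> pos y x = 1/6)"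

lemma sixth: "pos p y = 1/6 \<Longrightarrow> pos y (p + 1/6) = 0"
  using pos0_of_eq[of p y "p + 1/6"] pos_self_add[of "1/6" p] by simp

lemma Sx_Zpt: "Sx p \<Longrightarrow> Zpt p \<and> Zpt (p + 1/6)"
proof -
  assume "Sx p"
  then interpret special p by unfold_locales
  have "pos (p + 1/6) (3 * (p + 1/6)) = pos p (3 * p + 1/3)"
  proof -
    have "3 * (p + 1/6) = (3 * p + 1/3) + 1/6" by simp
    then show ?thesis using pos_shift[of p "1/6" "3 * p + 1/3"] by (simp only:)
  qed
  then show ?thesis using pos_p3 pos_add_right[of "1/3" p "3 * p"] unfolding Zpt_def by auto
qed

lemma SP_Zpt: "SP x y \<Longrightarrow> Zpt x \<and> Zpt y"
proof -
  have "Zpt a \<and> Zpt b" if s: "Sx a" "pos a b = 1/6" for a b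
    using Sx_Zpt[OF s(1)] Zpt_cong[OF pos0_sym[OF sixth[OF s(2)]]] by blast
  then show "SP x y \<Longrightarrow> Zpt x \<and> Zpt y" unfolding SP_def by blast
qed

lemma SP_sym: "SP x y \<Longrightarrow> SP y x"
  unfolding SP_def by blast

lemma Sx_cong: "pos a b = 0 \<Longrightarrow> Sx a \<Longrightarrow> Sx b"
proof -
  assume "pos a b = 0" "Sx a"
  then have "4 * (b - a) \<in> \<int>" unfolding pos_eq0 by (intro Ints_mult) simp_all
  from Ints_add[OF \<open>Sx a\<close> this] show ?thesis by (simp add: algebra_simps)
qed

lemma SP_cong: "pos a a' = 0 \<Longrightarrow> pos b b' = 0 \<Longrightarrow> SP a b \<Longrightarrow> SP a' b'"
  unfolding SP_def using Sx_cong[of a a'] Sx_cong[of b b'] pos_cong[of a a' b b'] pos_cong[of b b' a a'] by auto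

text \<open>Special points differ by multiples of 1/4, never by 1/6, so different special chords
  share no end.\<close>

lemma Sx_exclusive: "Sx x \<Longrightarrow> pos x z = 1/6 \<Longrightarrow> \<not> Sx z"
proof
  assume *: "Sx x" "pos x z = 1/6" "Sx z"
  have "4 * (z - x - pos x z) \<in> \<int>" by (rule Ints_mult[OF _ pos_Ints]) simp
  from Ints_diff[OF Ints_diff[OF *(3,1)] this] have "(2/3 :: real) \<in> \<int>" unfolding *(2) by (simp add: algebra_simps)
  then obtain n :: int where "(2/3 :: real) = of_int n" by (elim Ints_cases)
  then have "real_of_int 2 = real_of_int (3 * n)" by simp
  then have "2 = 3 * n" by (simp only: of_int_eq_iff)
  then show False by presburger
qed

lemma Sx_unlinked: "Sx x \<Longrightarrow> Sx y \<Longrightarrow> \<not> linked x (x + 1/6) y (y + 1/6)"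
proof
  assume *: "Sx x" "Sx y" and l: "linked x (x + 1/6) y (y + 1/6)"
  have "4 * (y - x - pos x y) \<in> \<int>" by (rule Ints_mult[OF _ pos_Ints]) simp
  from Ints_diff[OF Ints_diff[OF *(2,1)] this] have "4 * pos x y \<in> \<int>" by (simp add: algebra_simps)
  then obtain n :: int where n: "4 * pos x y = of_int n" by (elim Ints_cases)
  have "0 \<le> n" "n < 4" using n pos_ge0[of x y] pos_lt1[of x y] by linarith+
  then have "n = 0 \<or> n = 1 \<or> n = 2 \<or> n = 3" by linarith
  then have d: "pos x y = 0 \<or> pos x y = 1/4 \<or> pos x y = 1/2 \<or> pos x y = 3/4" using n by auto
  have "pos x (x + 1/6) = 1/6" by (simp add: pos_self_add)
  moreover have "pos x (y + 1/6) = pos x y + 1/6" using pos_add_right[of "1/6" x y] d by auto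
  ultimately show False using l d unfolding linked_base by auto
qed

lemma SP_unlinked: "SP a b \<Longrightarrow> SP c d \<Longrightarrow> \<not> linked a b c d"
proof -
  have 1: "\<not> linked a b c d" if s: "Sx a" "pos a b = 1/6" "Sx c" "pos c d = 1/6" for a b c d
    using Sx_unlinked[OF s(1,3)] linked_cong[OF pos_self sixth[OF s(2)] pos_self sixth[OF s(4)]] by blast
  have 2: "\<not> linked a b c d" if s: "Sx a" "pos a b = 1/6" "SP c d" for a b c d
    using s(3) 1[OF s(1,2), of c d] 1[OF s(1,2), of d c] linked_swap_right[of a b c d] unfolding SP_def by blast
  show "SP a b \<Longrightarrow> SP c d \<Longrightarrow> \<not> linked a b c d"
    using 2[of a b c d] 2[of b a c d] linked_swap_left[of a b c d] unfolding SP_def[of a b] by blast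
qed

lemma Q_SP_unlinked: "Q a b \<Longrightarrow> SP c d \<Longrightarrow> \<not> linked a b c d"
proof
  assume *: "Q a b" "SP c d" "linked a b c d"
  have "Zpt c" "Zpt d" using SP_Zpt[OF *(2)] by blast+
  moreover have "pos a c \<le> pos a b \<or> pos a d \<le> pos a b" using *(3) unfolding linked_base by auto
  ultimately show False using Q_avoid[OF *(1)] by blast
qed

section \<open>The equivalence relation generated by the comajors\<close>

definition A :: "real \<Rightarrow> real \<Rightarrow> bool" where "A x y \<longleftrightarrow> pos x y = 0 \<or> QQ x y \<or> SP x y"

lemma A_sym: "A x y \<Longrightarrow> A y x"
  unfolding A_def using pos0_sym QQ_sym SP_sym by blast

text \<open>Special chords and chords with \<open>Q\<close> have no common end, as
  \<open>Zpt\<close> shows, so the two kinds never mix.\<close>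

lemma A_trans:
  assumes "A x z" "A z y"
  shows "A x y"
proof -
  have L: "A x y" if "pos x z = 0" "A z y" for x y z
    using that(2) pos0_trans[OF that(1), of y] QQ_cong[OF pos0_sym[OF that(1)] pos_self, of y] SP_cong[OF pos0_sym[OF that(1)] pos_self, of y]
    unfolding A_def by blast
  consider "pos x z = 0" | "pos z y = 0" | "QQ x z" "QQ z y" | "QQ x z" "SP z y" | "SP x z" "QQ z y" | "SP x z" "SP z y"
    using assms unfolding A_def by blast
  then show ?thesis
  proof cases
    case 1
    then show ?thesis using L assms(2) by blast
  next
    case 2
    then have "A y x" using L[of y z x] pos0_sym[of z y] A_sym[OF assms(1)] by blast
    then show ?thesis by (rule A_sym)
  next
    case 3
    then show ?thesis using QQ_join unfolding A_def by blast
  next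
    case 4
    then show ?thesis using QQ_Zpt SP_Zpt by blast
  next
    case 5
    then show ?thesis using QQ_Zpt SP_Zpt by blast
  next
    case 6
    then consider "Sx x" "pos x z = 1/6" "Sx z" | "Sx z" "Sx y" "pos y z = 1/6" | "pos x z = 1/6" "pos y z = 1/6" | "pos z x = 1/6" "pos z y = 1/6"
      unfolding SP_def by blast
    then show ?thesis
    proof cases
      case 1
      then show ?thesis using Sx_exclusive by blast
    next
      case 2
      then show ?thesis using Sx_exclusive[of y z] by blast
    next
      case 3
      have "pos (x + 1/6) (y + 1/6) = 0" by (rule pos0_trans[OF pos0_sym[OF sixth[OF 3(1)]] sixth[OF 3(2)]])
      then show ?thesis unfolding A_def by simp
    next
      case 4
      have "pos x y = 0" by (rule pos0_of_eq[of z]) (use 4 in simp)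
      then show ?thesis unfolding A_def by simp
    qed
  qed
qed

text \<open>Provides the disjoint hulls: special chords are unlinked with everything related by
  \<open>A\<close>, and for two crossing chords with \<open>Q\<close> the classes coincide by
  \<open>QQ_linked\<close>.\<close>

lemma A_linked:
  assumes "A a b" "A c d" "linked a b c d"
  shows "A a c"
proof -
  have 1: "A a c" if "Q a b" "QQ c d" "linked a b c d" for a b c d
  proof -
    consider "Q c d" | "Q d c" using \<open>QQ c d\<close> unfolding QQ_def by blast
    then show ?thesis
    proof cases
      case 1
      show ?thesis using QQ_linked[OF that(1) 1 that(3)] unfolding A_def by blast
    next
      case 2
      have "linked a b d c" using that(3) linked_swap_right by blast
      then have "A a d" using QQ_linked[OF that(1) 2] unfolding A_def by blast
      moreover have "A d c" using 2 unfolding A_def QQ_def by blast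
      ultimately show ?thesis by (rule A_trans)
    qed
  qed
  have n: "pos a b \<noteq> 0" "pos c d \<noteq> 0" using linked_distinct[OF assms(3)] by auto
  have l: "linked b a c d" "linked c d a b" "linked d c a b"
    using assms(3) linked_swap_left linked_sym by blast+
  have u: False if "QQ a b" "SP c d" using that Q_SP_unlinked[of a b c d] Q_SP_unlinked[of b a c d] assms(3) l(1) unfolding QQ_def by blast
  have u': False if "SP a b" "QQ c d" using that Q_SP_unlinked[of c d a b] Q_SP_unlinked[of d c a b] l unfolding QQ_def by blast
  have "QQ a b" "QQ c d" using assms(1,2) n u u' SP_unlinked[of a b c d] assms(3) unfolding A_def by blast+
  from this(1) consider "Q a b" | "Q b a" unfolding QQ_def by blast
  then show ?thesis
  proof cases
    case 1
    then show ?thesis using \<open>\<And>a b c d. Q a b \<Longrightarrow> QQ c d \<Longrightarrow> linked a b c d \<Longrightarrow> A a c\<close> \<open>QQ c d\<close> assms(3) by blast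
  next
    case 2
    have "A b c" by (rule 1[OF 2 \<open>QQ c d\<close> l(1)])
    with assms(1) show ?thesis by (rule A_trans)
  qed
qed

lemma seg_A: "seg s t \<in> CsCL \<Longrightarrow> A s t"
proof -
  have E: "A s t" if "seg s t = seg p q" "A p q" for s t p q
  proof -
    have "(pos s p = 0 \<and> pos t q = 0) \<or> (pos s q = 0 \<and> pos t p = 0)"
      using that(1) unfolding seg_eq doubleton_eq_iff ex_eq by blast
    then have "(A s p \<and> A t q) \<or> (A s q \<and> A t p)" unfolding A_def by blast
    then show ?thesis using A_trans A_sym that(2) by meson
  qed
  assume "seg s t \<in> CsCL"
  then consider x where "x \<in> circle" "seg s t = {x}" | p where "Sx p" "seg s t = seg p (p + 1/6)" | p q where "seg s t = seg p q" "edgeQ p q"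
    unfolding CsCL_iff by blast
  then show ?thesis
  proof cases
    case 1
    then have "degenerate (seg s t)" unfolding degenerate_def by blast
    then show ?thesis unfolding seg_degenerate A_def by blast
  next
    case 2
    have "A p (p + 1/6)" using 2(1) unfolding A_def SP_def by (simp add: pos_self_add)
    then show ?thesis using E 2(2) by blast
  next
    case 3
    then have "A p q" unfolding edgeQ_def A_def QQ_def by blast
    then show ?thesis using E 3(1) by blast
  qed
qed

abbreviation "rel \<equiv> {(a, b). a \<in> circle \<and> b \<in> circle \<and> closed_segment a b \<in> CsCL}"

lemma rel_ex: "(ex s, ex t) \<in> rel \<longleftrightarrow> seg s t \<in> CsCL"
  unfolding seg_def by simp

text \<open>Induction on the number of partners strictly between the ends. With none the chord is an
  edge, hence a comajor; otherwise it is replaced by the two chords to such a partner.\<close>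

lemma rel_path: "Q x y \<Longrightarrow> (ex x, ex y) \<in> rel\<^sup>*"
proof (induction "card {t. 0 \<le> t \<and> t < 1 \<and> QQ x t \<and> 0 < pos x t \<and> pos x t < pos x y}" arbitrary: x y rule: less_induct)
  case less
  let ?S = "\<lambda>x y. {t. 0 \<le> t \<and> t < 1 \<and> QQ x t \<and> 0 < pos x t \<and> pos x t < pos x y}"
  note Q = less.prems
  have QQxy: "QQ x y" "QQ y x" using Q unfolding QQ_def by blast+
  have e: "pos x y < 1/6" "0 < pos x y" using Q unfolding Q_def by auto
  have fin: "finite (?S x y)" by (rule finite_subset[OF _ finite_QQ[of x]]) blast
  show ?case
  proof (cases "?S x y = {}")
    case True
    have "edgeQ x y"
    proof (rule edgeQ_class[OF Q])
      fix u v assume uv: "QQ x u" "QQ x v"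
      have no: "\<not> (0 < pos x w \<and> pos x w < pos x y)" if "QQ x w" for w
      proof
        assume "0 < pos x w \<and> pos x w < pos x y"
        moreover have "QQ x (frac w)" by (rule QQ_cong[OF pos_self _ that]) (simp add: pos0_sym)
        ultimately have "frac w \<in> ?S x y" by (simp add: frac_lt_1)
        then show False using True by blast
      qed
      show "\<not> linked x y u v" unfolding linked_base using no[OF uv(1)] no[OF uv(2)] by blast
    qed
    then have "seg x y \<in> CsCL" by (rule edgeQ_CsCL)
    then show ?thesis using rel_ex by blast
  next
    case False
    then obtain u where u: "0 \<le> u" "u < 1" "QQ x u" "0 < pos x u" "pos x u < pos x y" by blast
    have "\<not> Q u x" using u e pos_swap[of u x] unfolding Q_def by auto
    then have Qxu: "Q x u" using u(3) unfolding QQ_def by blast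
    have uy: "pos u y = pos x y - pos x u" using pos_base[of u y x] u by simp
    then have "QQ u y" using QQ_join[OF QQ_sym[OF u(3)] QQxy(1)] u by simp
    moreover have "\<not> Q y u" using uy u e pos_swap[of y u] unfolding Q_def by auto
    ultimately have Quy: "Q u y" unfolding QQ_def by blast
    have "?S x u \<subset> ?S x y" using u by auto
    then have "card (?S x u) < card (?S x y)" by (rule psubset_card_mono[OF fin])
    from less.hyps[OF this Qxu] have 1: "(ex x, ex u) \<in> rel\<^sup>*" .
    have "?S u y \<subseteq> ?S x y"
    proof
      fix t assume "t \<in> ?S u y"
      then have t: "0 \<le> t" "t < 1" "QQ u t" "0 < pos u t" "pos u t < pos u y" by auto
      have "pos u t = (if pos x u \<le> pos x t then pos x t - pos x u else pos x t - pos x u + 1)" by (rule pos_base)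
      then have p: "0 < pos x t" "pos x t < pos x y" using t(4,5) uy u e pos_ge0[of x t] by (auto split: if_splits)
      have "QQ x t" by (rule QQ_join[OF u(3) t(3)]) (use p in simp)
      then show "t \<in> ?S x y" using t p by blast
    qed
    moreover have "u \<in> ?S x y" "u \<notin> ?S u y" using u by auto
    ultimately have "?S u y \<subset> ?S x y" by blast
    then have "card (?S u y) < card (?S x y)" by (rule psubset_card_mono[OF fin])
    from less.hyps[OF this Quy] have "(ex u, ex y) \<in> rel\<^sup>*" .
    with 1 show ?thesis by (rule rtrancl_trans)
  qed
qed

lemma rel_sym: "(a, b) \<in> rel \<Longrightarrow> (b, a) \<in> rel"
  by (auto simp: closed_segment_commute)

lemma lam_rel_A: "(ex s, ex t) \<in> lam_rel CsCL \<longleftrightarrow> A s t"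
proof
  assume "(ex s, ex t) \<in> lam_rel CsCL"
  then have "(ex s, ex t) \<in> rel\<^sup>*" unfolding lam_rel_def by blast
  then have "\<exists>t'. ex t = ex t' \<and> A s t'"
  proof (induction rule: rtrancl_induct)
    case base
    show ?case unfolding A_def by (intro exI[of _ s]) simp
  next
    case (step y z)
    then obtain t1 where t1: "y = ex t1" "A s t1" by blast
    have "z \<in> circle" using step(2) by blast
    then obtain t2 where t2: "z = ex t2" by (rule ex_surj)
    have "seg t1 t2 \<in> CsCL" using step(2) unfolding t1(1) t2 rel_ex .
    from A_trans[OF t1(2) seg_A[OF this]] show ?case using t2 by blast
  qed
  then obtain t' where "ex t = ex t'" "A s t'" by blast
  moreover then have "A t' t" unfolding A_def ex_eq using pos0_sym by blast
  ultimately show "A s t" using A_trans by blast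
next
  assume "A s t"
  then consider "pos s t = 0" | "Q s t" | "Q t s" | "Sx s" "pos s t = 1/6" | "Sx t" "pos t s = 1/6" unfolding A_def QQ_def SP_def by blast
  then have "(ex s, ex t) \<in> rel\<^sup>*"
  proof cases
    case 1
    then show ?thesis using ex_cong[OF 1] by simp
  next
    case 2
    then show ?thesis by (rule rel_path)
  next
    case 3
    have "sym rel" by (rule symI) (rule rel_sym)
    then have "sym (rel\<^sup>*)" by (rule sym_rtrancl)
    then show ?thesis using rel_path[OF 3] by (rule symD)
  next
    case 4
    have "seg s t = seg s (s + 1/6)" by (rule seg_cong[OF pos_self sixth[OF 4(2)]])
    then have "seg s t \<in> CsCL" using 4(1) unfolding CsCL_iff by blast
    then show ?thesis using rel_ex by blast
  next
    case 5
    have "seg t s = seg t (t + 1/6)" by (rule seg_cong[OF pos_self sixth[OF 5(2)]])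
    then have "seg t s \<in> CsCL" using 5(1) unfolding CsCL_iff by blast
    then have "seg s t \<in> CsCL" using seg_commute by simp
    then show ?thesis using rel_ex by blast
  qed
  then show "(ex s, ex t) \<in> lam_rel CsCL" unfolding lam_rel_def by simp
qed

section \<open>Closedness and the main theorem\<close>

text \<open>Sector membership with base point and width as further variables, in terms of continuous
  functions, so that limits of chords with varying strips can be taken.\<close>

fun Ksin :: "sector \<Rightarrow> real \<Rightarrow> real \<Rightarrow> real \<Rightarrow> bool" where
  "Ksin Near s e w \<longleftrightarrow> 0 \<le> sin (pi * (w - s - 1/6)) * sin (pi * (w - s - (e + 5/6)))"
| "Ksin Far s e w \<longleftrightarrow> sin (pi * (w - s - (e + 1/3))) * sin (pi * (w - s - 2/3)) \<le> 0"
| "Ksin Mid s e w \<longleftrightarrow> sin (pi * (w - s - (e + 1/6))) * sin (pi * (w - s - 1/3)) \<le> 0 \<or>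
    sin (pi * (w - s - (e + 2/3))) * sin (pi * (w - s - 5/6)) \<le> 0"

lemma K_Ksin: "0 \<le> e \<Longrightarrow> e \<le> 1/12 \<Longrightarrow> K s e j w \<longleftrightarrow> Ksin j s e w"
  unfolding K_def using arc_outside[of "1/6" "e + 5/6" s w] arc_inside[of "e + 1/3" "2/3" s w]
    arc_inside[of "e + 1/6" "1/3" s w] arc_inside[of "e + 2/3" "5/6" s w]
  by (cases j) simp_all

lemma closed_Ksin:
  fixes f g h :: "real \<times> real \<Rightarrow> real"
  assumes "continuous_on UNIV f" "continuous_on UNIV g" "continuous_on UNIV h"
  shows "closed {z. Ksin j (f z) (g z) (h z)}"
proof (cases j)
  case Near
  then show ?thesis by (simp only: Ksin.simps) (intro closed_Collect_le continuous_intros assms)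
next
  case Far
  then show ?thesis by (simp only: Ksin.simps) (intro closed_Collect_le continuous_intros assms)
next
  case Mid
  then show ?thesis by (simp only: Ksin.simps) (intro closed_Collect_disj closed_Collect_le continuous_intros assms)
qed

text \<open>Lifts of chords with \<open>Q\<close> whose difference is the arc length, together with
  the diagonal. The bound 1/12 from \<open>Q_le\<close> replaces the strict bound 1/6, so the set is
  closed.\<close>

definition near_pairs :: "(real \<times> real) set" where
  "near_pairs = {z. 0 \<le> snd z - fst z \<and> snd z - fst z \<le> 1/12 \<and> sim (fst z) (snd z - fst z) (fst z) (snd z)}"

lemma closed_near_pairs: "closed near_pairs"
proof -
  let ?B = "{z :: real \<times> real. 0 \<le> snd z - fst z} \<inter> {z. snd z - fst z \<le> 1/12}"
  let ?X = "\<Inter>n. \<Union>j\<in>{Near, Far, Mid}. {z. Ksin j (fst z) (snd z - fst z) (3 ^ n * fst z)} \<inter> {z. Ksin j (fst z) (snd z - fst z) (3 ^ n * snd z)}"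
  have eq: "near_pairs = ?B \<inter> ?X"
  proof (intro set_eqI)
    fix z :: "real \<times> real"
    have all: "(\<exists>j. R j) \<longleftrightarrow> (\<exists>j\<in>{Near, Far, Mid}. R j)" for R
    proof -
      have "j \<in> {Near, Far, Mid}" for j by (cases j) auto
      then show ?thesis by blast
    qed
    show "z \<in> near_pairs \<longleftrightarrow> z \<in> ?B \<inter> ?X"
    proof (cases "z \<in> ?B")
      case True
      then have e: "0 \<le> snd z - fst z" "snd z - fst z \<le> 1/12" by auto
      have "sim (fst z) (snd z - fst z) (fst z) (snd z) \<longleftrightarrow> z \<in> ?X"
        unfolding sim_def same_def K_Ksin[OF e] all INT_iff UN_iff Int_iff mem_Collect_eq by blast
      then show ?thesis using True e unfolding near_pairs_def by blast
    next
      case False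
      then show ?thesis unfolding near_pairs_def by blast
    qed
  qed
  have cB: "closed ?B" by (intro closed_Int closed_Collect_le continuous_intros)
  have cX: "closed ?X"
    by (auto intro!: closed_INT closed_Un closed_Int closed_Ksin continuous_intros simp del: Ksin.simps)
  show ?thesis unfolding eq by (rule closed_Int[OF cB cX])
qed

lemma near_pairs_Q: "(s, t) \<in> near_pairs \<Longrightarrow> s = t \<or> Q s t"
proof -
  assume "(s, t) \<in> near_pairs"
  then have *: "0 \<le> t - s" "t - s \<le> 1/12" "sim s (t - s) s t" unfolding near_pairs_def by simp_all
  have p: "pos s t = t - s" using * by (intro pos_unique) auto
  show ?thesis using * unfolding Q_def p by auto
qed

lemma Q_near_pairs:
  assumes "Q p q"
  shows "\<exists>s t. s \<in> {0..1} \<and> t \<in> {0..2} \<and> (s, t) \<in> near_pairs \<and> pos p s = 0 \<and> pos q t = 0"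
proof -
  define s t where st: "s = frac p" "t = frac p + pos p q"
  have e: "0 \<le> pos p q" "pos p q \<le> 1/12" using Q_le[OF assms] pos_ge0 by auto
  have s: "0 \<le> s" "s < 1" unfolding st by (simp_all add: frac_lt_1)
  have ps: "pos p s = 0" unfolding st by (simp add: pos0_sym)
  have "pos s t = pos p q" unfolding st using pos_self_add[of "pos p q" "frac p"] e by simp
  then have "pos s t = pos s q" using pos_cong[OF ps pos_self, of q] by simp
  then have qt: "pos q t = 0" using pos0_of_eq[of s q t] by simp
  have "Q s t" by (rule Q_cong[OF ps qt assms])
  moreover have "t - s = pos s t" unfolding \<open>pos s t = pos p q\<close> unfolding st by simp
  ultimately have "(s, t) \<in> near_pairs" unfolding near_pairs_def Q_def using e \<open>pos s t = pos p q\<close> by simp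
  moreover have "s \<in> {0..1}" "t \<in> {0..2}" using s e unfolding st by auto
  ultimately show ?thesis using ps qt by blast
qed

definition edge_pairs :: "(real \<times> real) set" where
  "edge_pairs = near_pairs \<inter> (\<Inter>z\<in>{(u, v). Q u v}. {(s, t). \<not> linked s t (fst z) (snd z)})"

lemma closed_edge_pairs: "closed edge_pairs"
  unfolding edge_pairs_def by (intro closed_Int closed_near_pairs closed_INT ballI closed_unlinked)

lemma edge_pairs_iff: "(s, t) \<in> edge_pairs \<longleftrightarrow> (s, t) \<in> near_pairs \<and> (\<forall>u v. Q u v \<longrightarrow> \<not> linked s t u v)"
  unfolding edge_pairs_def by auto

definition Sx_set :: "real set" where "Sx_set = {p. ex (4 * p - 2/3) = ex 0} \<inter> {0..1}"

lemma Sx_ex: "Sx p \<longleftrightarrow> ex (4 * p - 2/3) = ex 0"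
  using pos0_comm[of "4 * p - 2/3" 0] unfolding ex_eq pos_eq0 by simp

lemma compact_Sx: "compact Sx_set"
  unfolding Sx_set_def by (intro closed_Int_compact closed_Collect_eq continuous_intros compact_Icc)

lemma Sx_frac: "Sx p \<Longrightarrow> frac p \<in> Sx_set"
  unfolding Sx_set_def using Sx_cong[of p "frac p"] Sx_ex[of "frac p"] by (simp add: pos0_sym frac_lt_1 less_imp_le)

text \<open>Edges and special chords come from compact sets of lifts. A limit of ever shorter edges
  is a point of the circle, and all of these are leaves.\<close>

lemma closed_Union_CsCL: "closed (\<Union>CsCL)"
proof -
  let ?g = "\<lambda>z :: (real \<times> real) \<times> real. (1 - snd z) *\<^sub>R ex (fst (fst z)) + snd z *\<^sub>R ex (snd (fst z))"
  let ?K1 = "(edge_pairs \<inter> ({0..1} \<times> {0..2})) \<times> {0..1::real}"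
  let ?K2 = "((\<lambda>p. (p, p + 1/6)) ` Sx_set) \<times> {0..1::real}"
  have mem: "z \<in> seg s t \<longleftrightarrow> (\<exists>u\<in>{0..1}. z = ?g ((s, t), u))" for z s t
    unfolding seg_def in_segment by auto
  have im: "?g ` (X \<times> {0..1}) = (\<Union>(s, t)\<in>X. seg s t)" for X
  proof (intro set_eqI iffI)
    fix z assume "z \<in> ?g ` (X \<times> {0..1})"
    then obtain s t u where "(s, t) \<in> X" "u \<in> {0..1}" "z = ?g ((s, t), u)" by auto
    then show "z \<in> (\<Union>(s, t)\<in>X. seg s t)" using mem[of z s t] by blast
  next
    fix z assume "z \<in> (\<Union>(s, t)\<in>X. seg s t)"
    then obtain s t where st: "(s, t) \<in> X" "z \<in> seg s t" by blast
    then obtain u where "u \<in> {0..1}" "z = ?g ((s, t), u)" using mem[of z s t] by blast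
    then show "z \<in> ?g ` (X \<times> {0..1})" using st(1) by blast
  qed
  have "\<Union>CsCL = circle \<union> ?g ` ?K1 \<union> ?g ` ?K2"
    unfolding im
  proof (intro set_eqI iffI)
    fix z assume "z \<in> \<Union>CsCL"
    then obtain c where c: "z \<in> c" "c \<in> CsCL" by blast
    from c(2) consider x where "x \<in> circle" "c = {x}" | p where "Sx p" "c = seg p (p + 1/6)" | p q where "c = seg p q" "edgeQ p q"
      unfolding CsCL_iff by blast
    then show "z \<in> circle \<union> (\<Union>(s, t)\<in>edge_pairs \<inter> ({0..1} \<times> {0..2}). seg s t) \<union> (\<Union>(s, t)\<in>(\<lambda>p. (p, p + 1/6)) ` Sx_set. seg s t)"
    proof cases
      case 1
      then show ?thesis using c by blast
    next
      case 2
      have "pos p (frac p) = 0" "pos (p + 1/6) (frac p + 1/6) = 0" by (simp_all add: pos0_sym)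
      then have "c = seg (frac p) (frac p + 1/6)" unfolding 2(2) by (rule seg_cong)
      then show ?thesis using c(1) Sx_frac[OF 2(1)] by blast
    next
      case 3
      have Q: "Q p q" using 3(2) unfolding edgeQ_def by blast
      obtain s t where st: "s \<in> {0..1}" "t \<in> {0..2}" "(s, t) \<in> near_pairs" "pos p s = 0" "pos q t = 0" using Q_near_pairs[OF Q] by blast
      have "\<not> linked s t u v" if "Q u v" for u v
        using 3(2) that linked_cong[OF st(4,5) pos_self pos_self] unfolding edgeQ_def by blast
      then have "(s, t) \<in> edge_pairs" unfolding edge_pairs_iff using st(3) by blast
      moreover have "c = seg s t" unfolding 3(1) by (rule seg_cong[OF st(4,5)])
      ultimately show ?thesis using c(1) st(1,2) by blast
    qed
  next
    fix z assume "z \<in> circle \<union> (\<Union>(s, t)\<in>edge_pairs \<inter> ({0..1} \<times> {0..2}). seg s t) \<union> (\<Union>(s, t)\<in>(\<lambda>p. (p, p + 1/6)) ` Sx_set. seg s t)"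
    then consider "z \<in> circle" | s t where "(s, t) \<in> edge_pairs" "z \<in> seg s t" | p where "p \<in> Sx_set" "z \<in> seg p (p + 1/6)" by blast
    then show "z \<in> \<Union>CsCL"
    proof cases
      case 1
      then show ?thesis using degenerate_CsCL by blast
    next
      case 2
      have "seg s t \<in> CsCL"
      proof (cases "s = t")
        case True
        then show ?thesis using seg_self degenerate_CsCL[OF ex_circle(1), of s] by simp
      next
        case False
        then have "edgeQ s t" using 2(1) near_pairs_Q unfolding edge_pairs_iff edgeQ_def by blast
        then show ?thesis by (rule edgeQ_CsCL)
      qed
      then show ?thesis using 2(2) by blast
    next
      case 3
      then have "seg p (p + 1/6) \<in> CsCL" unfolding CsCL_iff Sx_ex Sx_set_def by blast
      then show ?thesis using 3(2) by blast
    qed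
  qed
  moreover have "compact ?K1" by (intro compact_Times closed_Int_compact closed_edge_pairs compact_Icc)
  moreover have "compact ?K2" by (intro compact_Times compact_continuous_image compact_Sx compact_Icc continuous_intros)
  moreover have "continuous_on X ?g" for X by (intro continuous_intros)
  ultimately show ?thesis
    using compact_imp_closed[OF compact_continuous_image[of ?K1 ?g]] compact_imp_closed[OF compact_continuous_image[of ?K2 ?g]]
    by (simp only: closed_Un closed_sphere)
qed

lemma CsCL_unlinked:
  assumes st: "seg s t \<in> CsCL" and uv: "seg u v \<in> CsCL"
  shows "\<not> linked s t u v"
proof
  assume l: "linked s t u v"
  have form: "(\<exists>p. Sx p \<and> {ex a, ex b} = {ex p, ex (p + 1/6)}) \<or> (\<exists>p q. {ex a, ex b} = {ex p, ex q} \<and> edgeQ p q)"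
    if "seg a b \<in> CsCL" "pos a b \<noteq> 0" for a b
  proof -
    have "\<not> (\<exists>x\<in>circle. seg a b = {x})" using that(2) seg_degenerate[of a b] unfolding degenerate_def by blast
    then show ?thesis using that(1) unfolding CsCL_iff seg_eq[symmetric] by blast
  qed
  have tr: "linked p q c d" if "{ex a, ex b} = {ex p, ex q}" "linked a b c d" for a b c d p q
  proof -
    have "pos a p = 0 \<and> pos b q = 0 \<or> pos a q = 0 \<and> pos b p = 0" using that(1) unfolding doubleton_eq_iff ex_eq .
    then show ?thesis
    proof
      assume h: "pos a p = 0 \<and> pos b q = 0"
      then show ?thesis using linked_cong[of a p b q c c d d] that(2) by simp
    next
      assume h: "pos a q = 0 \<and> pos b p = 0"
      then show ?thesis using linked_cong[of a q b p c c d d] that(2) linked_swap_left[of p q c d] by simp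
    qed
  qed
  have n: "pos s t \<noteq> 0" "pos u v \<noteq> 0" using linked_distinct[OF l] by auto
  have sp: "SP p (p + 1/6)" if "Sx p" for p using that unfolding SP_def by (simp add: pos_self_add)
  obtain p q where pq: "{ex s, ex t} = {ex p, ex q}" "SP p q \<or> edgeQ p q" using form[OF st n(1)] sp by blast
  obtain a b where ab: "{ex u, ex v} = {ex a, ex b}" "SP a b \<or> edgeQ a b" using form[OF uv n(2)] sp by blast
  have "linked a b p q" by (rule tr[OF ab(1) linked_sym[OF tr[OF pq(1) l]]])
  then have l': "linked a b p q" "linked p q a b" using linked_sym by blast+
  show False
    using pq(2) ab(2) l' SP_unlinked[of p q a b] Q_SP_unlinked[of p q a b] Q_SP_unlinked[of a b p q] unfolding edgeQ_def by blast
qed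

lemma CsCL_seg: "c \<in> CsCL \<Longrightarrow> \<exists>s t. c = seg s t"
  unfolding CsCL_iff using seg_self ex_surj by metis

lemma lamination_CsCL: "lamination CsCL"
  unfolding lamination_def
proof (intro conjI ballI closed_Union_CsCL)
  show "CsCL \<subseteq> chords" using CsCL_seg seg_chord by blast
  show "{x} \<in> CsCL" if "x \<in> circle" for x using degenerate_CsCL that .
  show "\<not> crossing l m" if lm: "l \<in> CsCL" "m \<in> CsCL" for l m
  proof -
    obtain s t where st: "l = seg s t" using CsCL_seg[OF lm(1)] by blast
    obtain u v where uv: "m = seg u v" using CsCL_seg[OF lm(2)] by blast
    show ?thesis unfolding st uv crossing_seg by (rule CsCL_unlinked) (use lm st uv in blast)+
  qed
qed

lemma lam_rel_circle: "lam_rel CsCL \<subseteq> circle \<times> circle"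
  unfolding lam_rel_def by blast

lemma lam_relE:
  assumes "z \<in> lam_rel CsCL"
  obtains s t where "z = (ex s, ex t)" "A s t"
proof -
  obtain x y where xy: "z = (x, y)" "x \<in> circle" "y \<in> circle" using assms lam_rel_circle by blast
  obtain s where s: "x = ex s" using ex_surj[OF xy(2)] by blast
  obtain t where t: "y = ex t" using ex_surj[OF xy(3)] by blast
  show thesis by (rule that[of s t]) (use assms lam_rel_A xy s t in auto)
qed

lemma equiv_CsCL: "equiv circle (lam_rel CsCL)"
proof (rule equivI)
  show "lam_rel CsCL \<subseteq> circle \<times> circle" by (rule lam_rel_circle)
  show "refl_on circle (lam_rel CsCL)"
  proof (rule refl_onI)
    fix x assume "x \<in> circle"
    then obtain s where "x = ex s" by (rule ex_surj)
    then show "(x, x) \<in> lam_rel CsCL" using lam_rel_A[of s s] by (simp add: A_def)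
  qed
  show "sym (lam_rel CsCL)"
  proof (rule symI)
    fix x y assume xy: "(x, y) \<in> lam_rel CsCL"
    then obtain s t where "(x, y) = (ex s, ex t)" "A s t" by (rule lam_relE)
    then show "(y, x) \<in> lam_rel CsCL" using lam_rel_A[of t s] A_sym by blast
  qed
  show "trans (lam_rel CsCL)"
  proof (rule transI)
    fix x y z assume xy: "(x, y) \<in> lam_rel CsCL" and yz: "(y, z) \<in> lam_rel CsCL"
    obtain s t where st: "(x, y) = (ex s, ex t)" "A s t" using xy by (rule lam_relE)
    have "z \<in> circle" using yz lam_rel_circle by blast
    then obtain u where u: "z = ex u" by (rule ex_surj)
    have "A t u" using yz lam_rel_A[of t u] st(1) u by blast
    then have "A s u" using A_trans st(2) by blast
    then show "(x, z) \<in> lam_rel CsCL" using lam_rel_A[of s u] st(1) u by blast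
  qed
qed

text \<open>The graph is the union of the diagonal, the pairs with \<open>Q\<close>, the special
  pairs and the transposes of the last two, each a continuous image of a compact set.\<close>

lemma closed_lam_rel: "closed (lam_rel CsCL)"
proof -
  let ?f = "\<lambda>z. (ex (fst z), ex (snd z))"
  define NN where "NN = ?f ` (near_pairs \<inter> ({0..1} \<times> {0..2}))"
  define SS where "SS = ?f ` ((\<lambda>p. (p, p + 1/6)) ` Sx_set)"
  define DD where "DD = (\<lambda>x::complex. (x, x)) ` circle"
  have "lam_rel CsCL = DD \<union> (NN \<union> prod.swap ` NN) \<union> (SS \<union> prod.swap ` SS)"
  proof (intro set_eqI iffI)
    fix z assume "z \<in> lam_rel CsCL"
    then obtain s t where z: "z = (ex s, ex t)" "A s t" by (rule lam_relE)
    have qn: "(ex a, ex b) \<in> NN" if q: "Q a b" for a b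
    proof -
      obtain s t where st: "s \<in> {0..1}" "t \<in> {0..2}" "(s, t) \<in> near_pairs" "pos a s = 0" "pos b t = 0" using Q_near_pairs[OF q] by blast
      show ?thesis unfolding NN_def using ex_cong[OF st(4)] ex_cong[OF st(5)] st(1-3) by (intro image_eqI[of _ _ "(s, t)"]) auto
    qed
    have sn: "(ex a, ex b) \<in> SS" if "Sx a" "pos a b = 1/6" for a b
    proof -
      have "ex b = ex (frac a + 1/6)" "ex a = ex (frac a)"
        using ex_cong[OF pos0_trans[OF sixth[OF that(2)], of "frac a + 1/6"]] ex_cong[of a "frac a"] by (simp_all add: pos0_sym)
      note e = this
      have "(frac a, frac a + 1/6) \<in> (\<lambda>p. (p, p + 1/6)) ` Sx_set" using Sx_frac[OF that(1)] by blast
      then have "?f (frac a, frac a + 1/6) \<in> SS" unfolding SS_def by (rule imageI)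
      then show ?thesis unfolding e fst_conv snd_conv .
    qed
    have sw: "(x, y) \<in> prod.swap ` X" if "(y, x) \<in> X" for x y :: complex and X using that by force
    from z(2) consider "pos s t = 0" | "Q s t" | "Q t s" | "Sx s" "pos s t = 1/6" | "Sx t" "pos t s = 1/6" unfolding A_def QQ_def SP_def by blast
    then have "z \<in> DD \<or> z \<in> NN \<or> z \<in> prod.swap ` NN \<or> z \<in> SS \<or> z \<in> prod.swap ` SS"
    proof cases
      case 1
      then have "z = (ex s, ex s)" using z(1) ex_cong by simp
      then have "z \<in> DD" unfolding DD_def using ex_circle(1)[of s] by blast
      then show ?thesis by blast
    next
      case 2
      have "z \<in> NN" unfolding z(1) by (rule qn[OF 2])
      then show ?thesis by blast
    next
      case 3
      have "z \<in> prod.swap ` NN" unfolding z(1) by (rule sw[OF qn[OF 3]])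
      then show ?thesis by blast
    next
      case 4
      have "z \<in> SS" unfolding z(1) by (rule sn[OF 4])
      then show ?thesis by blast
    next
      case 5
      have "z \<in> prod.swap ` SS" unfolding z(1) by (rule sw[OF sn[OF 5]])
      then show ?thesis by blast
    qed
    then show "z \<in> DD \<union> (NN \<union> prod.swap ` NN) \<union> (SS \<union> prod.swap ` SS)" unfolding Un_iff by blast
  next
    fix z assume z: "z \<in> DD \<union> (NN \<union> prod.swap ` NN) \<union> (SS \<union> prod.swap ` SS)"
    have sy: "(y, x) \<in> lam_rel CsCL" if "(x, y) \<in> lam_rel CsCL" for x y
      using equiv_CsCL that unfolding equiv_def sym_def by blast
    have N: "w \<in> lam_rel CsCL" if "w \<in> NN" for w
    proof -
      obtain s t where st: "(s, t) \<in> near_pairs" "w = (ex s, ex t)" using \<open>w \<in> NN\<close> unfolding NN_def by auto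
      then have "A s t" using near_pairs_Q[OF st(1)] unfolding A_def QQ_def by auto
      then show ?thesis using lam_rel_A st(2) by blast
    qed
    have S: "w \<in> lam_rel CsCL" if "w \<in> SS" for w
    proof -
      obtain p where p: "p \<in> Sx_set" "w = (ex p, ex (p + 1/6))" using \<open>w \<in> SS\<close> unfolding SS_def by auto
      then have "Sx p" unfolding Sx_ex Sx_set_def by blast
      then have "A p (p + 1/6)" unfolding A_def SP_def by (simp add: pos_self_add)
      then show ?thesis using lam_rel_A p(2) by blast
    qed
    have D: "w \<in> lam_rel CsCL" if "w \<in> DD" for w
      using equiv_CsCL that unfolding equiv_def refl_on_def DD_def by blast
    from z consider "z \<in> DD" | "z \<in> NN" | "z \<in> prod.swap ` NN" | "z \<in> SS" | "z \<in> prod.swap ` SS" by blast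
    then show "z \<in> lam_rel CsCL"
    proof cases
      case 3
      then obtain w where w: "w \<in> NN" "z = (snd w, fst w)" unfolding prod.swap_def by blast
      show ?thesis using sy[of "fst w" "snd w"] N[OF w(1)] unfolding w(2) by simp
    next
      case 5
      then obtain w where w: "w \<in> SS" "z = (snd w, fst w)" unfolding prod.swap_def by blast
      show ?thesis using sy[of "fst w" "snd w"] S[OF w(1)] unfolding w(2) by simp
    qed (use D N S in blast)+
  qed
  moreover have cN: "compact NN"
    unfolding NN_def by (rule compact_continuous_image) (auto intro!: continuous_intros compact_Times closed_Int_compact closed_near_pairs)
  moreover have cS: "compact SS"
    unfolding SS_def by (rule compact_continuous_image) (auto intro!: continuous_intros compact_continuous_image compact_Sx)
  moreover have "compact DD" unfolding DD_def by (rule compact_continuous_image) (auto intro!: continuous_intros)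
  moreover have "compact (prod.swap ` X)" if "compact X" for X :: "(complex \<times> complex) set"
    by (rule compact_continuous_image[OF _ that]) (auto intro!: continuous_intros simp: prod.swap_def)
  ultimately have "compact (lam_rel CsCL)" by (simp add: compact_Un)
  then show ?thesis by (rule compact_imp_closed)
qed

section \<open>The classes and the main result\<close>

lemma classE:
  assumes "X \<in> circle // lam_rel CsCL"
  obtains s where "X = {ex t | t. A s t}"
proof -
  obtain x where x: "x \<in> circle" "X = lam_rel CsCL `` {x}" using assms by (rule quotientE)
  obtain s where s: "x = ex s" using ex_surj[OF x(1)] by blast
  have "X = {ex t | t. A s t}"
  proof (intro set_eqI iffI)
    fix y assume "y \<in> X"
    then have y: "(ex s, y) \<in> lam_rel CsCL" unfolding x(2) s by blast
    then have "y \<in> circle" using lam_rel_circle by blast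
    then obtain t where "y = ex t" by (rule ex_surj)
    then show "y \<in> {ex t | t. A s t}" using y lam_rel_A by blast
  next
    fix y assume "y \<in> {ex t | t. A s t}"
    then show "y \<in> X" unfolding x(2) s using lam_rel_A by blast
  qed
  then show thesis by (rule that)
qed

lemma class_mem: "X = {ex t | t. A s t} \<Longrightarrow> ex a \<in> X \<longleftrightarrow> A s a"
proof -
  assume X: "X = {ex t | t. A s t}"
  have "A s a" if "A s t" "ex a = ex t" for t
  proof -
    have "A t a" using that(2) pos0_sym unfolding A_def ex_eq by blast
    with that(1) show ?thesis by (rule A_trans)
  qed
  then show ?thesis unfolding X by blast
qed

lemma class_circle: "X \<in> circle // lam_rel CsCL \<Longrightarrow> X \<subseteq> circle"
  by (erule classE) auto

lemma class_finite: "X \<in> circle // lam_rel CsCL \<Longrightarrow> finite X"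
proof -
  assume "X \<in> circle // lam_rel CsCL"
  then obtain s where X: "X = {ex t | t. A s t}" by (rule classE)
  have "X \<subseteq> ex ` {t. 0 \<le> t \<and> t < 1 \<and> QQ s t} \<union> {ex s, ex (s + 1/6), ex (s - 1/6)}"
  proof
    fix y assume "y \<in> X"
    then obtain t where t: "y = ex t" "A s t" unfolding X by blast
    then consider "pos s t = 0" | "QQ s t" | "pos s t = 1/6" | "pos t s = 1/6" unfolding A_def SP_def by blast
    then show "y \<in> ex ` {t. 0 \<le> t \<and> t < 1 \<and> QQ s t} \<union> {ex s, ex (s + 1/6), ex (s - 1/6)}"
    proof cases
      case 1
      then show ?thesis using ex_cong t(1) by auto
    next
      case 2
      have f: "pos t (frac t) = 0" by (simp add: pos0_sym)
      then have "QQ s (frac t)" using QQ_cong[OF pos_self _ 2] by blast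
      then have "ex (frac t) \<in> ex ` {t. 0 \<le> t \<and> t < 1 \<and> QQ s t}" by (intro imageI) (simp add: frac_lt_1)
      then show ?thesis using ex_cong[OF f] t(1) by simp
    next
      case 3
      then show ?thesis using ex_cong[OF sixth[OF 3]] t(1) by simp
    next
      case 4
      have "pos s (t + 1/6) = 0" by (rule sixth[OF 4])
      then have "pos (s - 1/6) t = 0" unfolding pos_eq0 by (simp add: algebra_simps)
      then have "ex t = ex (s - 1/6)" using ex_cong pos0_sym by metis
      then show ?thesis using t(1) by simp
    qed
  qed
  then show ?thesis by (rule finite_subset) (use finite_QQ in simp)
qed

lemma laminational_CsCL: "laminational (lam_rel CsCL)"
  unfolding laminational_def
proof (intro conjI ballI impI equiv_CsCL)
  show "closedin (top_of_set (circle \<times> circle)) (lam_rel CsCL)"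
    by (rule closed_subset[OF lam_rel_circle closed_lam_rel])
  show "finite X" if "X \<in> circle // lam_rel CsCL" for X using that by (rule class_finite)
  show "convex hull X \<inter> convex hull Y = {}" if XY: "X \<in> circle // lam_rel CsCL" "Y \<in> circle // lam_rel CsCL" "X \<noteq> Y" for X Y
  proof (rule hulls_disjoint[OF class_circle[OF XY(1)] class_finite[OF XY(1)] class_circle[OF XY(2)]])
    show d: "X \<inter> Y = {}" using quotient_disj[OF equiv_CsCL XY(1,2)] XY(3) by blast
    fix a b c d assume *: "ex a \<in> X" "ex b \<in> X" "ex c \<in> Y" "ex d \<in> Y"
    show "\<not> linked a b c d"
    proof
      assume l: "linked a b c d"
      obtain s where s: "X = {ex t | t. A s t}" using XY(1) by (rule classE)
      obtain t where t: "Y = {ex u | u. A t u}" using XY(2) by (rule classE)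
      have "A s a" "A s b" "A t c" "A t d" using * class_mem[OF s] class_mem[OF t] by blast+
      then have "A a b" "A c d" using A_trans A_sym by blast+
      then have "A a c" using A_linked l by blast
      then have "A s c" using A_trans \<open>A s a\<close> by blast
      then have "ex c \<in> X" using class_mem[OF s] by blast
      then show False using *(3) d by blast
    qed
  qed
qed

theorem theorem6p9:
  shows "q_lamination CsCL"
  unfolding q_lamination_def
proof (intro conjI lamination_CsCL laminational_CsCL)
  show "CsCL = {{x} | x. x \<in> circle} \<union> {e. \<exists>X\<in>circle // lam_rel CsCL. e edge_of (convex hull X)}"
  proof (intro set_eqI iffI)
    fix c assume c: "c \<in> CsCL"
    then obtain p q where pq: "c = seg p q" using CsCL_seg by blast
    show "c \<in> {{x} | x. x \<in> circle} \<union> {e. \<exists>X\<in>circle // lam_rel CsCL. e edge_of (convex hull X)}"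
    proof (cases "pos p q = 0")
      case True
      then have "degenerate c" unfolding pq seg_degenerate .
      then show ?thesis unfolding degenerate_def by blast
    next
      case False
      define X where "X = lam_rel CsCL `` {ex p}"
      have X: "X \<in> circle // lam_rel CsCL" unfolding X_def by (rule quotientI) simp
      have mem: "ex t \<in> X \<longleftrightarrow> A p t" for t unfolding X_def using lam_rel_A by blast
      have Apq: "A p q" using c unfolding pq by (rule seg_A)
      have App: "A p p" unfolding A_def by simp
      have "seg p q edge_of convex hull X"
      proof (rule edge_of_hull[OF class_circle[OF X]])
        show "ex p \<in> X" "ex q \<in> X" using mem Apq App by blast+
        show "ex p \<noteq> ex q" using False unfolding ex_eq .
        fix u v assume uv: "ex u \<in> X" "ex v \<in> X"
        show "\<not> linked p q u v"
        proof
          assume l: "linked p q u v"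
          have n: "pos u v \<noteq> 0" using linked_distinct[OF l] by auto
          have "A u v" using uv mem A_trans A_sym by blast
          then consider "QQ u v" | "SP u v" using n unfolding A_def by blast
          then show False
          proof cases
            case 1
            \<comment> \<open>The comajor is special or an edge, and neither kind crosses a chord
              with \<open>Q\<close>.\<close>
            have "(\<exists>r. Sx r \<and> seg p q = seg r (r + 1/6)) \<or> (\<exists>r s. seg p q = seg r s \<and> edgeQ r s)"
              using c False seg_degenerate[of p q] unfolding pq CsCL_iff degenerate_def by blast
            moreover have "SP r (r + 1/6)" if "Sx r" for r using that unfolding SP_def by (simp add: pos_self_add)
            ultimately obtain r s where rs: "{ex p, ex q} = {ex r, ex s}" "SP r s \<or> edgeQ r s" unfolding seg_eq by blast
            have "pos p r = 0 \<and> pos q s = 0 \<or> pos p s = 0 \<and> pos q r = 0" using rs(1) unfolding doubleton_eq_iff ex_eq .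
            then have "linked r s u v"
              using l linked_cong[of p r q s u u v v] linked_cong[of p s q r u u v v] linked_swap_left[of r s u v] by auto
            then have l': "linked r s u v" "linked r s v u" "linked u v r s" "linked v u r s"
              using linked_swap_right linked_swap_left linked_sym by blast+
            show False using rs(2) 1 l' Q_SP_unlinked[of u v r s] Q_SP_unlinked[of v u r s] unfolding edgeQ_def QQ_def by blast
          next
            case 2
            \<comment> \<open>Ends of a special chord have no partners, so \<open>p\<close> is
              joined to both by special chords; as these share no ends unless they agree,
              \<open>u\<close> and \<open>v\<close> coincide.\<close>
            have Zu: "Zpt u" "Zpt v" using SP_Zpt[OF 2] by blast+
            have "\<not> QQ p u" "\<not> QQ p v" using QQ_Zpt Zu by blast+
            moreover have "A p u" "A p v" "pos p u \<noteq> 0" "pos p v \<noteq> 0" using uv mem linked_distinct[OF l] pos0_comm by auto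
            ultimately have spp: "SP p u" "SP p v" unfolding A_def by blast+
            have "pos u v = 0"
            proof -
              from spp consider "Sx p" "pos p u = 1/6" "pos p v = 1/6" | "Sx u" "Sx v" "pos u p = 1/6" "pos v p = 1/6"
                | "Sx p" "Sx u" "pos u p = 1/6" | "Sx p" "Sx v" "pos v p = 1/6" unfolding SP_def by blast
              then show ?thesis
              proof cases
                case 1
                show ?thesis by (rule pos0_of_eq[of p]) (use 1 in simp)
              next
                case 2
                have "pos (u + 1/6) (v + 1/6) = 0" by (rule pos0_trans[OF pos0_sym[OF sixth[OF 2(3)]] sixth[OF 2(4)]])
                then show ?thesis by simp
              qed (use Sx_exclusive in blast)+
            qed
            then show False using n by blast
          qed
        qed
      qed
      then show ?thesis using X unfolding pq by blast
    qed
  next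
    fix c assume "c \<in> {{x} | x. x \<in> circle} \<union> {e. \<exists>X\<in>circle // lam_rel CsCL. e edge_of (convex hull X)}"
    then consider x where "x \<in> circle" "c = {x}" | X where "X \<in> circle // lam_rel CsCL" "c edge_of convex hull X" by blast
    then show "c \<in> CsCL"
    proof cases
      case 1
      then show ?thesis using degenerate_CsCL by simp
    next
      case 2
      obtain p q where pq: "ex p \<in> X" "ex q \<in> X" "ex p \<noteq> ex q" "c = seg p q" "\<forall>u v. ex u \<in> X \<longrightarrow> ex v \<in> X \<longrightarrow> \<not> linked p q u v"
        using edge_of_hull_cases[OF class_circle[OF 2(1)] class_finite[OF 2(1)] 2(2)] by blast
      obtain s where s: "X = {ex t | t. A s t}" using 2(1) by (rule classE)
      note mem = class_mem[OF s]
      have sp: "A s p" "A s q" using pq(1,2) mem by blast+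
      then have Apq: "A p q" using A_trans A_sym by blast
      \<comment> \<open>Partners of an end belong to the class \<open>X\<close>, so the absence of
        crossings within \<open>X\<close> is all that \<open>edgeQ_class\<close> asks for.\<close>
      have edge: "edgeQ a b" if "Q a b" "{a, b} = {p, q}" for a b
      proof (rule edgeQ_class[OF that(1)])
        fix u v assume uv: "QQ a u" "QQ a v"
        have "A s a" using that(2) sp by auto
        moreover have "A a u" "A a v" using uv unfolding A_def by blast+
        ultimately have "ex u \<in> X" "ex v \<in> X" using mem A_trans by blast+
        then have "\<not> linked p q u v" using pq(5) by blast
        then show "\<not> linked a b u v" using that(2) linked_swap_left[of p q u v] unfolding doubleton_eq_iff by blast
      qed
      have "pos p q \<noteq> 0" using pq(3) unfolding ex_eq .
      then consider "Q p q" | "Q q p" | "Sx p" "pos p q = 1/6" | "Sx q" "pos q p = 1/6" using Apq unfolding A_def QQ_def SP_def by blast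
      then show ?thesis
      proof cases
        case 1
        then show ?thesis unfolding pq(4) using edgeQ_CsCL[OF edge] by blast
      next
        case 2
        then have "seg q p \<in> CsCL" using edgeQ_CsCL[OF edge] by blast
        then show ?thesis unfolding pq(4) by (subst seg_commute)
      next
        case 3
        have "seg p q = seg p (p + 1/6)" by (rule seg_cong[OF pos_self sixth[OF 3(2)]])
        then show ?thesis unfolding pq(4) CsCL_iff using 3(1) by blast
      next
        case 4
        have "seg q p = seg q (q + 1/6)" by (rule seg_cong[OF pos_self sixth[OF 4(2)]])
        then show ?thesis unfolding pq(4) seg_commute[of p q] CsCL_iff using 4(1) by blast
      qed
    qed
  qed
qed

end
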